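(* Let $N\ge 2$, let $\Omega\subset\mathbb R^N$ be an open bounded set with Lipschitz boundary, let $s_\sharp\in(0,1]$ and $\bar\lambda\in\mathbb R$. There exists $\gamma_0>0$, depending only on $N,\Omega,s_\sharp$ and $\bar\lambda$, such that the following holds. Let $\gamma\in[0,\gamma_0]$, let $\bar s\in(0,s_\sharp]$, and let $\mu=\mu^+-\mu^-$, where $\mu^+,\mu^-$ are nonnegative finite Borel measures on $[0,1]$ such that $$\mu^+([\bar s,1])>0,\qquad \mu^-|_{[\bar s,1]}=0,\qquad \mu^-([0,\bar s])\le\gamma\,\mu^+([\bar s,1]),\qquad \mu^+([s_\sharp,1])>0.$$ Let $f:\Omega\times\mathbb R\to\mathbb R$ be a Carathéodory function such that $x\mapsto\sup_{|t|\le\tau}|f(x,t)|$ belongs to $L^\infty(\Omega)$ for every $\tau>0$, and $$\lim_{|t|\to+\infty}\frac{f(x,t)}{t}=0\quad\text{uniformly for almost every }x\in\Omega.$$ If $\bar\lambda\notin\sigma(A_\mu)$, then there exists a weak solution $u\in X_0(\Omega)$ of the problem $$A_\mu u-\bar\lambda u=f(x,u)\ \text{ in }\Omega,\qquad u=0\ \text{ in }\mathbb R^N\setminus\Omega.$$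
   Context: For $s\in(0,1)$ and measurable $u:\mathbb R^N\to\mathbb R$, set $$[u]_s=\Big(c_{N,s}\int_{\mathbb R^N}\int_{\mathbb R^N}\frac{|u(x)-u(y)|^2}{|x-y|^{N+2s}}\,dx\,dy\Big)^{1/2},$$ where $c_{N,s}>0$ is the usual normalization constant of the fractional Laplacian, so that $[u]_s^2=\int_{\mathbb R^N}|\xi|^{2s}|\hat u(\xi)|^2\,d\xi$ for Schwartz functions $u$ (with unitary Fourier transform); in particular $[u]_s\to[u]_1:=\|\nabla u\|_{L^2(\mathbb R^N)}$ as $s\to1^-$ and $[u]_s\to[u]_0:=\|u\|_{L^2(\mathbb R^N)}$ as $s\to0^+$. For $s\in[0,1]$ let $\langle u,v\rangle_s$ be the bilinear form associated with $[\cdot]_s^2$: for $s\in(0,1)$, $\langle u,v\rangle_s=c_{N,s}\iint\frac{(u(x)-u(y))(v(x)-v(y))}{|x-y|^{N+2s}}\,dx\,dy$; for $s=1$ it is $\int\nabla u\cdot\nabla v\,dx$; for $s=0$ it is $\int uv\,dx$. $X_0(\Omega)$ is the space of measurable $u:\mathbb R^N\to\mathbb R$ (up to a.e. equality) with $u=0$ in $\mathbb R^N\setminus\Omega$ and $\int_{[0,1]}[u]_s^2\,d\mu^+(s)<+\infty$; it is a Hilbert space with norm $(\int_{[0,1]}[u]_s^2\,d\mu^+(s))^{1/2}$. For $u,v\in X_0(\Omega)$ put $$\langle u,v\rangle=\int_{[0,1]}\langle u,v\rangle_s\,d\mu^+(s),\qquad (u,v)=\int_{[0,\bar s]}\langle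 u,v\rangle_s\,d\mu^-(s).$$ The operator is $A_\mu u=\int_{[0,1]}(-\Delta)^su\,d\mu(s)$, understood weakly: a weak solution of the problem in the claim is a $u\in X_0(\Omega)$ such that, for all $v\in X_0(\Omega)$, $$\langle u,v\rangle-(u,v)=\bar\lambda\int_\Omega uv\,dx+\int_\Omega f(x,u)v\,dx.$$ The spectrum $\sigma(A_\mu)$ is the set of $\lambda\in\mathbb R$ for which there is $u\in X_0(\Omega)\setminus\{0\}$ with $\langle u,v\rangle-(u,v)=\lambda\int_\Omega uv\,dx$ for all $v\in X_0(\Omega)$. *)

theory Defs
  imports "HOL-Analysis.Analysis" "HOL-Probability.Essential_Supremum"
begin

text \<open>Near every boundary point, the set lies strictly above the graph of a Lipschitz function
  over a hyperplane, in the direction of a unit normal \<open>e\<close> of that hyperplane.  For open sets this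
  also forces the frontier to be the graph itself.\<close>

definition lipschitz_boundary :: "'a::euclidean_space set \<Rightarrow> bool" where
  "lipschitz_boundary \<Omega> \<longleftrightarrow>
     (\<forall>p \<in> frontier \<Omega>. \<exists>(e::'a) U (\<phi>::'a \<Rightarrow> real) L.
        norm e = 1 \<and> open U \<and> p \<in> U \<and> L-lipschitz_on {y. y \<bullet> e = 0} \<phi> \<and>
        \<Omega> \<inter> U = {x \<in> U. \<phi> (x - (x \<bullet> e) *\<^sub>R e) < x \<bullet> e})"

text \<open>Weak gradient on the whole space, tested against compactly supported \<open>C\<^sup>1\<close> functions.\<close>

definition locally_integrable :: "('a::euclidean_space \<Rightarrow> 'b::euclidean_space) \<Rightarrow> bool" where
  "locally_integrable u \<longleftrightarrow> (\<forall>K. compact K \<longrightarrow> set_integrable lebesgue K u)"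

definition has_weak_gradient ::
    "('a::euclidean_space \<Rightarrow> real) \<Rightarrow> ('a \<Rightarrow> 'a) \<Rightarrow> bool" where
  "has_weak_gradient u g \<longleftrightarrow>
     locally_integrable u \<and> locally_integrable g \<and>
     (\<forall>\<phi> D\<phi>. (\<forall>x. GDERIV \<phi> x :> D\<phi> x) \<longrightarrow> continuous_on UNIV D\<phi> \<longrightarrow>
        bounded {x. \<phi> x \<noteq> 0} \<longrightarrow>
        (LINT x|lebesgue. u x *\<^sub>R D\<phi> x) = - (LINT x|lebesgue. \<phi> x *\<^sub>R g x))"

text \<open>The weak gradient is unique up to a null set, so the choice below is immaterial under
  an integral.\<close>

definition weak_gradient :: "('a::euclidean_space \<Rightarrow> real) \<Rightarrow> 'a \<Rightarrow> 'a" where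
  "weak_gradient u = (SOME g. has_weak_gradient u g)"

text \<open>The constant for which
  \<open>c\<^bsub>N,s\<^esub> \<integral>\<integral> |u(x) - u(y)|\<^sup>2 / |x - y|\<^bsup>N+2s\<^esup> dx dy = \<integral> |\<xi>|\<^bsup>2s\<^esup> |Fu(\<xi>)|\<^sup>2 d\<xi>\<close>
  with \<open>F\<close> the unitary Fourier transform.  It is one half of
  \<open>4\<^sup>s s \<Gamma>(N/2+s) / (\<pi>\<^bsup>N/2\<^esup> \<Gamma>(1-s))\<close>, the constant in the principal value formula for the
  fractional Laplacian.\<close>

definition frac_const :: "nat \<Rightarrow> real \<Rightarrow> real" where
  "frac_const N s =
     2 powr (2 * s - 1) * s * Gamma ((real N + 2 * s) / 2) / (pi powr (real N / 2) * Gamma (1 - s))"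

text \<open>\<open>[u]\<^sub>s\<^sup>2\<close> with values in \<open>[0,\<infinity>]\<close>, for \<open>s \<in> [0,1]\<close>.\<close>

definition seminorm_sq :: "real \<Rightarrow> ('a::euclidean_space \<Rightarrow> real) \<Rightarrow> ennreal" where
  "seminorm_sq s u =
     (if s = 0 then \<integral>\<^sup>+ x. ennreal ((u x)\<^sup>2) \<partial>lebesgue
      else if s = 1 then
        (if \<exists>g. has_weak_gradient u g
         then \<integral>\<^sup>+ x. ennreal ((norm (weak_gradient u x))\<^sup>2) \<partial>lebesgue else \<infinity>)
      else ennreal (frac_const DIM('a) s) *
        (\<integral>\<^sup>+ (x, y). ennreal (\<bar>u x - u y\<bar>\<^sup>2 / norm (x - y) powr (real DIM('a) + 2 * s))
           \<partial>(lebesgue :: ('a \<times> 'a) measure)))"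

definition form_s :: "real \<Rightarrow> ('a::euclidean_space \<Rightarrow> real) \<Rightarrow> ('a \<Rightarrow> real) \<Rightarrow> real" where
  "form_s s u v =
     (if s = 0 then LINT x|lebesgue. u x * v x
      else if s = 1 then LINT x|lebesgue. weak_gradient u x \<bullet> weak_gradient v x
      else frac_const DIM('a) s *
        (LINT (x, y)|(lebesgue :: ('a \<times> 'a) measure).
           (u x - u y) * (v x - v y) / norm (x - y) powr (real DIM('a) + 2 * s)))"

definition finite_borel_measure_01 :: "real measure \<Rightarrow> bool" where
  "finite_borel_measure_01 M \<longleftrightarrow>
     finite_measure M \<and> sets M = sets (restrict_space borel {0..1})"

text \<open>Elements of \<open>X\<^sub>0(\<Omega>)\<close> are represented by functions; equality is equality almost everywhere.\<close>

definition X0 :: "real measure \<Rightarrow> 'a::euclidean_space set \<Rightarrow> ('a \<Rightarrow> real) set" where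
  "X0 \<mu>p \<Omega> = {u \<in> borel_measurable lebesgue.
     (AE x in lebesgue. x \<notin> \<Omega> \<longrightarrow> u x = 0) \<and> (\<integral>\<^sup>+ s. seminorm_sq s u \<partial>\<mu>p) < \<infinity>}"

definition form_plus ::
    "real measure \<Rightarrow> ('a::euclidean_space \<Rightarrow> real) \<Rightarrow> ('a \<Rightarrow> real) \<Rightarrow> real" where
  "form_plus \<mu>p u v = (LINT s|\<mu>p. form_s s u v)"

definition form_minus ::
    "real measure \<Rightarrow> real \<Rightarrow> ('a::euclidean_space \<Rightarrow> real) \<Rightarrow> ('a \<Rightarrow> real) \<Rightarrow> real" where
  "form_minus \<mu>m sbar u v = (LINT s:{0..sbar}|\<mu>m. form_s s u v)"

definition spectrum_A ::
    "real measure \<Rightarrow> real measure \<Rightarrow> real \<Rightarrow> 'a::euclidean_space set \<Rightarrow> real set" where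
  "spectrum_A \<mu>p \<mu>m sbar \<Omega> =
     {lam. \<exists>u \<in> X0 \<mu>p \<Omega>. \<not> (AE x in lebesgue. u x = 0) \<and>
        (\<forall>v \<in> X0 \<mu>p \<Omega>. form_plus \<mu>p u v - form_minus \<mu>m sbar u v
           = lam * (LINT x:\<Omega>|lebesgue. u x * v x))}"

definition weak_solution ::
    "real measure \<Rightarrow> real measure \<Rightarrow> real \<Rightarrow> 'a::euclidean_space set \<Rightarrow> real \<Rightarrow>
     ('a \<Rightarrow> real \<Rightarrow> real) \<Rightarrow> ('a \<Rightarrow> real) \<Rightarrow> bool" where
  "weak_solution \<mu>p \<mu>m sbar \<Omega> lam f u \<longleftrightarrow>
     u \<in> X0 \<mu>p \<Omega> \<and>
     (\<forall>v \<in> X0 \<mu>p \<Omega>. form_plus \<mu>p u v - form_minus \<mu>m sbar u v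
        = lam * (LINT x:\<Omega>|lebesgue. u x * v x) + (LINT x:\<Omega>|lebesgue. f x (u x) * v x))"

definition caratheodory :: "'a::euclidean_space set \<Rightarrow> ('a \<Rightarrow> real \<Rightarrow> real) \<Rightarrow> bool" where
  "caratheodory \<Omega> f \<longleftrightarrow>
     (\<forall>t. (\<lambda>x. f x t) \<in> borel_measurable (lebesgue_on \<Omega>)) \<and>
     (AE x in lebesgue_on \<Omega>. continuous_on UNIV (f x))"

text \<open>\<open>esssup\<close> is \<open>\<infinity>\<close> for non-measurable functions, so finiteness below is membership
  in \<open>L\<^sup>\<infinity>(\<Omega>)\<close>, measurability included.\<close>

definition locally_bounded_nonlinearity ::
    "'a::euclidean_space set \<Rightarrow> ('a \<Rightarrow> real \<Rightarrow> real) \<Rightarrow> bool" where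
  "locally_bounded_nonlinearity \<Omega> f \<longleftrightarrow>
     (\<forall>\<tau>>0. esssup (lebesgue_on \<Omega>) (\<lambda>x. SUP t\<in>{t. \<bar>t\<bar> \<le> \<tau>}. ereal \<bar>f x t\<bar>) < \<infinity>)"

definition sublinear_at_infinity ::
    "'a::euclidean_space set \<Rightarrow> ('a \<Rightarrow> real \<Rightarrow> real) \<Rightarrow> bool" where
  "sublinear_at_infinity \<Omega> f \<longleftrightarrow>
     (\<exists>Z. Z \<in> null_sets lebesgue \<and>
        uniform_limit (\<Omega> - Z) (\<lambda>t x. f x t / t) (\<lambda>x. 0) at_infinity)"

end

theory Submission
  imports Defs "HOL-Complex_Analysis.Great_Picard" "HOL-Library.Function_Algebras" "HOL-Real_Asymp.Real_Asymp"
begin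

text \<open>
  Write \<open>B\<close> for the form \<open>\<langle>u,v\<rangle> - (u,v)\<close> on \<open>X\<^sub>0(\<Omega>)\<close>.  The proof treats the problem as a compact
  perturbation of \<open>B\<close>.

  The seminorms of functions supported in a fixed bounded set are comparable, uniformly in the orders:
  \<open>[u]\<^sub>s\<^sup>2 \<le> C [u]\<^sub>t\<^sup>2\<close> for \<open>0 \<le> s \<le> t \<le> 1\<close> (lemma \<open>seminorm_sq_comparison\<close>).  Without a Fourier transform this
  follows from the inequality \<open>\<parallel>u(\<cdot> + 2 h) - u\<parallel>\<^sup>2 \<le> 4 \<parallel>u(\<cdot> + h) - u\<parallel>\<^sup>2\<close> and the homogeneity of the kernel, which
  together produce exactly the factors \<open>s\<close> and \<open>1 - s\<close> of the normalization constant.  Averaging the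
  comparison over the two measures bounds the negative part \<open>(u,u)\<close> by \<open>C \<gamma> \<langle>u,u\<rangle>\<close>.  So for
  \<open>\<gamma> \<le> 1/(2 C)\<close> the form \<open>B\<close> is positive and equivalent to \<open>\<langle>\<cdot>,\<cdot>\<rangle>\<close>, and \<open>\<gamma>\<^sub>0 = 1/(2 C)\<close> works.

  The space with the form \<open>B\<close> is complete (Fatou's lemma in every order, and a separate argument with
  weak gradients when the order one has positive mass).  It embeds compactly in \<open>L\<^sup>2(\<Omega>)\<close>: since
  \<open>\<mu>\<^sup>+\<close> charges \<open>[s\<^sub>\<sharp>,1]\<close>, the form controls the seminorm of order \<open>s\<^sub>\<sharp>/2\<close>, and a function is close in
  \<open>L\<^sup>2\<close> to its averages over a fine grid of cubes, at a rate that depends on this seminorm only.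
  Hence, as \<open>\<lambda>\<close> is not in the spectrum, the Fredholm alternative solves
  \<open>B(u,v) - \<lambda> \<integral> u v = \<integral> g v\<close> for every \<open>g\<close> in \<open>L\<^sup>2(\<Omega>)\<close>, with a bound (lemma \<open>linear_problem\<close>).

  For the nonlinear problem, \<open>f(x,u)\<close> is first replaced by \<open>f(x, T\<^sub>n P\<^sub>n u)\<close>, where \<open>P\<^sub>n\<close> takes averages
  over cubes of side \<open>1/(n+1)\<close> and \<open>T\<^sub>n\<close> truncates at height \<open>n\<close>.  The unknown is then a finite family of
  numbers, and Brouwer's theorem gives a solution \<open>u\<^sub>n\<close>.  Sublinearity,
  \<open>|f(x,t)| \<le> \<epsilon> |t| + C\<^sub>\<epsilon>\<close> with \<open>\<epsilon>\<close> small against the bound of the linear problem, makes the \<open>u\<^sub>n\<close>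
  bounded in \<open>X\<^sub>0(\<Omega>)\<close>.  A subsequence converges in \<open>L\<^sup>2\<close>, the right-hand sides converge too, and the
  stability of the linear problem identifies the limit as a solution.
\<close>

section \<open>Symmetric bilinear forms: Riesz representation and the Fredholm alternative\<close>

locale semi_inner =
  fixes V :: "'v::real_vector set" and B :: "'v \<Rightarrow> 'v \<Rightarrow> real"
  assumes V: "subspace V"
    and sym: "\<lbrakk>u \<in> V; v \<in> V\<rbrakk> \<Longrightarrow> B u v = B v u"
    and add: "\<lbrakk>u \<in> V; v \<in> V; w \<in> V\<rbrakk> \<Longrightarrow> B (u + v) w = B u w + B v w"
    and scale: "\<lbrakk>u \<in> V; w \<in> V\<rbrakk> \<Longrightarrow> B (c *\<^sub>R u) w = c * B u w"
    and nonneg: "u \<in> V \<Longrightarrow> 0 \<le> B u u"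
begin

lemmas closed [simp] = subspace_add[OF V] subspace_diff[OF V] subspace_scale[OF V] subspace_0[OF V]

lemma diff: "\<lbrakk>u \<in> V; v \<in> V; w \<in> V\<rbrakk> \<Longrightarrow> B (u - v) w = B u w - B v w"
  using add[of u "(-1) *\<^sub>R v" w] scale[of v w "-1"] subspace_neg[OF V, of v] by simp

lemma add_right: "\<lbrakk>u \<in> V; v \<in> V; w \<in> V\<rbrakk> \<Longrightarrow> B w (u + v) = B w u + B w v"
  using add sym by simp

lemma diff_right: "\<lbrakk>u \<in> V; v \<in> V; w \<in> V\<rbrakk> \<Longrightarrow> B w (u - v) = B w u - B w v"
  using diff sym by simp

lemma scale_right: "\<lbrakk>u \<in> V; w \<in> V\<rbrakk> \<Longrightarrow> B w (c *\<^sub>R u) = c * B w u"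
  using scale sym by simp

lemmas bilinear = add diff scale add_right diff_right scale_right

lemma Cauchy_Schwarz:
  assumes "u \<in> V" "v \<in> V"
  shows "(B u v)\<^sup>2 \<le> B u u * B v v"
proof -
  have *: "0 \<le> B u u + t * (2 * B u v) + t\<^sup>2 * B v v" for t
    using nonneg[of "u + t *\<^sub>R v"] assms sym[of u v]
    by (simp add: bilinear algebra_simps power2_eq_square)
  show ?thesis
  proof (cases "B v v = 0")
    case False
    then have "0 < B v v" using nonneg assms by force
    then show ?thesis using *[of "- B u v / B v v"]
      by (simp add: field_simps power2_eq_square)
  next
    case True
    have "B u v = 0"
    proof (rule ccontr)
      assume "B u v \<noteq> 0"
      then show False using *[of "- (B u u + 1) / (2 * B u v)"] True by simp
    qed
    then show ?thesis using True by simp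
  qed
qed

lemma abs_le: "\<lbrakk>u \<in> V; v \<in> V\<rbrakk> \<Longrightarrow> \<bar>B u v\<bar> \<le> sqrt (B u u) * sqrt (B v v)"
  using real_sqrt_le_mono[OF Cauchy_Schwarz[of u v]] by (simp add: real_sqrt_mult)

lemma sq_add_le: "\<lbrakk>u \<in> V; v \<in> V\<rbrakk> \<Longrightarrow> B (u + v) (u + v) \<le> 2 * B u u + 2 * B v v"
  using nonneg[of "u - v"] sym[of u v] by (simp add: bilinear)

lemma sq_diff_le: "\<lbrakk>u \<in> V; v \<in> V\<rbrakk> \<Longrightarrow> B (u - v) (u - v) \<le> 2 * B u u + 2 * B v v"
  using nonneg[of "u + v"] sym[of u v] by (simp add: bilinear)

lemma tendsto_left:
  assumes "\<And>n. x n \<in> V" "l \<in> V" "v \<in> V" and lim: "(\<lambda>n. B (x n - l) (x n - l)) \<longlonglongrightarrow> 0"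
  shows "(\<lambda>n. B (x n) v) \<longlonglongrightarrow> B l v"
proof -
  have "(\<lambda>n. sqrt (B (x n - l) (x n - l)) * sqrt (B v v)) \<longlonglongrightarrow> 0"
    using tendsto_mult_right[OF tendsto_real_sqrt[OF lim], of "sqrt (B v v)"] by simp
  then have "(\<lambda>n. B (x n) v - B l v) \<longlonglongrightarrow> 0"
    by (rule Lim_null_comparison[rotated]) (use abs_le assms in \<open>auto simp flip: diff\<close>)
  then show ?thesis by (simp add: LIM_zero_iff)
qed

lemma tendsto_norm:
  assumes x: "\<And>n. x n \<in> V" "l \<in> V" and lim: "(\<lambda>n. B (x n - l) (x n - l)) \<longlonglongrightarrow> 0"
  shows "(\<lambda>n. B (x n) (x n)) \<longlonglongrightarrow> B l l"
proof -
  have "(\<lambda>n. B (x n - l) (x n - l) + 2 * B (x n) l - B l l) \<longlonglongrightarrow> 0 + 2 * B l l - B l l"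
    by (intro tendsto_intros lim tendsto_left x)
  then show ?thesis using x by (simp add: bilinear sym)
qed

definition complete_form :: bool where
  "complete_form \<longleftrightarrow> (\<forall>x. (\<forall>n. x n \<in> V) \<longrightarrow>
     (\<forall>e>0. \<exists>M. \<forall>m\<ge>M. \<forall>n\<ge>M. B (x m - x n) (x m - x n) < e) \<longrightarrow>
     (\<exists>l\<in>V. (\<lambda>n. B (x n - l) (x n - l)) \<longlonglongrightarrow> 0))"

text \<open>A minimizing sequence of \<open>B v v / 2 - l v\<close> is a Cauchy sequence by the parallelogram
  identity; its limit represents \<open>l\<close>.\<close>

lemma Riesz:
  assumes complete_form
    and l_add: "\<And>u v. \<lbrakk>u \<in> V; v \<in> V\<rbrakk> \<Longrightarrow> l (u + v) = l u + l v"
    and l_scale: "\<And>c u. u \<in> V \<Longrightarrow> l (c *\<^sub>R u) = c * l u"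
    and l_le: "\<And>u. u \<in> V \<Longrightarrow> \<bar>l u\<bar> \<le> K * sqrt (B u u)"
  shows "\<exists>u\<in>V. \<forall>v\<in>V. B u v = l v"
proof -
  define J where "J v = B v v / 2 - l v" for v
  have J_ge: "- K\<^sup>2 / 2 \<le> J v" if "v \<in> V" for v
  proof -
    have "l v \<le> K * sqrt (B v v)" using l_le[OF that] by simp
    moreover have "0 \<le> (sqrt (B v v) - K)\<^sup>2" by simp
    then have "K * sqrt (B v v) \<le> B v v / 2 + K\<^sup>2 / 2"
      using nonneg[OF that] by (simp add: power2_diff field_simps)
    ultimately show ?thesis by (simp add: J_def)
  qed
  define m where "m = Inf (J ` V)"
  have bdd: "bdd_below (J ` V)" using J_ge by (meson bdd_belowI2)
  have m_le: "m \<le> J v" if "v \<in> V" for v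
    unfolding m_def using bdd that by (simp add: cInf_lower)
  have "\<exists>v\<in>V. J v < m + inverse (real (Suc n))" for n
  proof -
    have "Inf (J ` V) < m + inverse (real (Suc n))" by (simp add: m_def)
    then show ?thesis using cInf_lessD[of "J ` V" "m + inverse (real (Suc n))"] subspace_0[OF V] by blast
  qed
  then obtain x where xV: "\<And>n. x n \<in> V" and x: "\<And>n. J (x n) < m + inverse (real (Suc n))"
    by metis
  have expand: "J (u + t *\<^sub>R v) = J u + t * (B u v - l v) + t\<^sup>2 / 2 * B v v" if "u \<in> V" "v \<in> V" for u v t
    using that sym[OF that] by (simp add: J_def bilinear l_add l_scale algebra_simps power2_eq_square)
  have small: "B (x i - x j) (x i - x j) \<le> 4 * (inverse (real (Suc i)) + inverse (real (Suc j)))" for i j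
  proof -
    let ?y = "x i" let ?z = "x j"
    have "J ((1/2) *\<^sub>R (?y + ?z)) \<ge> m" using xV by (intro m_le) simp
    moreover have "J ?y + J ?z - 2 * J ((1/2) *\<^sub>R (?y + ?z)) = B (?y - ?z) (?y - ?z) / 4"
      using xV sym[OF xV xV, of i j] by (simp add: J_def bilinear l_add l_scale algebra_simps)
    ultimately show ?thesis using x[of i] x[of j] by simp
  qed
  have "\<forall>e>0. \<exists>M. \<forall>m\<ge>M. \<forall>n\<ge>M. B (x m - x n) (x m - x n) < e"
  proof (intro allI impI)
    fix e :: real assume "e > 0"
    then obtain M where M: "inverse (real (Suc M)) < e / 8"
      using reals_Archimedean[of "e / 8"] by auto
    have "inverse (real (Suc k)) < e / 8" if "k \<ge> M" for k
      by (rule le_less_trans[OF _ M]) (use that in \<open>simp add: field_simps\<close>)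
    then have "B (x i - x j) (x i - x j) < e" if "i \<ge> M" "j \<ge> M" for i j
    proof -
      have "inverse (real (Suc i)) < e / 8" "inverse (real (Suc j)) < e / 8"
        using \<open>\<And>k. M \<le> k \<Longrightarrow> inverse (real (Suc k)) < e / 8\<close> that by blast+
      then have "4 * (inverse (real (Suc i)) + inverse (real (Suc j))) < 4 * (e / 8 + e / 8)"
        by (intro mult_strict_left_mono add_strict_mono) auto
      then show ?thesis using small[of i j] \<open>e > 0\<close> by simp
    qed
    then show "\<exists>M. \<forall>m\<ge>M. \<forall>n\<ge>M. B (x m - x n) (x m - x n) < e" by blast
  qed
  then obtain u where u: "u \<in> V" and lim: "(\<lambda>n. B (x n - u) (x n - u)) \<longlonglongrightarrow> 0"
    using assms(1) xV unfolding complete_form_def by blast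
  have "B u v = l v" if v: "v \<in> V" for v
  proof -
    have *: "0 \<le> t * (B u v - l v) + t\<^sup>2 / 2 * B v v" for t
    proof (rule LIMSEQ_le_const[where X="\<lambda>n. inverse (real (Suc n)) + t * (B (x n) v - l v) + t\<^sup>2 / 2 * B v v"])
      have "(\<lambda>n. inverse (real (Suc n)) + t * (B (x n) v - l v) + t\<^sup>2 / 2 * B v v) \<longlonglongrightarrow>
            0 + t * (B u v - l v) + t\<^sup>2 / 2 * B v v"
        by (intro tendsto_intros LIMSEQ_inverse_real_of_nat tendsto_left xV u v lim)
      then show "(\<lambda>n. inverse (real (Suc n)) + t * (B (x n) v - l v) + t\<^sup>2 / 2 * B v v) \<longlonglongrightarrow>
            t * (B u v - l v) + t\<^sup>2 / 2 * B v v" by simp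
      have "0 \<le> inverse (real (Suc n)) + t * (B (x n) v - l v) + t\<^sup>2 / 2 * B v v" for n
        using m_le[of "x n + t *\<^sub>R v"] x[of n] v xV expand[OF xV v, of n t] by simp
      then show "\<exists>N. \<forall>n\<ge>N. 0 \<le> inverse (real (Suc n)) + t * (B (x n) v - l v) + t\<^sup>2 / 2 * B v v"
        by blast
    qed
    show ?thesis
    proof (rule ccontr)
      assume ne: "B u v \<noteq> l v"
      define b where "b = B u v - l v"
      have "b \<noteq> 0" using ne by (simp add: b_def)
      have c: "B v v + 1 > 0" using nonneg[OF v] by simp
      define x where "x = b / (B v v + 1)"
      have b: "b = x * (B v v + 1)" using c by (simp add: x_def)
      have "0 \<le> - x * b + (- x)\<^sup>2 / 2 * B v v" using *[of "- x"] by (simp add: b_def)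
      also have "\<dots> = - (x\<^sup>2 * ((B v v + 2) / 2))"
        unfolding b by (simp add: field_simps power2_eq_square)
      also have "\<dots> < 0"
        using \<open>b \<noteq> 0\<close> c b by (simp add: zero_less_mult_iff)
      finally show False by simp
    qed
  qed
  then show ?thesis using u by blast
qed

text \<open>Let \<open>T\<close> represent \<open>m\<close>, so that \<open>S = 1 - lam T\<close> represents
  \<open>B - lam m\<close>. If \<open>B (S u) (S u)\<close> were not bounded below by a multiple
  of \<open>B u u\<close>, compactness would produce a normalized eigenvector. Hence \<open>b u v
  = B (S u) (S v)\<close> is again a complete form, and its Riesz theorem inverts the symmetric
  map \<open>S\<close>: if \<open>S\<^sup>2 w = S z\<close>, then \<open>S w - z\<close> lies in
  the kernel of \<open>S\<close> and has norm zero.\<close>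

lemma Fredholm_alternative:
  fixes m :: "'v \<Rightarrow> 'v \<Rightarrow> real"
  assumes compl: complete_form and "semi_inner V m"
    and m_le: "\<And>u. u \<in> V \<Longrightarrow> m u u \<le> C * B u u"
    and compact: "\<And>x R. \<lbrakk>\<And>n::nat. x n \<in> V; \<And>n. B (x n) (x n) \<le> R\<rbrakk> \<Longrightarrow>
        \<exists>r::nat\<Rightarrow>nat. strict_mono r \<and>
          (\<forall>e>0. \<exists>M. \<forall>i\<ge>M. \<forall>j\<ge>M. m (x (r i) - x (r j)) (x (r i) - x (r j)) < e)"
    and not_eigen: "\<And>u. \<lbrakk>u \<in> V; \<And>v. v \<in> V \<Longrightarrow> B u v = lam * m u v\<rbrakk> \<Longrightarrow> m u u = 0"
  shows "\<exists>K>0. \<forall>l k. 0 \<le> k \<longrightarrow> (\<forall>u\<in>V. \<forall>v\<in>V. l (u + v) = l u + l v) \<longrightarrow> (\<forall>u\<in>V. \<forall>c. l (c *\<^sub>R u) = c * l u) \<longrightarrow>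
     (\<forall>u\<in>V. \<bar>l u\<bar> \<le> k * sqrt (B u u)) \<longrightarrow> 
     (\<exists>u\<in>V. (\<forall>v\<in>V. B u v - lam * m u v = l v) \<and> sqrt (B u u) \<le> K * k)"
proof -
  interpret m: semi_inner V m by fact
  have m_bound: "\<bar>m u v\<bar> \<le> (\<bar>C\<bar> * sqrt (B u u)) * sqrt (B v v)" if "u \<in> V" "v \<in> V" for u v
  proof -
    have le: "sqrt (m w w) \<le> sqrt \<bar>C\<bar> * sqrt (B w w)" if "w \<in> V" for w
    proof -
      have "m w w \<le> \<bar>C\<bar> * B w w"
        by (rule order_trans[OF m_le[OF that] mult_right_mono]) (use nonneg that in auto)
      then show ?thesis by (simp flip: real_sqrt_mult)
    qed
    have "\<bar>m u v\<bar> \<le> sqrt (m u u) * sqrt (m v v)" using m.abs_le that by blast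
    also have "\<dots> \<le> (sqrt \<bar>C\<bar> * sqrt (B u u)) * (sqrt \<bar>C\<bar> * sqrt (B v v))"
      by (intro mult_mono le that mult_nonneg_nonneg) (auto simp: nonneg m.nonneg that)
    also have "\<dots> = (\<bar>C\<bar> * sqrt (B u u)) * sqrt (B v v)" by simp
    finally show ?thesis .
  qed
  have "\<exists>w\<in>V. \<forall>v\<in>V. B w v = m u v" if "u \<in> V" for u
    by (rule Riesz[OF compl]) (use that m_bound in \<open>auto simp: m.bilinear\<close>)
  then obtain T where TV: "\<And>u. u \<in> V \<Longrightarrow> T u \<in> V" and T: "\<And>u v. \<lbrakk>u \<in> V; v \<in> V\<rbrakk> \<Longrightarrow> B (T u) v = m u v"
    by metis
  define S where "S u = u - lam *\<^sub>R T u" for u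
  have SV: "S u \<in> V" if "u \<in> V" for u using that TV by (simp add: S_def)
  have S: "B (S u) v = B u v - lam * m u v" if "u \<in> V" "v \<in> V" for u v
    using that TV by (simp add: S_def bilinear T)
  have S_sym: "B (S u) v = B (S v) u" if "u \<in> V" "v \<in> V" for u v
    using that S sym m.sym by simp
  have S_null: "B u u = 0" if "u \<in> V" "\<And>v. v \<in> V \<Longrightarrow> B (S u) v = 0" for u
    using not_eigen[OF that(1)] that S by (metis eq_iff_diff_eq_0 mult_zero_right)
  have S_le: "B (S u) (S u) \<le> (2 + 2 * lam\<^sup>2 * C\<^sup>2) * B u u" if u: "u \<in> V" for u
  proof -
    have "B (T u) (T u) = m u (T u)" using T TV u by simp
    also have "\<dots> \<le> (\<bar>C\<bar> * sqrt (B u u)) * sqrt (B (T u) (T u))"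
      using m_bound[of u "T u"] TV u by simp
    finally have "sqrt (B (T u) (T u)) * sqrt (B (T u) (T u)) \<le> (\<bar>C\<bar> * sqrt (B u u)) * sqrt (B (T u) (T u))"
      using nonneg TV u by simp
    then have "sqrt (B (T u) (T u)) \<le> \<bar>C\<bar> * sqrt (B u u)"
      using nonneg[OF u] nonneg[OF TV[OF u]]
      by (cases "B (T u) (T u) = 0") (auto intro: mult_right_le_imp_le[of _ "sqrt (B (T u) (T u))"])
    then have "(sqrt (B (T u) (T u)))\<^sup>2 \<le> (\<bar>C\<bar> * sqrt (B u u))\<^sup>2"
      using nonneg TV u by (intro power_mono) auto
    then have "B (T u) (T u) \<le> C\<^sup>2 * B u u" using nonneg TV u by (simp add: power_mult_distrib)
    then have "lam\<^sup>2 * B (T u) (T u) \<le> lam\<^sup>2 * (C\<^sup>2 * B u u)" by (intro mult_left_mono) auto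
    moreover have "B (S u) (S u) \<le> 2 * B u u + 2 * (lam\<^sup>2 * B (T u) (T u))"
      using sq_diff_le[of u "lam *\<^sub>R T u"] u TV by (simp add: S_def bilinear power2_eq_square)
    ultimately show ?thesis by (simp add: algebra_simps)
  qed
  have "\<exists>c>0. \<forall>u\<in>V. c * B u u \<le> B (S u) (S u)"
  proof (rule ccontr)
    assume neg: "\<not> ?thesis"
    have "\<exists>u\<in>V. B u u = 1 \<and> B (S u) (S u) \<le> inverse (real (Suc n))" for n
    proof -
      obtain w where w: "w \<in> V" and lt: "B (S w) (S w) < inverse (real (Suc n)) * B w w"
        using neg by (metis inverse_positive_iff_positive not_le of_nat_0_less_iff zero_less_Suc)
      have pos: "0 < B w w"
      proof -
        have "0 \<le> B (S w) (S w)" using nonneg SV w by simp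
        then show ?thesis using lt nonneg[OF w] by (smt (verit) mult_eq_0_iff)
      qed
      define u where "u = (1 / sqrt (B w w)) *\<^sub>R w"
      have u: "u \<in> V" using w by (simp add: u_def)
      have "B u u = 1" using pos w by (simp add: u_def bilinear)
      have "B (S u) v = (1 / sqrt (B w w)) * B (S w) v" if "v \<in> V" for v
        using that w u by (simp add: S u_def bilinear m.bilinear algebra_simps)
      then have "B (S u) (S u) = (1 / sqrt (B w w)) * B (S w) (S u)"
        using SV u by blast
      also have "B (S w) (S u) = (1 / sqrt (B w w)) * B (S w) (S w)"
        using \<open>\<And>v. v \<in> V \<Longrightarrow> B (S u) v = (1 / sqrt (B w w)) * B (S w) v\<close> sym SV u w by metis
      finally have "B (S u) (S u) = B (S w) (S w) / B w w" using pos by simp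
      then have "B (S u) (S u) \<le> inverse (real (Suc n))"
        using lt pos by (simp add: pos_divide_le_eq)
      then show ?thesis using u \<open>B u u = 1\<close> by blast
    qed
    then obtain x where x: "\<And>n. x n \<in> V" "\<And>n. B (x n) (x n) = 1"
      and Sx: "\<And>n. B (S (x n)) (S (x n)) \<le> inverse (real (Suc n))" by metis
    obtain r where r: "strict_mono (r::nat\<Rightarrow>nat)" 
      and mC: "\<And>e. e > 0 \<Longrightarrow> \<exists>M. \<forall>i\<ge>M. \<forall>j\<ge>M. m (x (r i) - x (r j)) (x (r i) - x (r j)) < e"
      using compact[of x 1] x by auto
    define y where "y n = x (r n)" for n
    have y: "\<And>n. y n \<in> V" "\<And>n. B (y n) (y n) = 1" using x by (auto simp: y_def)
    have Sy: "B (S (y n)) (S (y n)) \<le> inverse (real (Suc n))" for n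
      unfolding y_def
      by (rule order_trans[OF Sx]) (use seq_suble[OF r, of n] in \<open>simp add: field_simps\<close>)
    have Sy_v: "\<bar>B (S (y n)) v\<bar> \<le> sqrt (inverse (real (Suc n))) * sqrt (B v v)" if "v \<in> V" for n v
      by (rule order_trans[OF abs_le mult_right_mono]) (use that SV y Sy nonneg in auto)
    have lim0: "(\<lambda>n. sqrt (inverse (real (Suc n)))) \<longlonglongrightarrow> 0"
      using tendsto_real_sqrt[OF LIMSEQ_inverse_real_of_nat] by simp
    have "\<forall>e>0. \<exists>M. \<forall>i\<ge>M. \<forall>j\<ge>M. B (y i - y j) (y i - y j) < e"
    proof (intro allI impI)
      fix e :: real assume e: "e > 0"
      obtain M1 where M1: "\<forall>i\<ge>M1. \<forall>j\<ge>M1. m (y i - y j) (y i - y j) < e / (2 * (\<bar>lam\<bar> + 1))"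
        using mC[of "e / (2 * (\<bar>lam\<bar> + 1))"] e by (auto simp: y_def)
      obtain M2 where M2: "\<And>n. n \<ge> M2 \<Longrightarrow> sqrt (inverse (real (Suc n))) < e / 8"
        using LIMSEQ_D[OF lim0, of "e/8"] e by auto
      have "B (y i - y j) (y i - y j) < e" if ij: "i \<ge> max M1 M2" "j \<ge> max M1 M2" for i j
      proof -
        define d where "d = y i - y j"
        have d: "d \<in> V" using y by (simp add: d_def)
        have "B d d \<le> 4" using sq_diff_le[of "y i" "y j"] y by (simp add: d_def)
        then have sd: "sqrt (B d d) \<le> 2" by (simp add: real_le_lsqrt nonneg d)
        have "B d d = B (y i) d - B (y j) d"
          using y d by (simp add: d_def bilinear)
        also have "\<dots> = B (S (y i)) d - B (S (y j)) d + lam * m d d"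
          using y d by (simp add: S d_def m.bilinear algebra_simps)
        also have "\<dots> \<le> sqrt (inverse (real (Suc i))) * sqrt (B d d) + sqrt (inverse (real (Suc j))) * sqrt (B d d) + \<bar>lam\<bar> * m d d"
          using Sy_v[OF d, of i] Sy_v[OF d, of j] mult_right_mono[OF abs_ge_self[of lam] m.nonneg[OF d]] by linarith
        also have "\<dots> \<le> e / 8 * 2 + e / 8 * 2 + \<bar>lam\<bar> * m d d"
          using M2 ij e sd nonneg[OF d] m.nonneg[OF d] by (intro add_mono mult_mono) (auto intro: less_imp_le)
        also have "\<bar>lam\<bar> * m d d \<le> (\<bar>lam\<bar> + 1) * m d d" using m.nonneg[OF d] by (intro mult_right_mono) auto
        also have "(\<bar>lam\<bar> + 1) * m d d < (\<bar>lam\<bar> + 1) * (e / (2 * (\<bar>lam\<bar> + 1)))"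
          using M1 ij by (intro mult_strict_left_mono) (auto simp: d_def)
        also have "(\<bar>lam\<bar> + 1) * (e / (2 * (\<bar>lam\<bar> + 1))) = e / 2" by (simp add: field_simps)
        finally show ?thesis by (simp add: d_def)
      qed
      then show "\<exists>M. \<forall>i\<ge>M. \<forall>j\<ge>M. B (y i - y j) (y i - y j) < e" by blast
    qed
    then obtain u where u: "u \<in> V" and lim: "(\<lambda>n. B (y n - u) (y n - u)) \<longlonglongrightarrow> 0"
      using compl y unfolding complete_form_def by blast
    have "B u u = 1"
      using LIMSEQ_unique[OF tendsto_norm[OF y(1) u lim]] y(2) by simp
    moreover have "B (S u) v = 0" if v: "v \<in> V" for v
    proof -
      have "(\<lambda>n. B (y n) (S v)) \<longlonglongrightarrow> B u (S v)"
        by (intro tendsto_left y u SV v lim)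
      moreover have "B w (S v) = B (S w) v" if "w \<in> V" for w
        using sym S_sym SV v that by metis
      ultimately have "(\<lambda>n. B (S (y n)) v) \<longlonglongrightarrow> B (S u) v" using y u by simp
      moreover have "(\<lambda>n. B (S (y n)) v) \<longlonglongrightarrow> 0"
        by (rule Lim_null_comparison[where g="\<lambda>n. sqrt (inverse (real (Suc n))) * sqrt (B v v)"])
           (use Sy_v[OF v] tendsto_mult_right[OF lim0] in auto)
      ultimately show ?thesis using LIMSEQ_unique by blast
    qed
    ultimately show False using S_null[OF u] by simp
  qed
  then obtain c where c: "c > 0" and c_le: "\<And>u. u \<in> V \<Longrightarrow> c * B u u \<le> B (S u) (S u)" by blast
  define b where "b u v = B (S u) (S v)" for u v
  interpret b: semi_inner V b
  proof
    show "b u v = b v u" if "u \<in> V" "v \<in> V" for u v using that sym SV by (simp add: b_def)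
    show "b (u + v) w = b u w + b v w" if "u \<in> V" "v \<in> V" "w \<in> V" for u v w
      using that SV by (simp add: b_def S bilinear m.bilinear algebra_simps)
    show "b (k *\<^sub>R u) w = k * b u w" if "u \<in> V" "w \<in> V" for u w k
      using that SV by (simp add: b_def S bilinear m.bilinear algebra_simps)
    show "0 \<le> b u u" if "u \<in> V" for u using that SV nonneg by (simp add: b_def)
  qed (rule V)
  have b_complete: "b.complete_form"
    unfolding b.complete_form_def
  proof (intro allI impI)
    fix x :: "nat \<Rightarrow> 'v"
    assume x: "\<forall>n. x n \<in> V" and C: "\<forall>e>0. \<exists>M. \<forall>m\<ge>M. \<forall>n\<ge>M. b (x m - x n) (x m - x n) < e"
    have "\<forall>e>0. \<exists>M. \<forall>m\<ge>M. \<forall>n\<ge>M. B (x m - x n) (x m - x n) < e"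
    proof (intro allI impI)
      fix e :: real assume "e > 0"
      then obtain M where M: "\<forall>m\<ge>M. \<forall>n\<ge>M. b (x m - x n) (x m - x n) < c * e" using C c by fastforce
      have "B (x i - x j) (x i - x j) < e" if "i \<ge> M" "j \<ge> M" for i j
      proof -
        have "c * B (x i - x j) (x i - x j) < c * e"
          by (rule le_less_trans[OF c_le]) (use M that x in \<open>auto simp: b_def\<close>)
        then show ?thesis using c by simp
      qed
      then show "\<exists>M. \<forall>m\<ge>M. \<forall>n\<ge>M. B (x m - x n) (x m - x n) < e" by blast
    qed
    then obtain l where l: "l \<in> V" and lim: "(\<lambda>n. B (x n - l) (x n - l)) \<longlonglongrightarrow> 0"
      using compl x unfolding complete_form_def by blast
    have "(\<lambda>n. b (x n - l) (x n - l)) \<longlonglongrightarrow> 0"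
      by (rule Lim_null_comparison[OF _ tendsto_mult_right_zero[OF lim, of "2 + 2 * lam\<^sup>2 * C\<^sup>2"]])
         (use S_le l x b.nonneg in \<open>auto simp: b_def\<close>)
    then show "\<exists>l\<in>V. (\<lambda>n. b (x n - l) (x n - l)) \<longlonglongrightarrow> 0" using l by blast
  qed
  have main: "\<exists>u\<in>V. (\<forall>v\<in>V. B u v - lam * m u v = l v) \<and> sqrt (B u u) \<le> sqrt (1 / c) * k"
    if k: "0 \<le> k" and l_add: "\<forall>u\<in>V. \<forall>v\<in>V. l (u + v) = l u + l v" and l_scale: "\<forall>u\<in>V. \<forall>c. l (c *\<^sub>R u) = c * l u"
      and l_le: "\<forall>u\<in>V. \<bar>l u\<bar> \<le> k * sqrt (B u u)" for l k
  proof -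
    obtain z where z: "z \<in> V" and zl: "\<And>v. v \<in> V \<Longrightarrow> B z v = l v"
    proof -
      have "\<exists>u\<in>V. \<forall>v\<in>V. B u v = l v"
        by (rule Riesz[OF compl l_add[rule_format] l_scale[rule_format] l_le[rule_format]])
      then show ?thesis using that by blast
    qed
    have z_le: "sqrt (B z z) \<le> \<bar>k\<bar>"
    proof -
      have "B z z \<le> k * sqrt (B z z)" using l_le z zl[OF z] by (metis abs_le_D1)
      then have "sqrt (B z z) * sqrt (B z z) \<le> k * sqrt (B z z)" using nonneg[OF z] by simp
      then show ?thesis
        using nonneg[OF z] k
        by (cases "B z z = 0") (auto intro: mult_right_le_imp_le[of _ "sqrt (B z z)"])
    qed
    have "\<exists>w\<in>V. \<forall>v\<in>V. b w v = B (S z) v"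
    proof (rule b.Riesz[OF b_complete, where K="sqrt (B (S z) (S z)) * sqrt (1 / c)"])
      fix v assume v: "v \<in> V"
      have "B v v \<le> 1 / c * b v v" using c_le[OF v] c by (simp add: b_def field_simps)
      then have "sqrt (B v v) \<le> sqrt (1 / c) * sqrt (b v v)"
        by (simp flip: real_sqrt_mult del: real_sqrt_le_iff) (simp only: real_sqrt_le_iff)
      then have "sqrt (B (S z) (S z)) * sqrt (B v v) \<le> sqrt (B (S z) (S z)) * (sqrt (1 / c) * sqrt (b v v))"
        using nonneg SV z by (intro mult_left_mono) auto
      then show "\<bar>B (S z) v\<bar> \<le> sqrt (B (S z) (S z)) * sqrt (1 / c) * sqrt (b v v)"
        using abs_le[of "S z" v] SV z v by (simp add: mult.assoc)
    qed (use SV z in \<open>auto simp: bilinear\<close>)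
    then obtain w where w: "w \<in> V" and wz: "\<And>v. v \<in> V \<Longrightarrow> b w v = B (S z) v" by blast
    define y where "y = S w - z"
    have y: "y \<in> V" using SV w z by (simp add: y_def)
    have "B (S y) v = 0" if v: "v \<in> V" for v
    proof -
      have "B (S y) v = B y (S v)" using S_sym sym SV y v by metis
      also have "\<dots> = b w v - B z (S v)" using SV w z v by (simp add: y_def b_def bilinear)
      also have "B z (S v) = B (S z) v" using S_sym sym SV z v by metis
      finally show ?thesis using wz[OF v] by simp
    qed
    then have "B y y = 0" using S_null[OF y] by blast
    then have "B y v = 0" if "v \<in> V" for v using Cauchy_Schwarz[OF y that] by simp
    then have eq: "B (S w) v = B z v" if "v \<in> V" for v
      using that SV w z by (force simp: y_def bilinear)
    have "B (S w) (S w) = B z z"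
      using eq sym SV w z by metis
    then have "B w w \<le> 1 / c * B z z" using c_le[OF w] c by (simp add: field_simps)
    then have "sqrt (B w w) \<le> sqrt (1 / c) * sqrt (B z z)"
      by (simp flip: real_sqrt_mult del: real_sqrt_le_iff) (simp only: real_sqrt_le_iff)
    also have "\<dots> \<le> sqrt (1 / c) * \<bar>k\<bar>" using z_le c by (intro mult_left_mono) auto
    finally show ?thesis using w eq z zl S k by auto
  qed
  show ?thesis
  proof (intro exI[of _ "sqrt (1 / c)"] conjI allI impI)
    show "0 < sqrt (1 / c)" using c by simp
  qed (rule main)
qed

end

section \<open>Fixed points of bounded continuous maps in finitely many variables\<close>

text \<open>Brouwer's theorem for a cube whose dimension is the cardinality of a set, not of a type. Kuhn's
  combinatorial lemma gives, for every mesh, nearby grid points at which the coordinate of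
  \<open>\<Phi> x - x\<close> belonging to \<open>g\<close> is nonnegative and nonpositive; a
  limit of such points is a fixed point.\<close>

lemma Brouwer_finite_set:
  fixes \<Phi> :: "('i \<Rightarrow> real) \<Rightarrow> 'i \<Rightarrow> real"
  assumes "finite G" and bound: "\<And>x g. g \<in> G \<Longrightarrow> \<bar>\<Phi> x g\<bar> \<le> R"
    and cont: "\<And>X x g. \<lbrakk>\<And>g. g \<in> G \<Longrightarrow> (\<lambda>k::nat. X k g) \<longlonglongrightarrow> x g; g \<in> G\<rbrakk>
                \<Longrightarrow> (\<lambda>k. \<Phi> (X k) g) \<longlonglongrightarrow> \<Phi> x g"
  shows "\<exists>x. \<forall>g\<in>G. \<Phi> x g = x g"
proof (cases "G = {}")
  case False
  define S where "S = R + 1"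
  have "0 \<le> R" using bound False by (meson abs_ge_zero equals0I order_trans)
  then have S: "S > 0" "R \<le> S" by (auto simp: S_def)
  obtain h where h: "bij_betw h {..<card G} G"
    using ex_bij_betw_nat_finite[OF \<open>finite G\<close>] by (auto simp: atLeast0LessThan)
  define e where "e = inv_into {..<card G} h"
  have e: "e g < card G" "h (e g) = g" if "g \<in> G" for g
    using that h bij_betw_inv_into_right[OF h that] bij_betwE[OF bij_betw_inv_into[OF h]] by (auto simp: e_def)
  define P where "P p x g = S * (2 * real (x (e g)) / real (Suc p) - 1)" for p :: nat and x :: "nat \<Rightarrow> nat" and g
  \<comment> \<open>The label of a grid point tells in which direction \<open>\<Phi>\<close> moves the coordinate; on the faces of the
    cube it is prescribed, consistently because \<open>\<Phi>\<close> maps into the cube.\<close>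
  define label where "label p x i = (if x i = Suc p \<or> (x i \<noteq> 0 \<and> \<Phi> (P p x) (h i) < P p x (h i)) then 1 else 0::nat)" for p x i
  define near where "near q r \<longleftrightarrow> (\<forall>j<card G. q j \<le> r j \<and> r j \<le> q j + 1)" for q r :: "nat \<Rightarrow> nat"
  define good where "good p q \<longleftrightarrow> (\<forall>i<card G. q i < Suc p) \<and>
      (\<forall>i<card G. \<exists>r s. near q r \<and> near q s \<and> label p r i \<noteq> label p s i)" for p q
  have "\<exists>q. good p q" for p
  proof -
    have 1: "\<forall>x. (\<forall>i<card G. x i \<le> Suc p) \<longrightarrow> (\<forall>i<card G. label p x i = 0 \<or> label p x i = 1)"
      by (simp add: label_def)
    have 2: "\<forall>x. (\<forall>i<card G. x i \<le> Suc p) \<longrightarrow> (\<forall>i<card G. x i = 0 \<longrightarrow> label p x i = 0)"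
      by (simp add: label_def)
    have 3: "\<forall>x. (\<forall>i<card G. x i \<le> Suc p) \<longrightarrow> (\<forall>i<card G. x i = Suc p \<longrightarrow> label p x i = 1)"
      by (simp add: label_def)
    obtain q where "\<forall>i<card G. q i < Suc p"
      "\<forall>i<card G. \<exists>r s. (\<forall>j<card G. q j \<le> r j \<and> r j \<le> q j + 1) \<and> (\<forall>j<card G. q j \<le> s j \<and> s j \<le> q j + 1) \<and> label p r i \<noteq> label p s i"
      by (rule kuhn_lemma[OF zero_less_Suc 1 2 3])
    then have "good p q" unfolding good_def near_def by (intro conjI)
    then show ?thesis by (rule exI[of "good p" q])
  qed
  then obtain q where "\<And>p. good p (q p)" by metis
  then have q: "\<And>p i. i < card G \<Longrightarrow> q p i < Suc p"
    and rs: "\<And>p i. i < card G \<Longrightarrow> \<exists>r s. near (q p) r \<and> near (q p) s \<and> label p r i \<noteq> label p s i"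
    unfolding good_def by blast+
  have split: "\<exists>a b. near (q p) a \<and> near (q p) b \<and> P p a g \<le> \<Phi> (P p a) g \<and> \<Phi> (P p b) g \<le> P p b g"
    if g: "g \<in> G" for p g
  proof -
    have low: "P p x g \<le> \<Phi> (P p x) g" if "label p x (e g) = 0" for x
    proof (cases "x (e g) = 0")
      case True
      then have "P p x g = - S" by (simp add: P_def)
      then show ?thesis using bound[OF g, of "P p x"] S by linarith
    qed (use that e[OF g] in \<open>auto simp: label_def split: if_splits\<close>)
    have high: "\<Phi> (P p x) g \<le> P p x g" if "label p x (e g) \<noteq> 0" for x
    proof (cases "x (e g) = Suc p")
      case True
      then have "P p x g = S" by (simp add: P_def field_simps)
      then show ?thesis using bound[OF g, of "P p x"] S by linarith
    qed (use that e[OF g] in \<open>auto simp: label_def split: if_splits\<close>)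
    obtain r s where "near (q p) r" "near (q p) s" "label p r (e g) \<noteq> label p s (e g)"
      using rs[of "e g" p] e[OF g] by blast
    moreover from this(3) have "label p r (e g) = 0 \<and> label p s (e g) \<noteq> 0 \<or> label p s (e g) = 0 \<and> label p r (e g) \<noteq> 0"
      by (auto simp: label_def split: if_splits)
    ultimately show ?thesis using low[of r] low[of s] high[of r] high[of s] by blast
  qed
  have "norm (P p (q p) g) \<le> S" if "g \<in> G" for p g
  proof -
    have "2 * real (q p (e g)) / real (Suc p) \<le> 2"
      using q[OF e(1)[OF that], of p] by (simp add: field_simps)
    then have "\<bar>2 * real (q p (e g)) / real (Suc p) - 1\<bar> \<le> 1" by (simp add: abs_le_iff)
    from mult_left_mono[OF this, of S] show ?thesis using S by (simp add: P_def abs_mult)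
  qed
  then obtain k where k: "strict_mono (k::nat\<Rightarrow>nat)" 
     and "\<And>g. g \<in> G \<Longrightarrow> \<exists>l. (\<lambda>n. P (k n) (q (k n)) g) \<longlonglongrightarrow> l"
    using function_convergent_subsequence[of G "\<lambda>p. P p (q p)" S, OF countable_finite[OF \<open>finite G\<close>]] by blast
  then obtain x where x: "\<And>g. g \<in> G \<Longrightarrow> (\<lambda>n. P (k n) (q (k n)) g) \<longlonglongrightarrow> x g" by metis
  have lim_near: "(\<lambda>n. P (k n) (a n) g) \<longlonglongrightarrow> x g" 
    if g: "g \<in> G" and a: "\<And>n. near (q (k n)) (a n)" for a g
  proof -
    have "(\<lambda>n. P (k n) (a n) g - P (k n) (q (k n)) g) \<longlonglongrightarrow> 0"
    proof (rule Lim_null_comparison[where g="\<lambda>n. 2 * S * inverse (real (Suc n))"])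
      show "(\<lambda>n. 2 * S * inverse (real (Suc n))) \<longlonglongrightarrow> 0"
        by (rule tendsto_mult_right_zero[OF LIMSEQ_inverse_real_of_nat])
      have "norm (P (k n) (a n) g - P (k n) (q (k n)) g) \<le> 2 * S * inverse (real (Suc n))" for n
      proof -
        have "\<bar>real (a n (e g)) - real (q (k n) (e g))\<bar> \<le> 1" using a[of n] e(1)[OF g] unfolding near_def by force
        moreover have "inverse (real (Suc (k n))) \<le> inverse (real (Suc n))"
          using seq_suble[OF k, of n] by (simp add: field_simps)
        ultimately have "2 * S * (\<bar>real (a n (e g)) - real (q (k n) (e g))\<bar> * inverse (real (Suc (k n)))) \<le> 2 * S * (1 * inverse (real (Suc n)))"
          using S by (intro mult_left_mono mult_mono) auto
        moreover have "P (k n) (a n) g - P (k n) (q (k n)) g = 2 * S * ((real (a n (e g)) - real (q (k n) (e g))) * inverse (real (Suc (k n))))"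
          by (simp add: P_def divide_inverse algebra_simps)
        ultimately show ?thesis using S by (simp add: abs_mult)
      qed
      then show "\<forall>\<^sub>F n in sequentially. norm (P (k n) (a n) g - P (k n) (q (k n)) g) \<le> 2 * S * inverse (real (Suc n))"
        by simp
    qed
    from tendsto_add[OF this x[OF g]] show ?thesis by simp
  qed
  have "\<Phi> x g = x g" if g: "g \<in> G" for g
  proof -
    have "\<forall>p. \<exists>ab. near (q p) (fst ab) \<and> near (q p) (snd ab) \<and>
        P p (fst ab) g \<le> \<Phi> (P p (fst ab)) g \<and> \<Phi> (P p (snd ab)) g \<le> P p (snd ab) g"
      using split[OF g] by simp
    from choice[OF this] obtain ab where ab: "\<And>p. near (q p) (fst (ab p)) \<and> near (q p) (snd (ab p)) \<and>
        P p (fst (ab p)) g \<le> \<Phi> (P p (fst (ab p))) g \<and> \<Phi> (P p (snd (ab p))) g \<le> P p (snd (ab p)) g"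
      by blast
    define a b where "a n = fst (ab (k n))" and "b n = snd (ab (k n))" for n
    have a: "\<And>n. near (q (k n)) (a n)" and b: "\<And>n. near (q (k n)) (b n)"
      and le: "\<And>n. P (k n) (a n) g \<le> \<Phi> (P (k n) (a n)) g" "\<And>n. \<Phi> (P (k n) (b n)) g \<le> P (k n) (b n) g"
      using ab by (auto simp: a_def b_def)
    have "x g \<le> \<Phi> x g"
      by (rule LIMSEQ_le[OF lim_near[OF g a] cont[OF lim_near[OF _ a] g]]) (use le in auto)
    moreover have "\<Phi> x g \<le> x g"
      by (rule LIMSEQ_le[OF cont[OF lim_near[OF _ b] g] lim_near[OF g b]]) (use le in auto)
    ultimately show ?thesis by simp
  qed
  then show ?thesis by blast
qed simp

section \<open>Differences of a function and the singular part of the kernel\<close>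

lemma nn_integral_lborel_shift:
  fixes f :: "'a::euclidean_space \<Rightarrow> ennreal"
  assumes [measurable]: "f \<in> borel_measurable borel"
  shows "(\<integral>\<^sup>+x. f (x + a) \<partial>lborel) = (\<integral>\<^sup>+x. f x \<partial>lborel)"
proof -
  have "(\<integral>\<^sup>+x. f x \<partial>lborel) = (\<integral>\<^sup>+x. f x \<partial>distr lborel borel ((+) a))"
    by (simp add: lborel_distr_plus)
  also have "\<dots> = (\<integral>\<^sup>+x. f (a + x) \<partial>lborel)" by (rule nn_integral_distr) auto
  finally show ?thesis by (simp add: add.commute)
qed

lemma nn_integral_lborel_scale:
  fixes f :: "'a::euclidean_space \<Rightarrow> ennreal"
  assumes [measurable]: "f \<in> borel_measurable borel" and c: "0 < c"
  shows "(\<integral>\<^sup>+x. f x \<partial>lborel) = ennreal (c ^ DIM('a)) * (\<integral>\<^sup>+x. f (c *\<^sub>R x) \<partial>lborel)"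
  by (subst lborel_affine[of c 0])
     (use c in \<open>auto simp: nn_integral_density nn_integral_distr nn_integral_cmult ennreal_power\<close>)

definition wt :: "real \<Rightarrow> 'a::euclidean_space \<Rightarrow> real" where
  "wt a h = norm h powr - (real DIM('a) + 2 * a)"

definition shift_sq :: "('a::euclidean_space \<Rightarrow> real) \<Rightarrow> 'a \<Rightarrow> ennreal" where
  "shift_sq u h = (\<integral>\<^sup>+x. ennreal ((u (x + h) - u x)\<^sup>2) \<partial>lborel)"

lemma wt_nonneg [simp]: "0 \<le> wt a h" by (simp add: wt_def)

lemma measurable_wt [measurable (raw)]:
  assumes [measurable]: "f \<in> borel_measurable M"
  shows "(\<lambda>x. wt a (f x)) \<in> borel_measurable M"
  unfolding wt_def by measurable

lemma ball_in_borel [measurable]: "ball (c::'a::euclidean_space) r \<in> sets borel"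
  by simp

text \<open>Homogeneity of the kernel, in the form in which it meets \<open>shift_sq_double\<close>.\<close>

lemma wt_double: "ennreal (wt a h) = ennreal (2 ^ DIM('a) * 4 powr a) * ennreal (wt a (2 *\<^sub>R (h::'a::euclidean_space)))"
proof -
  have "(2::real) ^ DIM('a) * 4 powr a = 2 powr (real DIM('a) + 2 * a)"
    by (simp add: powr_add powr_realpow flip: powr_powr)
  moreover have "(2::real) powr (real DIM('a) + 2 * a) * 2 powr (- real DIM('a) - 2 * a) = 1"
    by (simp flip: powr_add)
  ultimately show ?thesis
    by (simp add: wt_def powr_mult flip: ennreal_mult'')
qed

lemma wt_mono:
  assumes "s \<le> t" "norm (h::'a::euclidean_space) \<le> d"
  shows "wt s h \<le> d powr (2 * (t - s)) * wt t h"
proof (cases "h = 0")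
  case False
  have "wt s h = norm h powr (2 * (t - s)) * wt t h"
    by (simp add: wt_def algebra_simps flip: powr_add)
  also have "\<dots> \<le> d powr (2 * (t - s)) * wt t h"
    using assms by (intro mult_right_mono powr_mono2) auto
  finally show ?thesis .
qed (simp add: wt_def)

lemma measurable_shift_sq [measurable (raw)]:
  assumes [measurable]: "u \<in> borel_measurable borel" "f \<in> borel_measurable M"
  shows "(\<lambda>x. shift_sq u (f x)) \<in> borel_measurable M"
  unfolding shift_sq_def by measurable

text \<open>The increment over \<open>2 h\<close> is the sum of two increments over \<open>h\<close> with the
  same norm, so the triangle inequality gives the factor \<open>2\<^sup>2\<close>.\<close>

lemma shift_sq_double:
  assumes [measurable]: "u \<in> borel_measurable borel"
  shows "shift_sq u (2 *\<^sub>R h) \<le> 4 * shift_sq u h"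
proof -
  have "(u (x + 2 *\<^sub>R h) - u x)\<^sup>2 \<le> 2 * (u (x + h + h) - u (x + h))\<^sup>2 + 2 * (u (x + h) - u x)\<^sup>2" for x
  proof -
    have e: "x + 2 *\<^sub>R h = x + h + h" by (simp add: scaleR_2)
    show ?thesis unfolding e
      using sum_squares_bound[of "u (x + h + h) - u (x + h)" "u (x + h) - u x"]
      by (simp add: power2_eq_square algebra_simps)
  qed
  then have "shift_sq u (2 *\<^sub>R h) \<le> (\<integral>\<^sup>+x. 2 * ennreal ((u (x + h + h) - u (x + h))\<^sup>2) + 2 * ennreal ((u (x + h) - u x)\<^sup>2) \<partial>lborel)"
    unfolding shift_sq_def
    by (intro nn_integral_mono) (simp flip: ennreal_plus ennreal_mult'' ennreal_numeral)
  also have "\<dots> = 2 * (\<integral>\<^sup>+x. ennreal ((u (x + h + h) - u (x + h))\<^sup>2) \<partial>lborel) + 2 * shift_sq u h"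
    unfolding shift_sq_def by (simp add: nn_integral_add nn_integral_cmult)
  also have "(\<integral>\<^sup>+x. ennreal ((u (x + h + h) - u (x + h))\<^sup>2) \<partial>lborel) = shift_sq u h"
    using nn_integral_lborel_shift[of "\<lambda>x. ennreal ((u (x + h) - u x)\<^sup>2)" h]
    by (simp add: shift_sq_def)
  finally show ?thesis by (simp flip: distrib_right)
qed

text \<open>A shift longer than the diameter of the support makes the two terms of the difference disjointly
  supported.\<close>

lemma shift_sq_far:
  fixes u :: "'a::euclidean_space \<Rightarrow> real"
  assumes [measurable]: "u \<in> borel_measurable borel" 
    and u: "\<And>x. d / 2 \<le> norm x \<Longrightarrow> u x = 0" and h: "d \<le> norm h"
  shows "shift_sq u h = 2 * (\<integral>\<^sup>+x. ennreal ((u x)\<^sup>2) \<partial>lborel)"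
proof -
  have "(u (x + h) - u x)\<^sup>2 = (u (x + h))\<^sup>2 + (u x)\<^sup>2" for x
  proof -
    have "norm h \<le> norm (x + h) + norm x" using norm_triangle_ineq4[of "x + h" x] by simp
    then have "u (x + h) = 0 \<or> u x = 0" using u[of x] u[of "x + h"] h by force
    then show ?thesis by auto
  qed
  then have "shift_sq u h = (\<integral>\<^sup>+x. ennreal ((u (x + h))\<^sup>2) \<partial>lborel) + (\<integral>\<^sup>+x. ennreal ((u x)\<^sup>2) \<partial>lborel)"
    unfolding shift_sq_def by (simp add: nn_integral_add)
  then show ?thesis
    using nn_integral_lborel_shift[of "\<lambda>x. ennreal ((u x)\<^sup>2)" h] by (simp add: mult_2)
qed

lemma ennreal_geometric_eq:
  assumes "J = A + ennreal q * J" "J < \<infinity>" "0 \<le> q" "q < 1"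
  shows "A = ennreal (1 - q) * J"
proof -
  obtain j where j: "J = ennreal j" "0 \<le> j" using assms(2) by (cases J) auto
  have "A \<le> J" by (subst assms(1)) simp
  then obtain a where a: "A = ennreal a" "0 \<le> a" using j by (cases A) (auto simp: top_unique)
  have "ennreal j = ennreal (a + q * j)"
    using assms(1,3) j a by (simp add: ennreal_mult')
  then have "j = a + q * j" using j a assms by (subst (asm) ennreal_inj) auto
  then have "a = (1 - q) * j" by (simp add: algebra_simps)
  then show ?thesis using j a assms by (simp add: ennreal_mult')
qed

lemma ennreal_geometric_le:
  assumes X0: "X 0 = 0" and X: "\<And>n. X (Suc n) = A + ennreal q * X n" and q: "0 \<le> q" "q < 1"
  shows "ennreal (1 - q) * X n \<le> A"
proof (cases "A = top")
  case False
  then obtain a where a: "A = ennreal a" "0 \<le> a" by (cases A) auto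
  have "X n \<le> ennreal (a / (1 - q))"
  proof (induction n)
    case (Suc n)
    have "X (Suc n) \<le> ennreal a + ennreal q * ennreal (a / (1 - q))"
      unfolding X a(1) by (intro add_left_mono mult_left_mono Suc) auto
    also have "\<dots> = ennreal (a + q * (a / (1 - q)))" using a q by (simp add: ennreal_mult[symmetric] del: times_divide_eq_right)
    also have "a + q * (a / (1 - q)) = a / (1 - q)" using q by (simp add: field_simps)
    finally show ?case .
  qed (simp add: X0)
  then have "ennreal (1 - q) * X n \<le> ennreal (1 - q) * ennreal (a / (1 - q))" by (intro mult_left_mono) auto
  also have "\<dots> = A" using a q by (simp flip: ennreal_mult'')
  finally show ?thesis .
qed simp

definition near_int :: "real \<Rightarrow> real \<Rightarrow> ('a::euclidean_space \<Rightarrow> real) \<Rightarrow> ennreal" where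
  "near_int d s u = (\<integral>\<^sup>+h. shift_sq u h * ennreal (wt s h) * indicator (ball 0 d) h \<partial>lborel)"

definition defect :: "real \<Rightarrow> ('a::euclidean_space \<Rightarrow> real) \<Rightarrow> 'a \<Rightarrow> ennreal" where
  "defect d u h = indicator (ball 0 d) h *
     (shift_sq u h - ennreal (1/4) * (shift_sq u (2 *\<^sub>R h) * indicator (ball 0 d) (2 *\<^sub>R h)))"

lemma measurable_defect [measurable (raw)]:
  assumes [measurable]: "u \<in> borel_measurable borel" "f \<in> borel_measurable M"
  shows "(\<lambda>x. defect d u (f x)) \<in> borel_measurable M"
  unfolding defect_def by measurable

text \<open>By the substitution \<open>h \<mapsto> 2 h\<close> the subtracted term of the defect integrates to
  \<open>4 powr (t - 1)\<close> times the whole. This is how the factor \<open>1 - t\<close> of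
  the normalization constant enters.\<close>

lemma near_int_defect:
  fixes u :: "'a::euclidean_space \<Rightarrow> real"
  assumes [measurable]: "u \<in> borel_measurable borel" and t: "t < 1" and fin: "near_int d t u < \<infinity>"
    and d: "0 < d"
  shows "(\<integral>\<^sup>+h. defect d u h * ennreal (wt t h) \<partial>lborel) = ennreal (1 - 4 powr (t - 1)) * near_int d t u"
proof (rule ennreal_geometric_eq[OF _ fin])
  define q where "q h = ennreal (1/4) * (shift_sq u (2 *\<^sub>R h) * indicator (ball 0 d) (2 *\<^sub>R h)) * ennreal (wt t h)" for h
  have [measurable]: "q \<in> borel_measurable borel" unfolding q_def by measurable
  have "shift_sq u h * ennreal (wt t h) * indicator (ball 0 d) h = defect d u h * ennreal (wt t h) + q h" for h
  proof (cases "norm h < d")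
    case True
    have "ennreal (1/4) * (shift_sq u (2 *\<^sub>R h) * indicator (ball 0 d) (2 *\<^sub>R h)) \<le> ennreal (1/4) * (4 * shift_sq u h)"
      by (intro mult_left_mono order_trans[OF mult_right_mono[OF shift_sq_double]]) (auto simp: indicator_def)
    also have "\<dots> = shift_sq u h"
      by (simp flip: mult.assoc ennreal_numeral ennreal_mult'')
    finally have "shift_sq u h = defect d u h + ennreal (1/4) * (shift_sq u (2 *\<^sub>R h) * indicator (ball 0 d) (2 *\<^sub>R h))"
      using True by (simp add: defect_def diff_add_cancel_ennreal)
    then show ?thesis using True by (simp add: q_def distrib_right)
  next
    case False
    then show ?thesis using d by (simp add: q_def defect_def)
  qed
  then have "near_int d t u = (\<integral>\<^sup>+h. defect d u h * ennreal (wt t h) \<partial>lborel) + (\<integral>\<^sup>+h. q h \<partial>lborel)"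
    unfolding near_int_def by (simp add: nn_integral_add)
  also have "(\<integral>\<^sup>+h. q h \<partial>lborel) = ennreal (1/4) * ennreal (2 ^ DIM('a) * 4 powr t) *
     (\<integral>\<^sup>+h. shift_sq u (2 *\<^sub>R h) * ennreal (wt t (2 *\<^sub>R h)) * indicator (ball 0 d) (2 *\<^sub>R h) \<partial>lborel)"
  proof -
    have "q h = ennreal (1/4) * ennreal (2 ^ DIM('a) * 4 powr t) *
        (shift_sq u (2 *\<^sub>R h) * ennreal (wt t (2 *\<^sub>R h)) * indicator (ball 0 d) (2 *\<^sub>R h))" for h
      unfolding q_def by (subst wt_double[of t h]) (simp only: ac_simps)
    then show ?thesis by (simp only:) (rule nn_integral_cmult, measurable)
  qed
  also have "\<dots> = ennreal (1/4 * 4 powr t) * (ennreal (2 ^ DIM('a)) *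
     (\<integral>\<^sup>+h. shift_sq u (2 *\<^sub>R h) * ennreal (wt t (2 *\<^sub>R h)) * indicator (ball 0 d) (2 *\<^sub>R h) \<partial>lborel))"
  proof -
    have "ennreal (1/4 * 4 powr t) = ennreal (1/4) * ennreal (4 powr t)" by (rule ennreal_mult'') simp
    then show ?thesis by (simp only: ennreal_mult'' powr_ge_zero ac_simps)
  qed
  also have "\<dots> = ennreal (1/4 * 4 powr t) * near_int d t u"
    unfolding near_int_def
    using nn_integral_lborel_scale[of "\<lambda>h. shift_sq u h * ennreal (wt t h) * indicator (ball 0 d) h" 2] by simp
  also have "1/4 * 4 powr t = 4 powr (t - 1)" by (simp add: powr_diff)
  finally show "near_int d t u = (\<integral>\<^sup>+h. defect d u h * ennreal (wt t h) \<partial>lborel) + ennreal (4 powr (t - 1)) * near_int d t u" .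
  show "4 powr (t - 1) < 1" using t by (simp add: powr_less_one)
qed simp

text \<open>The defect is nonnegative and does not depend on the order, so on \<open>ball 0 d\<close> its
  integrals against \<open>wt s\<close> and \<open>wt t\<close> compare as the weights do.\<close>

lemma near_int_mono:
  fixes u :: "'a::euclidean_space \<Rightarrow> real"
  assumes [measurable]: "u \<in> borel_measurable borel" and st: "s \<le> t" "t < 1" and d: "0 < d"
  shows "ennreal (1 - 4 powr (s - 1)) * near_int d s u
       \<le> ennreal (d powr (2 * (t - s))) * (ennreal (1 - 4 powr (t - 1)) * near_int d t u)"
proof (cases "near_int d t u < \<infinity>")
  case True
  have "near_int d s u \<le> (\<integral>\<^sup>+h. ennreal (d powr (2 * (t - s))) * (shift_sq u h * ennreal (wt t h) * indicator (ball 0 d) h) \<partial>lborel)"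
    unfolding near_int_def
  proof (intro nn_integral_mono)
    fix h :: 'a
    show "shift_sq u h * ennreal (wt s h) * indicator (ball 0 d) h
        \<le> ennreal (d powr (2 * (t - s))) * (shift_sq u h * ennreal (wt t h) * indicator (ball 0 d) h)"
    proof (cases "norm h < d")
      case True
      then have "shift_sq u h * ennreal (wt s h) \<le> shift_sq u h * ennreal (d powr (2 * (t - s)) * wt t h)"
        using wt_mono[OF st(1), of h d] by (intro mult_left_mono ennreal_leI) auto
      then show ?thesis using True by (simp add: ennreal_mult'' ac_simps)
    qed simp
  qed
  also have "\<dots> = ennreal (d powr (2 * (t - s))) * near_int d t u"
    unfolding near_int_def by (rule nn_integral_cmult) measurable
  also have "\<dots> < \<infinity>" using True by (simp add: ennreal_mult_less_top)
  finally have fin: "near_int d s u < \<infinity>" .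
  have "ennreal (1 - 4 powr (s - 1)) * near_int d s u = (\<integral>\<^sup>+h. defect d u h * ennreal (wt s h) \<partial>lborel)"
    using near_int_defect[OF _ _ fin] st d by simp
  also have "\<dots> \<le> (\<integral>\<^sup>+h. ennreal (d powr (2 * (t - s))) * (defect d u h * ennreal (wt t h)) \<partial>lborel)"
  proof (intro nn_integral_mono)
    fix h :: 'a
    show "defect d u h * ennreal (wt s h) \<le> ennreal (d powr (2 * (t - s))) * (defect d u h * ennreal (wt t h))"
    proof (cases "norm h < d")
      case True
      then have "defect d u h * ennreal (wt s h) \<le> defect d u h * ennreal (d powr (2 * (t - s)) * wt t h)"
        using wt_mono[OF st(1), of h d] by (intro mult_left_mono ennreal_leI) auto
      then show ?thesis by (simp add: ennreal_mult'' ac_simps)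
    qed (simp add: defect_def)
  qed
  also have "\<dots> = ennreal (d powr (2 * (t - s))) * (ennreal (1 - 4 powr (t - 1)) * near_int d t u)"
    using near_int_defect[OF _ _ True] st d by (simp add: nn_integral_cmult)
  finally show ?thesis .
next
  case False
  then have "near_int d t u = top" using less_top by force
  moreover have "4 powr (t - 1) < 1" using st by (simp add: powr_less_one)
  ultimately have "ennreal (d powr (2 * (t - s))) * (ennreal (1 - 4 powr (t - 1)) * near_int d t u) = top"
    using d st by (simp add: less_top ennreal_mult_eq_top_iff)
  then show ?thesis by simp
qed

section \<open>The normalization constant and the kernel on shells\<close>

text \<open>The factor \<open>1 / Gamma (1 - s)\<close> vanishes like \<open>1 - s\<close>; what remains
  besides \<open>s (1 - s)\<close> is continuous and positive on \<open>[0,1]\<close>.\<close>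

lemma frac_const_bounds:
  assumes N: "N > 0"
  shows "\<exists>k0 k1. 0 < k0 \<and> 0 < k1 \<and>
    (\<forall>s\<in>{0<..<1}. k0 * (s * (1 - s)) \<le> frac_const N s \<and> frac_const N s \<le> k1 * (s * (1 - s)))"
proof -
  define k where "k s = 2 powr (2 * s - 1) * Gamma ((real N + 2 * s) / 2) / (pi powr (real N / 2) * Gamma (2 - s))" for s :: real
  have k: "frac_const N s = s * (1 - s) * k s" if "s \<in> {0<..<1}" for s
  proof -
    have "1 - s \<notin> \<int>\<^sub>\<le>\<^sub>0" using that by (auto elim!: nonpos_Ints_cases)
    then have "Gamma (2 - s) = (1 - s) * Gamma (1 - s)" using Gamma_plus1[of "1 - s"] by (simp add: algebra_simps)
    then show ?thesis using that by (simp add: frac_const_def k_def)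
  qed
  have Gamma_pos: "Gamma (2 - s) > 0" if "s \<in> {0..1}" for s :: real
    using that by (intro Gamma_real_pos) auto
  have "continuous_on {0<..} (Gamma :: real \<Rightarrow> real)"
    by (rule continuous_on_Gamma) (auto elim!: nonpos_Ints_cases)
  then have "continuous_on {0..1} (\<lambda>s. Gamma ((real N + 2 * s) / 2))" "continuous_on {0..1} (\<lambda>s::real. Gamma (2 - s))"
    using N by (auto intro!: continuous_on_compose2[of "{0<..}" Gamma] continuous_intros)
  then have "continuous_on {0..1} k"
    unfolding k_def using Gamma_pos by (intro continuous_intros) (auto simp: less_imp_neq[symmetric])
  moreover have "k s > 0" if "s \<in> {0..1}" for s
  proof -
    have "(real N + 2 * s) / 2 > 0" "2 - s > 0" using that N by auto
    then show ?thesis unfolding k_def by (intro divide_pos_pos mult_pos_pos Gamma_real_pos) auto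
  qed
  ultimately obtain a b where a: "a \<in> {0..1}" "\<forall>s\<in>{0..1}. k a \<le> k s" and b: "b \<in> {0..1}" "\<forall>s\<in>{0..1}. k s \<le> k b"
    using continuous_attains_inf[of "{0..1}" k] continuous_attains_sup[of "{0..1}" k] by auto
  have "0 < k a" "0 < k b" using \<open>\<And>s. s \<in> {0..1} \<Longrightarrow> k s > 0\<close> a b by auto
  moreover have "k a * (s * (1 - s)) \<le> frac_const N s \<and> frac_const N s \<le> k b * (s * (1 - s))"
    if s: "s \<in> {0<..<1}" for s
  proof -
    have "k a * (s * (1 - s)) \<le> k s * (s * (1 - s))" "k s * (s * (1 - s)) \<le> k b * (s * (1 - s))"
      using a b s by (auto intro!: mult_right_mono)
    then show ?thesis using k[OF s] by (simp add: mult.commute)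
  qed
  ultimately show ?thesis by blast
qed

lemma one_minus_powr_4_le: "0 \<le> x \<Longrightarrow> 1 - 4 powr - x \<le> ln 4 * (x::real)"
  using exp_ge_add_one_self[of "- (x * ln 4)"] by (simp add: powr_def algebra_simps)

lemma one_minus_powr_4_ge:
  assumes "0 \<le> x" "x \<le> (1::real)" shows "ln 4 / (1 + ln 4) * x \<le> 1 - 4 powr - x"
proof -
  have l: "0 < ln (4::real)" by simp
  have "1 + x * ln 4 \<le> exp (x * ln 4)" by (rule exp_ge_add_one_self)
  then have "4 powr - x \<le> 1 / (1 + x * ln 4)"
    using assms l by (simp add: powr_def exp_minus divide_inverse add_pos_nonneg)
  moreover have "ln 4 / (1 + ln 4) * x \<le> 1 - 1 / (1 + x * ln 4)"
  proof -
    have p: "0 < 1 + x * ln 4" using assms l by (simp add: add_pos_nonneg)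
    have "1 - 1 / (1 + x * ln 4) = (ln 4 * x) / (1 + x * ln 4)" using p by (simp add: field_simps)
    moreover have "ln 4 / (1 + ln 4) * x = (ln 4 * x) / (1 + ln 4)" by simp
    moreover have "(ln 4 * x) / (1 + ln 4) \<le> (ln 4 * x) / (1 + x * ln 4)"
    proof (rule divide_left_mono)
      show "1 + x * ln 4 \<le> 1 + ln 4" using assms l mult_right_mono[of x 1 "ln 4"] by simp
      show "0 < (1 + ln 4) * (1 + x * ln 4)" using l p by (intro mult_pos_pos) linarith+
    qed (use assms in auto)
    ultimately show ?thesis by simp
  qed
  ultimately show ?thesis by linarith
qed

definition shell :: "real \<Rightarrow> real \<Rightarrow> 'a::euclidean_space set" where
  "shell a b = {h. a \<le> norm h \<and> norm h < b}"

lemma shell_borel [measurable]: "shell a b \<in> sets borel"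
  unfolding shell_def by measurable

definition far_int :: "'a::euclidean_space itself \<Rightarrow> real \<Rightarrow> real \<Rightarrow> ennreal" where
  "far_int _ d s = (\<integral>\<^sup>+h. ennreal (wt s (h::'a)) * indicator {h. d \<le> norm h} h \<partial>lborel)"

lemma wt_scale:
  fixes A :: "'a::euclidean_space set"
  assumes c: "0 < c" and [measurable]: "A \<in> sets borel"
  shows "(\<integral>\<^sup>+h. ennreal (wt s h) * indicator A ((1 / c) *\<^sub>R h) \<partial>lborel)
    = ennreal (c powr (- 2 * s)) * (\<integral>\<^sup>+h. ennreal (wt s h) * indicator A h \<partial>lborel)"
proof -
  have w: "ennreal (c ^ DIM('a)) * ennreal (wt s (c *\<^sub>R h)) = ennreal (c powr (- 2 * s)) * ennreal (wt s h)" for h :: 'a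
  proof -
    have "c ^ DIM('a) * c powr - (real DIM('a) + 2 * s) = c powr (- 2 * s)"
      using c by (simp flip: powr_realpow powr_add)
    then show ?thesis using c by (simp add: wt_def powr_mult abs_of_pos mult.assoc[symmetric] flip: ennreal_mult'')
  qed
  have "(\<integral>\<^sup>+h. ennreal (wt s h) * indicator A ((1 / c) *\<^sub>R h) \<partial>lborel)
    = ennreal (c ^ DIM('a)) * (\<integral>\<^sup>+h. ennreal (wt s (c *\<^sub>R h)) * indicator A ((1 / c) *\<^sub>R c *\<^sub>R h) \<partial>lborel)"
    by (rule nn_integral_lborel_scale[OF _ c]) measurable
  also have "\<dots> = (\<integral>\<^sup>+h. ennreal (c ^ DIM('a)) * (ennreal (wt s (c *\<^sub>R h)) * indicator A h) \<partial>lborel)"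
    using c by (simp add: nn_integral_cmult)
  also have "\<dots> = (\<integral>\<^sup>+h. ennreal (c powr (- 2 * s)) * (ennreal (wt s h) * indicator A h) \<partial>lborel)"
    by (intro nn_integral_cong) (simp only: w mult.assoc[symmetric])
  also have "\<dots> = ennreal (c powr (- 2 * s)) * (\<integral>\<^sup>+h. ennreal (wt s h) * indicator A h \<partial>lborel)"
    by (rule nn_integral_cmult) measurable
  finally show ?thesis .
qed

lemma wt_shell_scale:
  assumes c: "0 < c"
  shows "(\<integral>\<^sup>+h. ennreal (wt s (h::'a::euclidean_space)) * indicator (shell (c * a) (c * b)) h \<partial>lborel)
    = ennreal (c powr (- 2 * s)) * (\<integral>\<^sup>+h. ennreal (wt s (h::'a)) * indicator (shell a b) h \<partial>lborel)"
proof -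
  have "indicator (shell (c * a) (c * b)) h = (indicator (shell a b) ((1 / c) *\<^sub>R h) :: ennreal)" for h :: 'a
    using c by (simp add: shell_def indicator_def field_simps)
  then show ?thesis using wt_scale[OF c, of "shell a b" s] by simp
qed

lemma nn_integral_shell_split:
  assumes [measurable]: "f \<in> borel_measurable borel" and "a \<le> b" "b \<le> c"
  shows "(\<integral>\<^sup>+h. f h * indicator (shell a c) h \<partial>lborel) =
    (\<integral>\<^sup>+h. f h * indicator (shell a b) h \<partial>lborel) + (\<integral>\<^sup>+h. f h * indicator (shell b c) h \<partial>lborel)"
  by (subst nn_integral_add[symmetric], measurable, intro nn_integral_cong)
     (use assms in \<open>auto simp: shell_def indicator_def\<close>)

lemma far_int_upper:
  assumes s: "0 < s" and d: "0 < d"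
  shows "ennreal (1 - 4 powr - s) * far_int TYPE('a::euclidean_space) d s
    \<le> (\<integral>\<^sup>+h. ennreal (wt s (h::'a)) * indicator (shell d (2 * d)) h \<partial>lborel)"
proof -
  define X where "X n = (\<integral>\<^sup>+h. ennreal (wt s (h::'a)) * indicator (shell d (2 ^ n * d)) h \<partial>lborel)" for n
  have q: "2 powr (- 2 * s) = (4::real) powr - s"
    using powr_powr[of 2 2 "-s"] by simp
  have "X (Suc n) = (\<integral>\<^sup>+h. ennreal (wt s (h::'a)) * indicator (shell d (2 * d)) h \<partial>lborel) + ennreal (4 powr - s) * X n" for n
  proof -
    have "X (Suc n) = (\<integral>\<^sup>+h. ennreal (wt s (h::'a)) * indicator (shell d (2 * d)) h \<partial>lborel)
       + (\<integral>\<^sup>+h. ennreal (wt s (h::'a)) * indicator (shell (2 * d) (2 * (2 ^ n * d))) h \<partial>lborel)"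
      unfolding X_def power_Suc mult.assoc
      by (rule nn_integral_shell_split) (use d in auto)
    then show ?thesis unfolding X_def by (simp add: wt_shell_scale flip: q)
  qed
  moreover have "X 0 = 0" by (simp add: X_def shell_def)
  ultimately have "ennreal (1 - 4 powr - s) * X n \<le> (\<integral>\<^sup>+h. ennreal (wt s (h::'a)) * indicator (shell d (2 * d)) h \<partial>lborel)" for n
    by (intro ennreal_geometric_le) (use s in \<open>auto simp: powr_less_one\<close>)
  moreover have "far_int TYPE('a) d s = (SUP n. X n)"
  proof -
    have "ennreal (wt s h) * indicator {h. d \<le> norm h} h = (SUP n. ennreal (wt s h) * indicator (shell d (2 ^ n * d)) h)" for h :: 'a
    proof (rule antisym)
      obtain n where "norm h < 2 ^ n * d"
        using real_arch_pow[of 2 "norm h / d"] d by (auto simp: field_simps)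
      then show "ennreal (wt s h) * indicator {h. d \<le> norm h} h \<le> (SUP n. ennreal (wt s h) * indicator (shell d (2 ^ n * d)) h)"
        by (intro SUP_upper2[of n]) (auto simp: shell_def indicator_def)
    qed (auto intro!: SUP_least simp: shell_def indicator_def)
    then show ?thesis unfolding far_int_def X_def
      by (simp only:) (rule nn_integral_monotone_convergence_SUP,
         use d in \<open>auto simp: incseq_def le_fun_def shell_def indicator_def intro: order_less_le_trans power_increasing\<close>)
  qed
  ultimately show ?thesis by (simp add: SUP_mult_left_ennreal SUP_least)
qed

lemma wt_shell_bounds:
  assumes "0 < a" "a < b"
  shows "\<exists>c>0. \<exists>C>0. \<forall>s\<in>{-1..1}.
    ennreal c \<le> (\<integral>\<^sup>+h. ennreal (wt s (h::'a::euclidean_space)) * indicator (shell a b) h \<partial>lborel) \<and>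
    (\<integral>\<^sup>+h. ennreal (wt s (h::'a)) * indicator (shell a b) h \<partial>lborel) \<le> ennreal C"
proof -
  define L where "L = (real DIM('a) + 2) * max \<bar>ln a\<bar> \<bar>ln b\<bar>"
  have w: "exp (- L) \<le> wt s h" "wt s h \<le> exp L" if h: "h \<in> shell a b" and s: "s \<in> {-1..1}" for h :: 'a and s
  proof -
    have n: "a \<le> norm h" "norm h < b" "0 < norm h" using h assms by (auto simp: shell_def)
    then have "ln a \<le> ln (norm h)" "ln (norm h) \<le> ln b" using assms by auto
    then have "\<bar>ln (norm h)\<bar> \<le> max \<bar>ln a\<bar> \<bar>ln b\<bar>" by linarith
    moreover have "\<bar>real DIM('a) + 2 * s\<bar> \<le> real DIM('a) + 2" using s by auto
    ultimately have "\<bar>real DIM('a) + 2 * s\<bar> * \<bar>ln (norm h)\<bar> \<le> L" unfolding L_def by (intro mult_mono) auto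
    then have "\<bar>(real DIM('a) + 2 * s) * ln (norm h)\<bar> \<le> L" by (simp only: abs_mult)
    moreover have "wt s h = exp (- ((real DIM('a) + 2 * s) * ln (norm h)))"
      using n by (simp add: wt_def powr_def algebra_simps)
    ultimately show "exp (- L) \<le> wt s h" "wt s h \<le> exp L" by auto
  qed
  have fin: "emeasure lborel (shell a b :: 'a set) < \<infinity>"
    by (rule emeasure_bounded_finite, rule bounded_subset[OF bounded_ball[of 0 b]]) (auto simp: shell_def)
  obtain e :: 'a where e: "e \<in> Basis" using nonempty_Basis by blast
  define p where "p = ((a + b) / 2) *\<^sub>R e"
  have "norm p = (a + b) / 2" using e assms by (simp add: p_def)
  have "ball p ((b - a) / 2) \<subseteq> shell a b"
  proof
    fix x assume "x \<in> ball p ((b - a) / 2)"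
    then have "norm (x - p) < (b - a) / 2" by (simp add: dist_norm norm_minus_commute)
    moreover have "\<bar>norm x - norm p\<bar> \<le> norm (x - p)" by (rule norm_triangle_ineq3)
    ultimately show "x \<in> shell a b" using \<open>norm p = (a + b) / 2\<close> by (simp add: shell_def field_simps abs_le_iff)
  qed
  then have "emeasure lborel (ball p ((b - a) / 2)) \<le> emeasure lborel (shell a b :: 'a set)"
    by (intro emeasure_mono) auto
  moreover have "0 < measure lborel (ball p ((b - a) / 2))" using assms by (intro content_ball_pos) auto
  ultimately have pos: "0 < measure lborel (shell a b :: 'a set)"
    by (metis emeasure_eq_ennreal_measure ennreal_0 fin infinity_ennreal_def less_irrefl measure_def enn2real_positive_iff not_gr_zero top.extremum_strict zero_less_measure_iff le_zero_eq less_le_trans zero_less_iff_neq_zero)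
  have em: "emeasure lborel (shell a b :: 'a set) = ennreal (measure lborel (shell a b :: 'a set))"
    using fin by (intro emeasure_eq_ennreal_measure) auto
  define c C where "c = exp (- L) * measure lborel (shell a b :: 'a set)"
    and "C = exp L * measure lborel (shell a b :: 'a set)"
  have "0 < c" "0 < C" using pos by (auto simp: c_def C_def)
  moreover have "ennreal c \<le> (\<integral>\<^sup>+h. ennreal (wt s (h::'a)) * indicator (shell a b) h \<partial>lborel) \<and>
    (\<integral>\<^sup>+h. ennreal (wt s (h::'a)) * indicator (shell a b) h \<partial>lborel) \<le> ennreal C" if s: "s \<in> {-1..1}" for s
  proof
    have "ennreal c = (\<integral>\<^sup>+(h::'a). ennreal (exp (- L)) * indicator (shell a b) h \<partial>lborel)"
      using em by (simp add: nn_integral_cmult_indicator ennreal_mult'' c_def)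
    also have "\<dots> \<le> (\<integral>\<^sup>+h. ennreal (wt s (h::'a)) * indicator (shell a b) h \<partial>lborel)"
      using w[OF _ s] by (intro nn_integral_mono) (auto simp: indicator_def)
    finally show "ennreal c \<le> (\<integral>\<^sup>+h. ennreal (wt s (h::'a)) * indicator (shell a b) h \<partial>lborel)" .
    have "(\<integral>\<^sup>+h. ennreal (wt s (h::'a)) * indicator (shell a b) h \<partial>lborel) \<le> (\<integral>\<^sup>+(h::'a). ennreal (exp L) * indicator (shell a b) h \<partial>lborel)"
      using w[OF _ s] by (intro nn_integral_mono) (auto simp: indicator_def)
    also have "\<dots> = ennreal C"
      using em by (simp add: nn_integral_cmult_indicator ennreal_mult'' C_def)
    finally show "(\<integral>\<^sup>+h. ennreal (wt s (h::'a)) * indicator (shell a b) h \<partial>lborel) \<le> ennreal C" .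
  qed
  ultimately show ?thesis by blast
qed

text \<open>Dyadic decomposition: each shell contributes \<open>4 powr (- s)\<close> times the previous one.
  The resulting factor \<open>1 / s\<close> cancels the factor \<open>s\<close> of the
  normalization constant.\<close>

lemma far_int_eq:
  assumes s: "0 < s" "s \<le> 1" and d: "0 < d"
  shows "ennreal (1 - 4 powr - s) * far_int TYPE('a::euclidean_space) d s
    = (\<integral>\<^sup>+h. ennreal (wt s (h::'a)) * indicator (shell d (2 * d)) h \<partial>lborel)"
proof (rule ennreal_geometric_eq[symmetric])
  let ?S = "\<integral>\<^sup>+h. ennreal (wt s (h::'a)) * indicator (shell d (2 * d)) h \<partial>lborel"
  obtain C where "?S \<le> ennreal C" using wt_shell_bounds[of d "2 * d", where 'a='a] d s by fastforce
  then have fin: "ennreal (1 - 4 powr - s) * far_int TYPE('a) d s < \<infinity>"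
    using far_int_upper[OF s(1) d, where 'a='a] by (metis ennreal_less_top infinity_ennreal_def le_less_trans)
  have q: "4 powr - s < 1" using s by (simp add: powr_less_one)
  then show "far_int TYPE('a) d s < \<infinity>" 
    using fin by (auto simp: ennreal_mult_less_top)
  have "far_int TYPE('a) d s = (\<integral>\<^sup>+h. ennreal (wt s (h::'a)) * indicator (shell d (2 * d)) h +
      ennreal (wt s (h::'a)) * indicator {h. d \<le> norm h} ((1 / 2) *\<^sub>R h) \<partial>lborel)"
    unfolding far_int_def using d by (intro nn_integral_cong) (auto simp: shell_def indicator_def)
  also have "\<dots> = ?S + (\<integral>\<^sup>+h. ennreal (wt s (h::'a)) * indicator {h. d \<le> norm h} ((1 / 2) *\<^sub>R h) \<partial>lborel)"
    by (rule nn_integral_add) measurable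
  also have "(\<integral>\<^sup>+h. ennreal (wt s (h::'a)) * indicator {h. d \<le> norm h} ((1 / 2) *\<^sub>R h) \<partial>lborel)
     = ennreal (2 powr (- 2 * s)) * far_int TYPE('a) d s"
    unfolding far_int_def by (rule wt_scale) auto
  also have "2 powr (- 2 * s) = (4::real) powr - s"
    using powr_powr[of 2 2 "-s"] by simp
  finally show "far_int TYPE('a) d s = ?S + ennreal (4 powr - s) * far_int TYPE('a) d s" .
  show "4 powr - s < 1" by fact
qed simp

text \<open>For functions with a gradient in \<open>L\<^sup>2\<close> the squared increment is at most
  \<open>A |h|\<^sup>2\<close>; the dyadic shells inside the ball then sum to a geometric series
  with ratio \<open>4 powr (s - 1)\<close>.\<close>

lemma near_int_grad_le:
  fixes u :: "'a::euclidean_space \<Rightarrow> real"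
  assumes [measurable]: "u \<in> borel_measurable borel" and A: "\<And>h. shift_sq u h \<le> A * ennreal ((norm h)\<^sup>2)"
    and s: "s < 1" and d: "0 < d"
  shows "ennreal (1 - 4 powr (s - 1)) * near_int d s u \<le> A * (\<integral>\<^sup>+h. ennreal (wt (s - 1) (h::'a)) * indicator (shell (d / 2) d) h \<partial>lborel)"
proof -
  let ?S = "\<integral>\<^sup>+h. ennreal (wt (s - 1) (h::'a)) * indicator (shell (d / 2) d) h \<partial>lborel"
  define X where "X n = (\<integral>\<^sup>+h. ennreal (wt (s - 1) (h::'a)) * indicator (shell (d / 2 ^ n) d) h \<partial>lborel)" for n
  have q: "(1 / 2) powr (- 2 * (s - 1)) = (4::real) powr (s - 1)"
  proof -
    have "1 / 2 = (2::real) powr - 1" "4 = (2::real) powr 2" by (simp_all add: powr_minus)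
    then show ?thesis by (simp only: powr_powr) simp
  qed
  have "X (Suc n) = ?S + ennreal (4 powr (s - 1)) * X n" for n
  proof -
    have "d / 2 ^ Suc n \<le> d / 2"
      using d by (simp add: field_simps)
    then have "X (Suc n) = (\<integral>\<^sup>+h. ennreal (wt (s - 1) (h::'a)) * indicator (shell ((1 / 2) * (d / 2 ^ n)) ((1 / 2) * d)) h \<partial>lborel) + ?S"
      using nn_integral_shell_split[of "\<lambda>h. ennreal (wt (s - 1) (h::'a))" "d / 2 ^ Suc n" "d / 2" d] d
      by (simp add: X_def)
    also have "(\<integral>\<^sup>+h. ennreal (wt (s - 1) (h::'a)) * indicator (shell ((1 / 2) * (d / 2 ^ n)) ((1 / 2) * d)) h \<partial>lborel)
       = ennreal (4 powr (s - 1)) * X n"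
      unfolding X_def q[symmetric] by (rule wt_shell_scale) simp
    finally show ?thesis by (simp add: add.commute)
  qed
  moreover have "X 0 = 0" by (simp add: X_def shell_def)
  ultimately have *: "ennreal (1 - 4 powr (s - 1)) * X n \<le> ?S" for n
    by (intro ennreal_geometric_le) (use s in \<open>auto simp: powr_less_one\<close>)
  have pointwise: "shift_sq u h * ennreal (wt s h) * indicator (ball 0 d) h
      \<le> A * (SUP n. ennreal (wt (s - 1) h) * indicator (shell (d / 2 ^ n) d) h)" for h
  proof (cases "h = 0 \<or> d \<le> norm h")
    case False
    then have "0 < norm h" by simp
    then obtain n where "d / norm h < 2 ^ n" using real_arch_pow[of 2 "d / norm h"] by auto
    then have n: "h \<in> shell (d / 2 ^ n) d" using False \<open>0 < norm h\<close> by (simp add: shell_def field_simps)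
    have "(norm h)\<^sup>2 * wt s h = wt (s - 1) h"
      using \<open>0 < norm h\<close> by (simp add: wt_def algebra_simps flip: powr_add powr_numeral)
    then have "ennreal ((norm h)\<^sup>2) * ennreal (wt s h) = ennreal (wt (s - 1) h)" by (simp flip: ennreal_mult'')
    then have "shift_sq u h * ennreal (wt s h) \<le> A * ennreal (wt (s - 1) h)"
      using mult_right_mono[OF A[of h], of "ennreal (wt s h)"] by (simp add: mult.assoc)
    also have "\<dots> \<le> A * (SUP n. ennreal (wt (s - 1) h) * indicator (shell (d / 2 ^ n) d) h)"
      using n by (intro mult_left_mono SUP_upper2[of n]) auto
    finally show ?thesis using False by simp
  qed (auto simp: wt_def indicator_def)
  have "near_int d s u \<le> (\<integral>\<^sup>+h. A * (SUP n. ennreal (wt (s - 1) (h::'a)) * indicator (shell (d / 2 ^ n) d) h) \<partial>lborel)"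
    unfolding near_int_def by (intro nn_integral_mono pointwise)
  also have "\<dots> = A * (SUP n. X n)"
  proof -
    have "incseq (\<lambda>n h. ennreal (wt (s - 1) (h::'a)) * indicator (shell (d / 2 ^ n) d) h)"
    proof (rule incseq_SucI, rule le_funI)
      fix n and h :: 'a
      have "d / 2 ^ Suc n \<le> d / 2 ^ n" using d by (simp add: field_simps)
      then show "ennreal (wt (s - 1) h) * indicator (shell (d / 2 ^ n) d) h \<le> ennreal (wt (s - 1) h) * indicator (shell (d / 2 ^ Suc n) d) h"
        by (intro mult_left_mono) (auto simp: shell_def indicator_def)
    qed
    then show ?thesis
      unfolding X_def by (subst nn_integral_monotone_convergence_SUP[symmetric]) (auto intro!: nn_integral_cmult)
  qed
  finally have "ennreal (1 - 4 powr (s - 1)) * near_int d s u \<le> ennreal (1 - 4 powr (s - 1)) * (A * (SUP n. X n))"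
    by (rule mult_left_mono) simp
  also have "\<dots> = A * (SUP n. ennreal (1 - 4 powr (s - 1)) * X n)"
    by (simp only: SUP_mult_left_ennreal[symmetric] mult.left_commute)
  also have "\<dots> \<le> A * ?S" using * by (intro mult_left_mono SUP_least) auto
  finally show ?thesis .
qed

text \<open>On the shell \<open>d / 2 \<le> |h| < d\<close> the shift by \<open>2 h\<close> separates the
  supports, so doubling gives \<open>shift_sq u h \<ge> \<parallel>u\<parallel>\<^sup>2 /
  2\<close> there. This is the source of the Poincare inequality.\<close>

lemma near_int_ge:
  fixes u :: "'a::euclidean_space \<Rightarrow> real"
  assumes [measurable]: "u \<in> borel_measurable borel" and u: "\<And>x. d / 2 \<le> norm x \<Longrightarrow> u x = 0"
    and t: "t < 1" and d: "0 < d"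
  shows "ennreal (1/2) * (\<integral>\<^sup>+x. ennreal ((u x)\<^sup>2) \<partial>lborel) * (\<integral>\<^sup>+h. ennreal (wt t (h::'a)) * indicator (shell (d / 2) d) h \<partial>lborel)
    \<le> ennreal (1 - 4 powr (t - 1)) * near_int d t u"
proof (cases "near_int d t u < \<infinity>")
  case True
  let ?n = "ennreal (1/2) * (\<integral>\<^sup>+x. ennreal ((u x)\<^sup>2) \<partial>lborel)"
  have *: "?n * indicator (shell (d / 2) d) h \<le> defect d u h" for h
  proof (cases "h \<in> shell (d / 2) d")
    case True
    then have h: "d / 2 \<le> norm h" "norm h < d" by (auto simp: shell_def)
    have "?n = ennreal (1/4) * (2 * (\<integral>\<^sup>+x. ennreal ((u x)\<^sup>2) \<partial>lborel))"
      by (simp flip: mult.assoc ennreal_numeral ennreal_mult'')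
    also have "\<dots> = ennreal (1/4) * shift_sq u (2 *\<^sub>R h)"
      using h u by (subst shift_sq_far[where d=d]) auto
    also have "\<dots> \<le> ennreal (1/4) * (4 * shift_sq u h)"
      by (intro mult_left_mono shift_sq_double) auto
    also have "\<dots> = shift_sq u h"
      by (simp flip: mult.assoc ennreal_numeral ennreal_mult'')
    also have "\<dots> = defect d u h" using h by (simp add: defect_def)
    finally show ?thesis using True by simp
  qed simp
  have "?n * (\<integral>\<^sup>+h. ennreal (wt t (h::'a)) * indicator (shell (d / 2) d) h \<partial>lborel)
     = (\<integral>\<^sup>+h. ?n * indicator (shell (d / 2) d) h * ennreal (wt t (h::'a)) \<partial>lborel)"
    by (subst nn_integral_cmult[symmetric]) (auto simp: ac_simps)
  also have "\<dots> \<le> (\<integral>\<^sup>+h. defect d u h * ennreal (wt t h) \<partial>lborel)"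
    by (intro nn_integral_mono mult_right_mono *) simp
  also have "\<dots> = ennreal (1 - 4 powr (t - 1)) * near_int d t u"
    using t True d by (intro near_int_defect) auto
  finally show ?thesis .
next
  case False
  then have "near_int d t u = top" using less_top by force
  moreover have "4 powr (t - 1) < 1" using t by (simp add: powr_less_one)
  ultimately show ?thesis using t by (simp add: ennreal_mult_eq_top_iff)
qed

section \<open>Comparison of the fractional seminorms of order below one\<close>

lemma seminorm_sq_eq_shift:
  fixes u :: "'a::euclidean_space \<Rightarrow> real"
  assumes [measurable]: "u \<in> borel_measurable borel" and s: "0 < s" "s < 1"
  shows "seminorm_sq s u = ennreal (frac_const DIM('a) s) * (\<integral>\<^sup>+h. shift_sq u h * ennreal (wt s h) \<partial>lborel)"
proof -
  let ?F = "\<lambda>x h. ennreal ((u (x + h) - u x)\<^sup>2) * ennreal (wt s h)"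
  have eq: "ennreal (\<bar>u x - u y\<bar>\<^sup>2 / norm (x - y) powr (real DIM('a) + 2 * s)) = ?F x (y - x)" for x y
  proof -
    have "wt s (y - x) = 1 / norm (x - y) powr (real DIM('a) + 2 * s)"
      unfolding wt_def powr_minus_divide by (simp add: norm_minus_commute)
    then show ?thesis by (simp add: power2_commute flip: ennreal_mult'')
  qed
  have "(\<integral>\<^sup>+ (x, y). ennreal (\<bar>u x - u y\<bar>\<^sup>2 / norm (x - y) powr (real DIM('a) + 2 * s)) \<partial>(lebesgue :: ('a \<times> 'a) measure))
    = (\<integral>\<^sup>+ (x, y). ?F x (y - x) \<partial>(lborel \<Otimes>\<^sub>M lborel))"
    unfolding eq lborel_prod by (rule nn_integral_completion)
  also have "\<dots> = (\<integral>\<^sup>+x. \<integral>\<^sup>+y. ?F x (y - x) \<partial>lborel \<partial>lborel)"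
    by (subst lborel.nn_integral_fst[symmetric]) auto
  also have "\<dots> = (\<integral>\<^sup>+x. \<integral>\<^sup>+h. ?F x h \<partial>lborel \<partial>lborel)"
  proof (rule nn_integral_cong)
    fix x
    show "(\<integral>\<^sup>+y. ?F x (y - x) \<partial>lborel) = (\<integral>\<^sup>+h. ?F x h \<partial>lborel)"
      using nn_integral_lborel_shift[of "\<lambda>h. ?F x h" "- x"] by simp
  qed
  also have "\<dots> = (\<integral>\<^sup>+h. \<integral>\<^sup>+x. ?F x h \<partial>lborel \<partial>lborel)"
    by (rule lborel_pair.Fubini') measurable
  also have "\<dots> = (\<integral>\<^sup>+h. shift_sq u h * ennreal (wt s h) \<partial>lborel)"
    unfolding shift_sq_def by (intro nn_integral_cong nn_integral_multc) measurable
  finally show ?thesis using s by (simp add: seminorm_sq_def)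
qed

abbreviation L2_sq :: "('a::euclidean_space \<Rightarrow> real) \<Rightarrow> ennreal" where
  "L2_sq u \<equiv> \<integral>\<^sup>+x. ennreal ((u x)\<^sup>2) \<partial>lborel"

lemma seminorm_sq_near_far:
  fixes u :: "'a::euclidean_space \<Rightarrow> real"
  assumes [measurable]: "u \<in> borel_measurable borel" and s: "0 < s" "s < 1"
    and u: "\<forall>x. d / 2 \<le> norm x \<longrightarrow> u x = 0"
  shows "seminorm_sq s u = ennreal (frac_const DIM('a) s) * (near_int d s u + 2 * L2_sq u * far_int TYPE('a) d s)"
proof -
  have "(\<integral>\<^sup>+h. shift_sq u h * ennreal (wt s h) \<partial>lborel) =
    (\<integral>\<^sup>+h. shift_sq u h * ennreal (wt s h) * indicator (ball 0 d) h + 2 * L2_sq u * (ennreal (wt s h) * indicator {h. d \<le> norm h} h) \<partial>lborel)"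
  proof (rule nn_integral_cong)
    fix h
    show "shift_sq u h * ennreal (wt s h) = shift_sq u h * ennreal (wt s h) * indicator (ball 0 d) h + 2 * L2_sq u * (ennreal (wt s h) * indicator {h. d \<le> norm h} h)"
    proof (cases "norm h < d")
      case False
      then show ?thesis using shift_sq_far[OF assms(1), of d h] u by (simp add: mult.assoc)
    qed simp
  qed
  also have "\<dots> = near_int d s u + 2 * L2_sq u * far_int TYPE('a) d s"
    unfolding near_int_def far_int_def by (subst nn_integral_add) (auto simp: nn_integral_cmult)
  finally show ?thesis using seminorm_sq_eq_shift[OF assms(1) s] by simp
qed

lemma powr_4_le_1 [simp]:
  "s \<le> 1 \<Longrightarrow> (4::real) powr (s - 1) \<le> 1" "0 \<le> s \<Longrightarrow> (4::real) powr - s \<le> 1"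
  using powr_mono[of "s - 1" 0 4] powr_mono[of "- s" 0 4] by simp_all

lemma ennreal_mult_mono:
  "\<lbrakk>a \<le> b; X \<le> Y\<rbrakk> \<Longrightarrow> ennreal a * X \<le> ennreal b * Y"
  by (intro mult_mono ennreal_leI) auto

lemma ennreal_mult_2: "ennreal (x * 2) = ennreal x * 2"
  using ennreal_mult''[of 2 x] by simp

lemma ennreal_mult_ge:
  assumes "ennreal a * X \<le> Y" "0 < a"
  shows "X \<le> ennreal (1 / a) * Y"
proof -
  have "X = ennreal (1 / a) * (ennreal a * X)" using assms(2) by (simp flip: mult.assoc ennreal_mult'')
  also have "\<dots> \<le> ennreal (1 / a) * Y" by (intro mult_left_mono assms) auto
  finally show ?thesis .
qed

text \<open>The constant does not depend on the order: \<open>near_int_ge\<close> bounds the part near the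
  diagonal when \<open>t\<close> is close to \<open>1\<close>, and the part far from it
  contributes when \<open>t\<close> is close to \<open>0\<close>.\<close>

lemma Poincare_Borel:
  fixes d :: real
  assumes d: "1 \<le> d"
  shows "\<exists>C>0. \<forall>t u. 0 < t \<longrightarrow> t < 1 \<longrightarrow> (u::'a::euclidean_space \<Rightarrow> real) \<in> borel_measurable borel \<longrightarrow>
     (\<forall>x. d / 2 \<le> norm x \<longrightarrow> u x = 0) \<longrightarrow> L2_sq u \<le> ennreal C * seminorm_sq t u"
proof -
  obtain k0 where k0: "0 < k0" and frac: "\<And>s. s \<in> {0<..<1} \<Longrightarrow> k0 * (s * (1 - s)) \<le> frac_const DIM('a) s"
    using frac_const_bounds[of "DIM('a)"] by (auto simp: DIM_positive)
  obtain c1 where c1: "0 < c1" "\<And>s. s \<in> {-1..1} \<Longrightarrow> ennreal c1 \<le> (\<integral>\<^sup>+h. ennreal (wt s (h::'a)) * indicator (shell d (2 * d)) h \<partial>lborel)"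
    using wt_shell_bounds[of d "2 * d", where 'a='a] d by force
  obtain c2 where c2: "0 < c2" "\<And>s. s \<in> {-1..1} \<Longrightarrow> ennreal c2 \<le> (\<integral>\<^sup>+h. ennreal (wt s (h::'a)) * indicator (shell (d / 2) d) h \<partial>lborel)"
    using wt_shell_bounds[of "d / 2" d, where 'a='a] d by force
  have l4: "0 < ln (4::real)" by simp
  define a where "a = min (k0 * c1 / ln 4) (k0 * c2 / (4 * ln 4))"
  have a: "0 < a" using k0 c1 c2 l4 by (simp add: a_def)
  have "ennreal a * L2_sq u \<le> seminorm_sq t u" if t: "0 < t" "t < 1" and u: "u \<in> borel_measurable borel"
    and u0: "\<forall>x. d / 2 \<le> norm x \<longrightarrow> u x = 0" for t and u :: "'a \<Rightarrow> real"
  proof (cases "t \<le> 1/2")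
    case True
    have "ennreal (k0 / 2 / ln 4 * 2) * (ennreal c1 * L2_sq u) \<le> ennreal (k0 / 2 / ln 4 * 2) * ((ennreal (1 - 4 powr - t) * far_int TYPE('a) d t) * L2_sq u)"
      using c1(2)[of t] t d by (intro mult_left_mono mult_right_mono) (auto simp: far_int_eq)
    also have "\<dots> = ennreal (k0 / 2 / ln 4 * 2 * (1 - 4 powr - t)) * (far_int TYPE('a) d t * L2_sq u)"
    proof -
      have "ennreal (k0 / 2 / ln 4 * 2 * (1 - 4 powr - t)) = ennreal (k0 / 2 / ln 4 * 2) * ennreal (1 - 4 powr - t)"
        using t k0 l4 by (intro ennreal_mult) auto
      then show ?thesis by (simp only: mult.assoc)
    qed
    also have "\<dots> \<le> ennreal (frac_const DIM('a) t * 2) * (far_int TYPE('a) d t * L2_sq u)"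
    proof (intro ennreal_mult_mono order_refl)
      have "k0 / 2 / ln 4 * 2 * (1 - 4 powr - t) \<le> k0 / 2 / ln 4 * 2 * (ln 4 * t)"
        using t k0 l4 by (intro mult_left_mono one_minus_powr_4_le) auto
      also have "\<dots> = k0 * (t * (1/2)) * 2" using l4 by simp
      also have "\<dots> \<le> k0 * (t * (1 - t)) * 2" using True t k0 by (intro mult_left_mono mult_right_mono) auto
      also have "\<dots> \<le> frac_const DIM('a) t * 2" using frac t by simp
      finally show "k0 / 2 / ln 4 * 2 * (1 - 4 powr - t) \<le> frac_const DIM('a) t * 2" .
    qed
    also have "\<dots> = ennreal (frac_const DIM('a) t) * (2 * L2_sq u * far_int TYPE('a) d t)"
      unfolding ennreal_mult_2 by (simp only: ac_simps)
    also have "\<dots> \<le> seminorm_sq t u"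
      unfolding seminorm_sq_near_far[OF u t u0] by (intro mult_left_mono) auto
    finally have "ennreal (k0 * c1 / ln 4) * L2_sq u \<le> seminorm_sq t u"
      using c1 k0 l4 by (simp flip: mult.assoc ennreal_mult'')
    then show ?thesis by (rule order_trans[rotated]) (auto intro!: ennreal_mult_mono simp: a_def)
  next
    case False
    have "ennreal (k0 / 2 / ln 4) * (ennreal (1/2) * L2_sq u * ennreal c2) \<le>
          ennreal (k0 / 2 / ln 4) * (ennreal (1/2) * L2_sq u * (\<integral>\<^sup>+h. ennreal (wt t (h::'a)) * indicator (shell (d / 2) d) h \<partial>lborel))"
      using c2(2)[of t] t by (intro mult_left_mono) auto
    also have "\<dots> \<le> ennreal (k0 / 2 / ln 4) * (ennreal (1 - 4 powr (t - 1)) * near_int d t u)"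
      using d t u u0 by (intro mult_left_mono near_int_ge) auto
    also have "\<dots> = ennreal (k0 / 2 / ln 4 * (1 - 4 powr (t - 1))) * near_int d t u"
      using t k0 l4 by (subst ennreal_mult) (auto simp: ac_simps)
    also have "\<dots> \<le> ennreal (frac_const DIM('a) t) * near_int d t u"
    proof (intro ennreal_mult_mono order_refl)
      have "k0 / 2 / ln 4 * (1 - 4 powr (t - 1)) \<le> k0 / 2 / ln 4 * (ln 4 * (1 - t))"
        using t k0 l4 one_minus_powr_4_le[of "1 - t"] by (intro mult_left_mono) auto
      also have "\<dots> = k0 * ((1/2) * (1 - t))" using l4 by simp
      also have "\<dots> \<le> k0 * (t * (1 - t))" using False t k0 by (intro mult_left_mono mult_right_mono) auto
      also have "\<dots> \<le> frac_const DIM('a) t" using frac t by simp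
      finally show "k0 / 2 / ln 4 * (1 - 4 powr (t - 1)) \<le> frac_const DIM('a) t" .
    qed
    also have "\<dots> \<le> seminorm_sq t u"
      unfolding seminorm_sq_near_far[OF u t u0] by (intro mult_left_mono) auto
    also have "ennreal (k0 / 2 / ln 4) * (ennreal (1/2) * L2_sq u * ennreal c2) = ennreal (k0 / 2 / ln 4 * (1/2) * c2) * L2_sq u"
      using c2 k0 l4 by (subst ennreal_mult, simp, simp, subst ennreal_mult) (simp_all add: ac_simps)
    also have "k0 / 2 / ln 4 * (1/2) * c2 = k0 * c2 / (4 * ln 4)" by simp
    finally show ?thesis by (rule order_trans[rotated]) (auto intro!: ennreal_mult_mono simp: a_def)
  qed
  then have "L2_sq u \<le> ennreal (1 / a) * seminorm_sq t u" if "0 < t" "t < 1" "u \<in> borel_measurable borel"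
     "\<forall>x. d / 2 \<le> norm x \<longrightarrow> u x = 0" for t and u :: "'a \<Rightarrow> real"
    using that a by (intro ennreal_mult_ge) auto
  then show ?thesis using a by (intro exI[of _ "1 / a"]) auto
qed

lemma seminorm_sq_upper:
  fixes d :: real
  assumes d: "1 \<le> d"
  shows "\<exists>C>0. \<forall>s u. 0 < s \<longrightarrow> s < 1 \<longrightarrow> (u::'a::euclidean_space \<Rightarrow> real) \<in> borel_measurable borel \<longrightarrow>
     (\<forall>x. d / 2 \<le> norm x \<longrightarrow> u x = 0) \<longrightarrow>
     seminorm_sq s u \<le> ennreal (C * s) * (ennreal (1 - 4 powr (s - 1)) * near_int d s u) + ennreal C * L2_sq u"
proof -
  obtain k1 where k1: "0 < k1" and frac: "\<And>s. s \<in> {0<..<1} \<Longrightarrow> frac_const DIM('a) s \<le> k1 * (s * (1 - s))"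
    using frac_const_bounds[of "DIM('a)"] by (auto simp: DIM_positive)
  obtain C1 where C1: "0 < C1" "\<And>s. s \<in> {-1..1} \<Longrightarrow> (\<integral>\<^sup>+h. ennreal (wt s (h::'a)) * indicator (shell d (2 * d)) h \<partial>lborel) \<le> ennreal C1"
    using wt_shell_bounds[of d "2 * d", where 'a='a] d by force
  have l4: "0 < ln (4::real)" by simp
  define L where "L = ln 4 / (1 + ln (4::real))"
  have L: "0 < L" unfolding L_def using l4 by (intro divide_pos_pos) linarith+
  have Lle: "s \<le> (1 / L) * (1 - 4 powr - s)" if "0 \<le> s" "s \<le> 1" for s
    using one_minus_powr_4_ge[OF that] L by (simp add: L_def[symmetric] field_simps)
  define C where "C = max (k1 / L) (k1 / L * C1 * 2)"
  have C: "0 < C" using k1 L by (simp add: C_def less_max_iff_disj)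
  have "seminorm_sq s u \<le> ennreal (C * s) * (ennreal (1 - 4 powr (s - 1)) * near_int d s u) + ennreal C * L2_sq u"
    if s: "0 < s" "s < 1" and u: "u \<in> borel_measurable borel" "\<forall>x. d / 2 \<le> norm x \<longrightarrow> u x = 0" for s and u :: "'a \<Rightarrow> real"
  proof -
    have "ennreal (frac_const DIM('a) s) * near_int d s u \<le> ennreal (C * s * (1 - 4 powr (s - 1))) * near_int d s u"
    proof (intro ennreal_mult_mono order_refl)
      have "frac_const DIM('a) s \<le> k1 * (s * (1 - s))" using frac s by simp
      also have "\<dots> \<le> k1 * (s * ((1 / L) * (1 - 4 powr (s - 1))))"
        using Lle[of "1 - s"] s k1 by (intro mult_left_mono) auto
      also have "\<dots> = (k1 / L) * (s * (1 - 4 powr (s - 1)))" by simp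
      also have "\<dots> \<le> C * (s * (1 - 4 powr (s - 1)))"
        using s by (intro mult_right_mono mult_nonneg_nonneg) (auto simp: C_def)
      finally show "frac_const DIM('a) s \<le> C * s * (1 - 4 powr (s - 1))" by (simp add: mult.assoc)
    qed
    also have "\<dots> = ennreal (C * s) * (ennreal (1 - 4 powr (s - 1)) * near_int d s u)"
      using s C by (subst ennreal_mult) (auto simp: mult.assoc)
    finally have near: "ennreal (frac_const DIM('a) s) * near_int d s u \<le> ennreal (C * s) * (ennreal (1 - 4 powr (s - 1)) * near_int d s u)" .
    have "ennreal (frac_const DIM('a) s) * (2 * L2_sq u * far_int TYPE('a) d s) \<le> ennreal (k1 / L * (1 - 4 powr - s)) * (2 * L2_sq u * far_int TYPE('a) d s)"
    proof (intro ennreal_mult_mono order_refl)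
      have "frac_const DIM('a) s \<le> k1 * (s * (1 - s))" using frac s by simp
      also have "\<dots> \<le> k1 * ((1 / L) * (1 - 4 powr - s) * 1)"
        using Lle[of s] s k1 by (intro mult_left_mono mult_mono) auto
      finally show "frac_const DIM('a) s \<le> k1 / L * (1 - 4 powr - s)" by simp
    qed
    also have "\<dots> = ennreal (k1 / L) * (2 * L2_sq u) * (ennreal (1 - 4 powr - s) * far_int TYPE('a) d s)"
      using s k1 L by (subst ennreal_mult) (auto simp: ac_simps)
    also have "\<dots> \<le> ennreal (k1 / L) * (2 * L2_sq u) * ennreal C1"
      using s d C1 by (intro mult_left_mono) (auto simp: far_int_eq)
    also have "\<dots> = ennreal (k1 / L * C1 * 2) * L2_sq u"
      using C1 unfolding ennreal_mult_2 by (subst ennreal_mult'') (simp_all only: less_imp_le ac_simps)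
    also have "\<dots> \<le> ennreal C * L2_sq u" by (intro ennreal_mult_mono) (auto simp: C_def)
    finally have far: "ennreal (frac_const DIM('a) s) * (2 * L2_sq u * far_int TYPE('a) d s) \<le> ennreal C * L2_sq u" .
    show ?thesis
      unfolding seminorm_sq_near_far[OF u(1) s u(2)] distrib_left by (rule add_mono[OF near far])
  qed
  then show ?thesis using C by blast
qed

text \<open>The near parts compare by \<open>near_int_mono\<close>; the far part of the smaller seminorm is a
  multiple of the \<open>L\<^sup>2\<close> norm, which \<open>Poincare_Borel\<close> absorbs.\<close>

lemma seminorm_sq_mono_Borel:
  fixes d :: real
  assumes d: "1 \<le> d"
  shows "\<exists>C>0. \<forall>s t u. 0 < s \<longrightarrow> s \<le> t \<longrightarrow> t < 1 \<longrightarrow> (u::'a::euclidean_space \<Rightarrow> real) \<in> borel_measurable borel \<longrightarrow>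
     (\<forall>x. d / 2 \<le> norm x \<longrightarrow> u x = 0) \<longrightarrow> seminorm_sq s u \<le> ennreal C * seminorm_sq t u"
proof -
  obtain C where C: "0 < C" and up: "\<And>s (u::'a \<Rightarrow> real). \<lbrakk>0 < s; s < 1; u \<in> borel_measurable borel; \<forall>x. d / 2 \<le> norm x \<longrightarrow> u x = 0\<rbrakk> \<Longrightarrow>
     seminorm_sq s u \<le> ennreal (C * s) * (ennreal (1 - 4 powr (s - 1)) * near_int d s u) + ennreal C * L2_sq u"
    using seminorm_sq_upper[OF d, where 'a='a] by blast
  obtain P where P: "0 < P" "\<And>t (u::'a \<Rightarrow> real). \<lbrakk>0 < t; t < 1; u \<in> borel_measurable borel; \<forall>x. d / 2 \<le> norm x \<longrightarrow> u x = 0\<rbrakk> \<Longrightarrow>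
     L2_sq u \<le> ennreal P * seminorm_sq t u"
    using Poincare_Borel[OF d, where 'a='a] by blast
  obtain k0 where k0: "0 < k0" and frac: "\<And>s. s \<in> {0<..<1} \<Longrightarrow> k0 * (s * (1 - s)) \<le> frac_const DIM('a) s"
    using frac_const_bounds[of "DIM('a)"] by (auto simp: DIM_positive)
  have l4: "0 < ln (4::real)" by simp
  define M where "M = C * d\<^sup>2 * ln 4 / k0 + C * P"
  have M: "0 < M" using C P l4 k0 d by (simp add: M_def add_nonneg_pos)
  have "seminorm_sq s u \<le> ennreal M * seminorm_sq t u"
    if s: "0 < s" "s \<le> t" "t < 1" and u: "u \<in> borel_measurable borel" "\<forall>x. d / 2 \<le> norm x \<longrightarrow> u x = 0" for s t and u :: "'a \<Rightarrow> real"
  proof -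
    have t: "0 < t" using s by simp
    have "ennreal (C * s) * (ennreal (1 - 4 powr (s - 1)) * near_int d s u) \<le>
       ennreal (C * t) * (ennreal (d powr (2 * (t - s))) * (ennreal (1 - 4 powr (t - 1)) * near_int d t u))"
      using s d u C by (intro ennreal_mult_mono near_int_mono mult_left_mono) auto
    also have "\<dots> \<le> ennreal (C * t) * (ennreal (d\<^sup>2) * (ennreal (ln 4 * (1 - t)) * near_int d t u))"
    proof (intro mult_left_mono ennreal_mult_mono order_refl)
      have "d powr (2 * (t - s)) \<le> d powr 2" using d s by (intro powr_mono) auto
      then show "d powr (2 * (t - s)) \<le> d\<^sup>2" using d by simp
      show "1 - 4 powr (t - 1) \<le> ln 4 * (1 - t)" using one_minus_powr_4_le[of "1 - t"] s by simp
    qed auto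
    also have "\<dots> = ennreal (C * t * d\<^sup>2 * (ln 4 * (1 - t))) * near_int d t u"
      using C t s l4 d by (simp add: ennreal_mult mult.assoc)
    also have "\<dots> \<le> ennreal (C * d\<^sup>2 * ln 4 / k0 * frac_const DIM('a) t) * near_int d t u"
    proof (intro ennreal_mult_mono order_refl)
      have "C * t * d\<^sup>2 * (ln 4 * (1 - t)) = C * d\<^sup>2 * ln 4 / k0 * (k0 * (t * (1 - t)))" using k0 by simp
      also have "\<dots> \<le> C * d\<^sup>2 * ln 4 / k0 * frac_const DIM('a) t"
        using frac[of t] s t C l4 k0 by (intro mult_left_mono) auto
      finally show "C * t * d\<^sup>2 * (ln 4 * (1 - t)) \<le> C * d\<^sup>2 * ln 4 / k0 * frac_const DIM('a) t" .
    qed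
    also have "\<dots> = ennreal (C * d\<^sup>2 * ln 4 / k0) * (ennreal (frac_const DIM('a) t) * near_int d t u)"
      using C l4 k0 frac[of t] s t by (subst ennreal_mult') (auto simp: mult.assoc)
    also have "\<dots> \<le> ennreal (C * d\<^sup>2 * ln 4 / k0) * seminorm_sq t u"
      using seminorm_sq_near_far[OF u(1) t s(3) u(2)] by (intro mult_left_mono) (auto intro!: mult_left_mono)
    finally have 1: "ennreal (C * s) * (ennreal (1 - 4 powr (s - 1)) * near_int d s u) \<le> ennreal (C * d\<^sup>2 * ln 4 / k0) * seminorm_sq t u" .
    have "ennreal C * L2_sq u \<le> ennreal C * (ennreal P * seminorm_sq t u)"
      using P(2)[OF t s(3) u] by (intro mult_left_mono) auto
    then have 2: "ennreal C * L2_sq u \<le> ennreal (C * P) * seminorm_sq t u"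
      using C P by (simp add: ennreal_mult mult.assoc)
    have "seminorm_sq s u \<le> ennreal (C * d\<^sup>2 * ln 4 / k0) * seminorm_sq t u + ennreal (C * P) * seminorm_sq t u"
      by (rule order_trans[OF up add_mono[OF 1 2]]) (use s u in auto)
    also have "\<dots> = ennreal M * seminorm_sq t u"
      using C P l4 k0 unfolding M_def by (subst ennreal_plus) (auto simp: distrib_right)
    finally show ?thesis .
  qed
  then show ?thesis using M by blast
qed

lemma seminorm_sq_grad_Borel:
  fixes d :: real
  assumes d: "1 \<le> d"
  shows "\<exists>C>0. \<forall>s u A. 0 < s \<longrightarrow> s < 1 \<longrightarrow> (u::'a::euclidean_space \<Rightarrow> real) \<in> borel_measurable borel \<longrightarrow>
     (\<forall>x. d / 2 \<le> norm x \<longrightarrow> u x = 0) \<longrightarrow> (\<forall>h. shift_sq u h \<le> A * ennreal ((norm h)\<^sup>2)) \<longrightarrow>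
     seminorm_sq s u \<le> ennreal C * A \<and> L2_sq u \<le> ennreal C * A"
proof -
  obtain C where C: "0 < C" and up: "\<And>s (u::'a \<Rightarrow> real). \<lbrakk>0 < s; s < 1; u \<in> borel_measurable borel; \<forall>x. d / 2 \<le> norm x \<longrightarrow> u x = 0\<rbrakk> \<Longrightarrow>
     seminorm_sq s u \<le> ennreal (C * s) * (ennreal (1 - 4 powr (s - 1)) * near_int d s u) + ennreal C * L2_sq u"
    using seminorm_sq_upper[OF d, where 'a='a] by blast
  obtain C1 where C1: "0 < C1" "\<And>s. s \<in> {-1..1} \<Longrightarrow> (\<integral>\<^sup>+h. ennreal (wt s (h::'a)) * indicator (shell (d / 2) d) h \<partial>lborel) \<le> ennreal C1"
    using wt_shell_bounds[of "d / 2" d, where 'a='a] d by force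
  define M where "M = C * C1 + C * d\<^sup>2 + d\<^sup>2"
  have M: "0 < M" using C C1 d by (simp add: M_def add_pos_nonneg)
  have "seminorm_sq s u \<le> ennreal M * A \<and> L2_sq u \<le> ennreal M * A"
    if s: "0 < s" "s < 1" and u: "u \<in> borel_measurable borel" "\<forall>x. d / 2 \<le> norm x \<longrightarrow> u x = 0" and A: "\<forall>h. shift_sq u h \<le> A * ennreal ((norm h)\<^sup>2)"
    for s A and u :: "'a \<Rightarrow> real"
  proof -
    obtain e :: 'a where e: "e \<in> Basis" using nonempty_Basis by blast
    have "L2_sq u \<le> 2 * L2_sq u" using mult_right_mono[of 1 2 "L2_sq u"] by simp
    also have "\<dots> = shift_sq u (d *\<^sub>R e)" using u d e by (subst shift_sq_far[where d=d]) auto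
    also have "\<dots> \<le> A * ennreal ((norm (d *\<^sub>R e))\<^sup>2)" using A by blast
    also have "\<dots> = ennreal (d\<^sup>2) * A" using e d by (simp add: mult.commute)
    finally have L2: "L2_sq u \<le> ennreal (d\<^sup>2) * A" .
    have "ennreal (C * s) * (ennreal (1 - 4 powr (s - 1)) * near_int d s u) \<le> ennreal C * (A * ennreal C1)"
    proof (rule ennreal_mult_mono)
      show "C * s \<le> C" using s C by simp
      have "ennreal (1 - 4 powr (s - 1)) * near_int d s u \<le> A * (\<integral>\<^sup>+h. ennreal (wt (s - 1) (h::'a)) * indicator (shell (d / 2) d) h \<partial>lborel)"
        using u A s d by (intro near_int_grad_le) auto
      also have "\<dots> \<le> A * ennreal C1" using s C1(2)[of "s - 1"] by (intro mult_left_mono) auto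
      finally show "ennreal (1 - 4 powr (s - 1)) * near_int d s u \<le> A * ennreal C1" .
    qed
    then have 1: "ennreal (C * s) * (ennreal (1 - 4 powr (s - 1)) * near_int d s u) \<le> ennreal (C * C1) * A"
      using C C1 by (simp add: ennreal_mult ac_simps)
    have "ennreal C * L2_sq u \<le> ennreal C * (ennreal (d\<^sup>2) * A)"
      using L2 by (intro mult_left_mono) auto
    then have 2: "ennreal C * L2_sq u \<le> ennreal (C * d\<^sup>2) * A" using C by (simp add: ennreal_mult ac_simps)
    have "seminorm_sq s u \<le> ennreal (C * C1) * A + ennreal (C * d\<^sup>2) * A"
      by (rule order_trans[OF up add_mono[OF 1 2]]) (use s u in auto)
    also have "\<dots> = ennreal (C * C1 + C * d\<^sup>2) * A"
      using C C1 by (subst ennreal_plus) (auto simp: distrib_right)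
    also have "\<dots> \<le> ennreal M * A" by (intro ennreal_mult_mono) (auto simp: M_def)
    finally have "seminorm_sq s u \<le> ennreal M * A" .
    moreover have "ennreal (d\<^sup>2) * A \<le> ennreal M * A"
      using C C1 by (intro ennreal_mult_mono) (auto simp: M_def)
    ultimately show ?thesis using L2 by auto
  qed
  then show ?thesis using M by blast
qed

section \<open>Test functions and the fundamental lemma of the calculus of variations\<close>

definition C1 :: "('a::euclidean_space \<Rightarrow> real) \<Rightarrow> bool" where
  "C1 \<phi> \<longleftrightarrow> (\<exists>D. (\<forall>x. GDERIV \<phi> x :> D x) \<and> continuous_on UNIV D)"

lemma GDERIV_continuous_on:
  assumes "\<And>x. GDERIV \<phi> x :> D x"
  shows "continuous_on UNIV \<phi>"
  using assms has_derivative_continuous unfolding gderiv_def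
  by (intro continuous_at_imp_continuous_on) blast

lemma C1_const: "C1 (\<lambda>x. c)"
  unfolding C1_def by (intro exI[of _ "\<lambda>x. 0"]) (auto intro: GDERIV_const)

lemma C1_mult:
  assumes "C1 f" "C1 g" shows "C1 (\<lambda>x. f x * g x)"
proof -
  obtain Df Dg where f: "\<And>x. GDERIV f x :> Df x" "continuous_on UNIV Df"
    and g: "\<And>x. GDERIV g x :> Dg x" "continuous_on UNIV Dg"
    using assms unfolding C1_def by blast
  show ?thesis unfolding C1_def
    by (intro exI[of _ "\<lambda>x. f x *\<^sub>R Dg x + g x *\<^sub>R Df x"] conjI allI GDERIV_mult f g continuous_intros
        GDERIV_continuous_on[OF f(1)] GDERIV_continuous_on[OF g(1)])
qed

lemma C1_prod: "finite I \<Longrightarrow> (\<And>i. i \<in> I \<Longrightarrow> C1 (f i)) \<Longrightarrow> C1 (\<lambda>x. \<Prod>i\<in>I. f i x)"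
  by (induction rule: finite_induct) (auto intro: C1_const C1_mult)

lemma C1_compose:
  assumes "C1 f" and h: "\<And>x. DERIV h (f x) :> h' (f x)" and cont: "continuous_on (range f) h'"
  shows "C1 (\<lambda>x. h (f x))"
proof -
  obtain D where f: "\<And>x. GDERIV f x :> D x" "continuous_on UNIV D"
    using assms unfolding C1_def by blast
  show ?thesis unfolding C1_def
    by (intro exI[of _ "\<lambda>x. h' (f x) *\<^sub>R D x"] conjI allI GDERIV_DERIV_compose[OF f(1) h] continuous_intros f(2)
        continuous_on_compose2[OF cont GDERIV_continuous_on[OF f(1)]]) auto
qed

lemma DERIV_pos_sq: "((\<lambda>r. (max 0 r)\<^sup>2) has_real_derivative 2 * max 0 r) (at (r::real))"
proof (cases r "0::real" rule: linorder_cases)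
  case less
  have "((\<lambda>r. 0) has_real_derivative 0) (at r)" by simp
  then have "((\<lambda>r. (max 0 r)\<^sup>2) has_real_derivative 0) (at r)"
    by (rule has_field_derivative_transform_within_open[of _ _ _ "{..<0}"]) (use less in auto)
  then show ?thesis using less by (simp add: max_def)
next
  case greater
  have "((\<lambda>r. r\<^sup>2) has_real_derivative 2 * r) (at r)" by (auto intro!: derivative_eq_intros)
  then have "((\<lambda>r. (max 0 r)\<^sup>2) has_real_derivative 2 * r) (at r)"
    by (rule has_field_derivative_transform_within_open[of _ _ _ "{0<..}"]) (use greater in auto)
  then show ?thesis using greater by (simp add: max_def)
next
  case equal
  have "((\<lambda>h. ((max 0 h)\<^sup>2 - (max 0 0)\<^sup>2) / h) \<longlongrightarrow> 0) (at (0::real))"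
  proof (rule Lim_null_comparison)
    show "\<forall>\<^sub>F h in at (0::real). norm (((max 0 h)\<^sup>2 - (max 0 0)\<^sup>2) / h) \<le> \<bar>h\<bar>"
      by (rule always_eventually) (auto simp: max_def power2_eq_square)
    show "((\<lambda>h. \<bar>h\<bar>) \<longlongrightarrow> 0) (at (0::real))" by (rule tendsto_eq_intros refl | simp)+
  qed
  then show ?thesis using equal by (simp add: DERIV_def)
qed

text \<open>Squares of positive parts, because \<open>C\<^sup>1\<close> test functions suffice.\<close>

definition bump :: "'a::euclidean_space \<Rightarrow> 'a \<Rightarrow> 'a \<Rightarrow> real" where
  "bump a b x = (\<Prod>i\<in>Basis. (max 0 ((x \<bullet> i - a \<bullet> i) * (b \<bullet> i - x \<bullet> i)))\<^sup>2)"

lemma C1_bump: "C1 (bump a b)"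
  unfolding bump_def
proof (rule C1_prod)
  fix i :: 'a assume "i \<in> Basis"
  have "C1 (\<lambda>x. x \<bullet> i)" unfolding C1_def gderiv_def
    by (intro exI[of _ "\<lambda>x. i"]) (auto intro!: derivative_eq_intros)
  then show "C1 (\<lambda>x. (max 0 ((x \<bullet> i - a \<bullet> i) * (b \<bullet> i - x \<bullet> i)))\<^sup>2)"
  proof (rule C1_compose[where h="\<lambda>y. (max 0 ((y - a \<bullet> i) * (b \<bullet> i - y)))\<^sup>2"
       and h'="\<lambda>y. 2 * max 0 ((y - a \<bullet> i) * (b \<bullet> i - y)) * (a \<bullet> i + b \<bullet> i - 2 * y)"])
    fix x
    show "((\<lambda>y. (max 0 ((y - a \<bullet> i) * (b \<bullet> i - y)))\<^sup>2) has_real_derivative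
        2 * max 0 ((x \<bullet> i - a \<bullet> i) * (b \<bullet> i - x \<bullet> i)) * (a \<bullet> i + b \<bullet> i - 2 * (x \<bullet> i))) (at (x \<bullet> i))"
      by (rule DERIV_chain'[OF _ DERIV_pos_sq, of "\<lambda>y. (y - a \<bullet> i) * (b \<bullet> i - y)", THEN DERIV_cong])
         (auto intro!: derivative_eq_intros)
  qed (intro continuous_intros)
qed simp

lemma bump_nonneg: "0 \<le> bump a b x"
  unfolding bump_def by (intro prod_nonneg) auto

lemma prod_pos_iff:
  fixes f :: "'i \<Rightarrow> real"
  shows "finite A \<Longrightarrow> (\<And>i. i \<in> A \<Longrightarrow> 0 \<le> f i) \<Longrightarrow> 0 < prod f A \<longleftrightarrow> (\<forall>i\<in>A. 0 < f i)"
proof (induction rule: finite_induct)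
  case (insert i A)
  then have "0 \<le> f i" "0 \<le> prod f A" by (auto intro: prod_nonneg)
  then show ?case using insert by (auto simp: zero_less_mult_iff)
qed simp

lemma bump_pos_iff:
  assumes "\<And>i. i \<in> Basis \<Longrightarrow> a \<bullet> i < b \<bullet> i"
  shows "0 < bump a b x \<longleftrightarrow> x \<in> box a b"
proof -
  have "0 < (max 0 ((x \<bullet> i - a \<bullet> i) * (b \<bullet> i - x \<bullet> i)))\<^sup>2 \<longleftrightarrow> a \<bullet> i < x \<bullet> i \<and> x \<bullet> i < b \<bullet> i" if "i \<in> Basis" for i
  proof -
    have pos: "0 < (max 0 r)\<^sup>2 \<longleftrightarrow> 0 < r" for r :: real
      by (cases "0 < r") (simp_all add: max_absorb1 max_absorb2)
    show ?thesis unfolding pos zero_less_mult_iff using assms[OF that] by linarith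
  qed
  moreover have "0 < bump a b x \<longleftrightarrow> (\<forall>i\<in>Basis. 0 < (max 0 ((x \<bullet> i - a \<bullet> i) * (b \<bullet> i - x \<bullet> i)))\<^sup>2)"
    unfolding bump_def by (rule prod_pos_iff) simp_all
  ultimately show ?thesis by (auto simp: mem_box)
qed

definition test_function :: "('a::euclidean_space \<Rightarrow> real) \<Rightarrow> ('a \<Rightarrow> 'a) \<Rightarrow> bool" where
  "test_function \<phi> D \<longleftrightarrow> (\<forall>x. GDERIV \<phi> x :> D x) \<and> continuous_on UNIV D \<and> bounded {x. \<phi> x \<noteq> 0}"

lemma test_function_continuous:
  "test_function \<phi> D \<Longrightarrow> continuous_on UNIV \<phi>" "test_function \<phi> D \<Longrightarrow> continuous_on UNIV D"
  using GDERIV_continuous_on by (auto simp: test_function_def)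

lemma test_function_support:
  assumes "test_function \<phi> D"
  obtains R where "0 < R" "\<And>x. x \<notin> cball 0 R \<Longrightarrow> \<phi> x = 0" "\<And>x. x \<notin> cball 0 R \<Longrightarrow> D x = 0"
proof -
  obtain R where R: "0 < R" "{x. \<phi> x \<noteq> 0} \<subseteq> ball 0 R"
    using assms bounded_subset_ballD unfolding test_function_def by blast
  have zero: "\<phi> x = 0" if "x \<notin> cball 0 R" for x using R that by auto
  have "D x = 0" if x: "x \<notin> cball 0 R" for x
  proof -
    have "(\<phi> has_derivative (\<lambda>h. h \<bullet> D x)) (at x)" using assms by (simp add: test_function_def gderiv_def)
    moreover have "(\<phi> has_derivative (\<lambda>h. 0)) (at x)"
      by (rule has_derivative_transform_within_open[of "\<lambda>x. 0" _ _ _ "- cball 0 R"])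
         (use x zero in \<open>auto simp: open_Compl\<close>)
    ultimately have "(\<lambda>h. h \<bullet> D x) = (\<lambda>h. 0)" by (rule has_derivative_unique)
    then have "D x \<bullet> D x = 0" by (rule fun_cong)
    then show ?thesis by simp
  qed
  then show ?thesis using that R zero by blast
qed

lemma continuous_bounded_support:
  fixes \<Psi> :: "'a::euclidean_space \<Rightarrow> 'b::real_normed_vector"
  assumes "continuous_on UNIV \<Psi>" "\<And>x. x \<notin> cball 0 R \<Longrightarrow> \<Psi> x = 0"
  obtains M where "0 \<le> M" "\<And>x. norm (\<Psi> x) \<le> M"
proof -
  have "compact (\<Psi> ` cball 0 R)" by (intro compact_continuous_image continuous_on_subset[OF assms(1)]) auto
  then obtain M where "\<And>x. x \<in> cball 0 R \<Longrightarrow> norm (\<Psi> x) \<le> M"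
    using compact_imp_bounded[THEN bounded_normE] by (metis imageI)
  then have "norm (\<Psi> x) \<le> max 0 M" for x using assms(2)[of x] by (cases "x \<in> cball 0 R") fastforce+
  then show ?thesis using that[of "max 0 M"] by auto
qed

lemma locally_integrable_times:
  fixes f :: "'a::euclidean_space \<Rightarrow> 'b::euclidean_space" and \<Psi> :: "'a \<Rightarrow> 'c::euclidean_space"
    and p :: "'b \<Rightarrow> 'c \<Rightarrow> 'd::euclidean_space"
  assumes "bounded_bilinear p" "locally_integrable f"
    and cont: "continuous_on UNIV \<Psi>" and supp: "\<And>x. x \<notin> cball 0 R \<Longrightarrow> \<Psi> x = 0"
  shows "integrable lebesgue (\<lambda>x. p (f x) (\<Psi> x))"
proof -
  interpret bounded_bilinear p by fact
  obtain M where M: "0 \<le> M" "\<And>x. norm (\<Psi> x) \<le> M" using continuous_bounded_support[OF cont supp] by blast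
  obtain K where K: "0 \<le> K" "\<And>a b. norm (p a b) \<le> norm a * norm b * K" using nonneg_bounded by blast
  define F where "F x = indicator (cball 0 R) x *\<^sub>R f x" for x
  have F: "integrable lebesgue F"
    using assms(2) unfolding locally_integrable_def set_integrable_def F_def by auto
  have eq: "p (f x) (\<Psi> x) = p (F x) (\<Psi> x)" for x
    using supp[of x] by (cases "x \<in> cball 0 R") (auto simp: F_def zero_right)
  have [measurable]: "\<Psi> \<in> borel_measurable lebesgue"
    using borel_measurable_continuous_onI[OF cont] by (simp add: measurable_completion)
  have [measurable]: "F \<in> borel_measurable lebesgue" using F by simp
  have "(\<lambda>x. p (F x) (\<Psi> x)) \<in> borel_measurable lebesgue"
    by (rule borel_measurable_continuous_Pair) (auto intro!: continuous_intros continuous_on)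
  then show ?thesis unfolding eq
  proof (rule Bochner_Integration.integrable_bound[rotated])
    show "integrable lebesgue (\<lambda>x. M * K * norm (F x))" using F by simp
    have "norm (p (F x) (\<Psi> x)) \<le> norm (M * K * norm (F x))" for x
    proof -
      have "norm (p (F x) (\<Psi> x)) \<le> norm (F x) * norm (\<Psi> x) * K" by (rule K)
      also have "\<dots> \<le> norm (F x) * M * K" using M K by (intro mult_right_mono mult_left_mono) auto
      finally show ?thesis using M K by (simp add: ac_simps)
    qed
    then show "AE x in lebesgue. norm (p (F x) (\<Psi> x)) \<le> norm (M * K * norm (F x))" by simp
  qed
qed

text \<open>The compositions \<open>n \<phi> / (1 + n \<phi>)\<close> of a bump function \<open>\<phi>\<close>
  tend to the indicator of its box, so \<open>g\<close> has integral zero over every box, and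
  boxes generate the Borel sets.\<close>

lemma fundamental_lemma:
  fixes g :: "'a::euclidean_space \<Rightarrow> 'b::euclidean_space"
  assumes g: "locally_integrable g"
    and test: "\<And>\<phi> D. test_function \<phi> D \<Longrightarrow> (LINT x|lebesgue. \<phi> x *\<^sub>R g x) = 0"
  shows "AE x in lebesgue. g x = 0"
proof -
  have box0: "(LINT x:box a b|lebesgue. g x) = 0" if ab: "\<And>i. i \<in> Basis \<Longrightarrow> a \<bullet> i < b \<bullet> i" for a b
  proof -
    define h where "h n t = real n * t / (1 + real n * t)" for n t
    define \<phi> where "\<phi> n x = h n (bump a b x)" for n x
    have pos: "0 < 1 + real n * t" if "0 \<le> t" for n t using that by (simp add: add_pos_nonneg)
    have "C1 (\<phi> n)" for n
      unfolding \<phi>_def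
    proof (rule C1_compose[OF C1_bump, where h'="\<lambda>t. real n / (1 + real n * t)\<^sup>2"])
      fix x
      show "DERIV (h n) (bump a b x) :> real n / (1 + real n * bump a b x)\<^sup>2"
        unfolding h_def using pos[OF bump_nonneg, of n a b x]
        by (auto intro!: derivative_eq_intros simp: field_simps power2_eq_square)
      show "continuous_on (range (bump a b)) (\<lambda>t. real n / (1 + real n * t)\<^sup>2)"
        using pos[OF bump_nonneg, of n a b] by (intro continuous_intros) (auto simp: less_imp_neq[symmetric])
    qed
    moreover have supp: "\<phi> n x = 0" if "x \<notin> box a b" for n x
      using bump_pos_iff[OF ab, of x] bump_nonneg[of a b x] that by (auto simp: \<phi>_def h_def)
    then have "bounded {x. \<phi> n x \<noteq> 0}" for n
      by (intro bounded_subset[OF bounded_box[of a b]]) auto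
    ultimately have zero: "(LINT x|lebesgue. \<phi> n x *\<^sub>R g x) = 0" for n
      using test unfolding C1_def test_function_def by blast
    have g_int: "integrable lebesgue (\<lambda>x. indicator (cbox a b) x *\<^sub>R g x)"
      using g unfolding locally_integrable_def set_integrable_def by auto
    have meas: "(\<lambda>x. indicator (cbox a b) x *\<^sub>R g x) \<in> borel_measurable lebesgue" using g_int by simp
    have bump_meas: "bump a b \<in> borel_measurable lebesgue"
    proof -
      have "continuous_on UNIV (bump a b)" using C1_bump[of a b] GDERIV_continuous_on unfolding C1_def by blast
      from borel_measurable_continuous_onI[OF this] show ?thesis by (simp add: measurable_completion)
    qed
    have \<phi>_bound: "0 \<le> \<phi> n x" "\<phi> n x \<le> 1" for n x
      using pos[OF bump_nonneg, of n a b x] bump_nonneg[of a b x] by (auto simp: \<phi>_def h_def)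
    have "(\<lambda>n. LINT x|lebesgue. \<phi> n x *\<^sub>R g x) \<longlonglongrightarrow> (LINT x|lebesgue. indicator (box a b) x *\<^sub>R g x)"
    proof (rule integral_dominated_convergence[where w="\<lambda>x. norm (indicator (cbox a b) x *\<^sub>R g x)"])
      have eq1: "(\<lambda>x. \<phi> n x *\<^sub>R g x) = (\<lambda>x. \<phi> n x *\<^sub>R (indicator (cbox a b) x *\<^sub>R g x))" for n
        using supp[of _ n] box_subset_cbox[of a b] by (auto simp: fun_eq_iff indicator_def)
      have \<phi>_meas: "\<phi> n \<in> borel_measurable lebesgue" for n
        unfolding \<phi>_def[abs_def] h_def using bump_meas by measurable
      show "(\<lambda>x. \<phi> n x *\<^sub>R g x) \<in> borel_measurable lebesgue" for n
        by (subst eq1) (rule borel_measurable_scaleR[OF \<phi>_meas meas])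
      have eq2: "(\<lambda>x. indicator (box a b) x *\<^sub>R g x) = (\<lambda>x. indicat_real (box a b) x *\<^sub>R (indicator (cbox a b) x *\<^sub>R g x))"
        using box_subset_cbox[of a b] by (auto simp: fun_eq_iff indicator_def)
      have ind_meas: "(indicat_real (box a b)) \<in> borel_measurable lebesgue" by (intro borel_measurable_indicator) auto
      show "(\<lambda>x. indicator (box a b) x *\<^sub>R g x) \<in> borel_measurable lebesgue"
        by (subst eq2) (rule borel_measurable_scaleR[OF ind_meas meas])
      show "integrable lebesgue (\<lambda>x. norm (indicator (cbox a b) x *\<^sub>R g x))"
        by (rule integrable_norm[OF g_int])
      have "(\<lambda>n. \<phi> n x) \<longlonglongrightarrow> indicator (box a b) x" for x
      proof (cases "x \<in> box a b")
        case True
        then have "0 < bump a b x" using bump_pos_iff[OF ab] by blast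
        then have "(\<lambda>n. h n (bump a b x)) \<longlonglongrightarrow> 1" unfolding h_def by real_asymp
        then show ?thesis using True by (simp add: \<phi>_def)
      qed (use supp in auto)
      then have "(\<lambda>n. \<phi> n x *\<^sub>R g x) \<longlonglongrightarrow> indicator (box a b) x *\<^sub>R g x" for x
        by (rule tendsto_scaleR) (rule tendsto_const)
      then show "AE x in lebesgue. (\<lambda>n. \<phi> n x *\<^sub>R g x) \<longlonglongrightarrow> indicator (box a b) x *\<^sub>R g x"
        by (rule AE_I2)
      have "norm (\<phi> n x *\<^sub>R g x) \<le> norm (indicat_real (cbox a b) x *\<^sub>R g x)" for n x
      proof (cases "x \<in> box a b")
        case True
        then have "indicat_real (cbox a b) x = 1" using box_subset_cbox[of a b] by auto
        moreover have "\<bar>\<phi> n x\<bar> * norm (g x) \<le> 1 * norm (g x)"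
          using \<phi>_bound[of n x] by (intro mult_right_mono) auto
        ultimately show ?thesis by simp
      next
        case False
        have "\<phi> n x *\<^sub>R g x = 0" unfolding supp[OF False] by (rule scaleR_zero_left)
        then show ?thesis by (metis norm_ge_zero norm_zero)
      qed
      then show "AE x in lebesgue. norm (\<phi> n x *\<^sub>R g x) \<le> norm (indicator (cbox a b) x *\<^sub>R g x)" for n
        by (rule AE_I2)
    qed
    then show ?thesis unfolding zero set_lebesgue_integral_def by (simp only: LIMSEQ_const_iff)
  qed
  have int_box: "g integrable_on cbox a b" for a b
    using g set_lebesgue_integral_eq_integral(1)[of "cbox a b" g] unfolding locally_integrable_def by auto
  have box_zero: "integral (cbox a b) g = 0" if ab: "\<And>i. i \<in> Basis \<Longrightarrow> a \<bullet> i < b \<bullet> i" for a b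
  proof -
    have "set_integrable lebesgue (box a b) g"
      using g box_subset_cbox[of a b] set_integrable_subset[of lebesgue "cbox a b" g "box a b"]
      unfolding locally_integrable_def by auto
    then show ?thesis
      using box0[OF ab] set_lebesgue_integral_eq_integral(2)[of "box a b" g] integral_open_interval[of a b g] by simp
  qed
  obtain N where N: "negligible N" and diff: "\<And>x e. \<lbrakk>x \<notin> N; 0 < e\<rbrakk> \<Longrightarrow>
      \<exists>d>0. \<forall>h. 0 < h \<and> h < d \<longrightarrow> norm (integral (cbox x (x + h *\<^sub>R One)) g /\<^sub>R h ^ DIM('a) - g x) < e"
    using integrable_ccontinuous_explicit[OF int_box] by blast
  have "g x = 0" if x: "x \<notin> N" for x
  proof (rule ccontr)
    assume "g x \<noteq> 0"
    then obtain d where d: "d > 0" and small: "\<And>h. 0 < h \<Longrightarrow> h < d \<Longrightarrow> norm (integral (cbox x (x + h *\<^sub>R One)) g /\<^sub>R h ^ DIM('a) - g x) < norm (g x)"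
      using diff[OF x, of "norm (g x)"] by auto
    have "integral (cbox x (x + (d / 2) *\<^sub>R One)) g = 0"
      by (rule box_zero) (use d in \<open>simp add: inner_add_left\<close>)
    then show False using small[of "d / 2"] d by simp
  qed
  then have "{x \<in> space lebesgue. \<not> g x = 0} \<subseteq> N" by blast
  moreover have "N \<in> null_sets lebesgue" using N negligible_iff_null_sets by blast
  ultimately show ?thesis by (rule AE_I'[rotated])
qed

section \<open>Weak gradients\<close>

lemma has_weak_gradient_iff:
  "has_weak_gradient u g \<longleftrightarrow> locally_integrable u \<and> locally_integrable g \<and>
    (\<forall>\<phi> D. test_function \<phi> D \<longrightarrow> (LINT x|lebesgue. u x *\<^sub>R D x) = - (LINT x|lebesgue. \<phi> x *\<^sub>R g x))"
  unfolding has_weak_gradient_def test_function_def by blast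

lemma locally_integrable_add:
  "locally_integrable f \<Longrightarrow> locally_integrable g \<Longrightarrow> locally_integrable (\<lambda>x. f x + g x)"
  unfolding locally_integrable_def by (blast intro: set_integral_add)

lemma locally_integrable_scaleR:
  assumes "locally_integrable f" shows "locally_integrable (\<lambda>x. a *\<^sub>R f x)"
proof (cases "a = 0")
  case True
  then show ?thesis by (simp add: locally_integrable_def set_integrable_def)
next
  case False
  have "(\<lambda>x. indicat_real K x *\<^sub>R (a *\<^sub>R f x)) = (\<lambda>x. a *\<^sub>R (indicat_real K x *\<^sub>R f x))" for K
    by (rule ext) (rule scaleR_left_commute)
  then show ?thesis using assms unfolding locally_integrable_def set_integrable_def
    by (metis integrable_scaleR_right)
qed

lemma locally_integrable_measurable:
  fixes f :: "'a::euclidean_space \<Rightarrow> 'b::euclidean_space"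
  assumes "locally_integrable f" shows "f \<in> borel_measurable lebesgue"
proof (rule borel_measurable_LIMSEQ_metric)
  show "(\<lambda>x. indicator (cball 0 (real n)) x *\<^sub>R f x) \<in> borel_measurable lebesgue" for n
    using assms unfolding locally_integrable_def set_integrable_def by (blast intro: borel_measurable_integrable compact_cball)
  fix x :: 'a
  show "(\<lambda>n. indicator (cball 0 (real n)) x *\<^sub>R f x) \<longlonglongrightarrow> f x"
  proof (rule tendsto_eventually)
    obtain m where "norm x \<le> real m" using real_arch_simple by blast
    then show "\<forall>\<^sub>F n in sequentially. indicator (cball 0 (real n)) x *\<^sub>R f x = f x"
      unfolding eventually_sequentially by (intro exI[of _ m]) (auto simp: indicator_def)
  qed
qed

lemma locally_integrable_cong_AE:
  fixes f :: "'a::euclidean_space \<Rightarrow> 'b::euclidean_space"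
  assumes "locally_integrable f" "g \<in> borel_measurable lebesgue" "AE x in lebesgue. f x = g x"
  shows "locally_integrable g"
  unfolding locally_integrable_def
proof (intro allI impI)
  fix K :: "'a set" assume "compact K"
  then have i: "integrable lebesgue (\<lambda>x. indicator K x *\<^sub>R f x)" and K: "K \<in> sets lebesgue"
    using assms(1) unfolding locally_integrable_def set_integrable_def by (auto simp: compact_imp_closed)
  have "(\<lambda>x. indicat_real K x *\<^sub>R g x) \<in> borel_measurable lebesgue"
    by (rule borel_measurable_scaleR[OF borel_measurable_indicator[OF K] assms(2)])
  then show "set_integrable lebesgue K g" unfolding set_integrable_def
    by (rule integrable_cong_AE_imp[OF i]) (use assms(3) in \<open>eventually_elim, simp\<close>)
qed

lemma locally_integrable_L2:
  fixes f :: "'a::euclidean_space \<Rightarrow> 'b::euclidean_space"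
  assumes f: "f \<in> borel_measurable lebesgue" and fin: "(\<integral>\<^sup>+x. ennreal ((norm (f x))\<^sup>2) \<partial>lebesgue) < \<infinity>"
  shows "locally_integrable f"
  unfolding locally_integrable_def set_integrable_def
proof (intro allI impI)
  fix K :: "'a set" assume "compact K"
  then have K: "K \<in> sets lebesgue" "emeasure lebesgue K < \<infinity>"
    using emeasure_compact_finite[of K] by (auto simp: compact_imp_closed)
  show "integrable lebesgue (\<lambda>x. indicator K x *\<^sub>R f x)"
  proof (rule Bochner_Integration.integrable_bound)
    have "integrable lebesgue (\<lambda>x. (norm (f x))\<^sup>2)"
      using f fin by (intro integrableI_bounded) (auto simp: borel_measurable_norm borel_measurable_power)
    then show "integrable lebesgue (\<lambda>x. indicat_real K x + (norm (f x))\<^sup>2)"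
      using K by (intro Bochner_Integration.integrable_add integrable_real_indicator)
    show "(\<lambda>x. indicator K x *\<^sub>R f x) \<in> borel_measurable lebesgue"
      by (rule borel_measurable_scaleR[OF borel_measurable_indicator[OF K(1)] f])
    have "norm (indicat_real K x *\<^sub>R f x) \<le> norm (indicat_real K x + (norm (f x))\<^sup>2)" for x
    proof -
      have "norm (f x) \<le> 1 + (norm (f x))\<^sup>2"
        using zero_le_power2[of "norm (f x) - 1/2"] by (simp add: power2_eq_square algebra_simps)
      then show ?thesis by (cases "x \<in> K") auto
    qed
    then show "AE x in lebesgue. norm (indicat_real K x *\<^sub>R f x) \<le> norm (indicat_real K x + (norm (f x))\<^sup>2)"
      by (rule AE_I2)
  qed
qed

lemma integrable_test:
  assumes "test_function \<phi> D"
  shows "locally_integrable (u :: 'a::euclidean_space \<Rightarrow> real) \<Longrightarrow> integrable lebesgue (\<lambda>x. u x *\<^sub>R D x)"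
    and "locally_integrable (g :: 'a \<Rightarrow> 'b::euclidean_space) \<Longrightarrow> integrable lebesgue (\<lambda>x. \<phi> x *\<^sub>R g x)"
proof -
  obtain R where R: "0 < R" "\<And>x. x \<notin> cball 0 R \<Longrightarrow> \<phi> x = 0" "\<And>x. x \<notin> cball 0 R \<Longrightarrow> D x = 0"
    using test_function_support[OF assms] by blast
  show "locally_integrable u \<Longrightarrow> integrable lebesgue (\<lambda>x. u x *\<^sub>R D x)"
    by (rule locally_integrable_times[OF bounded_bilinear_scaleR _ test_function_continuous(2)[OF assms] R(3)])
  show "locally_integrable g \<Longrightarrow> integrable lebesgue (\<lambda>x. \<phi> x *\<^sub>R g x)"
    by (rule locally_integrable_times[OF bounded_bilinear.flip[OF bounded_bilinear_scaleR] _ test_function_continuous(1)[OF assms] R(2)])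
qed

lemma weak_gradient_unique:
  assumes "has_weak_gradient u g" "has_weak_gradient u g'"
  shows "AE x in lebesgue. g x = g' x"
proof -
  have g: "locally_integrable g" "locally_integrable g'" using assms by (auto simp: has_weak_gradient_iff)
  have "AE x in lebesgue. g x + (-1) *\<^sub>R g' x = 0"
  proof (rule fundamental_lemma)
    show "locally_integrable (\<lambda>x. g x + (-1) *\<^sub>R g' x)" by (intro locally_integrable_add locally_integrable_scaleR g)
    fix \<phi> D assume t: "test_function \<phi> (D :: 'a \<Rightarrow> 'a)"
    have "(LINT x|lebesgue. \<phi> x *\<^sub>R (g x + (-1) *\<^sub>R g' x)) = (LINT x|lebesgue. \<phi> x *\<^sub>R g x - \<phi> x *\<^sub>R g' x)"
      by (simp add: scaleR_diff_right)
    also have "\<dots> = (LINT x|lebesgue. \<phi> x *\<^sub>R g x) - (LINT x|lebesgue. \<phi> x *\<^sub>R g' x)"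
      by (intro Bochner_Integration.integral_diff integrable_test(2)[OF t] g)
    also have "\<dots> = 0"
    proof -
      have "(LINT x|lebesgue. u x *\<^sub>R D x) = - (LINT x|lebesgue. \<phi> x *\<^sub>R g x)"
        "(LINT x|lebesgue. u x *\<^sub>R D x) = - (LINT x|lebesgue. \<phi> x *\<^sub>R g' x)"
        using assms t unfolding has_weak_gradient_iff by blast+
      then show ?thesis by (metis add.inverse_inverse diff_self)
    qed
    finally show "(LINT x|lebesgue. \<phi> x *\<^sub>R (g x + (-1) *\<^sub>R g' x)) = 0" .
  qed
  then show ?thesis by eventually_elim simp
qed

lemma has_weak_gradient_add:
  assumes u: "has_weak_gradient u g" and v: "has_weak_gradient v k"
  shows "has_weak_gradient (\<lambda>x. u x + v x) (\<lambda>x. g x + k x)"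
  unfolding has_weak_gradient_iff
proof (intro conjI allI impI)
  have li: "locally_integrable u" "locally_integrable g" "locally_integrable v" "locally_integrable k"
    using assms by (auto simp: has_weak_gradient_iff)
  show "locally_integrable (\<lambda>x. u x + v x)" "locally_integrable (\<lambda>x. g x + k x)"
    by (intro locally_integrable_add li)+
  fix \<phi> D assume t: "test_function \<phi> (D :: 'a \<Rightarrow> 'a)"
  have "(LINT x|lebesgue. (u x + v x) *\<^sub>R D x) = (LINT x|lebesgue. u x *\<^sub>R D x) + (LINT x|lebesgue. v x *\<^sub>R D x)"
    unfolding scaleR_add_left by (intro Bochner_Integration.integral_add integrable_test(1)[OF t] li)
  also have "\<dots> = - ((LINT x|lebesgue. \<phi> x *\<^sub>R g x) + (LINT x|lebesgue. \<phi> x *\<^sub>R k x))"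
    using u v t unfolding has_weak_gradient_iff by simp
  also have "(LINT x|lebesgue. \<phi> x *\<^sub>R g x) + (LINT x|lebesgue. \<phi> x *\<^sub>R k x) = (LINT x|lebesgue. \<phi> x *\<^sub>R (g x + k x))"
    unfolding scaleR_add_right by (intro Bochner_Integration.integral_add[symmetric] integrable_test(2)[OF t] li)
  finally show "(LINT x|lebesgue. (u x + v x) *\<^sub>R D x) = - (LINT x|lebesgue. \<phi> x *\<^sub>R (g x + k x))" .
qed

lemma has_weak_gradient_scale:
  assumes u: "has_weak_gradient u g"
  shows "has_weak_gradient (\<lambda>x. a * u x) (\<lambda>x. a *\<^sub>R g x)"
  unfolding has_weak_gradient_iff
proof (intro conjI allI impI)
  have li: "locally_integrable u" "locally_integrable g" using assms by (auto simp: has_weak_gradient_iff)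
  show "locally_integrable (\<lambda>x. a * u x)" "locally_integrable (\<lambda>x. a *\<^sub>R g x)"
    using locally_integrable_scaleR[OF li(1), of a] locally_integrable_scaleR[OF li(2), of a] by simp_all
  fix \<phi> D assume t: "test_function \<phi> (D :: 'a \<Rightarrow> 'a)"
  have "(LINT x|lebesgue. (a * u x) *\<^sub>R D x) = a *\<^sub>R (LINT x|lebesgue. u x *\<^sub>R D x)"
    by (simp flip: scaleR_scaleR)
  also have "\<dots> = - (a *\<^sub>R (LINT x|lebesgue. \<phi> x *\<^sub>R g x))"
    using u t unfolding has_weak_gradient_iff by simp
  also have "a *\<^sub>R (LINT x|lebesgue. \<phi> x *\<^sub>R g x) = (LINT x|lebesgue. \<phi> x *\<^sub>R (a *\<^sub>R g x))"
  proof -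
    have "(\<lambda>x. \<phi> x *\<^sub>R (a *\<^sub>R g x)) = (\<lambda>x. a *\<^sub>R (\<phi> x *\<^sub>R g x))"
      by (rule ext) (rule scaleR_left_commute)
    then show ?thesis by (simp only: integral_scaleR_right)
  qed
  finally show "(LINT x|lebesgue. (a * u x) *\<^sub>R D x) = - (LINT x|lebesgue. \<phi> x *\<^sub>R (a *\<^sub>R g x))" .
qed

lemma has_weak_gradient_cong_AE:
  assumes u: "has_weak_gradient u g" and "u' \<in> borel_measurable lebesgue" "g' \<in> borel_measurable lebesgue"
    and eq: "AE x in lebesgue. u x = u' x" "AE x in lebesgue. g x = g' x"
  shows "has_weak_gradient u' g'"
  unfolding has_weak_gradient_iff
proof (intro conjI allI impI)
  have li: "locally_integrable u" "locally_integrable g" using assms by (auto simp: has_weak_gradient_iff)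
  show li': "locally_integrable u'" "locally_integrable g'" using li assms locally_integrable_cong_AE by blast+
  fix \<phi> D assume t: "test_function \<phi> (D :: 'a \<Rightarrow> 'a)"
  have "(LINT x|lebesgue. u' x *\<^sub>R D x) = (LINT x|lebesgue. u x *\<^sub>R D x)"
    by (intro integral_cong_AE borel_measurable_integrable integrable_test[OF t] li li') (use eq in auto)
  moreover have "(LINT x|lebesgue. \<phi> x *\<^sub>R g' x) = (LINT x|lebesgue. \<phi> x *\<^sub>R g x)"
    by (intro integral_cong_AE borel_measurable_integrable integrable_test[OF t] li li') (use eq in auto)
  ultimately show "(LINT x|lebesgue. u' x *\<^sub>R D x) = - (LINT x|lebesgue. \<phi> x *\<^sub>R g' x)"
    using u t unfolding has_weak_gradient_iff by simp
qed

lemma weak_gradient_eq: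
  assumes "has_weak_gradient u g"
  shows "has_weak_gradient u (weak_gradient u)" "AE x in lebesgue. weak_gradient u x = g x"
proof -
  show w: "has_weak_gradient u (weak_gradient u)"
    unfolding weak_gradient_def by (rule someI[where P="has_weak_gradient u", OF assms])
  show "AE x in lebesgue. weak_gradient u x = g x" by (rule weak_gradient_unique[OF w assms])
qed

lemma borel_representative:
  fixes f :: "'a::euclidean_space \<Rightarrow> 'b::euclidean_space"
  assumes "f \<in> borel_measurable lebesgue"
  obtains f' where "f' \<in> borel_measurable borel" "AE x in lborel. f x = f' x"
proof -
  have "\<exists>h\<in>borel_measurable lborel. AE x in lborel. f x \<bullet> i = h x" for i
    by (rule completion_ex_borel_measurable_real) (use assms in auto)
  then obtain h where h: "\<And>i. h i \<in> borel_measurable borel" "\<And>i. AE x in lborel. f x \<bullet> i = h i x"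
    by (metis measurable_lborel2)
  have "AE x in lborel. \<forall>i\<in>Basis. f x \<bullet> i = h i x" by (intro AE_finite_allI h) auto
  then have "AE x in lborel. f x = (\<Sum>i\<in>Basis. h i x *\<^sub>R i)"
  proof eventually_elim
    case (elim x)
    then have "(\<Sum>i\<in>Basis. h i x *\<^sub>R i) = (\<Sum>i\<in>Basis. (f x \<bullet> i) *\<^sub>R i)" by (intro sum.cong) auto
    then show ?case by (simp only: euclidean_representation)
  qed
  moreover have "(\<lambda>x. \<Sum>i\<in>Basis. h i x *\<^sub>R i) \<in> borel_measurable borel"
    by (intro borel_measurable_sum borel_measurable_scaleR h borel_measurable_const)
  ultimately show ?thesis by (rule that[rotated])
qed

lemma lborel_integral_shift:
  fixes f :: "'a::euclidean_space \<Rightarrow> 'b::euclidean_space"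
  assumes "f \<in> borel_measurable borel"
  shows "(LINT x|lborel. f (x + a)) = (LINT x|lborel. f x)"
proof -
  have "(LINT x|lborel. f x) = (LINT x|distr lborel borel ((+) a). f x)"
    by (simp add: lborel_distr_plus)
  also have "\<dots> = (LINT x|lborel. f (a + x))" by (rule integral_distr) (use assms in auto)
  finally show ?thesis by (simp add: add.commute)
qed

lemma cball_in_borel [measurable]: "cball (c::'a::euclidean_space) r \<in> sets borel"
  by simp

lemma integrable_segment_average:
  fixes g :: "'a::euclidean_space \<Rightarrow> real" and \<phi> :: "'a \<Rightarrow> real \<Rightarrow> real"
  assumes [measurable]: "g \<in> borel_measurable borel" "case_prod \<phi> \<in> borel_measurable borel" and g: "locally_integrable g"
    and \<phi>: "\<And>x \<tau>. \<tau> \<in> {0..1} \<Longrightarrow> \<bar>\<phi> x \<tau>\<bar> \<le> M * indicator (cball 0 R) (x + \<tau> *\<^sub>R h)" and M: "0 \<le> M"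
  shows "integrable (lborel \<Otimes>\<^sub>M lborel) (\<lambda>(x, \<tau>). indicator {0..1} \<tau> * (\<phi> x \<tau> * g (x + \<tau> *\<^sub>R h)))"
proof (rule integrableI_bounded)
  define A where "A = (\<integral>\<^sup>+x. ennreal M * (indicator (cball 0 R) x * ennreal \<bar>g x\<bar>) \<partial>lborel)"
  have "integrable lebesgue (\<lambda>x. indicator (cball 0 R) x *\<^sub>R g x)"
    using g[unfolded locally_integrable_def set_integrable_def, rule_format, OF compact_cball] .
  then have "(\<integral>\<^sup>+x. ennreal (norm (indicator (cball 0 R) x *\<^sub>R g x)) \<partial>lebesgue) < \<infinity>" 
    unfolding integrable_iff_bounded by (rule conjunct2)
  also have "(\<integral>\<^sup>+x. ennreal (norm (indicator (cball 0 R) x *\<^sub>R g x)) \<partial>lebesgue) = (\<integral>\<^sup>+x. indicator (cball 0 R) x * ennreal \<bar>g x\<bar> \<partial>lborel)"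
    unfolding nn_integral_completion by (intro nn_integral_cong) (auto simp: indicator_def)
  finally have A: "A < \<infinity>" unfolding A_def by (subst nn_integral_cmult, measurable) (auto simp: ennreal_mult_less_top)
  have \<phi>_meas: "(\<lambda>z. \<phi> (fst z) (snd z)) \<in> borel_measurable (lborel \<Otimes>\<^sub>M lborel)"
    using assms(2) by (simp add: case_prod_beta' lborel_prod)
  have eqF: "(\<lambda>(x, \<tau>). indicator {0..1} \<tau> * (\<phi> x \<tau> * g (x + \<tau> *\<^sub>R h))) = (\<lambda>z. indicator {0..1} (snd z) * (\<phi> (fst z) (snd z) * g (fst z + snd z *\<^sub>R h)))"
    by auto
  show meas: "(\<lambda>(x, \<tau>). indicator {0..1} \<tau> * (\<phi> x \<tau> * g (x + \<tau> *\<^sub>R h))) \<in> borel_measurable (lborel \<Otimes>\<^sub>M lborel)"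
    unfolding eqF by (rule borel_measurable_times[OF _ borel_measurable_times[OF \<phi>_meas]]) measurable
  have "(\<lambda>z. ennreal (norm (case z of (x, \<tau>) \<Rightarrow> indicator {0..1} \<tau> * (\<phi> x \<tau> * g (x + \<tau> *\<^sub>R h))))) \<in> borel_measurable (lborel \<Otimes>\<^sub>M lborel)"
    by (rule measurable_compose[OF meas]) measurable
  from lborel_pair.nn_integral_snd[OF this]
  have "(\<integral>\<^sup>+z. ennreal (norm (case z of (x, \<tau>) \<Rightarrow> indicator {0..1} \<tau> * (\<phi> x \<tau> * g (x + \<tau> *\<^sub>R h)))) \<partial>(lborel \<Otimes>\<^sub>M lborel))
    = (\<integral>\<^sup>+\<tau>. \<integral>\<^sup>+x. ennreal (norm (indicator {0..1} \<tau> * (\<phi> x \<tau> * g (x + \<tau> *\<^sub>R h)))) \<partial>lborel \<partial>lborel)"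
    unfolding prod.case by (rule sym)
  also have "\<dots> \<le> (\<integral>\<^sup>+(\<tau>::real). indicator {0..1} \<tau> * A \<partial>lborel)"
  proof (rule nn_integral_mono)
    fix \<tau> :: real
    show "(\<integral>\<^sup>+x. ennreal (norm (indicator {0..1} \<tau> * (\<phi> x \<tau> * g (x + \<tau> *\<^sub>R h)))) \<partial>lborel) \<le> indicator {0..1} \<tau> * A"
    proof (cases "\<tau> \<in> {0..1}")
      case True
      have "(\<integral>\<^sup>+x. ennreal (norm (indicator {0..1} \<tau> * (\<phi> x \<tau> * g (x + \<tau> *\<^sub>R h)))) \<partial>lborel)
         \<le> (\<integral>\<^sup>+x. ennreal M * (indicator (cball 0 R) (x + \<tau> *\<^sub>R h) * ennreal \<bar>g (x + \<tau> *\<^sub>R h)\<bar>) \<partial>lborel)"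
      proof (rule nn_integral_mono)
        fix x
        have "\<bar>\<phi> x \<tau>\<bar> * \<bar>g (x + \<tau> *\<^sub>R h)\<bar> \<le> M * indicator (cball 0 R) (x + \<tau> *\<^sub>R h) * \<bar>g (x + \<tau> *\<^sub>R h)\<bar>"
          by (intro mult_right_mono \<phi> True) simp
        then have "ennreal (norm (indicator {0..1} \<tau> * (\<phi> x \<tau> * g (x + \<tau> *\<^sub>R h)))) \<le> ennreal (M * (indicator (cball 0 R) (x + \<tau> *\<^sub>R h) * \<bar>g (x + \<tau> *\<^sub>R h)\<bar>))"
          using True by (intro ennreal_leI) (simp add: abs_mult mult.assoc)
        also have "\<dots> = ennreal M * (indicator (cball 0 R) (x + \<tau> *\<^sub>R h) * ennreal \<bar>g (x + \<tau> *\<^sub>R h)\<bar>)"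
          using M by (simp add: ennreal_mult' ennreal_indicator)
        finally show "ennreal (norm (indicator {0..1} \<tau> * (\<phi> x \<tau> * g (x + \<tau> *\<^sub>R h)))) \<le> \<dots>" .
      qed
      also have "\<dots> = A" unfolding A_def
        by (rule nn_integral_lborel_shift[of "\<lambda>x. ennreal M * (indicator (cball 0 R) x * ennreal \<bar>g x\<bar>)"]) measurable
      finally show ?thesis using True by simp
    qed simp
  qed
  also have "\<dots> = A" by (simp add: nn_integral_multc)
  finally show "(\<integral>\<^sup>+z. ennreal (norm (case z of (x, \<tau>) \<Rightarrow> indicator {0..1} \<tau> * (\<phi> x \<tau> * g (x + \<tau> *\<^sub>R h)))) \<partial>(lborel \<Otimes>\<^sub>M lborel)) < \<infinity>"
    using A by (rule le_less_trans)
qed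

section \<open>Comparison with the Dirichlet energy\<close>

lemma test_function_translate:
  assumes "test_function \<phi> D" shows "test_function (\<lambda>x. \<phi> (x - a)) (\<lambda>x. D (x - a))"
  unfolding test_function_def
proof (intro conjI allI)
  show "GDERIV (\<lambda>x. \<phi> (x - a)) x :> D (x - a)" for x
  proof -
    have "(\<phi> has_derivative (\<lambda>h. h \<bullet> D (x - a))) (at (x - a))"
      using assms by (simp add: test_function_def gderiv_def)
    moreover have "((\<lambda>x. x - a) has_derivative (\<lambda>h. h)) (at x)" by (auto intro!: derivative_eq_intros)
    ultimately show ?thesis
      using has_derivative_compose[of "\<lambda>x. x - a" "\<lambda>h. h" x UNIV \<phi> "\<lambda>h. h \<bullet> D (x - a)"] by (simp add: gderiv_def)
  qed
  show "continuous_on UNIV (\<lambda>x. D (x - a))"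
    by (intro continuous_on_compose2[OF test_function_continuous(2)[OF assms]] continuous_intros) auto
  obtain R where "0 < R" and R: "\<And>x. x \<notin> cball 0 R \<Longrightarrow> \<phi> x = 0" and "\<And>x. x \<notin> cball 0 R \<Longrightarrow> D x = 0"
    using test_function_support[OF assms] by blast
  have "{x. \<phi> (x - a) \<noteq> 0} \<subseteq> cball a R"
  proof
    fix x assume "x \<in> {x. \<phi> (x - a) \<noteq> 0}"
    then have "x - a \<in> cball 0 R" using R[of "x - a"] by blast
    then show "x \<in> cball a R" by (simp add: dist_norm norm_minus_commute)
  qed
  then show "bounded {x. \<phi> (x - a) \<noteq> 0}" by (rule bounded_subset[OF bounded_cball])
qed

lemma locally_integrable_inner:
  assumes "locally_integrable g" shows "locally_integrable (\<lambda>x. g x \<bullet> h)"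
proof -
  have "(\<lambda>x. indicat_real K x *\<^sub>R (g x \<bullet> h)) = (\<lambda>x. (indicat_real K x *\<^sub>R g x) \<bullet> h)" for K
    by (rule ext) simp
  then show ?thesis using assms unfolding locally_integrable_def set_integrable_def
    by (metis integrable_inner_left)
qed

text \<open>The function \<open>x \<mapsto> \<integral>\<^bsub>0\<^esub>\<^bsup>1\<^esup> g(x + \<tau> h)
  \<cdot> h d\<tau>\<close>, which is \<open>u(x + h) - u(x)\<close> if \<open>g\<close> is the
  gradient of \<open>u\<close>.\<close>

definition segment_average :: "'a::euclidean_space \<Rightarrow> ('a \<Rightarrow> 'a) \<Rightarrow> 'a \<Rightarrow> real" where
  "segment_average h g x = (LINT \<tau>|lborel. indicator {0..1} \<tau> * (g (x + \<tau> *\<^sub>R h) \<bullet> h))"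

lemma segment_average_measurable:
  assumes [measurable]: "g \<in> borel_measurable borel"
  shows "segment_average h g \<in> borel_measurable borel"
  unfolding segment_average_def by measurable

lemma segment_average_locally_integrable:
  assumes [measurable]: "g \<in> borel_measurable borel" and g: "locally_integrable g"
  shows "locally_integrable (segment_average h g)"
  unfolding locally_integrable_def set_integrable_def
proof (intro allI impI)
  fix K :: "'a set" assume "compact K"
  then obtain R where R: "K \<subseteq> ball 0 R" using compact_imp_bounded bounded_subset_ballD by blast
  have K[measurable]: "K \<in> sets borel" using \<open>compact K\<close> by (simp add: compact_imp_closed)
  have "integrable (lborel \<Otimes>\<^sub>M lborel) (\<lambda>(x, \<tau>). indicator {0..1} \<tau> * (indicat_real K x * (g (x + \<tau> *\<^sub>R h) \<bullet> h)))"
  proof (rule integrable_segment_average[where M=1 and R="R + norm h"])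
    show "(\<lambda>(x, \<tau>::real). indicat_real K x) \<in> borel_measurable borel"
      by (simp add: case_prod_beta' flip: borel_prod)
    fix x and \<tau> :: real assume \<tau>: "\<tau> \<in> {0..1}"
    show "\<bar>indicat_real K x\<bar> \<le> 1 * indicator (cball 0 (R + norm h)) (x + \<tau> *\<^sub>R h)"
    proof (cases "x \<in> K")
      case True
      have "norm (x + \<tau> *\<^sub>R h) \<le> norm x + \<tau> * norm h" using norm_triangle_ineq[of x "\<tau> *\<^sub>R h"] \<tau> by simp
      also have "\<dots> \<le> R + 1 * norm h" using True R \<tau> by (intro add_mono mult_right_mono) auto
      finally show ?thesis by (simp add: indicator_def)
    qed simp
  qed (auto intro: locally_integrable_inner g)
  from lborel_pair.integrable_fst'[OF this]
  have "integrable lborel (\<lambda>x. LINT \<tau>|lborel. indicator {0..1} \<tau> * (indicat_real K x * (g (x + \<tau> *\<^sub>R h) \<bullet> h)))"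
    unfolding prod.case .
  also have "(\<lambda>x. LINT \<tau>|lborel. indicator {0..1} \<tau> * (indicat_real K x * (g (x + \<tau> *\<^sub>R h) \<bullet> h))) = (\<lambda>x. indicator K x *\<^sub>R segment_average h g x)"
    unfolding segment_average_def by (rule ext) (simp only: mult.left_commute[of "indicat_real {0..1} _"] integral_mult_right_zero real_scaleR_def)
  finally have i: "integrable lborel (\<lambda>x. indicator K x *\<^sub>R segment_average h g x)" .
  then show "integrable lebesgue (\<lambda>x. indicator K x *\<^sub>R segment_average h g x)"
    by (subst integrable_completion) (auto dest: borel_measurable_integrable)
qed

lemma test_function_FTC:
  assumes "test_function \<phi> D"
  shows "(LINT \<tau>|lborel. indicator {0..1} \<tau> * (D (x - \<tau> *\<^sub>R h) \<bullet> h)) = \<phi> x - \<phi> (x - h)"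
proof -
  have "(LINT \<tau>|lborel. (D (x - \<tau> *\<^sub>R h) \<bullet> h) * indicator {0..1} \<tau>) = - \<phi> (x - 1 *\<^sub>R h) - - \<phi> (x - 0 *\<^sub>R h)"
  proof (rule integral_FTC_Icc_real)
    fix \<tau> :: real
    have "(\<phi> has_derivative (\<lambda>k. k \<bullet> D (x - \<tau> *\<^sub>R h))) (at (x - \<tau> *\<^sub>R h))"
      using assms by (simp add: test_function_def gderiv_def)
    moreover have "((\<lambda>\<tau>. x - \<tau> *\<^sub>R h) has_derivative (\<lambda>t. - (t *\<^sub>R h))) (at \<tau>)"
      by (auto intro!: derivative_eq_intros)
    ultimately have "((\<lambda>\<tau>. \<phi> (x - \<tau> *\<^sub>R h)) has_derivative (\<lambda>t. - (t *\<^sub>R h) \<bullet> D (x - \<tau> *\<^sub>R h))) (at \<tau>)"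
      using has_derivative_compose by blast
    from has_derivative_minus[OF this]
    show "((\<lambda>\<tau>. - \<phi> (x - \<tau> *\<^sub>R h)) has_real_derivative D (x - \<tau> *\<^sub>R h) \<bullet> h) (at \<tau>)"
      by (simp add: has_field_derivative_def inner_commute mult.commute[of "_ \<bullet> _"] mult_commute_abs)
    have "continuous_on UNIV (\<lambda>\<tau>. D (x - \<tau> *\<^sub>R h) \<bullet> h)"
      by (intro continuous_intros continuous_on_compose2[OF test_function_continuous(2)[OF assms]]) auto
    then show "isCont (\<lambda>\<tau>. D (x - \<tau> *\<^sub>R h) \<bullet> h) \<tau>" by (simp add: continuous_on_eq_continuous_at)
  qed simp
  then show ?thesis by (simp add: mult.commute)
qed

text \<open>The segment average on the right has the same integral against every test function as the
  difference on the left: move the shift onto the test function, use the fundamental theorem of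
  calculus there and the definition of the weak gradient.\<close>

lemma weak_gradient_segment:
  fixes u :: "'a::euclidean_space \<Rightarrow> real"
  assumes [measurable]: "u \<in> borel_measurable borel" "g \<in> borel_measurable borel" and wg: "has_weak_gradient u g"
  shows "AE x in lborel. u (x + h) - u x = segment_average h g x"
proof -
  have u: "locally_integrable u" and g: "locally_integrable g" using wg by (auto simp: has_weak_gradient_iff)
  have [measurable]: "segment_average h g \<in> borel_measurable borel" by (rule segment_average_measurable) measurable
  have ush: "locally_integrable (\<lambda>x. u (x + h))"
    unfolding locally_integrable_def set_integrable_def
  proof (intro allI impI)
    fix K :: "'a set" assume K: "compact K"
    have [measurable]: "K \<in> sets borel" using K by (simp add: compact_imp_closed)
    have "compact ((\<lambda>x. x + h) ` K)" by (intro compact_continuous_image continuous_intros K)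
    then have "integrable lebesgue (\<lambda>x. indicat_real ((\<lambda>x. x + h) ` K) x *\<^sub>R u x)" and m: "(\<lambda>x. x + h) ` K \<in> sets borel"
      using u unfolding locally_integrable_def set_integrable_def by (auto simp: compact_imp_closed)
    then have "integrable lborel (\<lambda>x. indicat_real ((\<lambda>x. x + h) ` K) x *\<^sub>R u x)"
      by (subst (asm) integrable_completion) auto
    then have "integrable (distr lborel borel ((+) h)) (\<lambda>x. indicat_real ((\<lambda>x. x + h) ` K) x *\<^sub>R u x)"
      by (simp only: lborel_distr_plus)
    then have "integrable lborel (\<lambda>x. indicat_real ((\<lambda>x. x + h) ` K) (h + x) *\<^sub>R u (h + x))"
      by (subst (asm) integrable_distr_eq) (use m in auto)
    also have "(\<lambda>x. indicat_real ((\<lambda>x. x + h) ` K) (h + x) *\<^sub>R u (h + x)) = (\<lambda>x. indicator K x *\<^sub>R u (x + h))"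
      by (auto simp: fun_eq_iff indicator_def add.commute)
    finally show "integrable lebesgue (\<lambda>x. indicator K x *\<^sub>R u (x + h))"
      by (subst integrable_completion) auto
  qed
  define w where "w x = u (x + h) + (-1) *\<^sub>R (u x + segment_average h g x)" for x
  have w_li: "locally_integrable w" unfolding w_def
    by (intro locally_integrable_add locally_integrable_scaleR ush u segment_average_locally_integrable g) measurable
  have "AE x in lebesgue. w x = 0"
  proof (rule fundamental_lemma[OF w_li])
    fix \<phi> D assume t: "test_function \<phi> (D :: 'a \<Rightarrow> 'a)"
    obtain R where R: "0 < R" "\<And>x. x \<notin> cball 0 R \<Longrightarrow> \<phi> x = 0" "\<And>x. x \<notin> cball 0 R \<Longrightarrow> D x = 0"
      using test_function_support[OF t] by blast
    have \<phi>c: "continuous_on UNIV \<phi>" and Dc: "continuous_on UNIV D" using test_function_continuous t by blast+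
    have [measurable]: "\<phi> \<in> borel_measurable borel" "D \<in> borel_measurable borel"
      using \<phi>c Dc by (auto intro: borel_measurable_continuous_onI)
    obtain M1 where M1: "0 \<le> M1" "\<And>x. norm (\<phi> x) \<le> M1" using continuous_bounded_support[OF \<phi>c R(2)] by blast
    obtain M2 where M2: "0 \<le> M2" "\<And>x. norm (D x) \<le> M2" using continuous_bounded_support[OF Dc R(3)] by blast
    define F where "F x \<tau> = indicat_real {0..1} \<tau> * (\<phi> x * (g (x + \<tau> *\<^sub>R h) \<bullet> h))" for x \<tau>
    define G where "G x \<tau> = indicat_real {0..1} \<tau> * ((D (x - \<tau> *\<^sub>R h) \<bullet> h) * u (x + \<tau> *\<^sub>R 0))" for x \<tau>
    have le: "norm (x + \<tau> *\<^sub>R h) \<le> norm x + norm h" if "\<tau> \<in> {0..1}" for x and \<tau> :: real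
    proof -
      have "norm (x + \<tau> *\<^sub>R h) \<le> norm x + \<tau> * norm h" using norm_triangle_ineq[of x "\<tau> *\<^sub>R h"] that by simp
      also have "\<dots> \<le> norm x + 1 * norm h" using that by (intro add_mono mult_right_mono) auto
      finally show ?thesis by simp
    qed
    have F_int: "integrable (lborel \<Otimes>\<^sub>M lborel) (case_prod F)"
      unfolding F_def
    proof (rule integrable_segment_average[where M=M1 and R="R + norm h"])
      show "(\<lambda>(x, \<tau>::real). \<phi> x) \<in> borel_measurable borel"
        by (simp add: case_prod_beta' flip: borel_prod)
      fix x and \<tau> :: real assume \<tau>: "\<tau> \<in> {0..1}"
      show "\<bar>\<phi> x\<bar> \<le> M1 * indicator (cball 0 (R + norm h)) (x + \<tau> *\<^sub>R h)"
        using le[OF \<tau>, of x] M1(2)[of x] R(2)[of x] M1(1) by (cases "x \<in> cball 0 R") (auto simp: indicator_def)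
    qed (use M1 g in \<open>auto intro: locally_integrable_inner\<close>)
    have G_int: "integrable (lborel \<Otimes>\<^sub>M lborel) (case_prod G)"
      unfolding G_def
    proof (rule integrable_segment_average[where M="M2 * norm h" and R="R + norm h"])
      show "(\<lambda>(x, \<tau>::real). D (x - \<tau> *\<^sub>R h) \<bullet> h) \<in> borel_measurable borel"
        by (simp add: case_prod_beta' flip: borel_prod)
      fix x and \<tau> :: real assume \<tau>: "\<tau> \<in> {0..1}"
      show "\<bar>D (x - \<tau> *\<^sub>R h) \<bullet> h\<bar> \<le> M2 * norm h * indicator (cball 0 (R + norm h)) (x + \<tau> *\<^sub>R 0)"
      proof (cases "x - \<tau> *\<^sub>R h \<in> cball 0 R")
        case True
        have "norm x \<le> R + norm h" using le[OF \<tau>, of "x - \<tau> *\<^sub>R h"] True by simp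
        moreover have "\<bar>D (x - \<tau> *\<^sub>R h) \<bullet> h\<bar> \<le> M2 * norm h"
          by (rule order_trans[OF Cauchy_Schwarz_ineq2 mult_right_mono[OF M2(2)]]) simp
        ultimately show ?thesis by simp
      next
        case False
        then show ?thesis using R(3) M2(1) by simp
      qed
    qed (use M2 u in auto)
    have FG: "(LINT x|lborel. F x \<tau>) = - (LINT x|lborel. G x \<tau>)" for \<tau>
    proof -
      have t': "test_function (\<lambda>x. \<phi> (x - \<tau> *\<^sub>R h)) (\<lambda>x. D (x - \<tau> *\<^sub>R h))"
        by (rule test_function_translate[OF t])
      have "(LINT x|lborel. \<phi> x * (g (x + \<tau> *\<^sub>R h) \<bullet> h)) = (LINT x|lborel. (\<phi> (x - \<tau> *\<^sub>R h) *\<^sub>R g x) \<bullet> h)"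
        using lborel_integral_shift[of "\<lambda>x. (\<phi> (x - \<tau> *\<^sub>R h) *\<^sub>R g x) \<bullet> h" "\<tau> *\<^sub>R h"] by simp
      also have "\<dots> = (LINT x|lebesgue. (\<phi> (x - \<tau> *\<^sub>R h) *\<^sub>R g x) \<bullet> h)"
        by (rule integral_completion[symmetric]) measurable
      also have "\<dots> = (LINT x|lebesgue. \<phi> (x - \<tau> *\<^sub>R h) *\<^sub>R g x) \<bullet> h"
        by (rule integral_inner_left) (intro impI integrable_test(2)[OF t' g])
      also have "\<dots> = - ((LINT x|lebesgue. u x *\<^sub>R D (x - \<tau> *\<^sub>R h)) \<bullet> h)"
        using wg t' unfolding has_weak_gradient_iff by simp
      also have "(LINT x|lebesgue. u x *\<^sub>R D (x - \<tau> *\<^sub>R h)) \<bullet> h = (LINT x|lebesgue. (u x *\<^sub>R D (x - \<tau> *\<^sub>R h)) \<bullet> h)"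
        by (rule integral_inner_left[symmetric]) (intro impI integrable_test(1)[OF t' u])
      also have "\<dots> = (LINT x|lborel. (u x *\<^sub>R D (x - \<tau> *\<^sub>R h)) \<bullet> h)"
        by (rule integral_completion) measurable
      finally have "(LINT x|lborel. \<phi> x * (g (x + \<tau> *\<^sub>R h) \<bullet> h)) = - (LINT x|lborel. (D (x - \<tau> *\<^sub>R h) \<bullet> h) * u (x + \<tau> *\<^sub>R 0))"
        by (simp add: mult.commute)
      then show ?thesis unfolding F_def G_def integral_mult_right_zero by simp
    qed
    have "(LINT x|lborel. \<phi> x * segment_average h g x) = (LINT x|lborel. LINT \<tau>|lborel. F x \<tau>)"
      unfolding F_def segment_average_def mult.left_commute[of "indicat_real {0..1} _"] integral_mult_right_zero ..
    also have "\<dots> = (LINT \<tau>|lborel. LINT x|lborel. F x \<tau>)"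
      by (rule lborel_pair.Fubini_integral[OF F_int, symmetric])
    also have "\<dots> = - (LINT \<tau>|lborel. LINT x|lborel. G x \<tau>)" unfolding FG by simp
    also have "(LINT \<tau>|lborel. LINT x|lborel. G x \<tau>) = (LINT x|lborel. LINT \<tau>|lborel. G x \<tau>)"
      by (rule lborel_pair.Fubini_integral[OF G_int])
    also have "\<dots> = (LINT x|lborel. u x * (\<phi> x - \<phi> (x - h)))"
    proof (rule Bochner_Integration.integral_cong[OF refl])
      fix x
      have "(LINT \<tau>|lborel. G x \<tau>) = (LINT \<tau>|lborel. u x * (indicat_real {0..1} \<tau> * (D (x - \<tau> *\<^sub>R h) \<bullet> h)))"
        unfolding G_def by (simp add: ac_simps)
      also have "\<dots> = u x * (\<phi> x - \<phi> (x - h))"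
        unfolding integral_mult_right_zero test_function_FTC[OF t] ..
      finally show "(LINT \<tau>|lborel. G x \<tau>) = u x * (\<phi> x - \<phi> (x - h))" .
    qed
    finally have avg: "(LINT x|lborel. \<phi> x * segment_average h g x) = - (LINT x|lborel. u x * (\<phi> x - \<phi> (x - h)))" .
    have t': "test_function (\<lambda>x. \<phi> (x - h)) (\<lambda>x. D (x - h))" by (rule test_function_translate[OF t])
    have li: "integrable lborel (\<lambda>x. \<psi> x * v x)" if "test_function \<psi> E" "locally_integrable v" "v \<in> borel_measurable borel" for \<psi> v and E :: "'a \<Rightarrow> 'a"
    proof -
      have "\<psi> \<in> borel_measurable borel" using test_function_continuous(1)[OF that(1)] by (rule borel_measurable_continuous_onI)
      then have "(\<lambda>x. \<psi> x * v x) \<in> borel_measurable lborel" using that(3) by simp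
      then show ?thesis using integrable_test(2)[OF that(1,2)] by (simp add: integrable_completion)
    qed
    have i1: "integrable lborel (\<lambda>x. \<phi> x * u x)" by (rule li[OF t u]) measurable
    have i2: "integrable lborel (\<lambda>x. \<phi> (x - h) * u x)" by (rule li[OF t' u]) measurable
    have i3: "integrable lborel (\<lambda>x. \<phi> x * u (x + h))" by (rule li[OF t ush]) measurable
    have i4: "integrable lborel (\<lambda>x. \<phi> x * segment_average h g x)"
      by (rule li[OF t segment_average_locally_integrable[OF _ g]]) measurable
    have sh: "(LINT x|lborel. \<phi> x * u (x + h)) = (LINT x|lborel. \<phi> (x - h) * u x)"
      using lborel_integral_shift[of "\<lambda>x. \<phi> (x - h) * u x" h] by simp
    have "(LINT x|lebesgue. \<phi> x *\<^sub>R w x) = (LINT x|lborel. \<phi> x * u (x + h) - (\<phi> x * u x + \<phi> x * segment_average h g x))"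
      unfolding w_def by (subst integral_completion) (auto simp: algebra_simps)
    also have "\<dots> = (LINT x|lborel. \<phi> x * u (x + h)) - ((LINT x|lborel. \<phi> x * u x) + (LINT x|lborel. \<phi> x * segment_average h g x))"
      using i1 i3 i4 by simp
    also have "(LINT x|lborel. \<phi> x * segment_average h g x) = - ((LINT x|lborel. \<phi> x * u x) - (LINT x|lborel. \<phi> (x - h) * u x))"
      unfolding avg using i1 i2 by (subst Bochner_Integration.integral_diff[symmetric]) (auto simp: algebra_simps)
    finally show "(LINT x|lebesgue. \<phi> x *\<^sub>R w x) = 0" using sh by simp
  qed
  then have "AE x in lborel. w x = 0" by (simp only: AE_completion_iff)
  then show ?thesis by eventually_elim (simp add: w_def)
qed

lemma segment_average_sq_le:
  fixes g :: "'a::euclidean_space \<Rightarrow> 'a"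
  assumes [measurable]: "g \<in> borel_measurable borel"
  shows "ennreal ((segment_average h g x)\<^sup>2) \<le> (\<integral>\<^sup>+(\<tau>::real). indicator {0..1} \<tau> * (ennreal ((norm h)\<^sup>2) * ennreal ((norm (g (x + \<tau> *\<^sub>R h)))\<^sup>2)) \<partial>lborel)"
proof -
  let ?f = "\<lambda>\<tau>. indicat_real {0..1} \<tau> * (g (x + \<tau> *\<^sub>R h) \<bullet> h)"
  have "ennreal \<bar>segment_average h g x\<bar> \<le> (\<integral>\<^sup>+\<tau>. ennreal \<bar>?f \<tau>\<bar> \<partial>lborel)"
  proof (cases "integrable lborel ?f")
    case True
    from integral_norm_bound_ennreal[OF this] show ?thesis unfolding segment_average_def real_norm_def .
  next
    case False
    then have "segment_average h g x = 0" unfolding segment_average_def by (rule not_integrable_integral_eq)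
    then show ?thesis by simp
  qed
  then have "(ennreal \<bar>segment_average h g x\<bar>)\<^sup>2 \<le> (\<integral>\<^sup>+\<tau>. indicator {0..1} \<tau> * ennreal \<bar>?f \<tau>\<bar> \<partial>lborel)\<^sup>2"
  proof (intro power_mono)
    assume "ennreal \<bar>segment_average h g x\<bar> \<le> (\<integral>\<^sup>+\<tau>. ennreal \<bar>?f \<tau>\<bar> \<partial>lborel)"
    also have "(\<integral>\<^sup>+\<tau>. ennreal \<bar>?f \<tau>\<bar> \<partial>lborel) = (\<integral>\<^sup>+\<tau>. indicator {0..1} \<tau> * ennreal \<bar>?f \<tau>\<bar> \<partial>lborel)"
      by (intro nn_integral_cong) (simp add: indicator_def)
    finally show "ennreal \<bar>segment_average h g x\<bar> \<le> (\<integral>\<^sup>+\<tau>. indicator {0..1} \<tau> * ennreal \<bar>?f \<tau>\<bar> \<partial>lborel)" .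
  qed simp
  also have "\<dots> \<le> (\<integral>\<^sup>+\<tau>. (indicator {0..1::real} \<tau>)\<^sup>2 \<partial>lborel) * (\<integral>\<^sup>+\<tau>. (ennreal \<bar>?f \<tau>\<bar>)\<^sup>2 \<partial>lborel)"
    by (rule Cauchy_Schwarz_nn_integral) measurable
  also have "(\<integral>\<^sup>+\<tau>. (indicator {0..1::real} \<tau>)\<^sup>2 \<partial>lborel) = (1::ennreal)"
  proof -
    have "(indicator {0..1::real} \<tau> :: ennreal)\<^sup>2 = indicator {0..1} \<tau>" for \<tau> by (simp add: indicator_def)
    then show ?thesis by simp
  qed
  also have "1 * (\<integral>\<^sup>+\<tau>. (ennreal \<bar>?f \<tau>\<bar>)\<^sup>2 \<partial>lborel) \<le> (\<integral>\<^sup>+(\<tau>::real). indicator {0..1} \<tau> * (ennreal ((norm h)\<^sup>2) * ennreal ((norm (g (x + \<tau> *\<^sub>R h)))\<^sup>2)) \<partial>lborel)"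
    unfolding mult_1
  proof (rule nn_integral_mono)
    fix \<tau> :: real
    have "\<bar>g (x + \<tau> *\<^sub>R h) \<bullet> h\<bar>\<^sup>2 \<le> (norm (g (x + \<tau> *\<^sub>R h)) * norm h)\<^sup>2"
      by (intro power_mono Cauchy_Schwarz_ineq2) simp
    then have "ennreal (\<bar>g (x + \<tau> *\<^sub>R h) \<bullet> h\<bar>\<^sup>2) \<le> ennreal ((norm h)\<^sup>2 * (norm (g (x + \<tau> *\<^sub>R h)))\<^sup>2)"
      by (intro ennreal_leI) (simp add: power_mult_distrib mult.commute)
    then show "(ennreal \<bar>?f \<tau>\<bar>)\<^sup>2 \<le> indicator {0..1} \<tau> * (ennreal ((norm h)\<^sup>2) * ennreal ((norm (g (x + \<tau> *\<^sub>R h)))\<^sup>2))"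
      by (cases "\<tau> \<in> {0..1}") (simp_all add: ennreal_power ennreal_mult)
  qed
  finally show ?thesis by (simp add: ennreal_power)
qed

lemma shift_sq_le_gradient:
  fixes u :: "'a::euclidean_space \<Rightarrow> real"
  assumes [measurable]: "u \<in> borel_measurable borel" "g \<in> borel_measurable borel" and wg: "has_weak_gradient u g"
  shows "shift_sq u h \<le> (\<integral>\<^sup>+x. ennreal ((norm (g x))\<^sup>2) \<partial>lborel) * ennreal ((norm h)\<^sup>2)"
proof -
  have "shift_sq u h = (\<integral>\<^sup>+x. ennreal ((segment_average h g x)\<^sup>2) \<partial>lborel)"
    unfolding shift_sq_def
  proof (rule nn_integral_cong_AE)
    from weak_gradient_segment[OF assms, of h]
    show "AE x in lborel. ennreal ((u (x + h) - u x)\<^sup>2) = ennreal ((segment_average h g x)\<^sup>2)"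
      by eventually_elim simp
  qed
  also have "\<dots> \<le> (\<integral>\<^sup>+x. \<integral>\<^sup>+(\<tau>::real). indicator {0..1} \<tau> * (ennreal ((norm h)\<^sup>2) * ennreal ((norm (g (x + \<tau> *\<^sub>R h)))\<^sup>2)) \<partial>lborel \<partial>lborel)"
    by (intro nn_integral_mono segment_average_sq_le assms)
  also have "\<dots> = (\<integral>\<^sup>+(\<tau>::real). \<integral>\<^sup>+x. indicator {0..1} \<tau> * (ennreal ((norm h)\<^sup>2) * ennreal ((norm (g (x + \<tau> *\<^sub>R h)))\<^sup>2)) \<partial>lborel \<partial>lborel)"
    by (rule lborel_pair.Fubini'[symmetric]) measurable
  also have "\<dots> = (\<integral>\<^sup>+(\<tau>::real). indicator {0..1} \<tau> * (ennreal ((norm h)\<^sup>2) * (\<integral>\<^sup>+x. ennreal ((norm (g x))\<^sup>2) \<partial>lborel)) \<partial>lborel)"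
  proof (rule nn_integral_cong)
    fix \<tau> :: real
    have "(\<integral>\<^sup>+x. ennreal ((norm (g (x + \<tau> *\<^sub>R h)))\<^sup>2) \<partial>lborel) = (\<integral>\<^sup>+x. ennreal ((norm (g x))\<^sup>2) \<partial>lborel)"
      by (rule nn_integral_lborel_shift) measurable
    then show "(\<integral>\<^sup>+x. indicator {0..1} \<tau> * (ennreal ((norm h)\<^sup>2) * ennreal ((norm (g (x + \<tau> *\<^sub>R h)))\<^sup>2)) \<partial>lborel) = indicator {0..1} \<tau> * (ennreal ((norm h)\<^sup>2) * (\<integral>\<^sup>+x. ennreal ((norm (g x))\<^sup>2) \<partial>lborel))"
      by (simp add: nn_integral_cmult)
  qed
  also have "\<dots> = (\<integral>\<^sup>+x. ennreal ((norm (g x))\<^sup>2) \<partial>lborel) * ennreal ((norm h)\<^sup>2)"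
    by (simp add: nn_integral_multc mult.commute)
  finally show ?thesis .
qed

lemma AE_pair_lborel:
  assumes "AE x in (lborel :: 'a::euclidean_space measure). P x"
  shows "AE z in (lborel :: ('a \<times> 'a) measure). P (fst z) \<and> P (snd z)"
proof -
  obtain N where N: "N \<in> null_sets (lborel :: 'a measure)" "{x. \<not> P x} \<subseteq> N"
    using assms by (auto elim!: AE_E simp: null_sets_def)
  have "N \<times> UNIV \<in> null_sets (lborel \<Otimes>\<^sub>M lborel)" "UNIV \<times> N \<in> null_sets (lborel \<Otimes>\<^sub>M lborel)"
    using N(1) by (auto simp: null_sets_def lborel.emeasure_pair_measure_Times)
  then have "AE z in (lborel :: ('a \<times> 'a) measure). z \<notin> N \<times> UNIV" "AE z in (lborel :: ('a \<times> 'a) measure). z \<notin> UNIV \<times> N"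
    unfolding lborel_prod by (auto intro: AE_not_in)
  then show ?thesis by eventually_elim (use N(2) in auto)
qed

lemma seminorm_sq_cong_AE:
  fixes u v :: "'a::euclidean_space \<Rightarrow> real"
  assumes m: "u \<in> borel_measurable lebesgue" "v \<in> borel_measurable lebesgue" and eq: "AE x in lebesgue. u x = v x"
  shows "seminorm_sq s u = seminorm_sq s v"
proof -
  have eq': "AE x in lborel. u x = v x" using eq by (simp only: AE_completion_iff)
  have 0: "(\<integral>\<^sup>+x. ennreal ((u x)\<^sup>2) \<partial>lebesgue) = (\<integral>\<^sup>+x. ennreal ((v x)\<^sup>2) \<partial>lebesgue)"
    by (rule nn_integral_cong_AE) (use eq in \<open>eventually_elim, simp\<close>)
  have "has_weak_gradient u g \<longleftrightarrow> has_weak_gradient v g" for g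
  proof
    assume w: "has_weak_gradient u g"
    then have "g \<in> borel_measurable lebesgue" by (auto simp: has_weak_gradient_iff locally_integrable_measurable)
    then show "has_weak_gradient v g" using has_weak_gradient_cong_AE[OF w m(2) _ eq] by simp
  next
    assume w: "has_weak_gradient v g"
    then have g: "g \<in> borel_measurable lebesgue" by (auto simp: has_weak_gradient_iff locally_integrable_measurable)
    have "AE x in lebesgue. v x = u x" using eq by eventually_elim simp
    from has_weak_gradient_cong_AE[OF w m(1) g this] show "has_weak_gradient u g" by simp
  qed
  then have "has_weak_gradient u = has_weak_gradient v" by (rule ext)
  then have 1: "has_weak_gradient u = has_weak_gradient v" "weak_gradient u = weak_gradient v"
    unfolding weak_gradient_def by simp_all
  have 2: "(\<integral>\<^sup>+ (x, y). ennreal (\<bar>u x - u y\<bar>\<^sup>2 / norm (x - y) powr (real DIM('a) + 2 * s)) \<partial>(lebesgue :: ('a \<times> 'a) measure))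
     = (\<integral>\<^sup>+ (x, y). ennreal (\<bar>v x - v y\<bar>\<^sup>2 / norm (x - y) powr (real DIM('a) + 2 * s)) \<partial>(lebesgue :: ('a \<times> 'a) measure))"
    unfolding nn_integral_completion
  proof (rule nn_integral_cong_AE)
    from AE_pair_lborel[OF eq']
    show "AE z in (lborel :: ('a \<times> 'a) measure). (case z of (x, y) \<Rightarrow> ennreal (\<bar>u x - u y\<bar>\<^sup>2 / norm (x - y) powr (real DIM('a) + 2 * s)))
      = (case z of (x, y) \<Rightarrow> ennreal (\<bar>v x - v y\<bar>\<^sup>2 / norm (x - y) powr (real DIM('a) + 2 * s)))"
      by eventually_elim (simp add: case_prod_beta')
  qed
  show ?thesis unfolding seminorm_sq_def 0 1 2 ..
qed

lemma supported_borel_representative: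
  fixes u :: "'a::euclidean_space \<Rightarrow> real"
  assumes u: "u \<in> borel_measurable lebesgue" "AE x in lebesgue. x \<notin> \<Omega> \<longrightarrow> u x = 0" and "open \<Omega>"
  obtains u' where "u' \<in> borel_measurable borel" "AE x in lebesgue. u x = u' x" "\<And>x. x \<notin> \<Omega> \<Longrightarrow> u' x = 0"
proof -
  obtain v where v: "v \<in> borel_measurable borel" "AE x in lborel. u x = v x" using borel_representative[OF u(1)] by blast
  have "(\<lambda>x. indicator \<Omega> x * v x) \<in> borel_measurable borel"
    using v(1) \<open>open \<Omega>\<close> by (intro borel_measurable_times borel_measurable_indicator) auto
  moreover have "AE x in lebesgue. u x = v x" using v(2) by (rule AE_completion)
  then have "AE x in lebesgue. u x = indicator \<Omega> x * v x"
    using u(2) by eventually_elim (auto simp: indicator_def)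
  ultimately show ?thesis by (rule that) simp
qed

text \<open>For \<open>0 < s \<le> t < 1\<close> this is \<open>seminorm_sq_mono_Borel\<close> for a Borel
  representative; \<open>s = 0\<close> is the Poincare inequality, and at \<open>t = 1\<close> the
  hypothesis on increments in \<open>seminorm_sq_grad_Borel\<close> is
  \<open>shift_sq_le_gradient\<close>.\<close>

theorem seminorm_sq_comparison:
  fixes \<Omega> :: "'a::euclidean_space set"
  assumes "open \<Omega>" "bounded \<Omega>"
  shows "\<exists>C>0. \<forall>s t u. 0 \<le> s \<longrightarrow> s \<le> t \<longrightarrow> t \<le> 1 \<longrightarrow> u \<in> borel_measurable lebesgue \<longrightarrow>
    (AE x in lebesgue. x \<notin> \<Omega> \<longrightarrow> u x = 0) \<longrightarrow> seminorm_sq s u \<le> ennreal C * seminorm_sq t u"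
proof -
  obtain r where r: "0 < r" "\<Omega> \<subseteq> ball 0 r" using bounded_subset_ballD[OF assms(2)] by blast
  define d where "d = max 1 (2 * r)"
  have d: "1 \<le> d" and \<Omega>d: "x \<notin> \<Omega>" if "d / 2 \<le> norm x" for x using r that by (auto simp: d_def)
  have d: "1 \<le> d" by (simp add: d_def)
  obtain C1 where C1: "0 < C1" "\<And>s t (u::'a \<Rightarrow> real). \<lbrakk>0 < s; s \<le> t; t < 1; u \<in> borel_measurable borel; \<forall>x. d / 2 \<le> norm x \<longrightarrow> u x = 0\<rbrakk> \<Longrightarrow>
     seminorm_sq s u \<le> ennreal C1 * seminorm_sq t u"
    using seminorm_sq_mono_Borel[OF d, where 'a='a] by blast
  obtain C2 where C2: "0 < C2" "\<And>t (u::'a \<Rightarrow> real). \<lbrakk>0 < t; t < 1; u \<in> borel_measurable borel; \<forall>x. d / 2 \<le> norm x \<longrightarrow> u x = 0\<rbrakk> \<Longrightarrow>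
     L2_sq u \<le> ennreal C2 * seminorm_sq t u"
    using Poincare_Borel[OF d, where 'a='a] by blast
  obtain C3 where C3: "0 < C3" "\<And>s (u::'a \<Rightarrow> real) A. \<lbrakk>0 < s; s < 1; u \<in> borel_measurable borel; \<forall>x. d / 2 \<le> norm x \<longrightarrow> u x = 0;
     \<forall>h. shift_sq u h \<le> A * ennreal ((norm h)\<^sup>2)\<rbrakk> \<Longrightarrow> seminorm_sq s u \<le> ennreal C3 * A \<and> L2_sq u \<le> ennreal C3 * A"
    using seminorm_sq_grad_Borel[OF d, where 'a='a] by blast
  define C where "C = Max {1, C1, C2, C3}"
  have C: "1 \<le> C" "C1 \<le> C" "C2 \<le> C" "C3 \<le> C" by (auto simp: C_def)
  have "seminorm_sq s u \<le> ennreal C * seminorm_sq t u"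
    if st: "0 \<le> s" "s \<le> t" "t \<le> 1" and u: "u \<in> borel_measurable lebesgue" "AE x in lebesgue. x \<notin> \<Omega> \<longrightarrow> u x = 0" for s t and u :: "'a \<Rightarrow> real"
  proof -
    obtain v where v: "v \<in> borel_measurable borel" "AE x in lebesgue. u x = v x" and v0: "\<And>x. x \<notin> \<Omega> \<Longrightarrow> v x = 0"
      using supported_borel_representative[OF u assms(1)] by blast
    have vl: "v \<in> borel_measurable lebesgue" using v(1) by (simp add: measurable_completion)
    have uv: "seminorm_sq \<sigma> u = seminorm_sq \<sigma> v" for \<sigma> by (rule seminorm_sq_cong_AE[OF u(1) vl v(2)])
    have v0': "\<forall>x. d / 2 \<le> norm x \<longrightarrow> v x = 0" using \<Omega>d v0 by blast
    have L2: "seminorm_sq 0 v = L2_sq v" by (simp add: seminorm_sq_def nn_integral_completion)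
    have weaken: "X \<le> ennreal C * Y" if "X \<le> ennreal c * Y" "c \<le> C" for X Y c
      by (rule order_trans[OF that(1)]) (intro ennreal_mult_mono that order_refl)
    consider "s = t" | "s = 0" "0 < t" "t < 1" | "0 < s" "s < t" "t < 1" | "s < t" "t = 1" using st by fastforce
    then have "seminorm_sq s v \<le> ennreal C * seminorm_sq t v"
    proof cases
      case 1
      show ?thesis by (rule weaken[where c=1]) (use 1 C in auto)
    next
      case 2
      show ?thesis by (rule weaken[OF _ C(3)]) (use 2 C2(2)[OF 2(2,3) v(1) v0'] L2 in auto)
    next
      case 3
      show ?thesis by (rule weaken[OF _ C(2)]) (use 3 C1(2)[of s t v] v(1) v0' in auto)
    next
      case 4
      show ?thesis
      proof (cases "\<exists>g. has_weak_gradient v g")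
        case True
        then have w: "has_weak_gradient v (weak_gradient v)" using weak_gradient_eq(1) by blast
        then have "weak_gradient v \<in> borel_measurable lebesgue" by (auto simp: has_weak_gradient_iff locally_integrable_measurable)
        then obtain g where g: "g \<in> borel_measurable borel" "AE x in lborel. weak_gradient v x = g x"
          by (rule borel_representative)
        have "has_weak_gradient v g"
          by (rule has_weak_gradient_cong_AE[OF w vl _ _ AE_completion[OF g(2)]]) (use g(1) in \<open>auto simp: measurable_completion\<close>)
        then have sh: "\<forall>h. shift_sq v h \<le> (\<integral>\<^sup>+x. ennreal ((norm (g x))\<^sup>2) \<partial>lborel) * ennreal ((norm h)\<^sup>2)"
          using shift_sq_le_gradient v(1) g(1) by blast
        have "seminorm_sq 1 v = (\<integral>\<^sup>+x. ennreal ((norm (weak_gradient v x))\<^sup>2) \<partial>lborel)"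
          using True by (simp add: seminorm_sq_def nn_integral_completion)
        also have "\<dots> = (\<integral>\<^sup>+x. ennreal ((norm (g x))\<^sup>2) \<partial>lborel)"
          by (rule nn_integral_cong_AE) (use g(2) in \<open>eventually_elim, simp\<close>)
        finally have A: "(\<integral>\<^sup>+x. ennreal ((norm (g x))\<^sup>2) \<partial>lborel) = seminorm_sq t v" using 4 by simp
        show ?thesis
        proof (cases "s = 0")
          case True
          show ?thesis by (rule weaken[OF _ C(4)]) (use C3(2)[of "1/2" v, OF _ _ v(1) v0' sh] A L2 True in auto)
        next
          case False
          show ?thesis by (rule weaken[OF _ C(4)]) (use C3(2)[of s v, OF _ _ v(1) v0' sh] A 4 st False in auto)
        qed
      next
        case False
        then have "seminorm_sq t v = top" unfolding seminorm_sq_def using 4 by auto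
        then show ?thesis using C by (simp add: ennreal_mult_top)
      qed
    qed
    then show ?thesis by (simp only: uv)
  qed
  moreover have "0 < C" using C by simp
  ultimately show ?thesis by blast
qed

section \<open>The forms of a fixed order\<close>

instantiation "fun" :: (type, real_vector) real_vector
begin
definition scaleR_fun_def: "c *\<^sub>R f = (\<lambda>x. c *\<^sub>R f x)"
instance by standard (auto simp: scaleR_fun_def fun_eq_iff scaleR_add_right scaleR_add_left)
end

lemma scaleR_fun_apply [simp]: "(c *\<^sub>R f) x = c *\<^sub>R f x"
  by (simp add: scaleR_fun_def)

lemma borel_measurable_lebesgue_AE:
  fixes f g :: "'a::euclidean_space \<Rightarrow> 'b::topological_space"
  assumes f: "f \<in> borel_measurable lebesgue" and eq: "AE x in lebesgue. f x = g x"
  shows "g \<in> borel_measurable lebesgue"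
proof (rule measurableI)
  fix A :: "'b set" assume A: "A \<in> sets borel"
  have A: "f -` A \<inter> space lebesgue \<in> sets lebesgue" using f A by (rule measurable_sets)
  have ae: "AE x in lebesgue. x \<in> f -` A \<inter> space lebesgue \<longleftrightarrow> x \<in> g -` A \<inter> space lebesgue"
    using eq by eventually_elim simp
  show "g -` A \<inter> space lebesgue \<in> sets lebesgue"
    by (rule completion.in_sets_AE[OF ae A Int_lower2])
qed simp

text \<open>Every form of fixed order is the \<open>L\<^sup>2\<close> inner product pulled back along a map
  \<open>T\<close> that is linear up to null sets: the identity, the weak gradient, or a weighted
  difference \<open>u(x) - u(y)\<close>.\<close>

lemma L2_pullback:
  fixes T :: "'v::real_vector \<Rightarrow> 'x \<Rightarrow> 'b::euclidean_space"
  assumes W: "subspace W"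
    and meas: "\<And>u. u \<in> W \<Longrightarrow> T u \<in> borel_measurable M"
    and add: "\<And>u v. u \<in> W \<Longrightarrow> v \<in> W \<Longrightarrow> AE x in M. T (u + v) x = T u x + T v x"
    and scale: "\<And>c u. u \<in> W \<Longrightarrow> AE x in M. T (c *\<^sub>R u) x = c *\<^sub>R T u x"
  defines "V \<equiv> {u \<in> W. (\<integral>\<^sup>+x. ennreal ((norm (T u x))\<^sup>2) \<partial>M) < \<infinity>}"
  shows "semi_inner V (\<lambda>u v. LINT x|M. T u x \<bullet> T v x)"
    and "u \<in> V \<Longrightarrow> ennreal (LINT x|M. T u x \<bullet> T u x) = (\<integral>\<^sup>+x. ennreal ((norm (T u x))\<^sup>2) \<partial>M)"
proof -
  have VW: "u \<in> W" if "u \<in> V" for u using that by (simp add: V_def)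
  have sq_int: "integrable M (\<lambda>x. (norm (T u x))\<^sup>2)" if "u \<in> V" for u
    using that meas[OF VW[OF that]] by (intro integrableI_bounded borel_measurable_power borel_measurable_norm) (auto simp: V_def)
  have inner_int: "integrable M (\<lambda>x. T u x \<bullet> T v x)" if uv: "u \<in> V" "v \<in> V" for u v
  proof (rule Bochner_Integration.integrable_bound)
    show "integrable M (\<lambda>x. (norm (T u x))\<^sup>2 + (norm (T v x))\<^sup>2)"
      by (intro Bochner_Integration.integrable_add sq_int uv)
    show "(\<lambda>x. T u x \<bullet> T v x) \<in> borel_measurable M"
      by (intro borel_measurable_inner meas VW uv)
    have "norm (T u x \<bullet> T v x) \<le> norm ((norm (T u x))\<^sup>2 + (norm (T v x))\<^sup>2)" for x
    proof -
      have "\<bar>T u x \<bullet> T v x\<bar> \<le> norm (T u x) * norm (T v x)" by (rule Cauchy_Schwarz_ineq2)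
      also have "\<dots> \<le> (norm (T u x))\<^sup>2 + (norm (T v x))\<^sup>2"
      proof -
        have "0 \<le> norm (T u x) * norm (T v x)" by simp
        then show ?thesis using sum_squares_bound[of "norm (T u x)" "norm (T v x)"] by linarith
      qed
      finally show ?thesis by simp
    qed
    then show "AE x in M. norm (T u x \<bullet> T v x) \<le> norm ((norm (T u x))\<^sup>2 + (norm (T v x))\<^sup>2)" by (rule AE_I2)
  qed
  have addV: "u + v \<in> V" if uv: "u \<in> V" "v \<in> V" for u v
  proof -
    have "(\<integral>\<^sup>+x. ennreal ((norm (T (u + v) x))\<^sup>2) \<partial>M) \<le> (\<integral>\<^sup>+x. ennreal (2 * (norm (T u x))\<^sup>2 + 2 * (norm (T v x))\<^sup>2) \<partial>M)"
    proof (rule nn_integral_mono_AE)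
      show "AE x in M. ennreal ((norm (T (u + v) x))\<^sup>2) \<le> ennreal (2 * (norm (T u x))\<^sup>2 + 2 * (norm (T v x))\<^sup>2)"
        using add[OF VW[OF uv(1)] VW[OF uv(2)]]
      proof eventually_elim
        case (elim x)
        have "(norm (T u x + T v x))\<^sup>2 \<le> (norm (T u x) + norm (T v x))\<^sup>2" by (intro power_mono norm_triangle_ineq) simp
        also have "\<dots> \<le> 2 * (norm (T u x))\<^sup>2 + 2 * (norm (T v x))\<^sup>2"
          using sum_squares_bound[of "norm (T u x)" "norm (T v x)"] by (simp add: power2_sum)
        finally show ?case unfolding elim by (rule ennreal_leI)
      qed
    qed
    also have "\<dots> < \<infinity>"
    proof -
      have "integrable M (\<lambda>x. 2 * (norm (T u x))\<^sup>2 + 2 * (norm (T v x))\<^sup>2)"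
        by (intro Bochner_Integration.integrable_add integrable_mult_right sq_int uv)
      then show ?thesis by (simp add: integrable_iff_bounded)
    qed
    finally show ?thesis using subspace_add[OF W VW[OF uv(1)] VW[OF uv(2)]] unfolding V_def by blast
  qed
  have scaleV: "c *\<^sub>R u \<in> V" if u: "u \<in> V" for c u
  proof -
    have "(\<integral>\<^sup>+x. ennreal ((norm (T (c *\<^sub>R u) x))\<^sup>2) \<partial>M) = (\<integral>\<^sup>+x. ennreal (c\<^sup>2 * (norm (T u x))\<^sup>2) \<partial>M)"
    proof (rule nn_integral_cong_AE)
      show "AE x in M. ennreal ((norm (T (c *\<^sub>R u) x))\<^sup>2) = ennreal (c\<^sup>2 * (norm (T u x))\<^sup>2)"
        using scale[OF VW[OF u], of c] by eventually_elim (simp add: power_mult_distrib)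
    qed
    also have "\<dots> < \<infinity>"
    proof -
      have i: "integrable M (\<lambda>x. c\<^sup>2 * (norm (T u x))\<^sup>2)" by (intro integrable_mult_right sq_int u)
      show ?thesis by (subst nn_integral_eq_integral[OF i]) auto
    qed
    finally show ?thesis using subspace_scale[OF W VW[OF u]] unfolding V_def by blast
  qed
  have zeroV: "0 \<in> V"
  proof -
    have "AE x in M. T 0 x = 0" using scale[OF subspace_0[OF W], of 0] by eventually_elim simp
    then have "AE x in M. ennreal ((norm (T 0 x))\<^sup>2) = 0" by eventually_elim simp
    from nn_integral_cong_AE[OF this] have "(\<integral>\<^sup>+x. ennreal ((norm (T 0 x))\<^sup>2) \<partial>M) < \<infinity>" by simp
    then show ?thesis using subspace_0[OF W] unfolding V_def by blast
  qed
  show "semi_inner V (\<lambda>u v. LINT x|M. T u x \<bullet> T v x)"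
  proof
    show "subspace V" using addV scaleV zeroV unfolding subspace_def by blast
    show "(LINT x|M. T u x \<bullet> T v x) = (LINT x|M. T v x \<bullet> T u x)" for u v
      by (intro Bochner_Integration.integral_cong refl inner_commute)
    show "(LINT x|M. T (u + v) x \<bullet> T w x) = (LINT x|M. T u x \<bullet> T w x) + (LINT x|M. T v x \<bullet> T w x)"
      if "u \<in> V" "v \<in> V" "w \<in> V" for u v w
    proof -
      have "(LINT x|M. T (u + v) x \<bullet> T w x) = (LINT x|M. T u x \<bullet> T w x + T v x \<bullet> T w x)"
      proof (rule integral_cong_AE)
        show "AE x in M. T (u + v) x \<bullet> T w x = T u x \<bullet> T w x + T v x \<bullet> T w x"
          using add[OF VW[OF that(1)] VW[OF that(2)]] by eventually_elim (simp add: inner_add_left)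
      qed (use that addV inner_int in \<open>auto intro!: borel_measurable_integrable\<close>)
      also have "\<dots> = (LINT x|M. T u x \<bullet> T w x) + (LINT x|M. T v x \<bullet> T w x)"
        by (intro Bochner_Integration.integral_add inner_int that)
      finally show ?thesis .
    qed
    show "(LINT x|M. T (c *\<^sub>R u) x \<bullet> T w x) = c * (LINT x|M. T u x \<bullet> T w x)" if "u \<in> V" "w \<in> V" for u w c
    proof -
      have "(LINT x|M. T (c *\<^sub>R u) x \<bullet> T w x) = (LINT x|M. c * (T u x \<bullet> T w x))"
      proof (rule integral_cong_AE)
        show "AE x in M. T (c *\<^sub>R u) x \<bullet> T w x = c * (T u x \<bullet> T w x)"
          using scale[OF VW[OF that(1)], of c] by eventually_elim simp
      qed (use that scaleV inner_int in \<open>auto intro!: borel_measurable_integrable\<close>)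
      then show ?thesis by simp
    qed
    show "0 \<le> (LINT x|M. T u x \<bullet> T u x)" for u by (rule Bochner_Integration.integral_nonneg) simp
  qed
  show "ennreal (LINT x|M. T u x \<bullet> T u x) = (\<integral>\<^sup>+x. ennreal ((norm (T u x))\<^sup>2) \<partial>M)" if "u \<in> V"
    unfolding dot_square_norm by (rule nn_integral_eq_integral[symmetric]) (use sq_int[OF that] in auto)
qed

definition finite_energy :: "real \<Rightarrow> ('a::euclidean_space \<Rightarrow> real) set" where
  "finite_energy s = {u \<in> borel_measurable lebesgue. seminorm_sq s u < \<infinity>}"

lemma subspace_measurable: "subspace (borel_measurable M :: ('x \<Rightarrow> real) set)"
proof (rule subspaceI)
  show "(0 :: 'x \<Rightarrow> real) \<in> borel_measurable M" by (simp add: zero_fun_def)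
  show "x + y \<in> borel_measurable M" if "x \<in> borel_measurable M" "y \<in> borel_measurable M" for x y :: "'x \<Rightarrow> real"
    using that by (simp add: plus_fun_def)
  show "c *\<^sub>R x \<in> borel_measurable M" if "x \<in> borel_measurable M" for c and x :: "'x \<Rightarrow> real"
    using that by (simp add: scaleR_fun_def)
qed

lemma frac_const_pos:
  assumes "0 < s" "s < 1" "0 < N" shows "0 < frac_const N s"
proof -
  obtain k0 where "0 < k0" "k0 * (s * (1 - s)) \<le> frac_const N s" using frac_const_bounds[OF assms(3)] assms by fastforce
  moreover have "0 < k0 * (s * (1 - s))" using assms \<open>0 < k0\<close> by simp
  ultimately show ?thesis by linarith
qed

lemma form_s_semi_inner:
  assumes s: "0 \<le> s" "s \<le> 1"
  shows "semi_inner (finite_energy s) (form_s s :: ('a::euclidean_space \<Rightarrow> real) \<Rightarrow> _)"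
    and "(u :: 'a \<Rightarrow> real) \<in> finite_energy s \<Longrightarrow> ennreal (form_s s u u) = seminorm_sq s u"
proof -
  consider "s = 0" | "s = 1" | "0 < s" "s < 1" using s by fastforce
  then have "semi_inner (finite_energy s) (form_s s :: ('a \<Rightarrow> real) \<Rightarrow> _) \<and>
    (u \<in> finite_energy s \<longrightarrow> ennreal (form_s s u u) = seminorm_sq s u)"
  proof cases
    case 1
    have fe: "finite_energy s = {u \<in> borel_measurable lebesgue. (\<integral>\<^sup>+x. ennreal ((norm (u x))\<^sup>2) \<partial>(lebesgue :: 'a measure)) < \<infinity>}"
      using 1 by (simp add: finite_energy_def seminorm_sq_def)
    have fs: "form_s s = (\<lambda>u v. LINT x|(lebesgue :: 'a measure). u x \<bullet> v x)"
      using 1 by (auto simp: form_s_def fun_eq_iff)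
    have ss: "seminorm_sq s u = (\<integral>\<^sup>+x. ennreal ((norm (u x))\<^sup>2) \<partial>(lebesgue :: 'a measure))"
      using 1 by (simp add: seminorm_sq_def)
    show ?thesis
      unfolding fs fe ss
      using L2_pullback[where T="\<lambda>u. u" and W="borel_measurable lebesgue" and M="lebesgue :: 'a measure", OF subspace_measurable]
      by (auto simp del: norm_conv_dist)
  next
    case 2
    define W where "W = {u :: 'a \<Rightarrow> real. \<exists>g. has_weak_gradient u g}"
    have W: "subspace W"
    proof (rule subspaceI)
      have "has_weak_gradient (\<lambda>x::'a. 0::real) (\<lambda>x. 0)"
        by (simp add: has_weak_gradient_iff locally_integrable_def set_integrable_def)
      then show "0 \<in> W" by (auto simp: W_def zero_fun_def)
      show "x + y \<in> W" if "x \<in> W" "y \<in> W" for x y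
      proof -
        obtain g k where "has_weak_gradient x g" "has_weak_gradient y k" using \<open>x \<in> W\<close> \<open>y \<in> W\<close> unfolding W_def by blast
        from has_weak_gradient_add[OF this] show ?thesis unfolding W_def plus_fun_def by blast
      qed
      show "c *\<^sub>R x \<in> W" if "x \<in> W" for c x
      proof -
        obtain g where "has_weak_gradient x g" using \<open>x \<in> W\<close> unfolding W_def by blast
        from has_weak_gradient_scale[OF this, of c] show ?thesis unfolding W_def scaleR_fun_def real_scaleR_def by blast
      qed
    qed
    have w: "has_weak_gradient u (weak_gradient u)" if "u \<in> W" for u
      using that weak_gradient_eq(1) by (auto simp: W_def)
    have sn: "seminorm_sq s u = (if u \<in> W then \<integral>\<^sup>+x. ennreal ((norm (weak_gradient u x))\<^sup>2) \<partial>lebesgue else \<infinity>)" for u :: "'a \<Rightarrow> real"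
      unfolding 2 seminorm_sq_def W_def by simp
    have Wm: "u \<in> borel_measurable lebesgue" if "u \<in> W" for u
      using w[OF that] unfolding has_weak_gradient_iff by (intro locally_integrable_measurable) blast
    have fe: "finite_energy s = {u \<in> W. (\<integral>\<^sup>+x. ennreal ((norm (weak_gradient u x))\<^sup>2) \<partial>lebesgue) < \<infinity>}"
      unfolding finite_energy_def sn using Wm by auto
    have fs: "form_s s = (\<lambda>u v. LINT x|(lebesgue :: 'a measure). weak_gradient u x \<bullet> weak_gradient v x)"
      using 2 by (auto simp: form_s_def fun_eq_iff)
    have ss: "seminorm_sq s u = (\<integral>\<^sup>+x. ennreal ((norm (weak_gradient u x))\<^sup>2) \<partial>lebesgue)" if "u \<in> W" for u :: "'a \<Rightarrow> real"
      using that unfolding sn by simp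
    have a1: "weak_gradient u \<in> borel_measurable lebesgue" if "u \<in> W" for u
      using w[OF that] by (auto simp: has_weak_gradient_iff locally_integrable_measurable)
    have a2: "AE x in lebesgue. weak_gradient (u + v) x = weak_gradient u x + weak_gradient v x" if "u \<in> W" "v \<in> W" for u v
      using weak_gradient_eq(2)[OF has_weak_gradient_add[OF w[OF that(1)] w[OF that(2)]]] by (simp add: plus_fun_def)
    have a3: "AE x in lebesgue. weak_gradient (c *\<^sub>R u) x = c *\<^sub>R weak_gradient u x" if "u \<in> W" for u c
      using weak_gradient_eq(2)[OF has_weak_gradient_scale[OF w[OF that], of c]] by (simp add: scaleR_fun_def)
    note L = L2_pullback[where T=weak_gradient and W=W and M="lebesgue :: 'a measure", OF W a1 a2 a3]
    show ?thesis unfolding fs fe using L(1) L(2)[of u] ss by simp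
  next
    case 3
    define c where "c = sqrt (frac_const DIM('a) s)"
    have c: "frac_const DIM('a) s = c\<^sup>2" "0 \<le> frac_const DIM('a) s"
      using frac_const_pos[OF 3, of "DIM('a)"] by (simp_all add: c_def)
    define p where "p = real DIM('a) + 2 * s"
    define T where "T u z = c * (u (fst z) - u (snd z)) * norm (fst z - snd z) powr (- (p / 2))" for u :: "'a \<Rightarrow> real" and z :: "'a \<times> 'a"
    have pp: "norm (x - y) powr (- (p / 2)) * norm (x - y) powr (- (p / 2)) = 1 / norm (x - y) powr p" for x y :: 'a
    proof -
      have "norm (x - y) powr (- (p / 2)) * norm (x - y) powr (- (p / 2)) = norm (x - y) powr (- p)"
        by (simp flip: powr_add)
      then show ?thesis by (simp only: powr_minus_divide)
    qed
    have TT: "T u z * T v z = c\<^sup>2 * ((u (fst z) - u (snd z)) * (v (fst z) - v (snd z)) / norm (fst z - snd z) powr p)" for u v z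
    proof -
      have "T u z * T v z = c\<^sup>2 * ((u (fst z) - u (snd z)) * (v (fst z) - v (snd z))) * (norm (fst z - snd z) powr (- (p / 2)) * norm (fst z - snd z) powr (- (p / 2)))"
        by (simp add: T_def power2_eq_square)
      then show ?thesis unfolding pp by simp
    qed
    have a1: "T u \<in> borel_measurable lebesgue" if u: "u \<in> borel_measurable lebesgue" for u
    proof -
      obtain u' where u': "u' \<in> borel_measurable borel" "AE x in lborel. u x = u' x" using borel_representative[OF u] by blast
      have [measurable]: "u' \<in> borel_measurable borel" by fact
      have "T u' \<in> borel_measurable (borel \<Otimes>\<^sub>M borel)" unfolding T_def by measurable
      then have "T u' \<in> borel_measurable (lborel :: ('a \<times> 'a) measure)" by (simp add: borel_prod)
      then have "T u' \<in> borel_measurable (lebesgue :: ('a \<times> 'a) measure)" by (rule measurable_completion)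
      moreover have "AE z in (lborel :: ('a \<times> 'a) measure). T u' z = T u z"
        using AE_pair_lborel[OF u'(2)] by eventually_elim (simp add: T_def)
      then have "AE z in (lebesgue :: ('a \<times> 'a) measure). T u' z = T u z" by (rule AE_completion)
      ultimately show ?thesis by (rule borel_measurable_lebesgue_AE)
    qed
    have a2: "AE z in lebesgue. T (u + v) z = T u z + T v z" for u v by (simp add: T_def algebra_simps)
    have a3: "AE z in lebesgue. T (k *\<^sub>R u) z = k *\<^sub>R T u z" for u k by (simp add: T_def algebra_simps)
    have ss: "seminorm_sq s u = (\<integral>\<^sup>+z. ennreal ((norm (T u z))\<^sup>2) \<partial>lebesgue)" if u: "u \<in> borel_measurable lebesgue" for u :: "'a \<Rightarrow> real"
    proof -
      let ?f = "\<lambda>z. (u (fst z) - u (snd z)) * (u (fst z) - u (snd z)) / norm (fst z - snd z) powr p"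
      have sq: "(norm (T u z))\<^sup>2 = c\<^sup>2 * ?f z" for z
        using TT[of u z u] by (simp add: power2_eq_square)
      have "ennreal (c\<^sup>2) * (\<integral>\<^sup>+z. ennreal (?f z) \<partial>lebesgue) = (\<integral>\<^sup>+z. ennreal (c\<^sup>2) * ennreal (?f z) \<partial>lebesgue)"
      proof (rule nn_integral_cmult[symmetric])
        have c0: "c\<^sup>2 \<noteq> 0" using frac_const_pos[OF 3, of "DIM('a)"] c by simp
        have "?f = (\<lambda>z. (norm (T u z))\<^sup>2 / c\<^sup>2)"
          by (rule ext) (simp only: sq nonzero_mult_div_cancel_left[OF c0])
        moreover have "(\<lambda>z. (norm (T u z))\<^sup>2 / c\<^sup>2) \<in> borel_measurable lebesgue"
          using a1[OF u] by measurable
        ultimately show "(\<lambda>z. ennreal (?f z)) \<in> borel_measurable lebesgue" by (intro measurable_compose[OF _ measurable_ennreal]) simp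
      qed
      also have "\<dots> = (\<integral>\<^sup>+z. ennreal ((norm (T u z))\<^sup>2) \<partial>lebesgue)"
        unfolding sq by (intro nn_integral_cong) (rule ennreal_mult'[symmetric], simp)
      finally have sqT: "ennreal (c\<^sup>2) * (\<integral>\<^sup>+z. ennreal (?f z) \<partial>lebesgue) = (\<integral>\<^sup>+z. ennreal ((norm (T u z))\<^sup>2) \<partial>lebesgue)" .
      have "seminorm_sq s u = ennreal (frac_const DIM('a) s) *
          (\<integral>\<^sup>+ (x, y). ennreal (\<bar>u x - u y\<bar>\<^sup>2 / norm (x - y) powr (real DIM('a) + 2 * s)) \<partial>(lebesgue :: ('a \<times> 'a) measure))"
        using 3 by (simp add: seminorm_sq_def)
      also have "\<dots> = ennreal (c\<^sup>2) * (\<integral>\<^sup>+z. ennreal (?f z) \<partial>lebesgue)"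
        unfolding c(1) p_def case_prod_beta' power2_abs power2_eq_square[of "u _ - u _"] ..
      finally show ?thesis unfolding sqT .
    qed
    have fe: "finite_energy s = {u \<in> borel_measurable lebesgue. (\<integral>\<^sup>+z. ennreal ((norm (T u z))\<^sup>2) \<partial>lebesgue) < \<infinity>}"
      using ss by (auto simp: finite_energy_def)
    have fs: "form_s s = (\<lambda>u v. LINT z|(lebesgue :: ('a \<times> 'a) measure). T u z \<bullet> T v z)"
    proof (intro ext)
      fix u v :: "'a \<Rightarrow> real"
      have "form_s s u v = frac_const DIM('a) s * (LINT (x, y)|(lebesgue :: ('a \<times> 'a) measure).
           (u x - u y) * (v x - v y) / norm (x - y) powr (real DIM('a) + 2 * s))"
        using 3 by (simp add: form_s_def)
      also have "\<dots> = (LINT z|(lebesgue :: ('a \<times> 'a) measure). T u z \<bullet> T v z)"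
        unfolding inner_real_def TT c(1) p_def case_prod_beta' integral_mult_right_zero ..
      finally show "form_s s u v = (LINT z|(lebesgue :: ('a \<times> 'a) measure). T u z \<bullet> T v z)" .
    qed
    note L = L2_pullback[where T=T and W="borel_measurable lebesgue" and M="lebesgue :: ('a \<times> 'a) measure", OF subspace_measurable a1 a2 a3]
    show ?thesis unfolding fs fe using L(1) L(2)[of u] ss by simp
  qed
  then show "semi_inner (finite_energy s) (form_s s :: ('a \<Rightarrow> real) \<Rightarrow> _)" "u \<in> finite_energy s \<Longrightarrow> ennreal (form_s s u u) = seminorm_sq s u"
    by blast+
qed

section \<open>Integration of the forms over the order\<close>

lemma finite_borel_measure_01D:
  assumes "finite_borel_measure_01 M"
  shows "finite_measure M" "sets M = sets (restrict_space borel {0..1})" "space M = {0..1}"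
    "\<And>a b. 0 \<le> a \<Longrightarrow> b \<le> 1 \<Longrightarrow> {a..b} \<in> sets M"
proof -
  show "finite_measure M" and s: "sets M = sets (restrict_space borel {0..1})"
    using assms by (auto simp: finite_borel_measure_01_def)
  show "space M = {0..1}" using sets_eq_imp_space_eq[OF s] by (simp add: space_restrict_space)
  show "{a..b} \<in> sets M" if "0 \<le> a" "b \<le> 1" for a b
    unfolding s sets_restrict_space using that by (intro image_eqI[of _ _ "{a..b}"]) auto
qed

lemma frac_const_measurable:
  assumes "0 < N"
  shows "(\<lambda>s. indicator {0<..<1} s * frac_const N s) \<in> borel_measurable borel"
proof -
  have G: "continuous_on {0<..} (Gamma :: real \<Rightarrow> real)"
    by (rule continuous_on_Gamma) (auto elim!: nonpos_Ints_cases)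
  have "continuous_on {0<..<1} (\<lambda>s. Gamma ((real N + 2 * s) / 2))" "continuous_on {0<..<1} (\<lambda>s::real. Gamma (1 - s))"
    using assms by (auto intro!: continuous_on_compose2[OF G] continuous_intros)
  moreover have "Gamma (1 - s) \<noteq> 0" if "s \<in> {0<..<1}" for s :: real
  proof -
    have "0 < Gamma (1 - s)" using that by (intro Gamma_real_pos) auto
    then show ?thesis by simp
  qed
  ultimately have "continuous_on {0<..<1} (frac_const N)"
    unfolding frac_const_def by (intro continuous_intros) auto
  then have "(\<lambda>s. indicator {0<..<1} s *\<^sub>R frac_const N s) \<in> borel_measurable borel"
    by (intro borel_measurable_continuous_on_indicator) auto
  then show ?thesis by simp
qed

lemma measurable_on_unit_interval:
  assumes M: "sets M = sets (restrict_space borel {0..1::real})"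
    and f: "f \<in> borel_measurable borel" and eq: "\<And>s. 0 < s \<Longrightarrow> s < 1 \<Longrightarrow> g s = f s"
  shows "g \<in> borel_measurable M"
proof -
  have "(\<lambda>s. if s = 0 then g 0 else if s = 1 then g 1 else f s) \<in> borel_measurable borel"
    by (intro measurable_If f borel_measurable_const) auto
  then have "(\<lambda>s. if s = 0 then g 0 else if s = 1 then g 1 else f s) \<in> borel_measurable (restrict_space borel {0..1})"
    by (rule measurable_restrict_space1)
  then have "(\<lambda>s. if s = 0 then g 0 else if s = 1 then g 1 else f s) \<in> borel_measurable M"
    unfolding measurable_cong_sets[OF M refl] .
  moreover have "space M = {0..1}" using sets_eq_imp_space_eq[OF M] by (simp add: space_restrict_space)
  ultimately show ?thesis
    by (subst measurable_cong[where g="\<lambda>s. if s = 0 then g 0 else if s = 1 then g 1 else f s"]) (auto simp: eq)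
qed

lemma form_s_borel:
  fixes u v u' v' :: "'a::euclidean_space \<Rightarrow> real"
  assumes s: "0 < s" "s < 1" and [measurable]: "u' \<in> borel_measurable borel" "v' \<in> borel_measurable borel"
    and m: "u \<in> borel_measurable lebesgue" "v \<in> borel_measurable lebesgue"
    and eq: "AE x in lborel. u x = u' x" "AE x in lborel. v x = v' x"
  shows "form_s s u v = frac_const DIM('a) s * (LINT z|(lborel \<Otimes>\<^sub>M lborel).
    (u' (fst z) - u' (snd z)) * (v' (fst z) - v' (snd z)) / norm (fst z - snd z) powr (real DIM('a) + 2 * s))"
proof -
  let ?f = "\<lambda>u v z. (u (fst z) - u (snd z)) * (v (fst z) - v (snd z)) / norm (fst z - snd z :: 'a) powr (real DIM('a) + 2 * s)"
  have mb: "?f u' v' \<in> borel_measurable (lborel :: ('a \<times> 'a) measure)"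
  proof -
    have "?f u' v' \<in> borel_measurable (borel \<Otimes>\<^sub>M borel)" by measurable
    then show ?thesis by (simp add: borel_prod)
  qed
  have ae: "AE z in (lborel :: ('a \<times> 'a) measure). ?f u' v' z = ?f u v z"
    using AE_pair_lborel[OF eq(1)] AE_pair_lborel[OF eq(2)] by eventually_elim simp
  have m1: "?f u' v' \<in> borel_measurable (lebesgue :: ('a \<times> 'a) measure)" using mb by (rule measurable_completion)
  have m2: "?f u v \<in> borel_measurable (lebesgue :: ('a \<times> 'a) measure)"
    by (rule borel_measurable_lebesgue_AE[OF m1 AE_completion[OF ae]])
  have "(LINT z|(lebesgue :: ('a \<times> 'a) measure). ?f u v z) = (LINT z|(lebesgue :: ('a \<times> 'a) measure). ?f u' v' z)"
    by (rule integral_cong_AE[symmetric, OF m1 m2 AE_completion[OF ae]])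
  also have "\<dots> = (LINT z|(lborel :: ('a \<times> 'a) measure). ?f u' v' z)"
    by (rule integral_completion[OF mb])
  finally show ?thesis using s unfolding form_s_def lborel_prod case_prod_beta' by simp
qed

lemma seminorm_sq_borel:
  fixes u u' :: "'a::euclidean_space \<Rightarrow> real"
  assumes s: "0 < s" "s < 1" and [measurable]: "u' \<in> borel_measurable borel"
    and m: "u \<in> borel_measurable lebesgue" and eq: "AE x in lborel. u x = u' x"
  shows "seminorm_sq s u = ennreal (frac_const DIM('a) s) * (\<integral>\<^sup>+z. ennreal (
    (u' (fst z) - u' (snd z))\<^sup>2 / norm (fst z - snd z) powr (real DIM('a) + 2 * s)) \<partial>(lborel \<Otimes>\<^sub>M lborel))"
proof -
  have "u' \<in> borel_measurable lebesgue" using assms(3) by (simp add: measurable_completion)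
  then have "seminorm_sq s u = seminorm_sq s u'" by (rule seminorm_sq_cong_AE[OF m _ AE_completion[OF eq]])
  then show ?thesis using s unfolding seminorm_sq_def lborel_prod case_prod_beta' nn_integral_completion by simp
qed

text \<open>The endpoints \<open>0\<close> and \<open>1\<close> are single points, so it suffices to treat the
  open interval, where the integrand is jointly measurable.\<close>

lemma form_s_measurable:
  fixes u v :: "'a::euclidean_space \<Rightarrow> real"
  assumes M: "sets M = sets (restrict_space borel {0..1::real})"
    and m: "u \<in> borel_measurable lebesgue" "v \<in> borel_measurable lebesgue"
  shows "(\<lambda>s. form_s s u v) \<in> borel_measurable M" "(\<lambda>s. seminorm_sq s u) \<in> borel_measurable M"
proof -
  obtain u' where u'[measurable]: "u' \<in> borel_measurable borel" and ue: "AE x in lborel. u x = u' x"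
    using borel_representative[OF m(1)] by blast
  obtain v' where v'[measurable]: "v' \<in> borel_measurable borel" and ve: "AE x in lborel. v x = v' x"
    using borel_representative[OF m(2)] by blast
  show "(\<lambda>s. form_s s u v) \<in> borel_measurable M"
  proof (rule measurable_on_unit_interval[OF M])
    show "(\<lambda>s. (indicator {0<..<1} s * frac_const DIM('a) s) * (LINT z|(lborel \<Otimes>\<^sub>M lborel).
      (u' (fst z) - u' (snd z)) * (v' (fst z) - v' (snd z)) / norm (fst z - snd z) powr (real DIM('a) + 2 * s))) \<in> borel_measurable borel"
    proof (rule borel_measurable_times[OF frac_const_measurable[OF DIM_positive]], rule sigma_finite_measure.borel_measurable_lebesgue_integral)
      show "sigma_finite_measure (lborel \<Otimes>\<^sub>M lborel :: ('a \<times> 'a) measure)"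
        unfolding lborel_prod by (rule lborel.sigma_finite_measure_axioms)
    qed measurable
  qed (use form_s_borel[OF _ _ u' v' m ue ve] in simp)
  show "(\<lambda>s. seminorm_sq s u) \<in> borel_measurable M"
  proof (rule measurable_on_unit_interval[OF M])
    show "(\<lambda>s. ennreal (indicator {0<..<1} s * frac_const DIM('a) s) * (\<integral>\<^sup>+z. ennreal (
      (u' (fst z) - u' (snd z))\<^sup>2 / norm (fst z - snd z) powr (real DIM('a) + 2 * s)) \<partial>(lborel \<Otimes>\<^sub>M lborel))) \<in> borel_measurable borel"
    proof (rule borel_measurable_times_ennreal[OF measurable_compose[OF frac_const_measurable[OF DIM_positive] measurable_ennreal]], rule sigma_finite_measure.borel_measurable_nn_integral)
      show "sigma_finite_measure (lborel \<Otimes>\<^sub>M lborel :: ('a \<times> 'a) measure)"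
        unfolding lborel_prod by (rule lborel.sigma_finite_measure_axioms)
    qed measurable
  qed (use seminorm_sq_borel[OF _ _ u' m(1) ue] in simp)
qed

definition energy_space :: "real measure \<Rightarrow> real set \<Rightarrow> ('a::euclidean_space \<Rightarrow> real) set" where
  "energy_space M A = {u \<in> borel_measurable lebesgue. (\<integral>\<^sup>+s. indicator A s * seminorm_sq s u \<partial>M) < \<infinity>}"

text \<open>Almost every order has finite energy, so the bilinear identities hold for almost every order and
  may be integrated; Cauchy-Schwarz in each order gives integrability.\<close>

lemma integrated_form:
  fixes M :: "real measure"
  assumes M: "sets M = sets (restrict_space borel {0..1::real})" and A[measurable]: "A \<in> sets M"
  shows "semi_inner (energy_space M A) (\<lambda>u v :: 'a::euclidean_space \<Rightarrow> real. LINT s:A|M. form_s s u v)"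
    and "(w :: 'a \<Rightarrow> real) \<in> energy_space M A \<Longrightarrow> ennreal (LINT s:A|M. form_s s w w) = (\<integral>\<^sup>+s. indicator A s * seminorm_sq s w \<partial>M)"
proof -
  have space: "space M = {0..1}" using sets_eq_imp_space_eq[OF M] by (simp add: space_restrict_space)
  have meas: "u \<in> borel_measurable lebesgue" if "u \<in> energy_space M A" for u :: "'a \<Rightarrow> real"
    using that unfolding energy_space_def by blast
  note fm = form_s_measurable[OF M]
  have ind_meas: "(\<lambda>s. indicator A s * seminorm_sq s u) \<in> borel_measurable M" if "u \<in> borel_measurable lebesgue" for u :: "'a \<Rightarrow> real"
    by (intro borel_measurable_times_ennreal borel_measurable_indicator A fm(2)[OF that that])
  have inS: "AE s in M. s \<in> {0..1}" using AE_space[of M] unfolding space .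
  have ae: "AE s in M. s \<in> A \<longrightarrow> u \<in> finite_energy s" if u: "u \<in> energy_space M A" for u :: "'a \<Rightarrow> real"
  proof -
    have "(\<integral>\<^sup>+s. indicator A s * seminorm_sq s u \<partial>M) \<noteq> \<infinity>" using u unfolding energy_space_def by auto
    from nn_integral_noteq_infinite[OF ind_meas[OF meas[OF u]] this]
    show ?thesis
      by eventually_elim (use meas[OF u] in \<open>auto simp: finite_energy_def top.not_eq_extremum\<close>)
  qed
  have diag: "integrable M (\<lambda>s. indicator A s * enn2real (seminorm_sq s u))" if u: "u \<in> energy_space M A" for u :: "'a \<Rightarrow> real"
  proof (rule integrableI_bounded)
    show "(\<lambda>s. indicator A s * enn2real (seminorm_sq s u)) \<in> borel_measurable M"
      by (intro borel_measurable_times borel_measurable_indicator A measurable_compose[OF fm(2)[OF meas[OF u] meas[OF u]]]) measurable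
    have "(\<integral>\<^sup>+s. ennreal (norm (indicator A s * enn2real (seminorm_sq s u))) \<partial>M) \<le> (\<integral>\<^sup>+s. indicator A s * seminorm_sq s u \<partial>M)"
    proof (rule nn_integral_mono)
      fix s
      have "ennreal (enn2real x) \<le> x" for x by (cases x) auto
      then show "ennreal (norm (indicator A s * enn2real (seminorm_sq s u))) \<le> indicator A s * seminorm_sq s u"
        by (simp add: indicator_def)
    qed
    also have "\<dots> < \<infinity>" using u unfolding energy_space_def by blast
    finally show "(\<integral>\<^sup>+s. ennreal (norm (indicator A s * enn2real (seminorm_sq s u))) \<partial>M) < \<infinity>" .
  qed
  have int: "integrable M (\<lambda>s. indicator A s *\<^sub>R form_s s u v)" if u: "u \<in> energy_space M A" and v: "v \<in> energy_space M A" for u v :: "'a \<Rightarrow> real"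
  proof (rule Bochner_Integration.integrable_bound)
    show "integrable M (\<lambda>s. indicator A s * enn2real (seminorm_sq s u) + indicator A s * enn2real (seminorm_sq s v))"
      by (intro Bochner_Integration.integrable_add diag u v)
    show "(\<lambda>s. indicator A s *\<^sub>R form_s s u v) \<in> borel_measurable M"
      by (intro borel_measurable_scaleR borel_measurable_indicator A fm(1) meas u v)
    show "AE s in M. norm (indicator A s *\<^sub>R form_s s u v) \<le> norm (indicator A s * enn2real (seminorm_sq s u) + indicator A s * enn2real (seminorm_sq s v))"
      using ae[OF u] ae[OF v] inS
    proof eventually_elim
      case (elim s)
      show ?case
      proof (cases "s \<in> A")
        case True
        then have fe: "u \<in> finite_energy s" "v \<in> finite_energy s" using elim by auto
        have s: "0 \<le> s" "s \<le> 1" using elim by auto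
        interpret semi_inner "finite_energy s" "form_s s :: ('a \<Rightarrow> real) \<Rightarrow> _" by (rule form_s_semi_inner(1)[OF s])
        have e: "enn2real (seminorm_sq s u) = form_s s u u" "enn2real (seminorm_sq s v) = form_s s v v"
          using form_s_semi_inner(2)[OF s fe(1)] form_s_semi_inner(2)[OF s fe(2)] nonneg[OF fe(1)] nonneg[OF fe(2)]
          by (auto simp flip: form_s_semi_inner(2)[OF s fe(1)] form_s_semi_inner(2)[OF s fe(2)])
        have "\<bar>form_s s u v\<bar> \<le> sqrt (form_s s u u) * sqrt (form_s s v v)" by (rule abs_le[OF fe])
        also have "\<dots> \<le> form_s s u u + form_s s v v"
        proof -
          have "2 * sqrt (form_s s u u) * sqrt (form_s s v v) \<le> form_s s u u + form_s s v v"
            using sum_squares_bound[of "sqrt (form_s s u u)" "sqrt (form_s s v v)"] nonneg[OF fe(1)] nonneg[OF fe(2)] by simp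
          moreover have "0 \<le> sqrt (form_s s u u) * sqrt (form_s s v v)" using nonneg[OF fe(1)] nonneg[OF fe(2)] by simp
          ultimately show ?thesis by linarith
        qed
        finally show ?thesis using True e by simp
      qed simp
    qed
  qed
  have bil: "AE s in M. s \<in> A \<longrightarrow> form_s s (u + v) w = form_s s u w + form_s s v w"
    if "u \<in> energy_space M A" "v \<in> energy_space M A" "w \<in> energy_space M A" for u v w :: "'a \<Rightarrow> real"
    using ae[OF that(1)] ae[OF that(2)] ae[OF that(3)] inS
    by eventually_elim (auto intro!: semi_inner.add[OF form_s_semi_inner(1)])
  have bil_scale: "AE s in M. s \<in> A \<longrightarrow> form_s s (c *\<^sub>R u) w = c * form_s s u w"
    if "u \<in> energy_space M A" "w \<in> energy_space M A" for c and u w :: "'a \<Rightarrow> real"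
    using ae[OF that(1)] ae[OF that(2)] inS
    by eventually_elim (auto intro!: semi_inner.scale[OF form_s_semi_inner(1)])
  have sn: "AE s in M. s \<in> A \<longrightarrow> ennreal (form_s s u u) = seminorm_sq s u \<and> 0 \<le> form_s s u u"
    if "u \<in> energy_space M A" for u :: "'a \<Rightarrow> real"
    using ae[OF that] inS
    by eventually_elim (auto intro!: form_s_semi_inner(2) semi_inner.nonneg[OF form_s_semi_inner(1)])
  have sub: "subspace (energy_space M A :: ('a \<Rightarrow> real) set)"
  proof (rule subspaceI)
    note sm = subspace_measurable[of "lebesgue :: 'a measure"]
    have sq_le: "seminorm_sq s (u + v) \<le> 2 * seminorm_sq s u + 2 * seminorm_sq s v"
      if s: "0 \<le> s" "s \<le> 1" and u: "u \<in> finite_energy s" and v: "v \<in> finite_energy s" for s and u v :: "'a \<Rightarrow> real"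
    proof -
      interpret semi_inner "finite_energy s" "form_s s :: ('a \<Rightarrow> real) \<Rightarrow> _" by (rule form_s_semi_inner(1)[OF s])
      have "seminorm_sq s (u + v) = ennreal (form_s s (u + v) (u + v))"
        using form_s_semi_inner(2)[OF s subspace_add[OF V u v]] by (rule HOL.sym)
      also have "\<dots> \<le> ennreal (2 * form_s s u u + 2 * form_s s v v)" by (intro ennreal_leI sq_add_le u v)
      also have "\<dots> = 2 * seminorm_sq s u + 2 * seminorm_sq s v"
        using form_s_semi_inner(2)[OF s u] form_s_semi_inner(2)[OF s v] nonneg[OF u] nonneg[OF v]
        by (simp add: ennreal_plus ennreal_mult)
      finally show ?thesis .
    qed
    show "u + v \<in> energy_space M A" if u: "u \<in> energy_space M A" and v: "v \<in> energy_space M A" for u v :: "'a \<Rightarrow> real"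
    proof -
      have "(\<integral>\<^sup>+s. indicator A s * seminorm_sq s (u + v) \<partial>M) \<le> (\<integral>\<^sup>+s. 2 * (indicator A s * seminorm_sq s u) + 2 * (indicator A s * seminorm_sq s v) \<partial>M)"
      proof (rule nn_integral_mono_AE)
        show "AE s in M. indicator A s * seminorm_sq s (u + v) \<le> 2 * (indicator A s * seminorm_sq s u) + 2 * (indicator A s * seminorm_sq s v)"
          using ae[OF u] ae[OF v] inS by eventually_elim (auto simp: indicator_def intro: sq_le)
      qed
      also have "\<dots> = 2 * (\<integral>\<^sup>+s. indicator A s * seminorm_sq s u \<partial>M) + 2 * (\<integral>\<^sup>+s. indicator A s * seminorm_sq s v \<partial>M)"
        using ind_meas[OF meas[OF u]] ind_meas[OF meas[OF v]]
        by (subst nn_integral_add) (auto simp: nn_integral_cmult)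
      also have "\<dots> < \<infinity>" using u v unfolding energy_space_def by (auto simp: ennreal_mult_less_top)
      finally show ?thesis using subspace_add[OF sm meas[OF u] meas[OF v]] unfolding energy_space_def by blast
    qed
    show "c *\<^sub>R u \<in> energy_space M A" if u: "u \<in> energy_space M A" for c and u :: "'a \<Rightarrow> real"
    proof -
      have sc: "seminorm_sq s (c *\<^sub>R u) = ennreal (c\<^sup>2) * seminorm_sq s u"
        if s: "0 \<le> s" "s \<le> 1" and u: "u \<in> finite_energy s" for s and u :: "'a \<Rightarrow> real"
      proof -
        interpret semi_inner "finite_energy s" "form_s s :: ('a \<Rightarrow> real) \<Rightarrow> _" by (rule form_s_semi_inner(1)[OF s])
        have "seminorm_sq s (c *\<^sub>R u) = ennreal (form_s s (c *\<^sub>R u) (c *\<^sub>R u))"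
          using form_s_semi_inner(2)[OF s subspace_scale[OF V u]] by (rule HOL.sym)
        also have "form_s s (c *\<^sub>R u) (c *\<^sub>R u) = c\<^sup>2 * form_s s u u"
          using u by (simp add: scale scale_right power2_eq_square)
        also have "ennreal (c\<^sup>2 * form_s s u u) = ennreal (c\<^sup>2) * seminorm_sq s u"
          unfolding form_s_semi_inner(2)[OF s u, symmetric] by (rule ennreal_mult') simp
        finally show ?thesis .
      qed
      have "(\<integral>\<^sup>+s. indicator A s * seminorm_sq s (c *\<^sub>R u) \<partial>M) = (\<integral>\<^sup>+s. ennreal (c\<^sup>2) * (indicator A s * seminorm_sq s u) \<partial>M)"
      proof (rule nn_integral_cong_AE)
        show "AE s in M. indicator A s * seminorm_sq s (c *\<^sub>R u) = ennreal (c\<^sup>2) * (indicator A s * seminorm_sq s u)"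
          using ae[OF u] inS by eventually_elim (auto simp: indicator_def sc)
      qed
      also have "\<dots> = ennreal (c\<^sup>2) * (\<integral>\<^sup>+s. indicator A s * seminorm_sq s u \<partial>M)"
        using ind_meas[OF meas[OF u]] by (rule nn_integral_cmult)
      also have "\<dots> < \<infinity>" using u unfolding energy_space_def by (auto simp: ennreal_mult_less_top)
      finally show ?thesis using subspace_scale[OF sm meas[OF u]] unfolding energy_space_def by blast
    qed
    have "seminorm_sq s (0 :: 'a \<Rightarrow> real) = 0" if "s \<in> {0..1}" for s
    proof -
      have "seminorm_sq s (0 :: 'a \<Rightarrow> real) = ennreal (form_s s (0 :: 'a \<Rightarrow> real) 0)"
        using form_s_semi_inner(2)[of s "0 :: 'a \<Rightarrow> real"] semi_inner.closed(4)[OF form_s_semi_inner(1)[of s, where 'a='a]] that by auto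
      also have "form_s s (0 :: 'a \<Rightarrow> real) 0 = 0" 
        using semi_inner.scale[OF form_s_semi_inner(1)[of s, where 'a='a], of 0 0 0] semi_inner.closed(4)[OF form_s_semi_inner(1)[of s, where 'a='a]] that by auto
      finally show ?thesis unfolding ennreal_0 .
    qed
    then have "(\<integral>\<^sup>+s. indicator A s * seminorm_sq s (0 :: 'a \<Rightarrow> real) \<partial>M) = (\<integral>\<^sup>+s. 0 \<partial>M)"
      by (intro nn_integral_cong) (simp only: space mult_zero_right)
    then have "(\<integral>\<^sup>+s. indicator A s * seminorm_sq s (0 :: 'a \<Rightarrow> real) \<partial>M) < \<infinity>"
      unfolding nn_integral_const by (simp only: mult_zero_left ennreal_zero_less_top infinity_ennreal_def)
    then show "(0 :: 'a \<Rightarrow> real) \<in> energy_space M A" using subspace_0[OF sm] unfolding energy_space_def by blast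
  qed
  show "semi_inner (energy_space M A) (\<lambda>u v :: 'a \<Rightarrow> real. LINT s:A|M. form_s s u v)"
    unfolding set_lebesgue_integral_def
  proof
    show "subspace (energy_space M A :: ('a \<Rightarrow> real) set)" by (rule sub)
    fix u v w :: "'a \<Rightarrow> real" and c :: real
    show "(LINT s|M. indicator A s *\<^sub>R form_s s u v) = (LINT s|M. indicator A s *\<^sub>R form_s s v u)" if u: "u \<in> energy_space M A" and v: "v \<in> energy_space M A"
    proof (rule integral_cong_AE)
      show "AE s in M. indicator A s *\<^sub>R form_s s u v = indicator A s *\<^sub>R form_s s v u"
        using ae[OF u] ae[OF v] inS
        by eventually_elim (auto simp: indicator_def intro!: semi_inner.sym[OF form_s_semi_inner(1)])
    qed (intro borel_measurable_integrable int u v)+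
    show "(LINT s|M. indicator A s *\<^sub>R form_s s (u + v) w) = (LINT s|M. indicator A s *\<^sub>R form_s s u w) + (LINT s|M. indicator A s *\<^sub>R form_s s v w)"
      if u: "u \<in> energy_space M A" and v: "v \<in> energy_space M A" and w: "w \<in> energy_space M A"
    proof -
      have "(LINT s|M. indicator A s *\<^sub>R form_s s (u + v) w) = (LINT s|M. indicator A s *\<^sub>R form_s s u w + indicator A s *\<^sub>R form_s s v w)"
      proof (rule integral_cong_AE)
        show "AE s in M. indicator A s *\<^sub>R form_s s (u + v) w = indicator A s *\<^sub>R form_s s u w + indicator A s *\<^sub>R form_s s v w"
          using bil[OF u v w] by eventually_elim (auto simp: indicator_def)
      qed (intro borel_measurable_integrable int u v w subspace_add[OF sub] Bochner_Integration.integrable_add)+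
      also have "\<dots> = (LINT s|M. indicator A s *\<^sub>R form_s s u w) + (LINT s|M. indicator A s *\<^sub>R form_s s v w)"
        by (intro Bochner_Integration.integral_add int u v w)
      finally show ?thesis .
    qed
    show "(LINT s|M. indicator A s *\<^sub>R form_s s (c *\<^sub>R u) w) = c * (LINT s|M. indicator A s *\<^sub>R form_s s u w)"
      if u: "u \<in> energy_space M A" and w: "w \<in> energy_space M A"
    proof -
      have "(LINT s|M. indicator A s *\<^sub>R form_s s (c *\<^sub>R u) w) = (LINT s|M. c * (indicator A s *\<^sub>R form_s s u w))"
      proof (rule integral_cong_AE)
        show "AE s in M. indicator A s *\<^sub>R form_s s (c *\<^sub>R u) w = c * (indicator A s *\<^sub>R form_s s u w)"
          using bil_scale[OF u w] by eventually_elim (auto simp: indicator_def)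
      qed (intro borel_measurable_integrable int u w subspace_scale[OF sub] integrable_mult_right)+
      then show ?thesis by (simp only: integral_mult_right_zero)
    qed
    show "0 \<le> (LINT s|M. indicator A s *\<^sub>R form_s s u u)" if u: "u \<in> energy_space M A"
    proof (rule integral_nonneg_AE)
      show "AE s in M. 0 \<le> indicator A s *\<^sub>R form_s s u u"
        using sn[OF u] by eventually_elim (auto simp: indicator_def)
    qed
  qed
  show "ennreal (LINT s:A|M. form_s s w w) = (\<integral>\<^sup>+s. indicator A s * seminorm_sq s w \<partial>M)" if w: "w \<in> energy_space M A"
  proof -
    have "(\<integral>\<^sup>+s. indicator A s * seminorm_sq s w \<partial>M) = (\<integral>\<^sup>+s. ennreal (indicator A s *\<^sub>R form_s s w w) \<partial>M)"
    proof (rule nn_integral_cong_AE)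
      show "AE s in M. indicator A s * seminorm_sq s w = ennreal (indicator A s *\<^sub>R form_s s w w)"
        using sn[OF w] by eventually_elim (auto simp: indicator_def)
    qed
    also have "\<dots> = ennreal (LINT s|M. indicator A s *\<^sub>R form_s s w w)"
    proof (rule nn_integral_eq_integral[OF int[OF w w]])
      show "AE s in M. 0 \<le> indicator A s *\<^sub>R form_s s w w"
        using sn[OF w] by eventually_elim (auto simp: indicator_def)
    qed
    finally show ?thesis unfolding set_lebesgue_integral_def by (rule sym)
  qed
qed

section \<open>The energy form of the mixed operator\<close>

text \<open>The constant \<open>C\<close> is the one of the comparison of seminorms, and \<open>s0\<close> is
  \<open>s\<^sub>\<sharp>\<close>.\<close>

locale mixed_order =
  fixes \<Omega> :: "'a::euclidean_space set" and \<mu>p \<mu>m :: "real measure" and sbar s0 C \<gamma> :: real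
  assumes \<Omega>: "open \<Omega>" "bounded \<Omega>"
    and C_pos: "0 < C"
    and comparison: "\<And>s t u. \<lbrakk>0 \<le> s; s \<le> t; t \<le> 1; u \<in> borel_measurable lebesgue; AE x in lebesgue. x \<notin> \<Omega> \<longrightarrow> u x = 0\<rbrakk>
        \<Longrightarrow> seminorm_sq s u \<le> ennreal C * seminorm_sq t u"
    and s0: "0 < s0" "s0 \<le> 1" and sbar: "0 < sbar" "sbar \<le> s0"
    and \<mu>p: "finite_borel_measure_01 \<mu>p" and \<mu>m: "finite_borel_measure_01 \<mu>m"
    and \<mu>p_s0: "0 < measure \<mu>p {s0..1}" and \<mu>m_high: "measure \<mu>m {sbar..1} = 0"
    and \<mu>m_low: "measure \<mu>m {0..sbar} \<le> \<gamma> * measure \<mu>p {sbar..1}"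
    and \<gamma>: "C * \<gamma> \<le> 1 / 2"
begin

abbreviation "X \<equiv> X0 \<mu>p \<Omega>"
abbreviation "Q \<equiv> form_plus \<mu>p"
abbreviation "R \<equiv> form_minus \<mu>m sbar"

lemmas \<mu>pD = finite_borel_measure_01D[OF \<mu>p]
lemmas \<mu>mD = finite_borel_measure_01D[OF \<mu>m]

lemma XD:
  assumes "u \<in> X"
  shows "u \<in> borel_measurable lebesgue" "AE x in lebesgue. x \<notin> \<Omega> \<longrightarrow> u x = 0" "(\<integral>\<^sup>+s. seminorm_sq s u \<partial>\<mu>p) < \<infinity>"
  using assms by (auto simp: X0_def)

lemma whole_interval: "(\<integral>\<^sup>+s. indicator {0..1} s * seminorm_sq s u \<partial>\<mu>p) = (\<integral>\<^sup>+s. seminorm_sq s u \<partial>\<mu>p)"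
  by (rule nn_integral_cong) (simp add: \<mu>pD(3))

lemma X_eq: "X = energy_space \<mu>p {0..1} \<inter> {u. AE x in lebesgue. x \<notin> \<Omega> \<longrightarrow> u x = 0}"
  unfolding X0_def energy_space_def whole_interval by blast

lemma semi_inner_subspace:
  assumes "semi_inner V F" "subspace W" "W \<subseteq> V"
  shows "semi_inner W F"
proof -
  interpret semi_inner V F by fact
  show ?thesis
    by standard (use assms(2,3) in \<open>auto intro: sym add scale nonneg\<close>)
qed

lemma subspace_supported: "subspace {u :: 'a \<Rightarrow> real. AE x in lebesgue. x \<notin> \<Omega> \<longrightarrow> u x = 0}"
proof (rule subspaceI)
  show "0 \<in> {u :: 'a \<Rightarrow> real. AE x in lebesgue. x \<notin> \<Omega> \<longrightarrow> u x = 0}" by simp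
  fix u v :: "'a \<Rightarrow> real" and c :: real
  assume u: "u \<in> {u. AE x in lebesgue. x \<notin> \<Omega> \<longrightarrow> u x = 0}"
  then have u': "AE x in lebesgue. x \<notin> \<Omega> \<longrightarrow> u x = 0" by blast
  have "AE x in lebesgue. x \<notin> \<Omega> \<longrightarrow> (c *\<^sub>R u) x = 0" using u' by eventually_elim simp
  then show "c *\<^sub>R u \<in> {u. AE x in lebesgue. x \<notin> \<Omega> \<longrightarrow> u x = 0}" by blast
  assume "v \<in> {u. AE x in lebesgue. x \<notin> \<Omega> \<longrightarrow> u x = 0}"
  then have "AE x in lebesgue. x \<notin> \<Omega> \<longrightarrow> v x = 0" by blast
  with u' have "AE x in lebesgue. x \<notin> \<Omega> \<longrightarrow> (u + v) x = 0" by eventually_elim simp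
  then show "u + v \<in> {u. AE x in lebesgue. x \<notin> \<Omega> \<longrightarrow> u x = 0}" by blast
qed

lemma Q_eq: "Q = (\<lambda>u v. LINT s:{0..1}|\<mu>p. form_s s u v)"
  unfolding form_plus_def set_lebesgue_integral_def
  by (intro ext Bochner_Integration.integral_cong) (auto simp: \<mu>pD(3))

lemma semi_inner_Q: "semi_inner X Q"
proof -
  note F = integrated_form(1)[OF \<mu>pD(2) \<mu>pD(4)[of 0 1], where 'a='a]
  have "subspace X" unfolding X_eq
    by (intro subspace_inter subspace_supported semi_inner.V[OF F]) auto
  then show ?thesis unfolding Q_eq by (rule semi_inner_subspace[OF F, rotated 2]) (auto simp: X_eq)
qed

lemma Q_energy: "u \<in> X \<Longrightarrow> ennreal (Q u u) = (\<integral>\<^sup>+s. seminorm_sq s u \<partial>\<mu>p)"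
  unfolding Q_eq whole_interval[symmetric]
  by (rule integrated_form(2)[OF \<mu>pD(2) \<mu>pD(4)]) (auto simp: X_eq)

sublocale Q: semi_inner X Q by (rule semi_inner_Q)

text \<open>A bound by all seminorms of orders in \<open>{a..1}\<close> is a bound by their mean.\<close>

lemma le_energy:
  assumes u: "u \<in> X" and a: "0 \<le> a" and Y: "\<And>t. a \<le> t \<Longrightarrow> t \<le> 1 \<Longrightarrow> Y \<le> ennreal C * seminorm_sq t u"
  shows "Y * ennreal (measure \<mu>p {a..1}) \<le> ennreal (C * Q u u)"
proof -
  interpret finite_measure \<mu>p by (rule \<mu>pD(1))
  have m: "{a..1} \<in> sets \<mu>p" using \<mu>pD(4)[of a 1] a by simp
  have "Y * ennreal (measure \<mu>p {a..1}) = (\<integral>\<^sup>+s. Y * indicator {a..1} s \<partial>\<mu>p)"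
    using m by (simp add: nn_integral_cmult_indicator emeasure_eq_measure)
  also have "\<dots> \<le> (\<integral>\<^sup>+s. ennreal C * seminorm_sq s u \<partial>\<mu>p)"
    by (intro nn_integral_mono) (auto simp: indicator_def intro: Y)
  also have "\<dots> = ennreal C * (\<integral>\<^sup>+s. seminorm_sq s u \<partial>\<mu>p)"
    by (rule nn_integral_cmult) (rule form_s_measurable(2)[OF \<mu>pD(2) XD(1)[OF u] XD(1)[OF u]])
  also have "\<dots> = ennreal (C * Q u u)"
    using C_pos Q.nonneg[OF u] by (simp add: Q_energy[OF u, symmetric] ennreal_mult)
  finally show ?thesis .
qed

text \<open>The orders below \<open>sbar\<close> are dominated by those above it, at the price of the constant
  \<open>C\<close>; the ratio of the masses is at most \<open>\<gamma>\<close>, and \<open>C *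
  \<gamma> \<le> 1 / 2\<close>.\<close>

lemma R_energy_le:
  assumes u: "u \<in> X"
  shows "(\<integral>\<^sup>+s. indicator {0..sbar} s * seminorm_sq s u \<partial>\<mu>m) \<le> ennreal (Q u u / 2)"
proof -
  interpret p: finite_measure \<mu>p by (rule \<mu>pD(1))
  interpret m: finite_measure \<mu>m by (rule \<mu>mD(1))
  have sets: "{0..sbar} \<in> sets \<mu>m" "{sbar..1} \<in> sets \<mu>m" "{sbar..1} \<in> sets \<mu>p"
    using \<mu>mD(4)[of 0 sbar] \<mu>mD(4)[of sbar 1] \<mu>pD(4)[of sbar 1] s0 sbar by auto
  define a where "a = measure \<mu>p {sbar..1}"
  have "measure \<mu>p {s0..1} \<le> a" unfolding a_def using sets sbar by (intro p.finite_measure_mono) auto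
  then have a: "0 < a" using \<mu>p_s0 by simp
  define Y where "Y = ennreal (C * Q u u / a)"
  have le: "seminorm_sq s u \<le> Y" if s: "0 \<le> s" "s \<le> sbar" for s
  proof -
    have "seminorm_sq s u * ennreal a \<le> ennreal (C * Q u u)"
      unfolding a_def by (rule le_energy[OF u]) (use s sbar in \<open>auto intro!: comparison XD[OF u]\<close>)
    then have "ennreal a * seminorm_sq s u \<le> ennreal (C * Q u u)" by (simp only: mult.commute)
    from ennreal_mult_ge[OF this a] show ?thesis
      using C_pos Q.nonneg[OF u] a unfolding Y_def by (simp flip: ennreal_mult)
  qed
  have "(\<integral>\<^sup>+s. indicator {0..sbar} s * seminorm_sq s u \<partial>\<mu>m) \<le> (\<integral>\<^sup>+s. Y * indicator {0..sbar} s \<partial>\<mu>m)"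
    by (intro nn_integral_mono) (auto simp: indicator_def intro: le)
  also have "\<dots> = Y * ennreal (measure \<mu>m {0..sbar})"
    using sets by (simp add: nn_integral_cmult_indicator m.emeasure_eq_measure)
  also have "\<dots> = ennreal (C * Q u u / a * measure \<mu>m {0..sbar})"
    using C_pos Q.nonneg[OF u] a unfolding Y_def by (simp flip: ennreal_mult)
  also have "\<dots> \<le> ennreal (Q u u / 2)"
  proof (rule ennreal_leI)
    have "C * Q u u / a * measure \<mu>m {0..sbar} \<le> C * Q u u / a * (\<gamma> * a)"
      using C_pos Q.nonneg[OF u] a \<mu>m_low unfolding a_def by (intro mult_left_mono) auto
    also have "\<dots> = (C * \<gamma>) * Q u u" using a by simp
    also have "\<dots> \<le> 1 / 2 * Q u u" using \<gamma> Q.nonneg[OF u] by (intro mult_right_mono) auto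
    finally show "C * Q u u / a * measure \<mu>m {0..sbar} \<le> Q u u / 2" by simp
  qed
  finally show ?thesis .
qed

lemma R_facts: "semi_inner X R" "u \<in> X \<Longrightarrow> R u u \<le> Q u u / 2"
proof -
  have sb: "{0..sbar} \<in> sets \<mu>m" using \<mu>mD(4)[of 0 sbar] s0 sbar by simp
  have sub: "X \<subseteq> energy_space \<mu>m {0..sbar}"
  proof
    fix u assume u: "u \<in> X"
    have "(\<integral>\<^sup>+s. indicator {0..sbar} s * seminorm_sq s u \<partial>\<mu>m) < \<infinity>"
      by (rule le_less_trans[OF R_energy_le[OF u]]) simp
    then show "u \<in> energy_space \<mu>m {0..sbar}" using XD(1)[OF u] unfolding energy_space_def by blast
  qed
  have R_eq: "R = (\<lambda>u v. LINT s:{0..sbar}|\<mu>m. form_s s u v)" by (intro ext) (simp add: form_minus_def)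
  note F = integrated_form[OF \<mu>mD(2) sb, where 'a='a]
  show "semi_inner X R" unfolding R_eq by (rule semi_inner_subspace[OF F(1) Q.V sub])
  show "R u u \<le> Q u u / 2" if u: "u \<in> X"
  proof -
    have "ennreal (R u u) \<le> ennreal (Q u u / 2)"
      unfolding R_eq using F(2)[of u] R_energy_le[OF u] sub u by auto
    then show ?thesis using Q.nonneg[OF u] by (subst (asm) ennreal_le_iff) auto
  qed
qed

sublocale R: semi_inner X R by (rule R_facts(1))

definition B :: "('a \<Rightarrow> real) \<Rightarrow> ('a \<Rightarrow> real) \<Rightarrow> real" where "B u v = Q u v - R u v"

lemma B_le: "u \<in> X \<Longrightarrow> B u u \<le> Q u u" using R.nonneg by (simp add: B_def)
lemma B_ge: "u \<in> X \<Longrightarrow> Q u u \<le> 2 * B u u" using R_facts(2)[of u] by (simp add: B_def)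

sublocale B: semi_inner X B
proof
  show "subspace X" by (rule Q.V)
  show "B u v = B v u" if "u \<in> X" "v \<in> X" for u v
    unfolding B_def using Q.sym[OF that] R.sym[OF that] by simp
  show "B (u + v) w = B u w + B v w" if "u \<in> X" "v \<in> X" "w \<in> X" for u v w
    unfolding B_def using Q.add[OF that] R.add[OF that] by simp
  show "B (c *\<^sub>R u) w = c * B u w" if "u \<in> X" "w \<in> X" for u w c
    unfolding B_def using Q.scale[OF that, of c] R.scale[OF that, of c] by (simp add: right_diff_distrib)
  show "0 \<le> B u u" if "u \<in> X" for u using B_ge[OF that] Q.nonneg[OF that] by linarith
qed

definition K :: real where "K = 2 * C / measure \<mu>p {s0..1}"

lemma K_pos: "0 < K" using C_pos \<mu>p_s0 by (simp add: K_def)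

text \<open>The mass of \<open>\<mu>p\<close> on \<open>{s0..1}\<close> makes the form control every seminorm
  of order up to \<open>s0\<close>. This is the only quantity through which \<open>\<mu>p\<close>
  enters the compactness argument.\<close>

lemma low_seminorm_le:
  assumes u: "u \<in> X" and s: "0 \<le> s" "s \<le> s0"
  shows "seminorm_sq s u \<le> ennreal (K * B u u)"
proof -
  have "seminorm_sq s u * ennreal (measure \<mu>p {s0..1}) \<le> ennreal (C * Q u u)"
    by (rule le_energy[OF u]) (use s s0 in \<open>auto intro!: comparison XD[OF u]\<close>)
  then have "ennreal (measure \<mu>p {s0..1}) * seminorm_sq s u \<le> ennreal (C * Q u u)" by (simp only: mult.commute)
  from ennreal_mult_ge[OF this \<mu>p_s0]
  have "seminorm_sq s u \<le> ennreal (1 / measure \<mu>p {s0..1} * (C * Q u u))"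
    using C_pos Q.nonneg[OF u] \<mu>p_s0 by (subst ennreal_mult) auto
  also have "\<dots> \<le> ennreal (1 / measure \<mu>p {s0..1} * (C * (2 * B u u)))"
    using C_pos B_ge[OF u] \<mu>p_s0 by (intro ennreal_leI mult_left_mono) auto
  also have "1 / measure \<mu>p {s0..1} * (C * (2 * B u u)) = K * B u u" unfolding K_def by simp
  finally show ?thesis .
qed

definition L2 :: "('a \<Rightarrow> real) set" where
  "L2 = {g. (\<lambda>x. indicator \<Omega> x *\<^sub>R g x) \<in> borel_measurable lebesgue \<and>
     (\<integral>\<^sup>+x. ennreal ((norm (indicator \<Omega> x *\<^sub>R g x))\<^sup>2) \<partial>lebesgue) < \<infinity>}"

definition ip :: "('a \<Rightarrow> real) \<Rightarrow> ('a \<Rightarrow> real) \<Rightarrow> real" where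
  "ip g v = (LINT x:\<Omega>|lebesgue. g x * v x)"

lemma L2_facts: "semi_inner L2 ip" 
  "g \<in> L2 \<Longrightarrow> ennreal (ip g g) = (\<integral>\<^sup>+x. ennreal ((norm (indicator \<Omega> x *\<^sub>R g x))\<^sup>2) \<partial>lebesgue)"
proof -
  define T where "T g x = indicat_real \<Omega> x *\<^sub>R g x" for g :: "'a \<Rightarrow> real" and x
  define W where "W = {g. T g \<in> borel_measurable lebesgue}"
  have T_add: "T (u + v) = (\<lambda>x. T u x + T v x)" and T_scale: "T (c *\<^sub>R u) = (\<lambda>x. c *\<^sub>R T u x)" for u v c
    by (auto simp: T_def fun_eq_iff algebra_simps)
  have W: "subspace W"
  proof (rule subspaceI)
    have "T 0 = (\<lambda>x. 0)" by (simp add: T_def fun_eq_iff)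
    then show "0 \<in> W" unfolding W_def mem_Collect_eq by (simp only: borel_measurable_const)
    show "u + v \<in> W" if "u \<in> W" "v \<in> W" for u v using that unfolding W_def mem_Collect_eq T_add by (rule borel_measurable_add)
    show "c *\<^sub>R u \<in> W" if "u \<in> W" for u c
      using that unfolding W_def mem_Collect_eq T_scale by (intro borel_measurable_scaleR borel_measurable_const)
  qed
  have V: "{u \<in> W. (\<integral>\<^sup>+x. ennreal ((norm (T u x))\<^sup>2) \<partial>lebesgue) < \<infinity>} = L2"
    unfolding W_def L2_def T_def[abs_def] by blast
  have ip: "ip = (\<lambda>u v. LINT x|lebesgue. T u x \<bullet> T v x)"
    unfolding ip_def set_lebesgue_integral_def
    by (intro ext Bochner_Integration.integral_cong) (auto simp: T_def indicator_def)
  note L = L2_pullback[where T=T and W=W and M="lebesgue :: 'a measure", OF W, unfolded V]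
  show "semi_inner L2 ip" unfolding ip by (rule L(1)) (auto simp: W_def T_add T_scale)
  show "ennreal (ip g g) = (\<integral>\<^sup>+x. ennreal ((norm (indicator \<Omega> x *\<^sub>R g x))\<^sup>2) \<partial>lebesgue)" if "g \<in> L2"
    unfolding ip T_def[symmetric] by (rule L(2)) (use that in \<open>auto simp: W_def T_add T_scale\<close>)
qed

sublocale ip: semi_inner L2 ip by (rule L2_facts(1))

lemma L2_norm_X:
  assumes u: "u \<in> X"
  shows "(\<integral>\<^sup>+x. ennreal ((u x)\<^sup>2) \<partial>lebesgue) \<le> ennreal (K * B u u)"
  using low_seminorm_le[OF u, of 0] s0 by (simp add: seminorm_sq_def)

lemma ind_sq_eq:
  assumes u: "u \<in> X"
  shows "(\<integral>\<^sup>+x. ennreal ((norm (indicator \<Omega> x *\<^sub>R u x))\<^sup>2) \<partial>lebesgue) = (\<integral>\<^sup>+x. ennreal ((u x)\<^sup>2) \<partial>lebesgue)"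
proof (rule nn_integral_cong_AE)
  show "AE x in lebesgue. ennreal ((norm (indicator \<Omega> x *\<^sub>R u x))\<^sup>2) = ennreal ((u x)\<^sup>2)"
    using XD(2)[OF u] by eventually_elim (auto simp: indicator_def)
qed

lemma X_L2: "X \<subseteq> L2"
proof
  fix u assume u: "u \<in> X"
  have "(\<lambda>x. indicator \<Omega> x *\<^sub>R u x) \<in> borel_measurable lebesgue"
    by (intro borel_measurable_scaleR borel_measurable_indicator XD[OF u]) (use \<Omega> in auto)
  moreover have "(\<integral>\<^sup>+x. ennreal ((norm (indicator \<Omega> x *\<^sub>R u x))\<^sup>2) \<partial>lebesgue) < \<infinity>"
    unfolding ind_sq_eq[OF u] by (rule le_less_trans[OF L2_norm_X[OF u]]) simp
  ultimately show "u \<in> L2" unfolding L2_def by blast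
qed

lemma ip_X:
  assumes u: "u \<in> X"
  shows "ennreal (ip u u) = (\<integral>\<^sup>+x. ennreal ((u x)\<^sup>2) \<partial>lebesgue)" "ip u u \<le> K * B u u"
proof -
  show e: "ennreal (ip u u) = (\<integral>\<^sup>+x. ennreal ((u x)\<^sup>2) \<partial>lebesgue)"
    using L2_facts(2)[of u] X_L2 u ind_sq_eq[OF u] by auto
  have "ennreal (ip u u) \<le> ennreal (K * B u u)" unfolding e by (rule L2_norm_X[OF u])
  then show "ip u u \<le> K * B u u" using K_pos B.nonneg[OF u] by (subst (asm) ennreal_le_iff) auto
qed

lemma semi_inner_ip_X: "semi_inner X ip"
  by (rule semi_inner_subspace[OF L2_facts(1) Q.V X_L2])

end

section \<open>Averages over a cubic grid\<close>

text \<open>The corner with the smallest coordinates of the half-open grid cube of side \<open>e\<close> that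
  contains \<open>x\<close>; it serves as the name of this cube.\<close>

definition corner :: "real \<Rightarrow> 'a::euclidean_space \<Rightarrow> 'a" where
  "corner e x = (\<Sum>i\<in>Basis. (e * of_int \<lfloor>x \<bullet> i / e\<rfloor>) *\<^sub>R i)"

definition cube :: "real \<Rightarrow> 'a::euclidean_space \<Rightarrow> 'a set" where
  "cube e c = {y. corner e y = c}"

definition cube_integral :: "real \<Rightarrow> 'a::euclidean_space \<Rightarrow> ('a \<Rightarrow> real) \<Rightarrow> real" where
  "cube_integral e c u = (LINT y:cube e c|lebesgue. u y)"

definition cube_average :: "real \<Rightarrow> ('a::euclidean_space \<Rightarrow> real) \<Rightarrow> 'a \<Rightarrow> real" where
  "cube_average e u x = cube_integral e (corner e x) u / e ^ DIM('a)"

lemma corner_inner: "i \<in> Basis \<Longrightarrow> corner e x \<bullet> i = e * of_int \<lfloor>x \<bullet> i / e\<rfloor>"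
  by (simp add: corner_def inner_sum_left_Basis)

lemma corner_measurable: "corner e \<in> borel_measurable borel"
  unfolding corner_def by measurable

lemma cube_measurable [measurable]: "cube e (c::'a::euclidean_space) \<in> sets borel"
proof -
  have "corner e -` {c} \<inter> space borel \<in> sets borel" by (rule measurable_sets[OF corner_measurable]) simp
  also have "corner e -` {c} \<inter> space borel = cube e c" by (auto simp: cube_def)
  finally show ?thesis .
qed

lemma mem_cube_corner:
  assumes e: "0 < e"
  shows "y \<in> cube e (corner e x) \<longleftrightarrow> (\<forall>i\<in>Basis. corner e x \<bullet> i \<le> y \<bullet> i \<and> y \<bullet> i < corner e x \<bullet> i + e)"
proof -
  have "y \<in> cube e (corner e x) \<longleftrightarrow> (\<forall>i\<in>Basis. corner e y \<bullet> i = corner e x \<bullet> i)"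
    unfolding cube_def mem_Collect_eq by (rule euclidean_eq_iff)
  also have "\<dots> \<longleftrightarrow> (\<forall>i\<in>Basis. \<lfloor>y \<bullet> i / e\<rfloor> = \<lfloor>x \<bullet> i / e\<rfloor>)"
    using e by (intro ball_cong refl) (simp add: corner_inner)
  also have "\<dots> \<longleftrightarrow> (\<forall>i\<in>Basis. corner e x \<bullet> i \<le> y \<bullet> i \<and> y \<bullet> i < corner e x \<bullet> i + e)"
    using e by (intro ball_cong refl) (auto simp: corner_inner floor_eq_iff field_simps)
  finally show ?thesis .
qed

lemma cube_bounds:
  fixes x :: "'a::euclidean_space"
  assumes e: "0 < e"
  shows "box (corner e x) (corner e x + e *\<^sub>R One) \<subseteq> cube e (corner e x)"
    "cube e (corner e x) \<subseteq> cbox (corner e x) (corner e x + e *\<^sub>R One)"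
  unfolding subset_iff mem_cube_corner[OF e] mem_box
  by (auto simp: inner_add_left intro: less_imp_le)

lemma emeasure_cube:
  fixes x :: "'a::euclidean_space"
  assumes e: "0 < e"
  shows "emeasure lborel (cube e (corner e x)) = ennreal (e ^ DIM('a))"
proof (rule antisym)
  let ?c = "corner e x"
  have b: "?c \<bullet> i \<le> (?c + e *\<^sub>R One) \<bullet> i" "(?c + e *\<^sub>R One - ?c) \<bullet> i = e" if "i \<in> Basis" for i
    using that e by (auto simp: inner_add_left)
  have box: "emeasure lborel (box ?c (?c + e *\<^sub>R One)) = ennreal (e ^ DIM('a))"
    using b by (simp add: emeasure_lborel_box)
  have cbox: "emeasure lborel (cbox ?c (?c + e *\<^sub>R One)) = ennreal (e ^ DIM('a))"
    using b by (simp add: emeasure_lborel_cbox)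
  show "emeasure lborel (cube e ?c) \<le> ennreal (e ^ DIM('a))"
    unfolding cbox[symmetric] by (intro emeasure_mono cube_bounds e) simp
  show "ennreal (e ^ DIM('a)) \<le> emeasure lborel (cube e ?c)"
    unfolding box[symmetric] by (intro emeasure_mono cube_bounds e) simp
qed

lemma cube_diameter:
  fixes x y :: "'a::euclidean_space"
  assumes e: "0 < e" and "corner e x = corner e y"
  shows "norm (x - y) \<le> real DIM('a) * e"
proof -
  have "norm (x - y) \<le> (\<Sum>i\<in>Basis. \<bar>(x - y) \<bullet> i\<bar>)" by (rule norm_le_l1)
  also have "\<dots> \<le> (\<Sum>i\<in>(Basis::'a set). e)"
  proof (rule sum_mono)
    fix i :: 'a assume i: "i \<in> Basis"
    have "y \<in> cube e (corner e x)" "x \<in> cube e (corner e x)" using assms(2) by (auto simp: cube_def)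
    then show "\<bar>(x - y) \<bullet> i\<bar> \<le> e"
      unfolding mem_cube_corner[OF e] inner_diff_left using i by force
  qed
  finally show ?thesis by simp
qed

lemma finite_corners:
  fixes \<Omega> :: "'a::euclidean_space set"
  assumes "bounded \<Omega>" and e: "0 < e"
  shows "finite (corner e ` \<Omega>)"
proof -
  obtain r where r: "\<And>x. x \<in> \<Omega> \<Longrightarrow> norm x \<le> r" using assms(1) bounded_iff by blast
  define n where "n = \<lceil>r / e\<rceil> + 1"
  have "corner e ` \<Omega> \<subseteq> (\<lambda>k. \<Sum>i\<in>Basis. (e * of_int (k i)) *\<^sub>R i) ` (PiE Basis (\<lambda>_. {-n..n}))"
  proof
    fix c assume "c \<in> corner e ` \<Omega>"
    then obtain x where x: "x \<in> \<Omega>" "c = corner e x" by blast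
    define k where "k = restrict (\<lambda>i. \<lfloor>x \<bullet> i / e\<rfloor>) Basis"
    have "\<lfloor>x \<bullet> i / e\<rfloor> \<in> {-n..n}" if "i \<in> Basis" for i
    proof -
      have "\<bar>x \<bullet> i\<bar> \<le> r" using Basis_le_norm[OF that, of x] r[OF x(1)] by simp
      then have "\<bar>x \<bullet> i / e\<bar> \<le> r / e" using e by (simp add: divide_right_mono)
      moreover have "of_int \<lfloor>x \<bullet> i / e\<rfloor> \<le> x \<bullet> i / e" "x \<bullet> i / e < of_int \<lfloor>x \<bullet> i / e\<rfloor> + 1" "r / e \<le> of_int \<lceil>r / e\<rceil>"
        by linarith+
      ultimately have "of_int \<lfloor>x \<bullet> i / e\<rfloor> \<le> (of_int n :: real)" "(of_int (- n) :: real) \<le> of_int \<lfloor>x \<bullet> i / e\<rfloor>"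
        unfolding n_def of_int_add of_int_minus of_int_1 abs_le_iff by linarith+
      then show ?thesis unfolding of_int_le_iff by simp
    qed
    then have "k \<in> PiE Basis (\<lambda>_. {-n..n})" by (auto simp: k_def)
    moreover have "c = (\<Sum>i\<in>Basis. (e * of_int (k i)) *\<^sub>R i)" by (simp add: x(2) corner_def k_def)
    ultimately show "c \<in> (\<lambda>k. \<Sum>i\<in>Basis. (e * of_int (k i)) *\<^sub>R i) ` (PiE Basis (\<lambda>_. {-n..n}))" by blast
  qed
  moreover have "finite (PiE (Basis::'a set) (\<lambda>_. {-n..n}))" by (intro finite_PiE) auto
  ultimately show ?thesis using finite_subset by blast
qed

lemma cube_set_integrable:
  fixes u :: "'a::euclidean_space \<Rightarrow> real"
  assumes u: "u \<in> borel_measurable lebesgue" and fin: "(\<integral>\<^sup>+x. ennreal ((u x)\<^sup>2) \<partial>lebesgue) < \<infinity>" and e: "0 < e"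
  shows "set_integrable lebesgue (cube e (corner e x)) u"
proof -
  have "locally_integrable u" by (rule locally_integrable_L2[OF u]) (use fin in simp)
  then have "set_integrable lebesgue (cbox (corner e x) (corner e x + e *\<^sub>R One)) u"
    unfolding locally_integrable_def using compact_cbox by metis
  then show ?thesis by (rule set_integrable_subset[OF _ _ cube_bounds(2)[OF e]]) simp
qed

lemma ennreal_divide_square:
  assumes v: "0 < v" and le: "ennreal (v\<^sup>2 * D) \<le> ennreal v * I" and D: "0 \<le> D"
  shows "ennreal D \<le> ennreal (1 / v) * I"
proof -
  have "ennreal D = ennreal (1 / v\<^sup>2) * ennreal (v\<^sup>2 * D)"
    using v D by (subst ennreal_mult[symmetric]) auto
  also have "\<dots> \<le> ennreal (1 / v\<^sup>2) * (ennreal v * I)"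
    by (intro mult_left_mono le) simp
  also have "\<dots> = ennreal (1 / v\<^sup>2 * v) * I"
    using v by (subst ennreal_mult) (auto simp: mult.assoc)
  also have "1 / v\<^sup>2 * v = 1 / v" using v by (simp add: power2_eq_square)
  finally show ?thesis .
qed

text \<open>Jensen's inequality for the average over a cube.\<close>

lemma cube_mean_deviation:
  fixes u :: "'a::euclidean_space \<Rightarrow> real"
  assumes [measurable]: "u \<in> borel_measurable borel" and fin: "(\<integral>\<^sup>+x. ennreal ((u x)\<^sup>2) \<partial>lebesgue) < \<infinity>" and e: "0 < e"
  shows "ennreal ((a - cube_average e u x)\<^sup>2)
    \<le> ennreal (1 / e ^ DIM('a)) * (\<integral>\<^sup>+y. indicator (cube e (corner e x)) y * ennreal ((a - u y)\<^sup>2) \<partial>lborel)"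
proof -
  let ?Q = "cube e (corner e x)" and ?v = "e ^ DIM('a)"
  have v: "0 < ?v" using e by simp
  have ul: "u \<in> borel_measurable lebesgue" using assms(1) by (simp add: measurable_completion)
  have "integrable lebesgue (\<lambda>y. indicat_real ?Q y *\<^sub>R u y)"
    using cube_set_integrable[OF ul fin e] unfolding set_integrable_def .
  then have iu: "integrable lborel (\<lambda>y. indicat_real ?Q y * u y)"
    by (subst (asm) integrable_completion) auto
  have im: "integrable lborel (indicat_real ?Q)" using emeasure_cube[OF e, of x] by (intro integrable_real_indicator) auto
  have ia: "integrable lborel (\<lambda>y. indicat_real ?Q y * a)" by (intro integrable_mult_left im)
  have me: "measure lborel ?Q = ?v" using emeasure_cube[OF e, of x] v by (simp add: measure_def)
  have ci: "cube_integral e (corner e x) u = (LINT y|lborel. indicat_real ?Q y * u y)"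
    unfolding cube_integral_def set_lebesgue_integral_def by (subst integral_completion) auto
  have d1: "(LINT y|lborel. indicat_real ?Q y * (a - u y)) = (LINT y|lborel. indicat_real ?Q y * a) - (LINT y|lborel. indicat_real ?Q y * u y)"
    unfolding right_diff_distrib by (rule Bochner_Integration.integral_diff[OF ia iu])
  have d2: "(LINT y|lborel. indicat_real ?Q y * a) = ?v * a" by (simp add: me)
  have d3: "(LINT y|lborel. indicat_real ?Q y * u y) = ?v * cube_average e u x"
    unfolding cube_average_def ci times_divide_eq_right
    by (rule nonzero_mult_div_cancel_left[symmetric]) (rule less_imp_neq[OF v, symmetric])
  have d4: "(LINT y|lborel. indicat_real ?Q y * (a - u y)) = ?v * (a - cube_average e u x)"
    unfolding d1 d2 d3 by (rule right_diff_distrib[symmetric])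
  have eq: "?v * \<bar>a - cube_average e u x\<bar> = \<bar>LINT y|lborel. indicat_real ?Q y * (a - u y)\<bar>"
    unfolding d4 abs_mult abs_of_pos[OF v] ..
  have "integrable lborel (\<lambda>y. indicat_real ?Q y * (a - u y))"
    unfolding right_diff_distrib by (intro Bochner_Integration.integrable_diff ia iu)
  from integral_norm_bound_ennreal[OF this]
  have "ennreal (?v * \<bar>a - cube_average e u x\<bar>) \<le> (\<integral>\<^sup>+y. ennreal \<bar>indicat_real ?Q y * (a - u y)\<bar> \<partial>lborel)"
    unfolding eq real_norm_def .
  also have "\<dots> = (\<integral>\<^sup>+y. indicator ?Q y * (indicator ?Q y * ennreal \<bar>a - u y\<bar>) \<partial>lborel)"
    by (intro nn_integral_cong) (auto simp: indicator_def)
  finally have "(ennreal (?v * \<bar>a - cube_average e u x\<bar>))\<^sup>2 \<le> (\<integral>\<^sup>+y. indicator ?Q y * (indicator ?Q y * ennreal \<bar>a - u y\<bar>) \<partial>lborel)\<^sup>2"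
    by (rule power_mono) simp
  also have "\<dots> \<le> (\<integral>\<^sup>+y. (indicator ?Q y)\<^sup>2 \<partial>lborel) * (\<integral>\<^sup>+y. (indicator ?Q y * ennreal \<bar>a - u y\<bar>)\<^sup>2 \<partial>lborel)"
    by (rule Cauchy_Schwarz_nn_integral) measurable
  also have "(\<integral>\<^sup>+y. (indicator ?Q y :: ennreal)\<^sup>2 \<partial>lborel) = ennreal ?v"
  proof -
    have "(indicator ?Q y :: ennreal)\<^sup>2 = indicator ?Q y" for y by (simp add: indicator_def)
    then show ?thesis using emeasure_cube[OF e, of x] by simp
  qed
  also have "(\<integral>\<^sup>+y. (indicator ?Q y * ennreal \<bar>a - u y\<bar>)\<^sup>2 \<partial>lborel) = (\<integral>\<^sup>+y. indicator ?Q y * ennreal ((a - u y)\<^sup>2) \<partial>lborel)"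
    by (intro nn_integral_cong) (auto simp: indicator_def ennreal_power)
  finally have le: "ennreal (?v\<^sup>2 * (a - cube_average e u x)\<^sup>2) \<le> ennreal ?v * (\<integral>\<^sup>+y. indicator ?Q y * ennreal ((a - u y)\<^sup>2) \<partial>lborel)"
    using v by (simp add: ennreal_power power_mult_distrib)
  show ?thesis by (rule ennreal_divide_square[OF v le]) simp
qed

definition cube_error :: "nat \<Rightarrow> real \<Rightarrow> real \<Rightarrow> real" where
  "cube_error N s e = (real N * e) powr (real N + 2 * s) / (e ^ N * frac_const N s)"

lemma cube_average_error_Borel:
  fixes u :: "'a::euclidean_space \<Rightarrow> real"
  assumes [measurable]: "u \<in> borel_measurable borel" and fin: "(\<integral>\<^sup>+x. ennreal ((u x)\<^sup>2) \<partial>lebesgue) < \<infinity>" and e: "0 < e"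
    and s: "0 < s" "s < 1"
  shows "(\<integral>\<^sup>+x. ennreal ((u x - cube_average e u x)\<^sup>2) \<partial>lborel) \<le> ennreal (cube_error DIM('a) s e) * seminorm_sq s u"
proof -
  define v where "v = e ^ DIM('a)"
  let ?p = "real DIM('a) + 2 * s"
  define Z where "Z = (real DIM('a) * e) powr ?p"
  let ?k = "\<lambda>x y. ennreal ((u x - u y)\<^sup>2 / norm (x - y) powr ?p)"
  have v: "0 < v" using e unfolding v_def by simp
  have f: "0 < frac_const DIM('a) s" by (rule frac_const_pos[OF s]) simp
  have pt: "ennreal ((u x - cube_average e u x)\<^sup>2) \<le> ennreal (Z / v) * (\<integral>\<^sup>+y. ?k x y \<partial>lborel)" for x
  proof -
    have "indicator (cube e (corner e x)) y * ennreal ((u x - u y)\<^sup>2) \<le> ennreal Z * ?k x y" for y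
    proof (cases "y \<in> cube e (corner e x) \<and> x \<noteq> y")
      case True
      then have "norm (x - y) \<le> real DIM('a) * e" by (intro cube_diameter e) (auto simp: cube_def)
      then have "norm (x - y) powr ?p \<le> Z" unfolding Z_def using s by (intro powr_mono2) auto
      moreover have n: "0 < norm (x - y) powr ?p" using True by simp
      ultimately have "(u x - u y)\<^sup>2 / norm (x - y) powr ?p * norm (x - y) powr ?p \<le> (u x - u y)\<^sup>2 / norm (x - y) powr ?p * Z"
        by (intro mult_left_mono) auto
      then have "(u x - u y)\<^sup>2 \<le> Z * ((u x - u y)\<^sup>2 / norm (x - y) powr ?p)"
        using n by (simp add: mult.commute)
      then have "ennreal ((u x - u y)\<^sup>2) \<le> ennreal (Z * ((u x - u y)\<^sup>2 / norm (x - y) powr ?p))" by (rule ennreal_leI)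
      also have "\<dots> = ennreal Z * ?k x y" by (rule ennreal_mult) (auto simp: Z_def)
      finally show ?thesis using True by simp
    qed auto
    then have "(\<integral>\<^sup>+y. indicator (cube e (corner e x)) y * ennreal ((u x - u y)\<^sup>2) \<partial>lborel) \<le> (\<integral>\<^sup>+y. ennreal Z * ?k x y \<partial>lborel)"
      by (intro nn_integral_mono)
    also have "\<dots> = ennreal Z * (\<integral>\<^sup>+y. ?k x y \<partial>lborel)" by (rule nn_integral_cmult) measurable
    finally have "ennreal (1 / v) * (\<integral>\<^sup>+y. indicator (cube e (corner e x)) y * ennreal ((u x - u y)\<^sup>2) \<partial>lborel)
       \<le> ennreal (1 / v) * (ennreal Z * (\<integral>\<^sup>+y. ?k x y \<partial>lborel))" by (rule mult_left_mono) simp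
    also have "\<dots> = ennreal (1 / v * Z) * (\<integral>\<^sup>+y. ?k x y \<partial>lborel)"
      using v by (subst ennreal_mult) (auto simp: mult.assoc Z_def)
    finally have le: "ennreal (1 / v) * (\<integral>\<^sup>+y. indicator (cube e (corner e x)) y * ennreal ((u x - u y)\<^sup>2) \<partial>lborel)
       \<le> ennreal (1 / v * Z) * (\<integral>\<^sup>+y. ?k x y \<partial>lborel)" .
    have "1 / v * Z = Z / v" by simp
    then show ?thesis using order_trans[OF cube_mean_deviation[OF assms(1) fin e, of "u x" x, folded v_def] le] by (simp only:)
  qed
  have ss: "seminorm_sq s u = ennreal (frac_const DIM('a) s) * (\<integral>\<^sup>+x. \<integral>\<^sup>+y. ?k x y \<partial>lborel \<partial>lborel)"
  proof -
    have "u \<in> borel_measurable lebesgue" using assms(1) by (simp add: measurable_completion)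
    then have "seminorm_sq s u = ennreal (frac_const DIM('a) s) * (\<integral>\<^sup>+z. ?k (fst z) (snd z) \<partial>(lborel \<Otimes>\<^sub>M lborel))"
      by (rule seminorm_sq_borel[OF s assms(1)]) simp
    also have "(\<integral>\<^sup>+z. ?k (fst z) (snd z) \<partial>(lborel \<Otimes>\<^sub>M lborel)) = (\<integral>\<^sup>+x. \<integral>\<^sup>+y. ?k (fst (x, y)) (snd (x, y)) \<partial>lborel \<partial>lborel)"
      by (rule lborel.nn_integral_fst[symmetric]) measurable
    finally show ?thesis unfolding fst_conv snd_conv .
  qed
  have "(\<integral>\<^sup>+x. ennreal ((u x - cube_average e u x)\<^sup>2) \<partial>lborel) \<le> (\<integral>\<^sup>+x. ennreal (Z / v) * (\<integral>\<^sup>+y. ?k x y \<partial>lborel) \<partial>lborel)"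
    by (intro nn_integral_mono pt)
  also have "\<dots> = ennreal (Z / v) * (\<integral>\<^sup>+x. \<integral>\<^sup>+y. ?k x y \<partial>lborel \<partial>lborel)"
    by (rule nn_integral_cmult) measurable
  also have "\<dots> = ennreal (Z / v / frac_const DIM('a) s * frac_const DIM('a) s) * (\<integral>\<^sup>+x. \<integral>\<^sup>+y. ?k x y \<partial>lborel \<partial>lborel)"
  proof -
    have "Z / v / frac_const DIM('a) s * frac_const DIM('a) s = Z / v"
      using nonzero_eq_divide_eq[OF less_imp_neq[OF f, symmetric], of "Z / v / frac_const DIM('a) s" "Z / v"] by blast
    then show ?thesis by (rule ssubst) (rule refl)
  qed
  also have "\<dots> = ennreal (Z / v / frac_const DIM('a) s) * seminorm_sq s u"
    unfolding ss mult.assoc[symmetric] by (subst ennreal_mult''[OF less_imp_le[OF f]]) (rule refl)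
  finally show ?thesis unfolding cube_error_def Z_def[symmetric] v_def[symmetric] divide_divide_eq_left .
qed

text \<open>Two points of a cube have distance at most \<open>N e\<close>, so on pairs inside a cube the
  kernel is bounded below; the squared deviation from the mean is therefore a part of the
  seminorm.\<close>

lemma cube_average_error:
  fixes u :: "'a::euclidean_space \<Rightarrow> real"
  assumes u: "u \<in> borel_measurable lebesgue" and fin: "(\<integral>\<^sup>+x. ennreal ((u x)\<^sup>2) \<partial>lebesgue) < \<infinity>" and e: "0 < e"
    and s: "0 < s" "s < 1"
  shows "(\<integral>\<^sup>+x. ennreal ((u x - cube_average e u x)\<^sup>2) \<partial>lebesgue) \<le> ennreal (cube_error DIM('a) s e) * seminorm_sq s u"
proof -
  obtain u' where u': "u' \<in> borel_measurable borel" and "AE x in lborel. u x = u' x" using borel_representative[OF u] by blast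
  then have ae: "AE x in lebesgue. u x = u' x" by (intro AE_completion)
  have ul: "u' \<in> borel_measurable lebesgue" using u' by (simp add: measurable_completion)
  have "(\<integral>\<^sup>+x. ennreal ((u x)\<^sup>2) \<partial>lebesgue) = (\<integral>\<^sup>+x. ennreal ((u' x)\<^sup>2) \<partial>lebesgue)"
    by (rule nn_integral_cong_AE) (use ae in \<open>eventually_elim, simp\<close>)
  then have fin': "(\<integral>\<^sup>+x. ennreal ((u' x)\<^sup>2) \<partial>lebesgue) < \<infinity>" using fin by simp
  have "cube_integral e c u = cube_integral e c u'" for c
    unfolding cube_integral_def set_lebesgue_integral_def
  proof (rule integral_cong_AE)
    show "AE x in lebesgue. indicat_real (cube e c) x *\<^sub>R u x = indicat_real (cube e c) x *\<^sub>R u' x"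
      using ae by eventually_elim (simp only:)
  qed (intro borel_measurable_scaleR borel_measurable_indicator u ul, simp)+
  then have av: "cube_average e u = cube_average e u'" by (intro ext) (simp only: cube_average_def)
  have "(\<integral>\<^sup>+x. ennreal ((u x - cube_average e u x)\<^sup>2) \<partial>lebesgue) = (\<integral>\<^sup>+x. ennreal ((u' x - cube_average e u' x)\<^sup>2) \<partial>lebesgue)"
    unfolding av by (rule nn_integral_cong_AE) (use ae in \<open>eventually_elim, simp\<close>)
  also have "\<dots> \<le> ennreal (cube_error DIM('a) s e) * seminorm_sq s u'"
    unfolding nn_integral_completion by (rule cube_average_error_Borel[OF u' fin' e s])
  also have "seminorm_sq s u' = seminorm_sq s u" by (rule seminorm_sq_cong_AE[OF u ul ae, symmetric])
  finally show ?thesis .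
qed

lemma cube_error_tendsto:
  assumes "0 < N" "0 < s" "s < 1"
  shows "(\<lambda>k. cube_error N s (1 / real (Suc k))) \<longlonglongrightarrow> 0" "0 < e \<Longrightarrow> 0 \<le> cube_error N s e"
proof -
  have f: "0 < frac_const N s" by (rule frac_const_pos[OF assms(2,3,1)])
  then show "0 < e \<Longrightarrow> 0 \<le> cube_error N s e" by (simp add: cube_error_def)
  have eq: "cube_error N s e = real N powr (real N + 2 * s) / frac_const N s * e powr (2 * s)" if "0 < e" for e
  proof -
    have "e powr (real N + 2 * s) = e ^ N * e powr (2 * s)" using that by (simp add: powr_add powr_realpow)
    then show ?thesis using that assms by (simp add: cube_error_def powr_mult)
  qed
  have "(\<lambda>k. inverse (real (Suc k)) powr (2 * s)) \<longlonglongrightarrow> 0"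
    using assms(2) by (intro tendsto_zero_powrI[OF LIMSEQ_inverse_real_of_nat tendsto_const]) auto
  then have "(\<lambda>k. real N powr (real N + 2 * s) / frac_const N s * (inverse (real (Suc k)) powr (2 * s))) \<longlonglongrightarrow> 0"
    by (rule tendsto_mult_right_zero)
  then show "(\<lambda>k. cube_error N s (1 / real (Suc k))) \<longlonglongrightarrow> 0"
    by (simp add: eq inverse_eq_divide)
qed

section \<open>Limits in mean square\<close>

lemma summable_of_weighted_square_bound:
  fixes d :: "nat \<Rightarrow> 'b::real_normed_vector"
  assumes "\<And>n. 2 ^ n * (norm (d n))\<^sup>2 \<le> c"
  shows "summable (\<lambda>n. norm (d n))"
proof (rule summable_comparison_test')
  show "summable (\<lambda>n. sqrt c * (1 / sqrt 2) ^ n)"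
    by (intro summable_mult summable_geometric) simp
  fix n :: nat
  have "norm (d n) = sqrt ((norm (d n))\<^sup>2)" by simp
  also have "\<dots> \<le> sqrt (c * (1 / 2) ^ n)"
    using assms[of n] by (intro real_sqrt_le_mono) (simp add: power_divide field_simps)
  also have "\<dots> = sqrt c * (1 / sqrt 2) ^ n" by (simp add: real_sqrt_mult real_sqrt_power real_sqrt_divide)
  finally show "norm (norm (d n)) \<le> sqrt c * (1 / sqrt 2) ^ n" by simp
qed

text \<open>The Riesz-Fischer argument: along a subsequence with squared distances \<open>(1 /
  8)\<^sup>n\<close>, the series of \<open>2 ^ n * (norm (d n x))\<^sup>2\<close> has a finite
  integral, hence converges almost everywhere, and then \<open>norm (d n x)\<close> is summable.\<close>

lemma L2_Cauchy_AE_subsequence: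
  fixes f :: "nat \<Rightarrow> 'x \<Rightarrow> 'b::{banach, second_countable_topology}"
  assumes meas: "\<And>n. f n \<in> borel_measurable M"
    and Cauchy: "\<And>e. 0 < e \<Longrightarrow> \<exists>N. \<forall>m\<ge>N. \<forall>n\<ge>N. (\<integral>\<^sup>+x. ennreal ((norm (f m x - f n x))\<^sup>2) \<partial>M) \<le> ennreal e"
  obtains r g where "strict_mono (r :: nat \<Rightarrow> nat)" "g \<in> borel_measurable M" "AE x in M. (\<lambda>n. f (r n) x) \<longlonglongrightarrow> g x"
proof -
  have "\<exists>N. \<forall>m\<ge>N. \<forall>n\<ge>N. (\<integral>\<^sup>+x. ennreal ((norm (f m x - f n x))\<^sup>2) \<partial>M) \<le> ennreal ((1 / 8) ^ k)" for k :: nat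
    by (rule Cauchy) simp
  then obtain N where N: "\<And>k m n. N k \<le> m \<Longrightarrow> N k \<le> n \<Longrightarrow> (\<integral>\<^sup>+x. ennreal ((norm (f m x - f n x))\<^sup>2) \<partial>M) \<le> ennreal ((1 / 8) ^ k)"
    by metis
  define r where "r k = (\<Sum>i\<le>k. N i) + k" for k
  have r: "strict_mono r" by (rule strict_mono_Suc_iff[THEN iffD2]) (simp add: r_def)
  have rN: "N k \<le> r k" for k unfolding r_def by (rule trans_le_add1) (rule member_le_sum, auto)
  define d where "d n x = f (r (Suc n)) x - f (r n) x" for n x
  have [measurable]: "d n \<in> borel_measurable M" for n unfolding d_def[abs_def] using meas by measurable
  have d_le: "(\<integral>\<^sup>+x. ennreal ((norm (d n x))\<^sup>2) \<partial>M) \<le> ennreal ((1 / 8) ^ n)" for n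
    unfolding d_def using rN[of n] strict_monoD[OF r, of n "Suc n"] by (intro N) auto
  have "(\<integral>\<^sup>+x. (\<Sum>n. ennreal (2 ^ n * (norm (d n x))\<^sup>2)) \<partial>M) = (\<Sum>n. \<integral>\<^sup>+x. ennreal (2 ^ n * (norm (d n x))\<^sup>2) \<partial>M)"
    by (rule nn_integral_suminf) measurable
  also have "\<dots> \<le> (\<Sum>n. ennreal ((1 / 4) ^ n))"
  proof (intro suminf_le summableI)
    fix n :: nat
    have "(\<integral>\<^sup>+x. ennreal (2 ^ n * (norm (d n x))\<^sup>2) \<partial>M) = ennreal (2 ^ n) * (\<integral>\<^sup>+x. ennreal ((norm (d n x))\<^sup>2) \<partial>M)"
      by (subst nn_integral_cmult[symmetric], measurable, intro nn_integral_cong) (rule ennreal_mult, auto)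
    also have "\<dots> \<le> ennreal (2 ^ n) * ennreal ((1 / 8) ^ n)" by (intro mult_left_mono d_le) simp
    also have "\<dots> = ennreal ((1 / 4) ^ n)" by (simp flip: ennreal_mult power_mult_distrib)
    finally show "(\<integral>\<^sup>+x. ennreal (2 ^ n * (norm (d n x))\<^sup>2) \<partial>M) \<le> ennreal ((1 / 4) ^ n)" .
  qed
  also have "\<dots> = ennreal (\<Sum>n. (1 / 4) ^ n)" by (rule suminf_ennreal2) (auto intro: summable_geometric)
  also have "\<dots> < \<infinity>" by simp
  finally have "(\<integral>\<^sup>+x. (\<Sum>n. ennreal (2 ^ n * (norm (d n x))\<^sup>2)) \<partial>M) \<noteq> \<infinity>" by simp
  then have "AE x in M. (\<Sum>n. ennreal (2 ^ n * (norm (d n x))\<^sup>2)) \<noteq> \<infinity>"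
    by (rule nn_integral_noteq_infinite[rotated]) measurable
  then have conv: "AE x in M. convergent (\<lambda>n. f (r n) x)"
  proof eventually_elim
    case (elim x)
    define S where "S = (\<Sum>n. ennreal (2 ^ n * (norm (d n x))\<^sup>2))"
    have "S \<noteq> \<infinity>" using elim unfolding S_def .
    then obtain c where c: "S = ennreal c" "0 \<le> c" by (cases S) auto
    have "2 ^ n * (norm (d n x))\<^sup>2 \<le> c" for n
    proof -
      have "(\<Sum>i\<in>{n}. ennreal (2 ^ i * (norm (d i x))\<^sup>2)) \<le> S" unfolding S_def by (rule sum_le_suminf) auto
      then have "ennreal (2 ^ n * (norm (d n x))\<^sup>2) \<le> ennreal c" unfolding c(1) by (simp only: sum.insert sum.empty finite.emptyI empty_iff not_False_eq_True add_0_right)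
      then show ?thesis using c(2) by (simp only: ennreal_le_iff)
    qed
    then have "summable (\<lambda>n. norm (d n x))" by (rule summable_of_weighted_square_bound)
    then have "summable (\<lambda>n. d n x)" by (rule summable_norm_cancel)
    then have "convergent (\<lambda>n. \<Sum>i<n. d i x)" by (simp add: summable_iff_convergent)
    moreover have "(\<Sum>i<n. d i x) = f (r n) x - f (r 0) x" for n
      unfolding d_def by (rule sum_lessThan_telescope)
    ultimately have "convergent (\<lambda>n. f (r n) x - f (r 0) x)" by simp
    then have "convergent (\<lambda>n. (f (r n) x - f (r 0) x) + f (r 0) x)" by (intro convergent_add convergent_const)
    then show ?case by simp
  qed
  have "(\<lambda>x. lim (\<lambda>n. f (r n) x)) \<in> borel_measurable M"
    by (rule borel_measurable_lim_metric) (rule meas)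
  moreover have "AE x in M. (\<lambda>n. f (r n) x) \<longlonglongrightarrow> lim (\<lambda>n. f (r n) x)"
    using conv by eventually_elim (simp add: convergent_LIMSEQ_iff)
  ultimately show ?thesis by (rule that[OF r])
qed

lemma Fatou_square:
  fixes f :: "nat \<Rightarrow> 'x \<Rightarrow> 'b::{banach, second_countable_topology}"
  assumes [measurable]: "\<And>n. f n \<in> borel_measurable M" and lim: "AE x in M. (\<lambda>n. f n x) \<longlonglongrightarrow> g x"
  shows "(\<integral>\<^sup>+x. ennreal ((norm (g x))\<^sup>2) \<partial>M) \<le> liminf (\<lambda>n. \<integral>\<^sup>+x. ennreal ((norm (f n x))\<^sup>2) \<partial>M)"
proof -
  have "(\<integral>\<^sup>+x. ennreal ((norm (g x))\<^sup>2) \<partial>M) = (\<integral>\<^sup>+x. liminf (\<lambda>n. ennreal ((norm (f n x))\<^sup>2)) \<partial>M)"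
  proof (rule nn_integral_cong_AE)
    show "AE x in M. ennreal ((norm (g x))\<^sup>2) = liminf (\<lambda>n. ennreal ((norm (f n x))\<^sup>2))"
      using lim
    proof eventually_elim
      case (elim x)
      then have "(\<lambda>n. ennreal ((norm (f n x))\<^sup>2)) \<longlonglongrightarrow> ennreal ((norm (g x))\<^sup>2)"
        by (intro tendsto_ennrealI tendsto_power tendsto_norm)
      from lim_imp_Liminf[OF sequentially_bot this] show ?case by (rule HOL.sym)
    qed
  qed
  also have "\<dots> \<le> liminf (\<lambda>n. \<integral>\<^sup>+x. ennreal ((norm (f n x))\<^sup>2) \<partial>M)"
    by (rule nn_integral_liminf) measurable
  finally show ?thesis .
qed

lemma liminf_le_eventually:
  fixes a :: "nat \<Rightarrow> ennreal"
  assumes "\<And>n. n \<ge> N \<Longrightarrow> a n \<le> c" shows "liminf a \<le> c"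
proof -
  have "liminf a \<le> limsup a" by (rule Liminf_le_Limsup) simp
  also have "\<dots> \<le> c" using assms by (intro Limsup_bounded eventually_sequentiallyI[of N]) auto
  finally show ?thesis .
qed

text \<open>Fatou's lemma on the product space. At order one it would need weak gradients, which do not follow
  from pointwise convergence of the functions.\<close>

lemma seminorm_sq_Fatou:
  fixes f :: "nat \<Rightarrow> 'a::euclidean_space \<Rightarrow> real"
  assumes s: "0 \<le> s" "s < 1" and m: "\<And>n. f n \<in> borel_measurable lebesgue" "g \<in> borel_measurable lebesgue"
    and lim: "AE x in lebesgue. (\<lambda>n. f n x) \<longlonglongrightarrow> g x"
  shows "seminorm_sq s g \<le> liminf (\<lambda>n. seminorm_sq s (f n))"
proof (cases "s = 0")
  case True
  then show ?thesis using Fatou_square[OF m(1) lim] by (simp add: seminorm_sq_def)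
next
  case False
  then have s': "0 < s" using s by simp
  have "\<exists>h. h \<in> borel_measurable borel \<and> (AE x in lborel. f n x = h x)" for n
    using borel_representative[OF m(1)[of n]] by blast
  then obtain h where h: "\<And>n. h n \<in> borel_measurable borel" "\<And>n. AE x in lborel. f n x = h n x" by metis
  obtain k where k: "k \<in> borel_measurable borel" "AE x in lborel. g x = k x" using borel_representative[OF m(2)] by blast
  have lim': "AE x in lborel. (\<lambda>n. h n x) \<longlonglongrightarrow> k x"
  proof -
    have "AE x in lborel. \<forall>n. f n x = h n x" unfolding AE_all_countable using h(2) by blast
    moreover have "AE x in lborel. (\<lambda>n. f n x) \<longlonglongrightarrow> g x" using lim by (simp only: AE_completion_iff)
    ultimately show ?thesis using k(2) by eventually_elim simp
  qed
  let ?p = "real DIM('a) + 2 * s"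
  define F where "F u z = (u (fst z) - u (snd z)) * norm (fst z - snd z) powr (- (?p / 2))" for u :: "'a \<Rightarrow> real" and z :: "'a \<times> 'a"
  have F_meas: "F u \<in> borel_measurable (lborel \<Otimes>\<^sub>M lborel)" if [measurable]: "u \<in> borel_measurable borel" for u
    unfolding F_def by measurable
  have F_sq: "(u (fst z) - u (snd z))\<^sup>2 / norm (fst z - snd z) powr ?p = (norm (F u z))\<^sup>2" for u z
  proof -
    have "(norm (fst z - snd z) powr (- (?p / 2)))\<^sup>2 = norm (fst z - snd z) powr (- ?p)"
      by (simp add: power2_eq_square flip: powr_add)
    then show ?thesis unfolding F_def real_norm_def power2_abs power_mult_distrib powr_minus_divide by (simp only: times_divide_eq_right mult_1_right)
  qed
  have "(\<integral>\<^sup>+z. ennreal ((norm (F k z))\<^sup>2) \<partial>(lborel \<Otimes>\<^sub>M lborel)) \<le> liminf (\<lambda>n. \<integral>\<^sup>+z. ennreal ((norm (F (h n) z))\<^sup>2) \<partial>(lborel \<Otimes>\<^sub>M lborel))"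
  proof (rule Fatou_square[OF F_meas[OF h(1)]])
    have "AE z in (lborel \<Otimes>\<^sub>M lborel :: ('a \<times> 'a) measure). ((\<lambda>n. h n (fst z)) \<longlonglongrightarrow> k (fst z)) \<and> ((\<lambda>n. h n (snd z)) \<longlonglongrightarrow> k (snd z))"
      unfolding lborel_prod by (rule AE_pair_lborel[OF lim'])
    then show "AE z in (lborel \<Otimes>\<^sub>M lborel :: ('a \<times> 'a) measure). (\<lambda>n. F (h n) z) \<longlonglongrightarrow> F k z"
      by eventually_elim (unfold F_def, intro tendsto_mult tendsto_diff tendsto_const, auto)
  qed
  then have "ennreal (frac_const DIM('a) s) * (\<integral>\<^sup>+z. ennreal ((norm (F k z))\<^sup>2) \<partial>(lborel \<Otimes>\<^sub>M lborel))
     \<le> ennreal (frac_const DIM('a) s) * liminf (\<lambda>n. \<integral>\<^sup>+z. ennreal ((norm (F (h n) z))\<^sup>2) \<partial>(lborel \<Otimes>\<^sub>M lborel))"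
    by (rule mult_left_mono) simp
  also have "\<dots> = liminf (\<lambda>n. ennreal (frac_const DIM('a) s) * (\<integral>\<^sup>+z. ennreal ((norm (F (h n) z))\<^sup>2) \<partial>(lborel \<Otimes>\<^sub>M lborel)))"
    by (rule Liminf_compose_continuous_mono[symmetric]) (auto intro!: continuous_intros ennreal_continuous_on_cmult monoI mult_left_mono)
  finally show ?thesis
    unfolding seminorm_sq_borel[OF s' s(2) k(1) m(2) k(2)] seminorm_sq_borel[OF s' s(2) h(1) m(1) h(2)] F_sq .
qed

lemma L2_pairing_tendsto:
  fixes f :: "nat \<Rightarrow> 'x \<Rightarrow> ennreal"
  assumes [measurable]: "\<And>n. f n \<in> borel_measurable M" "g \<in> borel_measurable M"
    and lim: "(\<lambda>n. \<integral>\<^sup>+x. (f n x)\<^sup>2 \<partial>M) \<longlonglongrightarrow> 0" and fin: "(\<integral>\<^sup>+x. (g x)\<^sup>2 \<partial>M) < \<infinity>"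
  shows "(\<lambda>n. \<integral>\<^sup>+x. f n x * g x \<partial>M) \<longlonglongrightarrow> 0"
proof (rule order_tendstoI)
  fix e :: ennreal assume "0 < e"
  obtain c where c: "(\<integral>\<^sup>+x. (g x)\<^sup>2 \<partial>M) = ennreal c" using fin by (cases "\<integral>\<^sup>+x. (g x)\<^sup>2 \<partial>M") auto
  have "(\<lambda>n. (\<integral>\<^sup>+x. (f n x)\<^sup>2 \<partial>M) * ennreal c) \<longlonglongrightarrow> 0 * ennreal c"
    by (intro tendsto_mult_ennreal lim tendsto_const) auto
  moreover have "0 < e\<^sup>2" using \<open>0 < e\<close> by (simp add: power2_eq_square ennreal_zero_less_mult_iff)
  ultimately have "eventually (\<lambda>n. (\<integral>\<^sup>+x. (f n x)\<^sup>2 \<partial>M) * ennreal c < e\<^sup>2) sequentially"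
    by (intro order_tendstoD) auto
  then show "eventually (\<lambda>n. (\<integral>\<^sup>+x. f n x * g x \<partial>M) < e) sequentially"
  proof eventually_elim
    case (elim n)
    show ?case
    proof (rule ccontr)
      assume "\<not> ?case"
      then have "e\<^sup>2 \<le> (\<integral>\<^sup>+x. f n x * g x \<partial>M)\<^sup>2" by (intro power_mono) auto
      also have "\<dots> \<le> (\<integral>\<^sup>+x. (f n x)\<^sup>2 \<partial>M) * ennreal c"
        unfolding c[symmetric] by (rule Cauchy_Schwarz_nn_integral) measurable
      finally show False using elim by simp
    qed
  qed
qed simp

lemma tendsto_of_ennreal_norm_bound:
  fixes p :: "nat \<Rightarrow> 'b::real_normed_vector"
  assumes a: "a \<longlonglongrightarrow> 0" and le: "\<And>n. ennreal (norm (p n - q)) \<le> a n"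
  shows "p \<longlonglongrightarrow> q"
proof -
  have "(\<lambda>n. ennreal (norm (p n - q))) \<longlonglongrightarrow> 0"
    by (rule tendsto_sandwich[OF _ _ tendsto_const a]) (auto simp: le)
  then have "(\<lambda>n. ennreal (norm (p n - q))) \<longlonglongrightarrow> ennreal 0" by (simp only: ennreal_0)
  then have "(\<lambda>n. norm (p n - q)) \<longlonglongrightarrow> 0" by (subst (asm) tendsto_ennreal_iff) auto
  then show ?thesis by (rule LIM_zero_cancel[OF tendsto_norm_zero_cancel])
qed

text \<open>Both sides of the defining identity are continuous with respect to convergence in mean square,
  since test functions are square integrable.\<close>

lemma has_weak_gradient_limit:
  fixes v :: "nat \<Rightarrow> 'a::euclidean_space \<Rightarrow> real"
  assumes w: "\<And>n. has_weak_gradient (v n) (g n)" and um: "u \<in> borel_measurable lebesgue" and hm: "h \<in> borel_measurable lebesgue"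
    and u: "(\<lambda>n. \<integral>\<^sup>+x. ennreal ((norm (v n x - u x))\<^sup>2) \<partial>lebesgue) \<longlonglongrightarrow> 0"
    and h: "(\<lambda>n. \<integral>\<^sup>+x. ennreal ((norm (g n x - h x))\<^sup>2) \<partial>lebesgue) \<longlonglongrightarrow> 0"
  shows "has_weak_gradient u h"
proof -
  have vli: "locally_integrable (v n)" and gli: "locally_integrable (g n)" for n using w by (auto simp: has_weak_gradient_iff)
  have vm: "v n \<in> borel_measurable lebesgue" and gm: "g n \<in> borel_measurable lebesgue" for n
    using vli gli by (auto intro: locally_integrable_measurable)
  have dm: "(\<lambda>x. v n x - u x) \<in> borel_measurable lebesgue" and em: "(\<lambda>x. g n x - h x) \<in> borel_measurable lebesgue" for n
    by (intro borel_measurable_diff vm gm um hm)+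
  have uli: "locally_integrable u"
  proof -
    obtain n where "(\<integral>\<^sup>+x. ennreal ((norm (v n x - u x))\<^sup>2) \<partial>lebesgue) < \<infinity>"
      using order_tendstoD(2)[OF u, of \<infinity>] by (auto simp: eventually_sequentially)
    then have "locally_integrable (\<lambda>x. v n x - u x)" by (rule locally_integrable_L2[OF dm])
    from locally_integrable_add[OF vli locally_integrable_scaleR[OF this, of "-1"], of n] show ?thesis by simp
  qed
  have hli: "locally_integrable h"
  proof -
    obtain n where "(\<integral>\<^sup>+x. ennreal ((norm (g n x - h x))\<^sup>2) \<partial>lebesgue) < \<infinity>"
      using order_tendstoD(2)[OF h, of \<infinity>] by (auto simp: eventually_sequentially)
    then have "locally_integrable (\<lambda>x. g n x - h x)" by (rule locally_integrable_L2[OF em])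
    from locally_integrable_add[OF gli locally_integrable_scaleR[OF this, of "-1"], of n] show ?thesis by simp
  qed
  have "(LINT x|lebesgue. u x *\<^sub>R D x) = - (LINT x|lebesgue. \<phi> x *\<^sub>R h x)" if t: "test_function \<phi> D" for \<phi> D
  proof -
    have fin: "(\<integral>\<^sup>+x. (ennreal (norm (\<Psi> x)))\<^sup>2 \<partial>lebesgue) < \<infinity>" and \<Psi>m: "\<Psi> \<in> borel_measurable lebesgue"
      if cont: "continuous_on UNIV \<Psi>" and supp: "\<And>x. x \<notin> cball 0 \<rho> \<Longrightarrow> \<Psi> x = 0" for \<Psi> :: "'a \<Rightarrow> 'c::euclidean_space" and \<rho>
    proof -
      obtain c where c: "0 \<le> c" "\<And>x. norm (\<Psi> x) \<le> c" using continuous_bounded_support[OF cont supp] by blast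
      have "(\<integral>\<^sup>+x. (ennreal (norm (\<Psi> x)))\<^sup>2 \<partial>lebesgue) \<le> (\<integral>\<^sup>+(x::'a). ennreal (c\<^sup>2) * indicator (cball 0 \<rho>) x \<partial>lebesgue)"
      proof (rule nn_integral_mono)
        fix x
        show "(ennreal (norm (\<Psi> x)))\<^sup>2 \<le> ennreal (c\<^sup>2) * indicator (cball 0 \<rho>) x"
        proof (cases "x \<in> cball 0 \<rho>")
          case True
          have "(norm (\<Psi> x))\<^sup>2 \<le> c\<^sup>2" using c by (intro power_mono) auto
          then show ?thesis using True by (simp add: ennreal_power)
        next
          case False
          then show ?thesis using supp[OF False] by simp
        qed
      qed
      also have "\<dots> < \<infinity>" using emeasure_lborel_cball_finite[of "0::'a" \<rho>] by (simp add: nn_integral_cmult_indicator ennreal_mult_less_top)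
      finally show "(\<integral>\<^sup>+x. (ennreal (norm (\<Psi> x)))\<^sup>2 \<partial>lebesgue) < \<infinity>" .
      have "\<Psi> \<in> borel_measurable lborel" using borel_measurable_continuous_onI[OF cont] by (simp only: measurable_lborel2)
      then show "\<Psi> \<in> borel_measurable lebesgue" by (rule measurable_completion)
    qed
    obtain \<rho> where "0 < \<rho>" and \<rho>: "\<And>x. x \<notin> cball 0 \<rho> \<Longrightarrow> \<phi> x = 0" "\<And>x. x \<notin> cball 0 \<rho> \<Longrightarrow> D x = 0"
      using test_function_support[OF t] by blast
    note \<phi>f = fin[OF test_function_continuous(1)[OF t] \<rho>(1)] and \<phi>m = \<Psi>m[OF test_function_continuous(1)[OF t] \<rho>(1)]
    note Df = fin[OF test_function_continuous(2)[OF t] \<rho>(2)] and Dm = \<Psi>m[OF test_function_continuous(2)[OF t] \<rho>(2)]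
    have l1: "(\<lambda>n. LINT x|lebesgue. v n x *\<^sub>R D x) \<longlonglongrightarrow> (LINT x|lebesgue. u x *\<^sub>R D x)"
    proof -
      have "(\<lambda>n. \<integral>\<^sup>+x. ennreal (norm (v n x - u x)) * ennreal (norm (D x)) \<partial>lebesgue) \<longlonglongrightarrow> 0"
        by (rule L2_pairing_tendsto) (use u Df dm Dm in \<open>auto simp: ennreal_power\<close>)
      moreover have "ennreal (norm ((LINT x|lebesgue. v n x *\<^sub>R D x) - (LINT x|lebesgue. u x *\<^sub>R D x)))
          \<le> (\<integral>\<^sup>+x. ennreal (norm (v n x - u x)) * ennreal (norm (D x)) \<partial>lebesgue)" for n
      proof -
        have i: "integrable lebesgue (\<lambda>x. v n x *\<^sub>R D x - u x *\<^sub>R D x)"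
          by (intro Bochner_Integration.integrable_diff integrable_test(1)[OF t] vli uli)
        have "(LINT x|lebesgue. v n x *\<^sub>R D x) - (LINT x|lebesgue. u x *\<^sub>R D x) = (LINT x|lebesgue. v n x *\<^sub>R D x - u x *\<^sub>R D x)"
          by (intro Bochner_Integration.integral_diff[symmetric] integrable_test(1)[OF t] vli uli)
        then have "ennreal (norm ((LINT x|lebesgue. v n x *\<^sub>R D x) - (LINT x|lebesgue. u x *\<^sub>R D x))) \<le> (\<integral>\<^sup>+x. ennreal (norm (v n x *\<^sub>R D x - u x *\<^sub>R D x)) \<partial>lebesgue)"
          using integral_norm_bound_ennreal[OF i] by (simp only:)
        also have "\<dots> = (\<integral>\<^sup>+x. ennreal (norm (v n x - u x)) * ennreal (norm (D x)) \<partial>lebesgue)"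
          by (intro nn_integral_cong) (simp add: ennreal_mult flip: scaleR_diff_left)
        finally show ?thesis .
      qed
      ultimately show ?thesis by (rule tendsto_of_ennreal_norm_bound)
    qed
    have l2: "(\<lambda>n. LINT x|lebesgue. \<phi> x *\<^sub>R g n x) \<longlonglongrightarrow> (LINT x|lebesgue. \<phi> x *\<^sub>R h x)"
    proof -
      have "(\<lambda>n. \<integral>\<^sup>+x. ennreal (norm (g n x - h x)) * ennreal (norm (\<phi> x)) \<partial>lebesgue) \<longlonglongrightarrow> 0"
        by (rule L2_pairing_tendsto) (use h \<phi>f em \<phi>m in \<open>auto simp: ennreal_power\<close>)
      moreover have "ennreal (norm ((LINT x|lebesgue. \<phi> x *\<^sub>R g n x) - (LINT x|lebesgue. \<phi> x *\<^sub>R h x)))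
          \<le> (\<integral>\<^sup>+x. ennreal (norm (g n x - h x)) * ennreal (norm (\<phi> x)) \<partial>lebesgue)" for n
      proof -
        have i: "integrable lebesgue (\<lambda>x. \<phi> x *\<^sub>R g n x - \<phi> x *\<^sub>R h x)"
          by (intro Bochner_Integration.integrable_diff integrable_test(2)[OF t] gli hli)
        have "(LINT x|lebesgue. \<phi> x *\<^sub>R g n x) - (LINT x|lebesgue. \<phi> x *\<^sub>R h x) = (LINT x|lebesgue. \<phi> x *\<^sub>R g n x - \<phi> x *\<^sub>R h x)"
          by (intro Bochner_Integration.integral_diff[symmetric] integrable_test(2)[OF t] gli hli)
        then have "ennreal (norm ((LINT x|lebesgue. \<phi> x *\<^sub>R g n x) - (LINT x|lebesgue. \<phi> x *\<^sub>R h x))) \<le> (\<integral>\<^sup>+x. ennreal (norm (\<phi> x *\<^sub>R g n x - \<phi> x *\<^sub>R h x)) \<partial>lebesgue)"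
          using integral_norm_bound_ennreal[OF i] by (simp only:)
        also have "\<dots> = (\<integral>\<^sup>+x. ennreal (norm (g n x - h x)) * ennreal (norm (\<phi> x)) \<partial>lebesgue)"
          by (intro nn_integral_cong) (simp add: ennreal_mult mult.commute flip: scaleR_diff_right)
        finally show ?thesis .
      qed
      ultimately show ?thesis by (rule tendsto_of_ennreal_norm_bound)
    qed
    have "(LINT x|lebesgue. v n x *\<^sub>R D x) = - (LINT x|lebesgue. \<phi> x *\<^sub>R g n x)" for n
      using w[of n] t unfolding has_weak_gradient_iff by blast
    then have "(\<lambda>n. LINT x|lebesgue. v n x *\<^sub>R D x) \<longlonglongrightarrow> - (LINT x|lebesgue. \<phi> x *\<^sub>R h x)"
      using tendsto_minus[OF l2] by (simp only:)
    then show ?thesis using LIMSEQ_unique[OF l1] by blast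
  qed
  then show ?thesis unfolding has_weak_gradient_iff using uli hli by blast
qed

section \<open>Completeness of the energy space\<close>

lemma ennreal_tendsto_0I:
  fixes a :: "nat \<Rightarrow> ennreal"
  assumes "\<And>e. 0 < e \<Longrightarrow> \<exists>N. \<forall>n\<ge>N. a n \<le> ennreal e"
  shows "a \<longlonglongrightarrow> 0"
proof (rule order_tendstoI)
  fix e :: ennreal assume "0 < e"
  then obtain d where d: "0 < d" "d < e" using dense by blast
  then obtain c where c: "0 < c" "ennreal c < e" by (cases d) (auto simp: ennreal_zero_less_mult_iff)
  then show "eventually (\<lambda>n. a n < e) sequentially"
    using assms[OF c(1)] by (auto simp: eventually_sequentially intro: le_less_trans)
qed simp

lemma L2_Cauchy_limit:
  fixes f :: "nat \<Rightarrow> 'x \<Rightarrow> 'b::{banach, second_countable_topology}"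
  assumes meas: "\<And>n. f n \<in> borel_measurable M"
    and Cauchy: "\<And>e. 0 < e \<Longrightarrow> \<exists>N. \<forall>m\<ge>N. \<forall>n\<ge>N. (\<integral>\<^sup>+x. ennreal ((norm (f m x - f n x))\<^sup>2) \<partial>M) \<le> ennreal e"
    and r: "strict_mono r" and lim: "AE x in M. (\<lambda>n. f (r n) x) \<longlonglongrightarrow> g x"
  shows "(\<lambda>n. \<integral>\<^sup>+x. ennreal ((norm (f n x - g x))\<^sup>2) \<partial>M) \<longlonglongrightarrow> 0"
proof (rule ennreal_tendsto_0I)
  fix e :: real assume "0 < e"
  from Cauchy[OF this] obtain N where
    N: "\<And>m n. N \<le> m \<Longrightarrow> N \<le> n \<Longrightarrow> (\<integral>\<^sup>+x. ennreal ((norm (f m x - f n x))\<^sup>2) \<partial>M) \<le> ennreal e" by blast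
  have "(\<integral>\<^sup>+x. ennreal ((norm (f n x - g x))\<^sup>2) \<partial>M) \<le> ennreal e" if n: "N \<le> n" for n
  proof -
    have "(\<integral>\<^sup>+x. ennreal ((norm (f n x - g x))\<^sup>2) \<partial>M) \<le> liminf (\<lambda>j. \<integral>\<^sup>+x. ennreal ((norm (f n x - f (r j) x))\<^sup>2) \<partial>M)"
    proof (rule Fatou_square)
      show "(\<lambda>x. f n x - f (r j) x) \<in> borel_measurable M" for j by (intro borel_measurable_diff meas)
      show "AE x in M. (\<lambda>j. f n x - f (r j) x) \<longlonglongrightarrow> f n x - g x"
        using lim by eventually_elim (intro tendsto_diff tendsto_const)
    qed
    also have "\<dots> \<le> ennreal e"
    proof (rule liminf_le_eventually)
      fix j assume "N \<le> j"
      then have "N \<le> r j" using seq_suble[OF r, of j] by simp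
      then show "(\<integral>\<^sup>+x. ennreal ((norm (f n x - f (r j) x))\<^sup>2) \<partial>M) \<le> ennreal e" by (rule N[OF n])
    qed
    finally show ?thesis .
  qed
  then show "\<exists>N. \<forall>n\<ge>N. (\<integral>\<^sup>+x. ennreal ((norm (f n x - g x))\<^sup>2) \<partial>M) \<le> ennreal e" by blast
qed

lemma seminorm_sq_1_weak_gradient:
  assumes "has_weak_gradient u g"
  shows "seminorm_sq 1 u = (\<integral>\<^sup>+x. ennreal ((norm (g x))\<^sup>2) \<partial>lebesgue)"
proof -
  have "seminorm_sq 1 u = (\<integral>\<^sup>+x. ennreal ((norm (weak_gradient u x))\<^sup>2) \<partial>lebesgue)"
    using assms by (auto simp: seminorm_sq_def)
  also have "\<dots> = (\<integral>\<^sup>+x. ennreal ((norm (g x))\<^sup>2) \<partial>lebesgue)"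
  proof (rule nn_integral_cong_AE)
    show "AE x in lebesgue. ennreal ((norm (weak_gradient u x))\<^sup>2) = ennreal ((norm (g x))\<^sup>2)"
      using weak_gradient_eq(2)[OF assms] by eventually_elim (simp only:)
  qed
  finally show ?thesis .
qed

lemma has_weak_gradient_diff:
  assumes "has_weak_gradient u g" "has_weak_gradient v k"
  shows "has_weak_gradient (\<lambda>x. u x - v x) (\<lambda>x. g x - k x)"
proof -
  have "has_weak_gradient (\<lambda>x. u x + (- 1) * v x) (\<lambda>x. g x + (- 1) *\<^sub>R k x)"
    by (intro has_weak_gradient_add has_weak_gradient_scale assms)
  then show ?thesis by simp
qed

lemma corner_sum:
  assumes "finite G"
  shows "(\<Sum>c\<in>G. indicat_real (cube e c) x * h c) = (if corner e x \<in> G then h (corner e x) else 0)"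
proof -
  have "(\<Sum>c\<in>G. indicat_real (cube e c) x * h c) = (\<Sum>c\<in>G. if corner e x = c then h c else 0)"
    by (intro sum.cong refl) (auto simp: cube_def)
  also have "\<dots> = (if corner e x \<in> G then h (corner e x) else 0)" by (rule sum.delta'[OF assms])
  finally show ?thesis .
qed

context mixed_order
begin

lemma point_energy_le:
  assumes w: "w \<in> X"
  shows "ennreal (measure \<mu>p {1}) * seminorm_sq 1 w \<le> ennreal (Q w w)"
proof -
  interpret finite_measure \<mu>p by (rule \<mu>pD(1))
  have "{1} \<in> sets \<mu>p" using \<mu>pD(4)[of 1 1] by simp
  then have "ennreal (measure \<mu>p {1}) * seminorm_sq 1 w = (\<integral>\<^sup>+s. seminorm_sq 1 w * indicator {1} s \<partial>\<mu>p)"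
    by (simp add: nn_integral_cmult_indicator emeasure_eq_measure mult.commute)
  also have "\<dots> \<le> (\<integral>\<^sup>+s. seminorm_sq s w \<partial>\<mu>p)" by (intro nn_integral_mono) (auto simp: indicator_def)
  finally show ?thesis unfolding Q_energy[OF w] .
qed

text \<open>Lower semicontinuity of the integrated energy from lower semicontinuity in almost every order.\<close>

lemma energy_Fatou:
  assumes v: "v \<in> X" and x: "\<And>n. x n \<in> X" and u: "u \<in> borel_measurable lebesgue"
    and AE: "AE s in \<mu>p. seminorm_sq s (v - u) \<le> liminf (\<lambda>j. seminorm_sq s (v - x j))"
    and le: "\<And>j. N \<le> j \<Longrightarrow> Q (v - x j) (v - x j) \<le> e"
  shows "(\<integral>\<^sup>+s. seminorm_sq s (v - u) \<partial>\<mu>p) \<le> ennreal e"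
proof -
  have vx: "v - x j \<in> X" for j using v x by simp
  have m: "(\<lambda>s. seminorm_sq s (v - x j)) \<in> borel_measurable \<mu>p" for j
    by (rule form_s_measurable(2)[OF \<mu>pD(2) XD(1)[OF vx[of j]] XD(1)[OF vx[of j]]])
  have "(\<integral>\<^sup>+s. seminorm_sq s (v - u) \<partial>\<mu>p) \<le> (\<integral>\<^sup>+s. liminf (\<lambda>j. seminorm_sq s (v - x j)) \<partial>\<mu>p)"
    by (rule nn_integral_mono_AE[OF AE])
  also have "\<dots> \<le> liminf (\<lambda>j. \<integral>\<^sup>+s. seminorm_sq s (v - x j) \<partial>\<mu>p)" by (rule nn_integral_liminf[OF m])
  also have "\<dots> \<le> ennreal e"
  proof (rule liminf_le_eventually)
    show "(\<integral>\<^sup>+s. seminorm_sq s (v - x j) \<partial>\<mu>p) \<le> ennreal e" if "N \<le> j" for j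
      unfolding Q_energy[OF vx, symmetric] by (intro ennreal_leI le that)
  qed
  finally show ?thesis .
qed

lemma X_Cauchy_subsequence:
  assumes x: "\<And>n. x n \<in> X"
    and Cauchy: "\<And>e. 0 < e \<Longrightarrow> \<exists>M. \<forall>m\<ge>M. \<forall>n\<ge>M. ip (x m - x n) (x m - x n) < e"
  obtains r u where "strict_mono (r :: nat \<Rightarrow> nat)" "u \<in> borel_measurable lebesgue" "AE y in lebesgue. (\<lambda>n. x (r n) y) \<longlonglongrightarrow> u y"
    "AE y in lebesgue. y \<notin> \<Omega> \<longrightarrow> u y = 0" "(\<lambda>n. \<integral>\<^sup>+y. ennreal ((norm (x n y - u y))\<^sup>2) \<partial>lebesgue) \<longlonglongrightarrow> 0"
proof -
  have L2C: "\<exists>N. \<forall>m\<ge>N. \<forall>n\<ge>N. (\<integral>\<^sup>+y. ennreal ((norm (x m y - x n y))\<^sup>2) \<partial>lebesgue) \<le> ennreal e" if "0 < e" for e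
  proof -
    from Cauchy[OF that] obtain M where M: "\<And>m n. M \<le> m \<Longrightarrow> M \<le> n \<Longrightarrow> ip (x m - x n) (x m - x n) < e" by blast
    have "(\<integral>\<^sup>+y. ennreal ((norm (x m y - x n y))\<^sup>2) \<partial>lebesgue) \<le> ennreal e" if "M \<le> m" "M \<le> n" for m n
    proof -
      have d: "x m - x n \<in> X" using x by simp
      have "(\<integral>\<^sup>+y. ennreal ((norm (x m y - x n y))\<^sup>2) \<partial>lebesgue) = ennreal (ip (x m - x n) (x m - x n))"
        unfolding ip_X(1)[OF d] by simp
      also have "\<dots> \<le> ennreal e" using M[OF that] by (intro ennreal_leI) simp
      finally show ?thesis .
    qed
    then show ?thesis by blast
  qed
  obtain r u where r: "strict_mono (r :: nat \<Rightarrow> nat)" and u: "u \<in> borel_measurable lebesgue"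
    and lim: "AE y in lebesgue. (\<lambda>n. x (r n) y) \<longlonglongrightarrow> u y"
    by (rule L2_Cauchy_AE_subsequence[OF XD(1)[OF x] L2C])
  have "AE y in lebesgue. \<forall>n. y \<notin> \<Omega> \<longrightarrow> x n y = 0" unfolding AE_all_countable using XD(2)[OF x] by blast
  with lim have "AE y in lebesgue. y \<notin> \<Omega> \<longrightarrow> u y = 0"
  proof eventually_elim
    case (elim y)
    show ?case
    proof
      assume "y \<notin> \<Omega>"
      then have "(\<lambda>n. x (r n) y) = (\<lambda>n. 0)" using elim(2) by blast
      then show "u y = 0" using LIMSEQ_unique[OF elim(1)] by simp
    qed
  qed
  then show ?thesis by (rule that[OF r u lim _ L2_Cauchy_limit[OF XD(1)[OF x] L2C r lim]])
qed

text \<open>Orders below one need only convergence almost everywhere. If \<open>\<mu>p\<close> has an atom at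
  \<open>1\<close>, the weak gradients of a Cauchy sequence are Cauchy in
  \<open>L\<^sup>2\<close>, and a further subsequence makes them converge almost everywhere;
  without an atom the order one is negligible.\<close>

lemma lower_semicontinuous_seminorms:
  assumes x: "\<And>n. x n \<in> X" and u: "u \<in> borel_measurable lebesgue"
    and L2: "(\<lambda>n. \<integral>\<^sup>+y. ennreal ((norm (x n y - u y))\<^sup>2) \<partial>lebesgue) \<longlonglongrightarrow> 0"
    and r: "strict_mono (r :: nat \<Rightarrow> nat)" and lim: "AE y in lebesgue. (\<lambda>n. x (r n) y) \<longlonglongrightarrow> u y"
    and Cauchy: "\<And>e. 0 < e \<Longrightarrow> \<exists>M. \<forall>m\<ge>M. \<forall>n\<ge>M. Q (x m - x n) (x m - x n) < e"
  obtains r' where "strict_mono (r' :: nat \<Rightarrow> nat)"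
    "\<forall>n. AE s in \<mu>p. seminorm_sq s (x n - u) \<le> liminf (\<lambda>j. seminorm_sq s (x n - x (r' j)))"
proof -
  interpret finite_measure \<mu>p by (rule \<mu>pD(1))
  have one: "{1} \<in> sets \<mu>p" using \<mu>pD(4)[of 1 1] by simp
  have low: "seminorm_sq s (x n - u) \<le> liminf (\<lambda>j. seminorm_sq s (x n - x (r' j)))"
    if s: "0 \<le> s" "s < 1" and lim': "AE y in lebesgue. (\<lambda>n. x (r' n) y) \<longlonglongrightarrow> u y" for s n r'
  proof (rule seminorm_sq_Fatou[OF s])
    show "x n - x (r' j) \<in> borel_measurable lebesgue" for j using x by (intro XD(1)) simp
    show "x n - u \<in> borel_measurable lebesgue" unfolding fun_diff_def by (intro borel_measurable_diff XD(1)[OF x] u)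
    show "AE y in lebesgue. (\<lambda>j. (x n - x (r' j)) y) \<longlonglongrightarrow> (x n - u) y"
      using lim' by eventually_elim (unfold fun_diff_def, intro tendsto_diff tendsto_const)
  qed
  show ?thesis
  proof (cases "measure \<mu>p {1} = 0")
    case True
    then have "{1} \<in> null_sets \<mu>p" using one by (simp add: null_sets_def emeasure_eq_measure)
    then have "AE s in \<mu>p. s \<noteq> 1" using AE_not_in by force
    then have "AE s in \<mu>p. seminorm_sq s (x n - u) \<le> liminf (\<lambda>j. seminorm_sq s (x n - x (r j)))" for n
      using AE_space
    proof eventually_elim
      case (elim s)
      then have "0 \<le> s" "s < 1" unfolding \<mu>pD(3) by auto
      then show ?case by (rule low[OF _ _ lim])
    qed
    then show ?thesis using that[OF r] by blast
  next
    case False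
    then have a: "0 < measure \<mu>p {1}" using measure_nonneg[of \<mu>p "{1}"] by linarith
    have le: "seminorm_sq 1 w \<le> ennreal (Q w w / measure \<mu>p {1})" if w: "w \<in> X" for w
      using ennreal_mult_ge[OF point_energy_le[OF w] a] Q.nonneg[OF w] a by (simp flip: ennreal_mult)
    have "\<exists>g. has_weak_gradient (x n) g" for n
    proof (rule ccontr)
      assume "\<not> ?thesis"
      then have "\<not> (\<exists>g. has_weak_gradient (x n) g)" .
      then have "seminorm_sq 1 (x n) = \<infinity>" unfolding seminorm_sq_def by (simp only: if_True if_False zero_neq_one[symmetric] simp_thms)
      with le[OF x[of n]] show False by (simp add: top_unique)
    qed
    then obtain G where G: "\<And>n. has_weak_gradient (x n) (G n)" by metis
    have Gm: "G n \<in> borel_measurable lebesgue" for n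
      using G[of n] unfolding has_weak_gradient_iff by (blast intro: locally_integrable_measurable)
    have Gd: "seminorm_sq 1 (x m - x n) = (\<integral>\<^sup>+y. ennreal ((norm (G m y - G n y))\<^sup>2) \<partial>lebesgue)" for m n
      unfolding fun_diff_def by (rule seminorm_sq_1_weak_gradient[OF has_weak_gradient_diff[OF G G]])
    have GC: "\<exists>N. \<forall>m\<ge>N. \<forall>n\<ge>N. (\<integral>\<^sup>+y. ennreal ((norm (G m y - G n y))\<^sup>2) \<partial>lebesgue) \<le> ennreal e" if e: "0 < e" for e
    proof -
      have "0 < e * measure \<mu>p {1}" using e a by simp
      from Cauchy[OF this] obtain M where
        M: "\<And>m n. M \<le> m \<Longrightarrow> M \<le> n \<Longrightarrow> Q (x m - x n) (x m - x n) < e * measure \<mu>p {1}" by blast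
      have "(\<integral>\<^sup>+y. ennreal ((norm (G m y - G n y))\<^sup>2) \<partial>lebesgue) \<le> ennreal e" if "M \<le> m" "M \<le> n" for m n
      proof -
        have "seminorm_sq 1 (x m - x n) \<le> ennreal (Q (x m - x n) (x m - x n) / measure \<mu>p {1})" using x by (intro le) simp
        also have "\<dots> \<le> ennreal e" using M[OF that] a by (intro ennreal_leI) (simp add: divide_le_eq)
        finally show ?thesis unfolding Gd .
      qed
      then show ?thesis by blast
    qed
    have GC': "\<exists>N. \<forall>m\<ge>N. \<forall>n\<ge>N. (\<integral>\<^sup>+y. ennreal ((norm (G (r m) y - G (r n) y))\<^sup>2) \<partial>lebesgue) \<le> ennreal e" if e: "0 < e" for e
      using GC[OF e] by (meson order_trans seq_suble[OF r])
    obtain r2 h where r2: "strict_mono (r2 :: nat \<Rightarrow> nat)" and hm: "h \<in> borel_measurable lebesgue"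
      and hlim: "AE y in lebesgue. (\<lambda>n. G (r (r2 n)) y) \<longlonglongrightarrow> h y"
      by (rule L2_Cauchy_AE_subsequence[OF Gm GC'])
    define r' where "r' = r \<circ> r2"
    have r': "strict_mono r'" unfolding r'_def by (rule strict_mono_o[OF r r2])
    have hlim': "AE y in lebesgue. (\<lambda>n. G (r' n) y) \<longlonglongrightarrow> h y" using hlim by (simp only: r'_def o_def)
    have lim': "AE y in lebesgue. (\<lambda>n. x (r' n) y) \<longlonglongrightarrow> u y"
      using lim by eventually_elim (drule LIMSEQ_subseq_LIMSEQ[OF _ r2], simp only: r'_def o_def)
    have uh: "has_weak_gradient u h"
      by (rule has_weak_gradient_limit[OF G u hm L2 L2_Cauchy_limit[OF Gm GC r' hlim']])
    have high: "seminorm_sq 1 (x n - u) \<le> liminf (\<lambda>j. seminorm_sq 1 (x n - x (r' j)))" for n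
    proof -
      have "seminorm_sq 1 (x n - u) = (\<integral>\<^sup>+y. ennreal ((norm (G n y - h y))\<^sup>2) \<partial>lebesgue)"
        unfolding fun_diff_def by (rule seminorm_sq_1_weak_gradient[OF has_weak_gradient_diff[OF G uh]])
      also have "\<dots> \<le> liminf (\<lambda>j. \<integral>\<^sup>+y. ennreal ((norm (G n y - G (r' j) y))\<^sup>2) \<partial>lebesgue)"
      proof (rule Fatou_square)
        show "(\<lambda>y. G n y - G (r' j) y) \<in> borel_measurable lebesgue" for j by (intro borel_measurable_diff Gm)
        show "AE y in lebesgue. (\<lambda>j. G n y - G (r' j) y) \<longlonglongrightarrow> G n y - h y"
          using hlim' by eventually_elim (intro tendsto_diff tendsto_const)
      qed
      finally show ?thesis unfolding Gd .
    qed
    have "AE s in \<mu>p. seminorm_sq s (x n - u) \<le> liminf (\<lambda>j. seminorm_sq s (x n - x (r' j)))" for n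
      using AE_space
    proof eventually_elim
      case (elim s)
      show ?case
      proof (cases "s = 1")
        case True
        then show ?thesis using high by simp
      next
        case False
        then have "0 \<le> s" "s < 1" using elim unfolding \<mu>pD(3) by auto
        then show ?thesis by (rule low[OF _ _ lim'])
      qed
    qed
    then show ?thesis using that[OF r'] by blast
  qed
qed

text \<open>The limit \<open>u\<close> exists in \<open>L\<^sup>2\<close>. Lower semicontinuity bounds the
  energy of \<open>x n - u\<close> by the small energies of \<open>x n - x (r' j)\<close>; this
  shows both that \<open>u\<close> lies in the space and that the convergence holds there.\<close>

theorem complete: "B.complete_form"
  unfolding B.complete_form_def
proof (intro allI impI)
  fix x :: "nat \<Rightarrow> 'a \<Rightarrow> real"
  assume x': "\<forall>n. x n \<in> X" and BC: "\<forall>e>0. \<exists>M. \<forall>m\<ge>M. \<forall>n\<ge>M. B (x m - x n) (x m - x n) < e"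
  have x: "x n \<in> X" for n using x' by blast
  have d: "x m - x n \<in> X" for m n using x by simp
  have QC: "\<exists>M. \<forall>m\<ge>M. \<forall>n\<ge>M. Q (x m - x n) (x m - x n) < e" if "0 < e" for e
  proof -
    have "0 < e / 2" using that by simp
    then obtain M where M: "\<forall>m\<ge>M. \<forall>n\<ge>M. B (x m - x n) (x m - x n) < e / 2" using BC by blast
    have "Q (x m - x n) (x m - x n) < e" if "M \<le> m" "M \<le> n" for m n
      using B_ge[OF d[of m n]] M[rule_format, OF that] by linarith
    then show ?thesis by blast
  qed
  have IC: "\<exists>M. \<forall>m\<ge>M. \<forall>n\<ge>M. ip (x m - x n) (x m - x n) < e" if "0 < e" for e
  proof -
    have "0 < e / K" using that K_pos by simp
    then obtain M where M: "\<forall>m\<ge>M. \<forall>n\<ge>M. B (x m - x n) (x m - x n) < e / K" using BC by blast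
    have "ip (x m - x n) (x m - x n) < e" if "M \<le> m" "M \<le> n" for m n
    proof -
      have "K * B (x m - x n) (x m - x n) < e" using M[rule_format, OF that] K_pos by (simp add: pos_less_divide_eq mult.commute)
      then show ?thesis using ip_X(2)[OF d[of m n]] by linarith
    qed
    then show ?thesis by blast
  qed
  obtain r u where r: "strict_mono (r :: nat \<Rightarrow> nat)" and u: "u \<in> borel_measurable lebesgue"
    and lim: "AE y in lebesgue. (\<lambda>n. x (r n) y) \<longlonglongrightarrow> u y"
    and u0: "AE y in lebesgue. y \<notin> \<Omega> \<longrightarrow> u y = 0"
    and L2: "(\<lambda>n. \<integral>\<^sup>+y. ennreal ((norm (x n y - u y))\<^sup>2) \<partial>lebesgue) \<longlonglongrightarrow> 0"
    by (rule X_Cauchy_subsequence[OF x IC])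
  obtain r' where r': "strict_mono (r' :: nat \<Rightarrow> nat)"
    and lsc: "\<forall>n. AE s in \<mu>p. seminorm_sq s (x n - u) \<le> liminf (\<lambda>j. seminorm_sq s (x n - x (r' j)))"
    by (rule lower_semicontinuous_seminorms[OF x u L2 r lim QC])
  have close: "\<exists>M. \<forall>n\<ge>M. (\<integral>\<^sup>+s. seminorm_sq s (x n - u) \<partial>\<mu>p) \<le> ennreal e" if e: "0 < e" for e
  proof -
    from QC[OF e] obtain M where M: "\<And>m n. M \<le> m \<Longrightarrow> M \<le> n \<Longrightarrow> Q (x m - x n) (x m - x n) < e" by blast
    have "(\<integral>\<^sup>+s. seminorm_sq s (x n - u) \<partial>\<mu>p) \<le> ennreal e" if n: "M \<le> n" for n
    proof (rule energy_Fatou[OF x x u lsc[rule_format]])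
      fix j assume "M \<le> j"
      then have "M \<le> r' j" using seq_suble[OF r', of j] by simp
      then show "Q (x n - x (r' j)) (x n - x (r' j)) \<le> e" using M[OF n] by (simp add: less_imp_le)
    qed
    then show ?thesis by blast
  qed
  have xu: "x n - u \<in> X" if fin: "(\<integral>\<^sup>+s. seminorm_sq s (x n - u) \<partial>\<mu>p) < \<infinity>" for n
  proof -
    have "x n - u \<in> borel_measurable lebesgue" unfolding fun_diff_def by (intro borel_measurable_diff XD(1)[OF x] u)
    moreover have "AE y in lebesgue. y \<notin> \<Omega> \<longrightarrow> (x n - u) y = 0" using u0 XD(2)[OF x[of n]] by eventually_elim simp
    ultimately show ?thesis using fin unfolding X0_def by blast
  qed
  obtain M1 where M1: "\<forall>n\<ge>M1. (\<integral>\<^sup>+s. seminorm_sq s (x n - u) \<partial>\<mu>p) \<le> ennreal 1" using close[of 1] by auto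
  have "x M1 - u \<in> X" by (rule xu, rule le_less_trans[OF M1[rule_format, OF order_refl]]) simp
  from subspace_diff[OF Q.V x[of M1] this] have uX: "u \<in> X" by simp
  have xuX: "x n - u \<in> X" for n using x uX by simp
  have "(\<lambda>n. B (x n - u) (x n - u)) \<longlonglongrightarrow> 0"
  proof (rule LIMSEQ_I)
    fix e :: real assume "0 < e"
    then have "0 < e / 2" by simp
    from close[OF this] obtain M where M: "\<forall>n\<ge>M. (\<integral>\<^sup>+s. seminorm_sq s (x n - u) \<partial>\<mu>p) \<le> ennreal (e / 2)" by blast
    have "norm (B (x n - u) (x n - u) - 0) < e" if "M \<le> n" for n
    proof -
      have "ennreal (Q (x n - u) (x n - u)) \<le> ennreal (e / 2)" unfolding Q_energy[OF xuX] by (rule M[rule_format, OF that])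
      then have "Q (x n - u) (x n - u) \<le> e / 2" using \<open>0 < e / 2\<close> by (subst (asm) ennreal_le_iff) auto
      then show ?thesis using B_le[OF xuX[of n]] B.nonneg[OF xuX[of n]] \<open>0 < e\<close> by simp
    qed
    then show "\<exists>no. \<forall>n\<ge>no. norm (B (x n - u) (x n - u) - 0) < e" by blast
  qed
  then show "\<exists>l\<in>X. (\<lambda>n. B (x n - l) (x n - l)) \<longlonglongrightarrow> 0" using uX by blast
qed

end

section \<open>Compactness and the linear problem\<close>

context mixed_order
begin

lemma \<Omega>_lebesgue [measurable]: "\<Omega> \<in> sets lebesgue" using \<Omega>(1) by auto

definition vol :: real where "vol = measure lebesgue \<Omega>"

lemma vol: "emeasure lebesgue \<Omega> = ennreal vol" "0 \<le> vol"
proof -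
  have "\<Omega> \<in> lmeasurable" by (rule lmeasurable_open[OF \<Omega>(2) \<Omega>(1)])
  then show "emeasure lebesgue \<Omega> = ennreal vol" unfolding vol_def by (intro emeasure_eq_ennreal_measure fmeasurableD2)
  show "0 \<le> vol" by (simp add: vol_def)
qed

text \<open>The growth condition on the nonlinearity will be used in this form.\<close>

lemma L2_bounded:
  assumes w: "w \<in> L2" and m: "(\<lambda>x. indicator \<Omega> x *\<^sub>R g x) \<in> borel_measurable lebesgue"
    and le: "AE x in lebesgue. x \<in> \<Omega> \<longrightarrow> \<bar>g x\<bar> \<le> \<bar>w x\<bar> + c"
  shows "g \<in> L2" "ip g g \<le> 2 * ip w w + 2 * c\<^sup>2 * vol"
proof -
  have wm: "(\<lambda>x. indicator \<Omega> x *\<^sub>R w x) \<in> borel_measurable lebesgue" using w unfolding L2_def by blast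
  have "(\<integral>\<^sup>+x. ennreal ((norm (indicator \<Omega> x *\<^sub>R g x))\<^sup>2) \<partial>lebesgue)
      \<le> (\<integral>\<^sup>+x. 2 * ennreal ((norm (indicator \<Omega> x *\<^sub>R w x))\<^sup>2) + ennreal (2 * c\<^sup>2) * indicator \<Omega> x \<partial>lebesgue)"
  proof (rule nn_integral_mono_AE)
    show "AE x in lebesgue. ennreal ((norm (indicator \<Omega> x *\<^sub>R g x))\<^sup>2)
        \<le> 2 * ennreal ((norm (indicator \<Omega> x *\<^sub>R w x))\<^sup>2) + ennreal (2 * c\<^sup>2) * indicator \<Omega> x"
      using le
    proof eventually_elim
      case (elim x)
      show ?case
      proof (cases "x \<in> \<Omega>")
        case True
        then have "\<bar>g x\<bar>\<^sup>2 \<le> (\<bar>w x\<bar> + c)\<^sup>2" using elim by (intro power_mono) auto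
        then have "(g x)\<^sup>2 \<le> (\<bar>w x\<bar> + c)\<^sup>2" by (simp only: power2_abs)
        also have "\<dots> \<le> 2 * (w x)\<^sup>2 + 2 * c\<^sup>2" using sum_squares_bound[of "\<bar>w x\<bar>" c] by (simp add: power2_sum)
        finally have "ennreal ((g x)\<^sup>2) \<le> ennreal (2 * (w x)\<^sup>2 + 2 * c\<^sup>2)" by (rule ennreal_leI)
        also have "\<dots> = 2 * ennreal ((w x)\<^sup>2) + ennreal (2 * c\<^sup>2)" by (simp add: ennreal_mult)
        finally show ?thesis using True by simp
      qed simp
    qed
  qed
  also have "\<dots> = 2 * ennreal (ip w w) + ennreal (2 * c\<^sup>2) * ennreal vol"
  proof -
    have m1: "(\<lambda>x. ennreal ((norm (indicator \<Omega> x *\<^sub>R w x))\<^sup>2)) \<in> borel_measurable lebesgue" using wm by measurable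
    have m2: "(\<lambda>x. ennreal (2 * c\<^sup>2) * indicator \<Omega> x) \<in> borel_measurable lebesgue" by measurable
    show ?thesis
      unfolding L2_facts(2)[OF w] vol(1)[symmetric] nn_integral_cmult_indicator[OF \<Omega>_lebesgue, symmetric] nn_integral_cmult[OF m1, symmetric]
      by (rule nn_integral_add) (use m1 m2 in \<open>auto intro: borel_measurable_times\<close>)
  qed
  also have "\<dots> = ennreal (2 * ip w w + 2 * c\<^sup>2 * vol)"
    using ip.nonneg[OF w] vol(2) by (simp add: ennreal_mult ennreal_plus)
  finally have *: "(\<integral>\<^sup>+x. ennreal ((norm (indicator \<Omega> x *\<^sub>R g x))\<^sup>2) \<partial>lebesgue) \<le> ennreal (2 * ip w w + 2 * c\<^sup>2 * vol)" .
  from le_less_trans[OF this] m show g: "g \<in> L2" unfolding L2_def by simp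
  show "ip g g \<le> 2 * ip w w + 2 * c\<^sup>2 * vol"
    using * unfolding L2_facts(2)[OF g, symmetric] using ip.nonneg[OF w] vol(2) by (subst (asm) ennreal_le_iff) auto
qed

lemma L2_cong_AE:
  assumes g: "g \<in> L2" and eq: "AE x in lebesgue. x \<in> \<Omega> \<longrightarrow> g x = g' x"
  shows "g' \<in> L2" "v \<in> L2 \<Longrightarrow> ip g v = ip g' v"
proof -
  have e: "AE x in lebesgue. indicator \<Omega> x *\<^sub>R g x = indicator \<Omega> x *\<^sub>R g' x"
    using eq by eventually_elim (auto simp: indicator_def)
  have m: "(\<lambda>x. indicator \<Omega> x *\<^sub>R g x) \<in> borel_measurable lebesgue" using g unfolding L2_def by blast
  have m': "(\<lambda>x. indicator \<Omega> x *\<^sub>R g' x) \<in> borel_measurable lebesgue" by (rule borel_measurable_lebesgue_AE[OF m e])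
  show "g' \<in> L2"
    by (rule L2_bounded(1)[OF g m', of 0]) (use eq in \<open>eventually_elim, auto\<close>)
  assume "v \<in> L2"
  then have vm: "(\<lambda>x. indicator \<Omega> x *\<^sub>R v x) \<in> borel_measurable lebesgue" unfolding L2_def by blast
  have ip_eq: "ip h v = (LINT x|lebesgue. (indicator \<Omega> x *\<^sub>R h x) * (indicator \<Omega> x *\<^sub>R v x))" for h
    unfolding ip_def set_lebesgue_integral_def by (rule Bochner_Integration.integral_cong) (auto simp: indicator_def)
  show "ip g v = ip g' v" unfolding ip_eq
  proof (rule integral_cong_AE)
    show "AE x in lebesgue. (indicator \<Omega> x *\<^sub>R g x) * (indicator \<Omega> x *\<^sub>R v x) = (indicator \<Omega> x *\<^sub>R g' x) * (indicator \<Omega> x *\<^sub>R v x)"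
      using e by eventually_elim (simp only:)
  qed (rule borel_measurable_times[OF m vm] borel_measurable_times[OF m' vm])+
qed

lemma cube_indicator_L2:
  "indicat_real (cube e c) \<in> L2" "ip (indicat_real (cube e c)) (indicat_real (cube e c)) \<le> 2 * vol"
proof -
  have m: "(\<lambda>x. indicator \<Omega> x *\<^sub>R indicat_real (cube e c) x) \<in> borel_measurable lebesgue"
    by (intro borel_measurable_scaleR borel_measurable_indicator) auto
  note L = L2_bounded[OF subspace_0[OF ip.V] m, of 1]
  have le: "AE x in lebesgue. x \<in> \<Omega> \<longrightarrow> \<bar>indicat_real (cube e c) x\<bar> \<le> \<bar>0 x\<bar> + 1"
    by (rule AE_I2) (simp add: indicator_def)
  have "ip 0 0 = 0" by (simp add: ip_def)
  with L[OF le] show "indicat_real (cube e c) \<in> L2" "ip (indicat_real (cube e c)) (indicat_real (cube e c)) \<le> 2 * vol" by auto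
qed

lemma cube_integral_eq:
  assumes u: "u \<in> X"
  shows "cube_integral e c u = ip (indicat_real (cube e c)) u"
  unfolding cube_integral_def ip_def set_lebesgue_integral_def
proof (rule integral_cong_AE)
  have um: "u \<in> borel_measurable lebesgue" by (rule XD(1)[OF u])
  show "(\<lambda>x. indicat_real (cube e c) x *\<^sub>R u x) \<in> borel_measurable lebesgue"
    by (intro borel_measurable_scaleR borel_measurable_indicator um) auto
  show "(\<lambda>x. indicat_real \<Omega> x *\<^sub>R (indicat_real (cube e c) x * u x)) \<in> borel_measurable lebesgue"
    by (intro borel_measurable_scaleR borel_measurable_times borel_measurable_indicator um) auto
  show "AE x in lebesgue. indicat_real (cube e c) x *\<^sub>R u x = indicat_real \<Omega> x *\<^sub>R (indicat_real (cube e c) x * u x)"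
    using XD(2)[OF u] by eventually_elim (auto simp: indicator_def)
qed

lemma cube_integral_le:
  assumes u: "u \<in> X"
  shows "\<bar>cube_integral e c u\<bar> \<le> sqrt (2 * vol) * sqrt (ip u u)"
proof -
  have "\<bar>cube_integral e c u\<bar> \<le> sqrt (ip (indicat_real (cube e c)) (indicat_real (cube e c))) * sqrt (ip u u)"
    unfolding cube_integral_eq[OF u] by (rule ip.abs_le[OF cube_indicator_L2(1)]) (use X_L2 u in blast)
  also have "\<dots> \<le> sqrt (2 * vol) * sqrt (ip u u)"
    using ip.nonneg[of u] X_L2 u by (intro mult_right_mono real_sqrt_le_mono cube_indicator_L2(2)) auto
  finally show ?thesis .
qed

lemma cube_integral_diff:
  assumes "u \<in> X" "v \<in> X"
  shows "cube_integral e c (u - v) = cube_integral e c u - cube_integral e c v"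
proof -
  have "u - v \<in> X" using assms by simp
  note c = cube_integral_eq[OF this] cube_integral_eq[OF assms(1)] cube_integral_eq[OF assms(2)]
  show ?thesis unfolding c by (rule ip.diff_right) (use assms X_L2 cube_indicator_L2(1) in auto)
qed

lemma step_L2:
  assumes e: "0 < e"
  shows "(\<lambda>x. a (corner e x)) \<in> L2"
    "ip (\<lambda>x. a (corner e x)) (\<lambda>x. a (corner e x)) \<le> (\<Sum>c\<in>corner e ` \<Omega>. (a c)\<^sup>2 * e ^ DIM('a))"
proof -
  let ?G = "corner e ` \<Omega>"
  have fin: "finite ?G" by (rule finite_corners[OF \<Omega>(2) e])
  have eq: "indicator \<Omega> x *\<^sub>R a (corner e x) = indicator \<Omega> x *\<^sub>R (\<Sum>c\<in>?G. indicat_real (cube e c) x * a c)" for x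
    unfolding corner_sum[OF fin] by (auto simp: indicator_def)
  have m: "(\<lambda>x. indicator \<Omega> x *\<^sub>R a (corner e x)) \<in> borel_measurable lebesgue"
    unfolding eq by (intro borel_measurable_scaleR borel_measurable_sum borel_measurable_times borel_measurable_indicator borel_measurable_const) auto
  have cs: "cube e c \<in> sets lebesgue" for c :: 'a by simp
  have mc: "(\<lambda>x. ennreal ((a c)\<^sup>2) * indicator (cube e c) x) \<in> borel_measurable lebesgue" for c :: 'a
    using cs[of c] by measurable
  have "(\<integral>\<^sup>+x. ennreal ((norm (indicator \<Omega> x *\<^sub>R a (corner e x)))\<^sup>2) \<partial>lebesgue)
     \<le> (\<integral>\<^sup>+x. (\<Sum>c\<in>?G. ennreal ((a c)\<^sup>2) * indicator (cube e c) x) \<partial>lebesgue)"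
  proof (rule nn_integral_mono)
    fix x :: 'a
    show "ennreal ((norm (indicator \<Omega> x *\<^sub>R a (corner e x)))\<^sup>2) \<le> (\<Sum>c\<in>?G. ennreal ((a c)\<^sup>2) * indicator (cube e c) x)"
    proof (cases "x \<in> \<Omega>")
      case True
      then have "corner e x \<in> ?G" by blast
      then have "(\<Sum>c\<in>{corner e x}. ennreal ((a c)\<^sup>2) * indicator (cube e c) x) \<le> (\<Sum>c\<in>?G. ennreal ((a c)\<^sup>2) * indicator (cube e c) x)"
        by (intro sum_mono2 fin) auto
      then show ?thesis using True by (simp add: cube_def)
    qed simp
  qed
  also have "\<dots> = (\<Sum>c\<in>?G. \<integral>\<^sup>+x. ennreal ((a c)\<^sup>2) * indicator (cube e c) x \<partial>lebesgue)"
    by (rule nn_integral_sum[OF mc])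
  also have "\<dots> = (\<Sum>c\<in>?G. ennreal ((a c)\<^sup>2 * e ^ DIM('a)))"
  proof (rule sum.cong[OF refl])
    fix c assume "c \<in> ?G"
    then obtain x where "c = corner e x" by blast
    then have "emeasure lebesgue (cube e c) = ennreal (e ^ DIM('a))" using emeasure_cube[OF e, of x] by simp
    then show "(\<integral>\<^sup>+x. ennreal ((a c)\<^sup>2) * indicator (cube e c) x \<partial>lebesgue) = ennreal ((a c)\<^sup>2 * e ^ DIM('a))"
      unfolding nn_integral_cmult_indicator[OF cs] using e by (simp add: ennreal_mult)
  qed
  also have "\<dots> = ennreal (\<Sum>c\<in>?G. (a c)\<^sup>2 * e ^ DIM('a))" using e by (intro sum_ennreal) simp
  finally have *: "(\<integral>\<^sup>+x. ennreal ((norm (indicator \<Omega> x *\<^sub>R a (corner e x)))\<^sup>2) \<partial>lebesgue) \<le> ennreal (\<Sum>c\<in>?G. (a c)\<^sup>2 * e ^ DIM('a))" .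
  from le_less_trans[OF this] m show g: "(\<lambda>x. a (corner e x)) \<in> L2" unfolding L2_def by simp
  show "ip (\<lambda>x. a (corner e x)) (\<lambda>x. a (corner e x)) \<le> (\<Sum>c\<in>?G. (a c)\<^sup>2 * e ^ DIM('a))"
    using * unfolding L2_facts(2)[OF g, symmetric] using e by (subst (asm) ennreal_le_iff) (auto intro!: sum_nonneg)
qed

definition err :: "real \<Rightarrow> real" where "err e = cube_error DIM('a) (s0 / 2) e * K"

lemma err: "(\<lambda>k. err (1 / real (Suc k))) \<longlonglongrightarrow> 0" "0 < e \<Longrightarrow> 0 \<le> err e"
proof -
  have s: "0 < s0 / 2" "s0 / 2 < 1" using s0 by auto
  have "(\<lambda>k. cube_error DIM('a) (s0 / 2) (1 / real (Suc k)) * K) \<longlonglongrightarrow> 0 * K"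
    by (intro tendsto_mult_right cube_error_tendsto s) simp
  then show "(\<lambda>k. err (1 / real (Suc k))) \<longlonglongrightarrow> 0" by (simp only: err_def mult_zero_left)
  show "0 \<le> err e" if "0 < e" unfolding err_def
    using K_pos cube_error_tendsto(2)[OF _ s that, of "DIM('a)"] by simp
qed

lemma average_L2:
  assumes u: "u \<in> X" and e: "0 < e"
  shows "cube_average e u \<in> L2"
    "ip (u - cube_average e u) (u - cube_average e u) \<le> err e * B u u"
proof -
  show L: "cube_average e u \<in> L2"
    unfolding cube_average_def[abs_def] by (rule step_L2(1)[OF e])
  have s: "0 < s0 / 2" "s0 / 2 < 1" using s0 by auto
  have uL: "u \<in> L2" using X_L2 u by blast
  have fin: "(\<integral>\<^sup>+x. ennreal ((u x)\<^sup>2) \<partial>lebesgue) < \<infinity>" by (rule le_less_trans[OF L2_norm_X[OF u]]) simp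
  have dL: "u - cube_average e u \<in> L2" by (rule subspace_diff[OF ip.V uL L])
  have ce: "0 \<le> cube_error DIM('a) (s0 / 2) e" by (rule cube_error_tendsto(2)[OF _ s e]) simp
  have "ennreal (ip (u - cube_average e u) (u - cube_average e u)) \<le> (\<integral>\<^sup>+x. ennreal ((u x - cube_average e u x)\<^sup>2) \<partial>lebesgue)"
    unfolding L2_facts(2)[OF dL] by (intro nn_integral_mono) (auto simp: indicator_def)
  also have "\<dots> \<le> ennreal (cube_error DIM('a) (s0 / 2) e) * seminorm_sq (s0 / 2) u"
    by (rule cube_average_error[OF XD(1)[OF u] fin e s])
  also have "\<dots> \<le> ennreal (cube_error DIM('a) (s0 / 2) e) * ennreal (K * B u u)"
    by (intro mult_left_mono low_seminorm_le[OF u]) (use s0 in auto)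
  also have "\<dots> = ennreal (err e * B u u)"
    unfolding err_def mult.assoc by (rule ennreal_mult[symmetric]) (use ce K_pos B.nonneg[OF u] in auto)
  finally show "ip (u - cube_average e u) (u - cube_average e u) \<le> err e * B u u"
    using err(2)[OF e] B.nonneg[OF u] by (subst (asm) ennreal_le_iff) auto
qed

lemma average_bound:
  assumes u: "u \<in> X" and e: "0 < e"
  shows "ip (cube_average e u) (cube_average e u) \<le> 2 * (K + err e) * B u u"
proof -
  have uL: "u \<in> L2" using X_L2 u by blast
  note A = average_L2[OF u e]
  have dL: "u - cube_average e u \<in> L2" by (rule subspace_diff[OF ip.V uL A(1)])
  have "ip (u - (u - cube_average e u)) (u - (u - cube_average e u)) \<le> 2 * ip u u + 2 * ip (u - cube_average e u) (u - cube_average e u)"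
    by (rule ip.sq_diff_le[OF uL dL])
  also have "\<dots> \<le> 2 * (K * B u u) + 2 * (err e * B u u)" by (intro add_mono mult_left_mono ip_X(2)[OF u] A(2)) auto
  also have "\<dots> = 2 * (K + err e) * B u u" by (simp add: algebra_simps)
  finally show ?thesis by simp
qed

text \<open>The \<open>L\<^sup>2\<close> norm is controlled by a small multiple of the energy and finitely
  many linear functionals.\<close>

lemma norm_by_averages:
  assumes u: "u \<in> X" and e: "0 < e"
  shows "ip u u \<le> 2 * err e * B u u + 2 * (\<Sum>c\<in>corner e ` \<Omega>. (cube_integral e c u)\<^sup>2 / e ^ DIM('a))"
proof -
  have uL: "u \<in> L2" using X_L2 u by blast
  note A = average_L2[OF u e]
  have dL: "u - cube_average e u \<in> L2" by (rule subspace_diff[OF ip.V uL A(1)])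
  have "ip ((u - cube_average e u) + cube_average e u) ((u - cube_average e u) + cube_average e u)
     \<le> 2 * ip (u - cube_average e u) (u - cube_average e u) + 2 * ip (cube_average e u) (cube_average e u)"
    by (rule ip.sq_add_le[OF dL A(1)])
  also have "\<dots> \<le> 2 * (err e * B u u) + 2 * (\<Sum>c\<in>corner e ` \<Omega>. (cube_integral e c u / e ^ DIM('a))\<^sup>2 * e ^ DIM('a))"
    unfolding cube_average_def[abs_def] using A(2) step_L2(2)[OF e, of "\<lambda>c. cube_integral e c u / e ^ DIM('a)"]
    unfolding cube_average_def[abs_def] by (intro add_mono mult_left_mono) auto
  also have "(\<Sum>c\<in>corner e ` \<Omega>. (cube_integral e c u / e ^ DIM('a))\<^sup>2 * e ^ DIM('a)) = (\<Sum>c\<in>corner e ` \<Omega>. (cube_integral e c u)\<^sup>2 / e ^ DIM('a))"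
  proof (rule sum.cong[OF refl])
    fix c
    define q where "q = e ^ DIM('a)"
    have "0 < q" using e by (simp add: q_def)
    then show "(cube_integral e c u / e ^ DIM('a))\<^sup>2 * e ^ DIM('a) = (cube_integral e c u)\<^sup>2 / e ^ DIM('a)"
      unfolding q_def[symmetric] by (simp add: power2_eq_square)
  qed
  finally show ?thesis by simp
qed

text \<open>Rellich's theorem. A diagonal subsequence makes the averages over all cubes of all grids of side
  \<open>1 / (k + 1)\<close> converge; \<open>norm_by_averages\<close> then gives the Cauchy
  property.\<close>

theorem compact:
  fixes x :: "nat \<Rightarrow> 'a \<Rightarrow> real"
  assumes x: "\<And>n. x n \<in> X" and T: "\<And>n. B (x n) (x n) \<le> T"
  shows "\<exists>r::nat\<Rightarrow>nat. strict_mono r \<and> (\<forall>e>0. \<exists>M. \<forall>i\<ge>M. \<forall>j\<ge>M. ip (x (r i) - x (r j)) (x (r i) - x (r j)) < e)"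
proof -
  define h where "h k = 1 / real (Suc k)" for k
  have h: "0 < h k" for k by (simp add: h_def)
  define S where "S = (SIGMA k:UNIV. corner (h k) ` \<Omega>)"
  have S: "countable S" unfolding S_def by (rule countable_SIGMA[OF _ countable_finite[OF finite_corners[OF \<Omega>(2) h]]]) simp
  define f where "f n z = cube_integral (h (fst z)) (snd z) (x n)" for n and z :: "nat \<times> 'a"
  have f: "norm (f n z) \<le> sqrt (2 * vol) * sqrt (K * T)" if "z \<in> S" for n z
  proof -
    have "K * B (x n) (x n) \<le> K * T" using K_pos by (intro mult_left_mono T) simp
    then have "ip (x n) (x n) \<le> K * T" using ip_X(2)[OF x[of n]] by linarith
    then have "sqrt (2 * vol) * sqrt (ip (x n) (x n)) \<le> sqrt (2 * vol) * sqrt (K * T)"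
      using vol(2) by (intro mult_left_mono real_sqrt_le_mono) auto
    then show ?thesis unfolding f_def using cube_integral_le[OF x, of "h (fst z)" "snd z" n] by simp
  qed
  have "\<exists>r :: nat \<Rightarrow> nat. strict_mono r \<and> (\<forall>z\<in>S. \<exists>l. (\<lambda>n. f (r n) z) \<longlonglongrightarrow> l)"
  proof (rule function_convergent_subsequence[OF S, of f "sqrt (2 * vol) * sqrt (K * T)"])
    show "norm (f n z) \<le> sqrt (2 * vol) * sqrt (K * T)" if "z \<in> S" for n z by (rule f[OF that])
  qed blast
  then obtain r :: "nat \<Rightarrow> nat" where r: "strict_mono r" and l: "\<forall>z\<in>S. \<exists>l. (\<lambda>n. f (r n) z) \<longlonglongrightarrow> l" by blast
  from l obtain L where L: "\<And>z. z \<in> S \<Longrightarrow> (\<lambda>n. f (r n) z) \<longlonglongrightarrow> L z" by metis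
  have "\<exists>M. \<forall>i\<ge>M. \<forall>j\<ge>M. ip (x (r i) - x (r j)) (x (r i) - x (r j)) < e" if e: "0 < e" for e
  proof -
    have R0: "0 \<le> T" using B.nonneg[OF x[of 0]] T[of 0] by linarith
    have "(\<lambda>k. 2 * err (h k) * (4 * T)) \<longlonglongrightarrow> 2 * 0 * (4 * T)"
      unfolding h_def by (intro tendsto_intros err(1))
    then have lim0: "(\<lambda>k. 2 * err (h k) * (4 * T)) \<longlonglongrightarrow> 0" by (simp only: mult_zero_left mult_zero_right)
    have "eventually (\<lambda>k. 2 * err (h k) * (4 * T) < e / 2) sequentially" by (rule order_tendstoD(2)[OF lim0]) (use e in simp)
    then obtain k where k: "2 * err (h k) * (4 * T) < e / 2" by (auto simp: eventually_sequentially)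
    let ?G = "corner (h k) ` \<Omega>"
    define q where "q = h k ^ DIM('a)"
    have q: "0 < q" using h by (simp add: q_def)
    define D where "D n = (\<Sum>c\<in>?G. 2 * (f (r n) (k, c) - L (k, c))\<^sup>2 / q)" for n
    have "(\<lambda>n. D n) \<longlonglongrightarrow> (\<Sum>c\<in>?G. 2 * (L (k, c) - L (k, c))\<^sup>2 / q)"
      unfolding D_def using less_imp_neq[OF q, symmetric]
      by (intro tendsto_intros L) (auto simp: S_def)
    then have D0: "D \<longlonglongrightarrow> 0" by simp
    have "eventually (\<lambda>n. D n < e / 8) sequentially" by (rule order_tendstoD(2)[OF D0]) (use e in simp)
    then obtain M where M: "\<And>n. M \<le> n \<Longrightarrow> D n < e / 8" by (auto simp: eventually_sequentially)
    have "ip (x (r i) - x (r j)) (x (r i) - x (r j)) < e" if i: "M \<le> i" and j: "M \<le> j" for i j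
    proof -
      let ?w = "x (r i) - x (r j)"
      have w: "?w \<in> X" using x by simp
      have "B ?w ?w \<le> 2 * B (x (r i)) (x (r i)) + 2 * B (x (r j)) (x (r j))" by (rule B.sq_diff_le[OF x x])
      also have "\<dots> \<le> 4 * T" using T[of "r i"] T[of "r j"] by linarith
      finally have "2 * err (h k) * B ?w ?w \<le> 2 * err (h k) * (4 * T)" using err(2)[OF h] by (intro mult_left_mono) auto
      moreover have "(\<Sum>c\<in>?G. (cube_integral (h k) c ?w)\<^sup>2 / q) \<le> D i + D j"
        unfolding D_def sum.distrib[symmetric]
      proof (rule sum_mono)
        fix c
        have "cube_integral (h k) c ?w = (f (r i) (k, c) - L (k, c)) - (f (r j) (k, c) - L (k, c))"
          unfolding f_def fst_conv snd_conv cube_integral_diff[OF x x] by simp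
        moreover have "(a - b)\<^sup>2 \<le> 2 * a\<^sup>2 + 2 * b\<^sup>2" for a b :: real
          using zero_le_power2[of "a + b"] by (simp add: power2_sum power2_diff)
        ultimately have "(cube_integral (h k) c ?w)\<^sup>2 \<le> 2 * (f (r i) (k, c) - L (k, c))\<^sup>2 + 2 * (f (r j) (k, c) - L (k, c))\<^sup>2"
          by (simp only:)
        then show "(cube_integral (h k) c ?w)\<^sup>2 / q \<le> 2 * (f (r i) (k, c) - L (k, c))\<^sup>2 / q + 2 * (f (r j) (k, c) - L (k, c))\<^sup>2 / q"
          unfolding add_divide_distrib[symmetric] using q by (intro divide_right_mono) auto
      qed
      ultimately show ?thesis using norm_by_averages[OF w h[of k]] k M[OF i] M[OF j] unfolding q_def[symmetric] by linarith
    qed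
    then show ?thesis by blast
  qed
  then show ?thesis using r by blast
qed

end

locale nonresonant = mixed_order +
  fixes lam :: real
  assumes lam: "lam \<notin> spectrum_A \<mu>p \<mu>m sbar \<Omega>"
begin

definition solves :: "('a \<Rightarrow> real) \<Rightarrow> ('a \<Rightarrow> real) \<Rightarrow> bool" where
  "solves g u \<longleftrightarrow> u \<in> X \<and> (\<forall>v\<in>X. B u v - lam * ip u v = ip g v)"

lemma solves_diff:
  assumes "solves g u" "solves k w" "g \<in> L2" "k \<in> L2"
  shows "solves (g - k) (u - w)"
proof -
  have X: "u \<in> X" "w \<in> X" using assms by (auto simp: solves_def)
  have L: "u \<in> L2" "w \<in> L2" using X X_L2 by auto
  have "B (u - w) v - lam * ip (u - w) v = ip (g - k) v" if v: "v \<in> X" for v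
  proof -
    have vL: "v \<in> L2" using v X_L2 by auto
    have "B u v - lam * ip u v = ip g v" "B w v - lam * ip w v = ip k v" using assms v by (auto simp: solves_def)
    then show ?thesis
      unfolding B.diff[OF X v] ip.diff[OF L vL] ip.diff[OF assms(3,4) vL] by (simp add: right_diff_distrib)
  qed
  then show ?thesis unfolding solves_def using X by simp
qed

lemma kernel:
  assumes "u \<in> X" "\<And>v. v \<in> X \<Longrightarrow> B u v = lam * ip u v"
  shows "ip u u = 0"
proof -
  have "AE x in lebesgue. u x = 0"
    using lam assms unfolding spectrum_A_def B_def ip_def by blast
  then have "AE x in lebesgue. ennreal ((u x)\<^sup>2) = 0" by eventually_elim simp
  then have "(\<integral>\<^sup>+x. ennreal ((u x)\<^sup>2) \<partial>lebesgue) = (\<integral>\<^sup>+x. 0 \<partial>(lebesgue :: 'a measure))" by (rule nn_integral_cong_AE)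
  then have "ennreal (ip u u) = 0" unfolding ip_X(1)[OF assms(1)] by simp
  then show ?thesis using ip.nonneg[of u] X_L2 assms(1) by (auto simp: ennreal_eq_0_iff)
qed

text \<open>The third part is stability: the difference of two solutions for \<open>g\<close> and
  \<open>k\<close> differs from the bounded solution for \<open>g - k\<close> by an element of the
  kernel, which vanishes almost everywhere.\<close>

theorem linear_problem:
  obtains \<kappa> where "0 < \<kappa>" "\<forall>g\<in>L2. \<exists>u. solves g u \<and> B u u \<le> \<kappa> * ip g g"
    "\<forall>g\<in>L2. \<forall>k\<in>L2. \<forall>u w. solves g u \<longrightarrow> solves k w \<longrightarrow> ip (u - w) (u - w) \<le> \<kappa> * ip (g - k) (g - k)"
proof -
  have "\<exists>K'>0. \<forall>l k. 0 \<le> k \<longrightarrow> (\<forall>u\<in>X. \<forall>v\<in>X. l (u + v) = l u + l v) \<longrightarrow>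
      (\<forall>u\<in>X. \<forall>c. l (c *\<^sub>R u) = c * l u) \<longrightarrow> (\<forall>u\<in>X. \<bar>l u\<bar> \<le> k * sqrt (B u u)) \<longrightarrow>
      (\<exists>u\<in>X. (\<forall>v\<in>X. B u v - lam * ip u v = l v) \<and> sqrt (B u u) \<le> K' * k)"
  proof (rule B.Fredholm_alternative[OF complete semi_inner_ip_X])
    show "ip u u \<le> K * B u u" if "u \<in> X" for u by (rule ip_X(2)[OF that])
    show "\<exists>r::nat\<Rightarrow>nat. strict_mono r \<and> (\<forall>e>0. \<exists>M. \<forall>i\<ge>M. \<forall>j\<ge>M. ip (x (r i) - x (r j)) (x (r i) - x (r j)) < e)"
      if "\<And>n. x n \<in> X" "\<And>n. B (x n) (x n) \<le> T" for x :: "nat \<Rightarrow> 'a \<Rightarrow> real" and T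
      by (rule compact[OF that])
    show "ip u u = 0" if "u \<in> X" "\<And>v. v \<in> X \<Longrightarrow> B u v = lam * ip u v" for u by (rule kernel[OF that])
  qed
  then obtain K' where K': "0 < K'" and sol: "\<And>l k. 0 \<le> k \<Longrightarrow> (\<forall>u\<in>X. \<forall>v\<in>X. l (u + v) = l u + l v) \<Longrightarrow>
      (\<forall>u\<in>X. \<forall>c. l (c *\<^sub>R u) = c * l u) \<Longrightarrow> (\<forall>u\<in>X. \<bar>l u\<bar> \<le> k * sqrt (B u u)) \<Longrightarrow>
      (\<exists>u\<in>X. (\<forall>v\<in>X. B u v - lam * ip u v = l v) \<and> sqrt (B u u) \<le> K' * k)"
    by blast
  define \<kappa>0 where "\<kappa>0 = K'\<^sup>2 * K"
  have \<kappa>0: "0 < \<kappa>0" using K' K_pos by (simp add: \<kappa>0_def)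
  have ex: "\<exists>u. solves g u \<and> B u u \<le> \<kappa>0 * ip g g" if g: "g \<in> L2" for g
  proof -
    have g0: "0 \<le> ip g g" by (rule ip.nonneg[OF g])
    have XL: "u \<in> L2" if "u \<in> X" for u using that X_L2 by blast
    have "\<exists>u\<in>X. (\<forall>v\<in>X. B u v - lam * ip u v = ip g v) \<and> sqrt (B u u) \<le> K' * (sqrt (ip g g) * sqrt K)"
    proof (rule sol)
      show "0 \<le> sqrt (ip g g) * sqrt K" using g0 K_pos by simp
      show "\<forall>u\<in>X. \<forall>v\<in>X. ip g (u + v) = ip g u + ip g v" using ip.add_right[OF XL XL g] by blast
      show "\<forall>u\<in>X. \<forall>c. ip g (c *\<^sub>R u) = c * ip g u" using ip.scale_right[OF XL g] by blast
      show "\<forall>u\<in>X. \<bar>ip g u\<bar> \<le> sqrt (ip g g) * sqrt K * sqrt (B u u)"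
      proof
        fix u assume u: "u \<in> X"
        have "\<bar>ip g u\<bar> \<le> sqrt (ip g g) * sqrt (ip u u)" by (rule ip.abs_le[OF g XL[OF u]])
        also have "\<dots> \<le> sqrt (ip g g) * sqrt (K * B u u)" using g0 by (intro mult_left_mono real_sqrt_le_mono ip_X(2)[OF u]) simp
        finally show "\<bar>ip g u\<bar> \<le> sqrt (ip g g) * sqrt K * sqrt (B u u)" by (simp add: real_sqrt_mult)
      qed
    qed
    then obtain u where u: "u \<in> X" "\<forall>v\<in>X. B u v - lam * ip u v = ip g v" "sqrt (B u u) \<le> K' * (sqrt (ip g g) * sqrt K)" by blast
    have "(sqrt (B u u))\<^sup>2 \<le> (K' * (sqrt (ip g g) * sqrt K))\<^sup>2" by (rule power_mono[OF u(3)]) (simp add: B.nonneg[OF u(1)])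
    then have "B u u \<le> \<kappa>0 * ip g g" using B.nonneg[OF u(1)] g0 K_pos by (simp add: power_mult_distrib \<kappa>0_def mult_ac)
    then show ?thesis using u(1,2) unfolding solves_def by blast
  qed
  have stab: "ip (u - w) (u - w) \<le> 2 * K * \<kappa>0 * ip (g - k) (g - k)"
    if g: "g \<in> L2" and k: "k \<in> L2" and u: "solves g u" and w: "solves k w" for g k u w
  proof -
    have gk: "g - k \<in> L2" by (rule subspace_diff[OF ip.V g k])
    have d: "solves (g - k) (u - w)" by (rule solves_diff[OF u w g k])
    obtain z where z: "solves (g - k) z" "B z z \<le> \<kappa>0 * ip (g - k) (g - k)" using ex[OF gk] by blast
    have "solves ((g - k) - (g - k)) ((u - w) - z)" by (rule solves_diff[OF d z(1) gk gk])
    then have n: "(u - w) - z \<in> X" "\<And>v. v \<in> X \<Longrightarrow> B ((u - w) - z) v = lam * ip ((u - w) - z) v"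
      by (auto simp: solves_def ip_def)
    have zX: "z \<in> X" using z(1) by (simp add: solves_def)
    have "ip (((u - w) - z) + z) (((u - w) - z) + z) \<le> 2 * ip ((u - w) - z) ((u - w) - z) + 2 * ip z z"
      by (rule ip.sq_add_le) (use n(1) zX X_L2 in auto)
    then have "ip (u - w) (u - w) \<le> 2 * ip z z" using kernel[OF n] by simp
    also have "\<dots> \<le> 2 * (K * B z z)" using ip_X(2)[OF zX] by simp
    also have "\<dots> \<le> 2 * (K * (\<kappa>0 * ip (g - k) (g - k)))" using z(2) K_pos by simp
    finally show ?thesis by simp
  qed
  define \<kappa> where "\<kappa> = \<kappa>0 + 2 * K * \<kappa>0"
  have "0 < 2 * K * \<kappa>0" using \<kappa>0 K_pos by simp
  then have \<kappa>: "0 < \<kappa>" "\<kappa>0 \<le> \<kappa>" "2 * K * \<kappa>0 \<le> \<kappa>" using \<kappa>0 unfolding \<kappa>_def by linarith+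
  show ?thesis
  proof (rule that[OF \<kappa>(1)])
    show "\<forall>g\<in>L2. \<exists>u. solves g u \<and> B u u \<le> \<kappa> * ip g g"
      using ex mult_right_mono[OF \<kappa>(2) ip.nonneg] by (meson order_trans)
    show "\<forall>g\<in>L2. \<forall>k\<in>L2. \<forall>u w. solves g u \<longrightarrow> solves k w \<longrightarrow> ip (u - w) (u - w) \<le> \<kappa> * ip (g - k) (g - k)"
    proof (intro ballI allI impI)
      fix g k u w assume a: "g \<in> L2" "k \<in> L2" "solves g u" "solves k w"
      have "2 * K * \<kappa>0 * ip (g - k) (g - k) \<le> \<kappa> * ip (g - k) (g - k)"
        by (rule mult_right_mono[OF \<kappa>(3) ip.nonneg[OF subspace_diff[OF ip.V a(1,2)]]])
      then show "ip (u - w) (u - w) \<le> \<kappa> * ip (g - k) (g - k)" using stab[OF a] by linarith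
    qed
  qed
qed

end

section \<open>The sublinear problem\<close>

text \<open>The limit of an almost everywhere convergent subsequence is zero by Fatou's lemma.\<close>

lemma L2_null_AE_subsequence:
  fixes f :: "nat \<Rightarrow> 'x \<Rightarrow> 'b::{banach, second_countable_topology}"
  assumes meas: "\<And>n. f n \<in> borel_measurable M" and lim: "(\<lambda>n. \<integral>\<^sup>+x. ennreal ((norm (f n x))\<^sup>2) \<partial>M) \<longlonglongrightarrow> 0"
  obtains r where "strict_mono (r :: nat \<Rightarrow> nat)" "AE x in M. (\<lambda>n. f (r n) x) \<longlonglongrightarrow> 0"
proof -
  have small: "\<exists>N. \<forall>n\<ge>N. (\<integral>\<^sup>+x. ennreal ((norm (f n x))\<^sup>2) \<partial>M) \<le> ennreal e" if "0 < e" for e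
  proof -
    have "eventually (\<lambda>n. (\<integral>\<^sup>+x. ennreal ((norm (f n x))\<^sup>2) \<partial>M) < ennreal e) sequentially"
      by (rule order_tendstoD(2)[OF lim]) (use that in simp)
    then show ?thesis by (auto simp: eventually_sequentially intro: less_imp_le)
  qed
  have Cauchy: "\<exists>N. \<forall>m\<ge>N. \<forall>n\<ge>N. (\<integral>\<^sup>+x. ennreal ((norm (f m x - f n x))\<^sup>2) \<partial>M) \<le> ennreal e" if e: "0 < e" for e
  proof -
    have "0 < e / 4" using e by simp
    from small[OF this] obtain N where N: "\<And>n. N \<le> n \<Longrightarrow> (\<integral>\<^sup>+x. ennreal ((norm (f n x))\<^sup>2) \<partial>M) \<le> ennreal (e / 4)" by blast
    have "(\<integral>\<^sup>+x. ennreal ((norm (f m x - f n x))\<^sup>2) \<partial>M) \<le> ennreal e" if "N \<le> m" "N \<le> n" for m n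
    proof -
      have sq: "(norm (a - b))\<^sup>2 \<le> 2 * (norm a)\<^sup>2 + 2 * (norm b)\<^sup>2" for a b :: 'b
      proof -
        have "(norm (a - b))\<^sup>2 \<le> (norm a + norm b)\<^sup>2" by (intro power_mono norm_triangle_ineq4) simp
        also have "\<dots> \<le> 2 * (norm a)\<^sup>2 + 2 * (norm b)\<^sup>2" using sum_squares_bound[of "norm a" "norm b"] by (simp add: power2_sum)
        finally show ?thesis .
      qed
      have m2: "(\<lambda>x. ennreal ((norm (f n x))\<^sup>2)) \<in> borel_measurable M" for n using meas[of n] by measurable
      have m3: "(\<lambda>x. 2 * ennreal ((norm (f n x))\<^sup>2)) \<in> borel_measurable M" for n using meas[of n] by measurable
      have "(\<integral>\<^sup>+x. ennreal ((norm (f m x - f n x))\<^sup>2) \<partial>M) \<le> (\<integral>\<^sup>+x. 2 * ennreal ((norm (f m x))\<^sup>2) + 2 * ennreal ((norm (f n x))\<^sup>2) \<partial>M)"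
      proof (rule nn_integral_mono)
        fix x
        have "ennreal ((norm (f m x - f n x))\<^sup>2) \<le> ennreal (2 * (norm (f m x))\<^sup>2 + 2 * (norm (f n x))\<^sup>2)" by (rule ennreal_leI[OF sq])
        then show "ennreal ((norm (f m x - f n x))\<^sup>2) \<le> 2 * ennreal ((norm (f m x))\<^sup>2) + 2 * ennreal ((norm (f n x))\<^sup>2)"
          by (simp add: ennreal_mult)
      qed
      also have "\<dots> = 2 * (\<integral>\<^sup>+x. ennreal ((norm (f m x))\<^sup>2) \<partial>M) + 2 * (\<integral>\<^sup>+x. ennreal ((norm (f n x))\<^sup>2) \<partial>M)"
        unfolding nn_integral_cmult[OF m2, symmetric] by (rule nn_integral_add[OF m3 m3])
      also have "\<dots> \<le> 2 * ennreal (e / 4) + 2 * ennreal (e / 4)" by (intro add_mono mult_left_mono N that) auto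
      also have "2 * ennreal (e / 4) = ennreal (e / 2)" using ennreal_mult[of 2 "e / 4"] e by simp
      also have "ennreal (e / 2) + ennreal (e / 2) = ennreal e" by (subst ennreal_plus[symmetric]) (use e in auto)
      finally show ?thesis .
    qed
    then show ?thesis by blast
  qed
  obtain r g where r: "strict_mono (r :: nat \<Rightarrow> nat)" and gm: "g \<in> borel_measurable M" and g: "AE x in M. (\<lambda>n. f (r n) x) \<longlonglongrightarrow> g x"
    by (rule L2_Cauchy_AE_subsequence[OF meas Cauchy])
  have "(\<integral>\<^sup>+x. ennreal ((norm (g x))\<^sup>2) \<partial>M) \<le> liminf (\<lambda>n. \<integral>\<^sup>+x. ennreal ((norm (f (r n) x))\<^sup>2) \<partial>M)"
    by (rule Fatou_square[OF meas g])
  also have "\<dots> = 0" using lim_imp_Liminf[OF sequentially_bot LIMSEQ_subseq_LIMSEQ[OF lim r]] by (simp only: o_def)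
  finally have "(\<integral>\<^sup>+x. ennreal ((norm (g x))\<^sup>2) \<partial>M) = 0" by simp
  moreover have "(\<lambda>x. ennreal ((norm (g x))\<^sup>2)) \<in> borel_measurable M" using gm by measurable
  ultimately have "AE x in M. ennreal ((norm (g x))\<^sup>2) = 0" by (simp only: nn_integral_0_iff_AE)
  with g have "AE x in M. (\<lambda>n. f (r n) x) \<longlonglongrightarrow> 0"
  proof eventually_elim
    case (elim x)
    have "(norm (g x))\<^sup>2 = 0" using elim(2) zero_le_power2[of "norm (g x)"] by (simp only: ennreal_eq_0_iff) 
    then have "g x = 0" by simp
    then show ?case using elim(1) by simp
  qed
  then show ?thesis by (rule that[OF r])
qed

text \<open>Large \<open>t\<close> are covered by the sublinearity, the others by the local bound.\<close>

lemma sublinear_growth: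
  fixes f :: "'a::euclidean_space \<Rightarrow> real \<Rightarrow> real"
  assumes lb: "locally_bounded_nonlinearity \<Omega> f" and sub: "sublinear_at_infinity \<Omega> f" and \<Omega>: "\<Omega> \<in> sets lebesgue" and \<epsilon>: "0 < \<epsilon>"
  shows "\<exists>c\<ge>0. AE x in lebesgue. x \<in> \<Omega> \<longrightarrow> (\<forall>t. \<bar>f x t\<bar> \<le> \<epsilon> * \<bar>t\<bar> + c)"
proof -
  obtain Z where Z: "Z \<in> null_sets lebesgue" and ul: "uniform_limit (\<Omega> - Z) (\<lambda>t x. f x t / t) (\<lambda>x. 0) at_infinity"
    using sub unfolding sublinear_at_infinity_def by blast
  from uniform_limitD[OF ul \<epsilon>] obtain b where b: "\<And>t. b \<le> norm t \<Longrightarrow> \<forall>x\<in>\<Omega> - Z. dist (f x t / t) 0 < \<epsilon>"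
    unfolding eventually_at_infinity by blast
  define \<tau> where "\<tau> = max b 1"
  have \<tau>: "b \<le> \<tau>" "1 \<le> \<tau>" by (auto simp: \<tau>_def)
  define h where "h x = (SUP t\<in>{t. \<bar>t\<bar> \<le> \<tau>}. ereal \<bar>f x t\<bar>)" for x
  have "esssup (lebesgue_on \<Omega>) h < \<infinity>"
    using lb \<tau> unfolding locally_bounded_nonlinearity_def h_def[abs_def] by force
  then obtain c where c: "0 \<le> c" "esssup (lebesgue_on \<Omega>) h \<le> ereal c"
  proof (cases "esssup (lebesgue_on \<Omega>) h")
    case (real r)
    then show ?thesis by (intro that[of "max r 0"]) auto
  next
    case MInf
    then show ?thesis by (intro that[of 0]) auto
  qed auto
  have "AE x in lebesgue_on \<Omega>. h x \<le> esssup (lebesgue_on \<Omega>) h" by (rule esssup_AE)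
  then have hx: "AE x in lebesgue. x \<in> \<Omega> \<longrightarrow> h x \<le> esssup (lebesgue_on \<Omega>) h"
    using \<Omega> by (subst (asm) AE_restrict_space_iff) auto
  have "AE x in lebesgue. x \<in> \<Omega> \<longrightarrow> (\<forall>t. \<bar>f x t\<bar> \<le> \<epsilon> * \<bar>t\<bar> + c)"
    using hx AE_not_in[OF Z]
  proof eventually_elim
    case (elim x)
    show ?case
    proof (intro impI allI)
      fix t assume x: "x \<in> \<Omega>"
      show "\<bar>f x t\<bar> \<le> \<epsilon> * \<bar>t\<bar> + c"
      proof (cases "\<bar>t\<bar> \<le> \<tau>")
        case True
        then have "ereal \<bar>f x t\<bar> \<le> h x" unfolding h_def by (intro SUP_upper) simp
        also have "\<dots> \<le> ereal c" using elim(1) x c(2) by (auto intro: order_trans)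
        finally have "\<bar>f x t\<bar> \<le> c" by simp
        moreover have "0 \<le> \<epsilon> * \<bar>t\<bar>" using \<epsilon> by simp
        ultimately show ?thesis by linarith
      next
        case False
        then have t: "b \<le> norm t" "0 < \<bar>t\<bar>" using \<tau> by auto
        have "\<bar>f x t\<bar> / \<bar>t\<bar> < \<epsilon>" using b[OF t(1)] x elim(2) by auto
        then have "\<bar>f x t\<bar> < \<epsilon> * \<bar>t\<bar>" using t(2) by (simp only: pos_divide_less_eq)
        then show ?thesis using c(1) by linarith
      qed
    qed
  qed
  then show ?thesis using c(1) by blast
qed

definition clip :: "real \<Rightarrow> real \<Rightarrow> real" where "clip k t = max (- k) (min k t)"

lemma clip_abs: "0 \<le> k \<Longrightarrow> \<bar>clip k t\<bar> \<le> k" "0 \<le> k \<Longrightarrow> \<bar>clip k t\<bar> \<le> \<bar>t\<bar>" and clip_id: "\<bar>t\<bar> \<le> k \<Longrightarrow> clip k t = t"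
  by (auto simp: clip_def)

lemma clip_tendsto: "t \<longlonglongrightarrow> l \<Longrightarrow> (\<lambda>n. clip k (t n)) \<longlonglongrightarrow> clip k l"
  unfolding clip_def by (intro tendsto_intros)

lemma clip_exhausts:
  assumes t: "t \<longlonglongrightarrow> l" and k: "filterlim k at_top sequentially"
  shows "(\<lambda>n. clip (k n) (t n)) \<longlonglongrightarrow> l"
proof (rule Lim_transform_eventually[OF t])
  have a: "eventually (\<lambda>n. \<bar>t n\<bar> < \<bar>l\<bar> + 1) sequentially"
    by (rule order_tendstoD(2)[OF tendsto_rabs[OF t]]) simp
  have b: "eventually (\<lambda>n. \<bar>l\<bar> + 1 \<le> k n) sequentially" using k by (simp add: filterlim_at_top)
  show "eventually (\<lambda>n. t n = clip (k n) (t n)) sequentially"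
    using a b by eventually_elim (rule clip_id[symmetric], linarith)
qed

context mixed_order
begin

text \<open>Dominated convergence with a majorant \<open>|W n| + |h|\<close> whose first part depends on
  \<open>n\<close> but tends to zero in \<open>L\<^sup>2\<close>: what remains of \<open>|g n -
  l|\<^sup>2\<close> after subtracting \<open>2 |W n|\<^sup>2\<close> has the fixed majorant
  \<open>2 |h|\<^sup>2\<close>.\<close>

lemma L2_convergence:
  assumes g: "\<And>n. g n \<in> L2" and l: "l \<in> L2" and W: "\<And>n. W n \<in> L2" and h: "h \<in> L2"
    and lim: "AE x in lebesgue. x \<in> \<Omega> \<longrightarrow> (\<lambda>n. g n x) \<longlonglongrightarrow> l x"
    and le: "\<And>n. AE x in lebesgue. x \<in> \<Omega> \<longrightarrow> \<bar>g n x - l x\<bar> \<le> \<bar>W n x\<bar> + \<bar>h x\<bar>"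
    and W0: "(\<lambda>n. ip (W n) (W n)) \<longlonglongrightarrow> 0"
  shows "(\<lambda>n. ip (g n - l) (g n - l)) \<longlonglongrightarrow> 0"
proof -
  define T where "T u x = indicat_real \<Omega> x *\<^sub>R u x" for u :: "'a \<Rightarrow> real" and x
  have Tm: "T u \<in> borel_measurable lebesgue" if "u \<in> L2" for u using that unfolding L2_def T_def[abs_def] by blast
  have d: "g n - l \<in> L2" for n by (rule subspace_diff[OF ip.V g l])
  have ipT: "ennreal (ip u u) = (\<integral>\<^sup>+x. ennreal ((T u x)\<^sup>2) \<partial>lebesgue)" if "u \<in> L2" for u
    unfolding L2_facts(2)[OF that] T_def by simp
  \<comment> \<open>The part of the squared error that the moving majorant does not account for.\<close>
  define m where "m n x = max 0 ((T (g n - l) x)\<^sup>2 - 2 * (T (W n) x)\<^sup>2)" for n x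
  have mm: "(\<lambda>x. ennreal (m n x)) \<in> borel_measurable lebesgue" for n
    unfolding m_def using Tm[OF d[of n]] Tm[OF W[of n]] by measurable
  have Wm: "(\<lambda>x. ennreal (2 * (T u x)\<^sup>2)) \<in> borel_measurable lebesgue" if "u \<in> L2" for u
    using Tm[OF that] by measurable
  have W2: "(\<integral>\<^sup>+x. ennreal (2 * (T u x)\<^sup>2) \<partial>lebesgue) = 2 * ennreal (ip u u)" if u: "u \<in> L2" for u
  proof -
    have q: "(\<lambda>x. ennreal ((T u x)\<^sup>2)) \<in> borel_measurable lebesgue" using Tm[OF u] by measurable
    show ?thesis unfolding ipT[OF u] nn_integral_cmult[OF q, symmetric] by (intro nn_integral_cong) (simp add: ennreal_mult)
  qed
  have m0: "(\<lambda>n. \<integral>\<^sup>+x. ennreal (m n x) \<partial>lebesgue) \<longlonglongrightarrow> (\<integral>\<^sup>+x. 0 \<partial>(lebesgue :: 'a measure))"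
  proof (rule nn_integral_dominated_convergence[where w = "\<lambda>x. ennreal (2 * (T h x)\<^sup>2)"])
    show "(\<lambda>x. ennreal (m n x)) \<in> borel_measurable lebesgue" for n by (rule mm)
    show "(\<lambda>x. ennreal (2 * (T h x)\<^sup>2)) \<in> borel_measurable lebesgue" by (rule Wm[OF h])
    show "(\<integral>\<^sup>+x. ennreal (2 * (T h x)\<^sup>2) \<partial>lebesgue) < \<infinity>" unfolding W2[OF h] by (simp add: ennreal_mult_less_top)
    show "AE x in lebesgue. ennreal (m n x) \<le> ennreal (2 * (T h x)\<^sup>2)" for n
      using le[of n]
    proof eventually_elim
      case (elim x)
      show ?case
      proof (cases "x \<in> \<Omega>")
        case True
        have "\<bar>g n x - l x\<bar>\<^sup>2 \<le> (\<bar>W n x\<bar> + \<bar>h x\<bar>)\<^sup>2" using elim True by (intro power_mono) auto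
        also have "\<dots> \<le> 2 * (W n x)\<^sup>2 + 2 * (h x)\<^sup>2" using sum_squares_bound[of "\<bar>W n x\<bar>" "\<bar>h x\<bar>"] by (simp add: power2_sum)
        finally have "(g n x - l x)\<^sup>2 \<le> 2 * (W n x)\<^sup>2 + 2 * (h x)\<^sup>2" by (simp only: power2_abs)
        then show ?thesis using True by (intro ennreal_leI) (simp add: m_def T_def)
      qed (simp add: m_def T_def)
    qed
    show "AE x in lebesgue. (\<lambda>n. ennreal (m n x)) \<longlonglongrightarrow> 0"
      using lim
    proof eventually_elim
      case (elim x)
      have "(\<lambda>n. m n x) \<longlonglongrightarrow> 0"
      proof (cases "x \<in> \<Omega>")
        case True
        then have "(\<lambda>n. (g n x - l x)\<^sup>2) \<longlonglongrightarrow> (l x - l x)\<^sup>2" using elim by (intro tendsto_intros) auto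
        then have *: "(\<lambda>n. (g n x - l x)\<^sup>2) \<longlonglongrightarrow> 0" by simp
        show ?thesis
          by (rule tendsto_sandwich[OF _ _ tendsto_const *]) (auto simp: m_def T_def True)
      next
        case False
        then show ?thesis by (simp add: m_def T_def)
      qed
      then have "(\<lambda>n. ennreal (m n x)) \<longlonglongrightarrow> ennreal 0" by (rule tendsto_ennrealI)
      then show ?case by simp
    qed
  qed simp
  have le': "ennreal (norm (ip (g n - l) (g n - l) - 0)) \<le> (\<integral>\<^sup>+x. ennreal (m n x) \<partial>lebesgue) + 2 * ennreal (ip (W n) (W n))" for n
  proof -
    have "ennreal (norm (ip (g n - l) (g n - l) - 0)) = (\<integral>\<^sup>+x. ennreal ((T (g n - l) x)\<^sup>2) \<partial>lebesgue)"
      using ip.nonneg[OF d[of n]] unfolding ipT[OF d, symmetric] by simp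
    also have "\<dots> \<le> (\<integral>\<^sup>+x. ennreal (m n x) + ennreal (2 * (T (W n) x)\<^sup>2) \<partial>lebesgue)"
    proof (rule nn_integral_mono)
      fix x
      have "(T (g n - l) x)\<^sup>2 \<le> m n x + 2 * (T (W n) x)\<^sup>2" by (simp add: m_def)
      then have "ennreal ((T (g n - l) x)\<^sup>2) \<le> ennreal (m n x + 2 * (T (W n) x)\<^sup>2)" by (rule ennreal_leI)
      then show "ennreal ((T (g n - l) x)\<^sup>2) \<le> ennreal (m n x) + ennreal (2 * (T (W n) x)\<^sup>2)"
        by (subst (asm) ennreal_plus) (auto simp: m_def)
    qed
    also have "\<dots> = (\<integral>\<^sup>+x. ennreal (m n x) \<partial>lebesgue) + 2 * ennreal (ip (W n) (W n))"
      unfolding W2[OF W, symmetric] by (rule nn_integral_add[OF mm Wm[OF W]])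
    finally show ?thesis .
  qed
  have "(\<lambda>n. 2 * ennreal (ip (W n) (W n))) \<longlonglongrightarrow> 2 * ennreal 0"
    by (intro tendsto_mult_ennreal tendsto_const tendsto_ennrealI W0) auto
  from tendsto_add[OF m0 this] have "(\<lambda>n. (\<integral>\<^sup>+x. ennreal (m n x) \<partial>lebesgue) + 2 * ennreal (ip (W n) (W n))) \<longlonglongrightarrow> 0" by simp
  from tendsto_of_ennreal_norm_bound[OF this le'] show ?thesis .
qed

lemma const_L2: "(\<lambda>x. c) \<in> L2"
proof (rule L2_bounded(1)[OF subspace_0[OF ip.V]])
  show "(\<lambda>x. indicat_real \<Omega> x *\<^sub>R c) \<in> borel_measurable lebesgue"
    by (intro borel_measurable_scaleR borel_measurable_indicator borel_measurable_const) auto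
  show "AE x in lebesgue. x \<in> \<Omega> \<longrightarrow> \<bar>c\<bar> \<le> \<bar>0 x\<bar> + \<bar>c\<bar>" by (rule AE_I2) simp
qed

lemma ip_cong_AE:
  assumes "g \<in> L2" "AE x in lebesgue. x \<in> \<Omega> \<longrightarrow> g x = g' x"
  shows "ip g g = ip g' g'"
proof -
  note c = L2_cong_AE[OF assms]
  have "ip g g = ip g' g" by (rule c(2)[OF assms(1)])
  also have "\<dots> = ip g g'" by (rule ip.sym[OF c(1) assms(1)])
  also have "\<dots> = ip g' g'" by (rule c(2)[OF c(1)])
  finally show ?thesis .
qed

end

locale sublinear_problem = nonresonant +
  fixes f :: "'a \<Rightarrow> real \<Rightarrow> real"
  assumes f_Caratheodory: "caratheodory \<Omega> f" and f_bounded: "locally_bounded_nonlinearity \<Omega> f"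
    and f_sublinear: "sublinear_at_infinity \<Omega> f"
begin

lemma growth: "0 < \<epsilon> \<Longrightarrow> \<exists>c\<ge>0. AE x in lebesgue. x \<in> \<Omega> \<longrightarrow> (\<forall>t. \<bar>f x t\<bar> \<le> \<epsilon> * \<bar>t\<bar> + c)"
  by (rule sublinear_growth[OF f_bounded f_sublinear \<Omega>_lebesgue])

lemma f_measurable: "(\<lambda>x. indicator \<Omega> x *\<^sub>R f x t) \<in> borel_measurable lebesgue"
proof -
  have "(\<lambda>x. f x t) \<in> borel_measurable (lebesgue_on \<Omega>)" using f_Caratheodory unfolding caratheodory_def by blast
  then show ?thesis using \<Omega>_lebesgue by (subst (asm) borel_measurable_restrict_space_iff) auto
qed

lemma f_continuous: "AE x in lebesgue. x \<in> \<Omega> \<longrightarrow> continuous_on UNIV (f x)"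
proof -
  have "AE x in lebesgue_on \<Omega>. continuous_on UNIV (f x)" using f_Caratheodory unfolding caratheodory_def by blast
  then show ?thesis using \<Omega>_lebesgue by (subst (asm) AE_restrict_space_iff) auto
qed

lemma step_nonlinearity_measurable:
  assumes e: "0 < e"
  shows "(\<lambda>x. indicator \<Omega> x *\<^sub>R f x (a (corner e x))) \<in> borel_measurable lebesgue"
proof -
  let ?G = "corner e ` \<Omega>"
  have eq: "indicator \<Omega> x *\<^sub>R f x (a (corner e x)) = (\<Sum>c\<in>?G. indicat_real (cube e c) x * (indicator \<Omega> x *\<^sub>R f x (a c)))" for x
    unfolding corner_sum[OF finite_corners[OF \<Omega>(2) e], of e x "\<lambda>c. indicator \<Omega> x *\<^sub>R f x (a c)"] by (auto simp: indicator_def)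
  have cs: "cube e c \<in> sets lebesgue" for c :: 'a by simp
  show ?thesis unfolding eq
    by (rule borel_measurable_sum) (rule borel_measurable_times[OF borel_measurable_indicator[OF cs] f_measurable])
qed

lemma step_nonlinearity_L2:
  assumes e: "0 < e" and k: "0 \<le> k" and c: "AE x in lebesgue. x \<in> \<Omega> \<longrightarrow> (\<forall>t. \<bar>f x t\<bar> \<le> 1 * \<bar>t\<bar> + c)"
  shows "(\<lambda>x. f x (clip k (a (corner e x)))) \<in> L2"
    "ip (\<lambda>x. f x (clip k (a (corner e x)))) (\<lambda>x. f x (clip k (a (corner e x)))) \<le> 2 * (k + c)\<^sup>2 * vol"
proof -
  have le: "AE x in lebesgue. x \<in> \<Omega> \<longrightarrow> \<bar>f x (clip k (a (corner e x)))\<bar> \<le> \<bar>0 x\<bar> + (k + c)"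
    using c
  proof eventually_elim
    case (elim x)
    show ?case
    proof
      assume "x \<in> \<Omega>"
      then have "\<bar>f x (clip k (a (corner e x)))\<bar> \<le> 1 * \<bar>clip k (a (corner e x))\<bar> + c" using elim by blast
      then show "\<bar>f x (clip k (a (corner e x)))\<bar> \<le> \<bar>0 x\<bar> + (k + c)" using clip_abs(1)[OF k, of "a (corner e x)"] by simp
    qed
  qed
  have m: "(\<lambda>x. indicator \<Omega> x *\<^sub>R f x (clip k (a (corner e x)))) \<in> borel_measurable lebesgue"
    by (rule step_nonlinearity_measurable[OF e, of "\<lambda>c. clip k (a c)"])
  note L = L2_bounded[OF subspace_0[OF ip.V] m le]
  show "(\<lambda>x. f x (clip k (a (corner e x)))) \<in> L2" by (rule L(1))
  have zero: "ip 0 0 = 0" by (simp add: ip_def)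
  show "ip (\<lambda>x. f x (clip k (a (corner e x)))) (\<lambda>x. f x (clip k (a (corner e x)))) \<le> 2 * (k + c)\<^sup>2 * vol"
    using L(2) unfolding zero by simp
qed

definition well_posed :: "real \<Rightarrow> bool" where
  "well_posed \<kappa> \<longleftrightarrow> 0 < \<kappa> \<and> (\<forall>g\<in>L2. \<exists>u. solves g u \<and> B u u \<le> \<kappa> * ip g g) \<and>
    (\<forall>g\<in>L2. \<forall>k\<in>L2. \<forall>u w. solves g u \<longrightarrow> solves k w \<longrightarrow> ip (u - w) (u - w) \<le> \<kappa> * ip (g - k) (g - k))"

text \<open>The right-hand side depends on \<open>u\<close> only through its averages \<open>a\<close> over
  the finitely many cubes that meet \<open>\<Omega>\<close>. The map that takes \<open>a\<close>
  to the averages of the solution with right-hand side \<open>f (clip k a)\<close> is bounded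
  because of the truncation and continuous by dominated convergence, so Brouwer's theorem applies.\<close>

lemma approximate_solution:
  assumes wp: "well_posed \<kappa>" and e: "0 < e" and k: "0 \<le> k"
  shows "\<exists>u. solves (\<lambda>x. f x (clip k (cube_average e u x))) u \<and> (\<lambda>x. f x (clip k (cube_average e u x))) \<in> L2 \<and>
    B u u \<le> \<kappa> * ip (\<lambda>x. f x (clip k (cube_average e u x))) (\<lambda>x. f x (clip k (cube_average e u x)))"
proof -
  let ?G = "corner e ` \<Omega>"
  have fin: "finite ?G" by (rule finite_corners[OF \<Omega>(2) e])
  define q where "q = e ^ DIM('a)"
  have q: "0 < q" using e by (simp add: q_def)
  have \<kappa>: "0 < \<kappa>" using wp by (simp add: well_posed_def)
  obtain S where S: "\<And>g. g \<in> L2 \<Longrightarrow> solves g (S g)" "\<And>g. g \<in> L2 \<Longrightarrow> B (S g) (S g) \<le> \<kappa> * ip g g"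
    using wp unfolding well_posed_def by metis
  have SX: "S g \<in> X" if "g \<in> L2" for g using S(1)[OF that] by (simp add: solves_def)
  have stab: "ip (S g - S g') (S g - S g') \<le> \<kappa> * ip (g - g') (g - g')" if "g \<in> L2" "g' \<in> L2" for g g'
    using wp S(1) that unfolding well_posed_def by blast
  obtain c where c: "0 \<le> c" "AE x in lebesgue. x \<in> \<Omega> \<longrightarrow> (\<forall>t. \<bar>f x t\<bar> \<le> 1 * \<bar>t\<bar> + c)" using growth[of 1] by auto
  define N where "N a x = f x (clip k (a (corner e x)))" for a x
  have N: "N a \<in> L2" "ip (N a) (N a) \<le> 2 * (k + c)\<^sup>2 * vol" for a
    unfolding N_def[abs_def] by (rule step_nonlinearity_L2[OF e k c(2)])+
  define \<Phi> where "\<Phi> a z = cube_integral e z (S (N a)) / q" for a z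
  have "\<exists>a. \<forall>z\<in>?G. \<Phi> a z = a z"
  proof (rule Brouwer_finite_set[OF fin])
    fix a z
    have "ip (S (N a)) (S (N a)) \<le> K * B (S (N a)) (S (N a))" by (rule ip_X(2)[OF SX[OF N(1)]])
    also have "\<dots> \<le> K * (\<kappa> * (2 * (k + c)\<^sup>2 * vol))"
      using K_pos \<kappa> by (intro mult_left_mono order_trans[OF S(2)[OF N(1)]] N(2)) auto
    finally have "sqrt (2 * vol) * sqrt (ip (S (N a)) (S (N a))) \<le> sqrt (2 * vol) * sqrt (K * (\<kappa> * (2 * (k + c)\<^sup>2 * vol)))"
      using vol(2) by (intro mult_left_mono real_sqrt_le_mono) auto
    then have "\<bar>cube_integral e z (S (N a))\<bar> \<le> sqrt (2 * vol) * sqrt (K * (\<kappa> * (2 * (k + c)\<^sup>2 * vol)))"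
      using cube_integral_le[OF SX[OF N(1)], of e z a] by linarith
    then show "\<bar>\<Phi> a z\<bar> \<le> sqrt (2 * vol) * sqrt (K * (\<kappa> * (2 * (k + c)\<^sup>2 * vol))) / q"
      unfolding \<Phi>_def abs_divide using q by (simp add: divide_right_mono)
  next
    fix A :: "nat \<Rightarrow> 'a \<Rightarrow> real" and a z
    assume A: "\<And>z. z \<in> ?G \<Longrightarrow> (\<lambda>n. A n z) \<longlonglongrightarrow> a z"
    have N0: "(\<lambda>n. ip (N (A n) - N a) (N (A n) - N a)) \<longlonglongrightarrow> 0"
    proof (rule L2_convergence[where W = "\<lambda>n. 0" and h = "\<lambda>x. 2 * (k + c)"])
      show "0 \<in> L2" by (rule subspace_0[OF ip.V])
      show "(\<lambda>n. ip 0 0) \<longlonglongrightarrow> 0" by (simp add: ip_def)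
      show "AE x in lebesgue. x \<in> \<Omega> \<longrightarrow> (\<lambda>n. N (A n) x) \<longlonglongrightarrow> N a x"
        using f_continuous
      proof eventually_elim
        case (elim x)
        show ?case
        proof
          assume x: "x \<in> \<Omega>"
          then have "corner e x \<in> ?G" by blast
          from clip_tendsto[OF A[OF this]] have "(\<lambda>n. clip k (A n (corner e x))) \<longlonglongrightarrow> clip k (a (corner e x))" .
          then show "(\<lambda>n. N (A n) x) \<longlonglongrightarrow> N a x"
            unfolding N_def using elim x by (intro continuous_on_tendsto_compose[of UNIV "f x"]) auto
        qed
      qed
      show "AE x in lebesgue. x \<in> \<Omega> \<longrightarrow> \<bar>N (A n) x - N a x\<bar> \<le> \<bar>0 x\<bar> + \<bar>2 * (k + c)\<bar>" for n
        using c(2)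
      proof eventually_elim
        case (elim x)
        show ?case
        proof
          assume "x \<in> \<Omega>"
          then have Nb: "\<bar>N b x\<bar> \<le> 1 * \<bar>clip k (b (corner e x))\<bar> + c" for b unfolding N_def using elim by blast
          have Nk: "\<bar>N b x\<bar> \<le> k + c" for b using Nb[of b] clip_abs(1)[OF k, of "b (corner e x)"] by linarith
          from Nk[of "A n"] Nk[of a] show "\<bar>N (A n) x - N a x\<bar> \<le> \<bar>0 x\<bar> + \<bar>2 * (k + c)\<bar>" by simp
        qed
      qed
    qed (auto intro: N const_L2)
    have "(\<lambda>n. sqrt (2 * vol) * sqrt (\<kappa> * ip (N (A n) - N a) (N (A n) - N a)) / q) \<longlonglongrightarrow> sqrt (2 * vol) * sqrt (\<kappa> * 0) / q"
      using less_imp_neq[OF q, symmetric] by (intro tendsto_intros N0)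
    then have lim: "(\<lambda>n. sqrt (2 * vol) * sqrt (\<kappa> * ip (N (A n) - N a) (N (A n) - N a)) / q) \<longlonglongrightarrow> 0" by simp
    have "norm (\<Phi> (A n) z - \<Phi> a z) \<le> sqrt (2 * vol) * sqrt (\<kappa> * ip (N (A n) - N a) (N (A n) - N a)) / q" for n
    proof -
      let ?d = "S (N (A n)) - S (N a)"
      have dX: "?d \<in> X" using SX N(1) by simp
      have "\<bar>cube_integral e z ?d\<bar> \<le> sqrt (2 * vol) * sqrt (ip ?d ?d)" by (rule cube_integral_le[OF dX])
      also have "\<dots> \<le> sqrt (2 * vol) * sqrt (\<kappa> * ip (N (A n) - N a) (N (A n) - N a))"
        using vol(2) by (intro mult_left_mono real_sqrt_le_mono stab N) auto
      finally have "\<bar>cube_integral e z ?d\<bar> / q \<le> sqrt (2 * vol) * sqrt (\<kappa> * ip (N (A n) - N a) (N (A n) - N a)) / q"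
        using q by (intro divide_right_mono) auto
      moreover have "norm (\<Phi> (A n) z - \<Phi> a z) = \<bar>cube_integral e z ?d\<bar> / q"
        unfolding \<Phi>_def cube_integral_diff[OF SX[OF N(1)] SX[OF N(1)]] diff_divide_distrib[symmetric] using q by simp
      ultimately show ?thesis by simp
    qed
    then have "(\<lambda>n. \<Phi> (A n) z - \<Phi> a z) \<longlonglongrightarrow> 0"
      by (intro Lim_null_comparison[OF _ lim] always_eventually allI)
    then show "(\<lambda>n. \<Phi> (A n) z) \<longlonglongrightarrow> \<Phi> a z" by (rule LIM_zero_cancel)
  qed
  then obtain a where a: "\<And>z. z \<in> ?G \<Longrightarrow> \<Phi> a z = a z" by blast
  define u where "u = S (N a)"
  have eq: "AE x in lebesgue. x \<in> \<Omega> \<longrightarrow> N a x = f x (clip k (cube_average e u x))"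
  proof (rule AE_I2, rule impI)
    fix x assume "x \<in> \<Omega>"
    then have "a (corner e x) = cube_average e u x"
      using a[of "corner e x"] unfolding \<Phi>_def cube_average_def u_def q_def by simp
    then show "N a x = f x (clip k (cube_average e u x))" unfolding N_def by simp
  qed
  note c' = L2_cong_AE[OF N(1) eq]
  have "solves (\<lambda>x. f x (clip k (cube_average e u x))) u"
    using S(1)[OF N(1), of a] c'(2) X_L2 unfolding solves_def u_def[symmetric] by auto
  moreover have "B u u \<le> \<kappa> * ip (\<lambda>x. f x (clip k (cube_average e u x))) (\<lambda>x. f x (clip k (cube_average e u x)))"
    using S(2)[OF N(1), of a] unfolding u_def[symmetric] ip_cong_AE[OF N(1) eq] .
  ultimately show ?thesis using c'(1) by blast
qed

text \<open>The choice \<open>\<epsilon>\<^sup>2 = 1 / (8 \<kappa> (K + E))\<close> lets half of the energy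
  absorb the linear part of the growth. The bound is the same for all grids and truncations.\<close>

lemma a_priori_bound:
  assumes wp: "well_posed \<kappa>" and E: "\<And>n :: nat. err (h n) \<le> E" "\<And>n. 0 < h n"
  shows "\<exists>T. \<forall>n u k. 0 \<le> k \<longrightarrow> u \<in> X \<longrightarrow> (\<lambda>x. f x (clip k (cube_average (h n) u x))) \<in> L2 \<longrightarrow>
    B u u \<le> \<kappa> * ip (\<lambda>x. f x (clip k (cube_average (h n) u x))) (\<lambda>x. f x (clip k (cube_average (h n) u x))) \<longrightarrow> B u u \<le> T"
proof -
  have \<kappa>: "0 < \<kappa>" using wp by (simp add: well_posed_def)
  have E0: "0 \<le> E" using err(2)[OF E(2)[of 0]] E(1)[of 0] by linarith
  define D where "D = 8 * \<kappa> * (K + E)"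
  have D: "0 < D" using \<kappa> K_pos E0 by (simp add: D_def)
  define \<epsilon> where "\<epsilon> = 1 / sqrt D"
  have \<epsilon>: "0 < \<epsilon>" "\<epsilon> * \<epsilon> = 1 / D" using D by (auto simp: \<epsilon>_def)
  obtain c where c: "0 \<le> c" "AE x in lebesgue. x \<in> \<Omega> \<longrightarrow> (\<forall>t. \<bar>f x t\<bar> \<le> \<epsilon> * \<bar>t\<bar> + c)" using growth[OF \<epsilon>(1)] by blast
  have "B u u \<le> 4 * \<kappa> * (c\<^sup>2 * vol)"
    if k: "0 \<le> k" and u: "u \<in> X" and gL: "(\<lambda>x. f x (clip k (cube_average (h n) u x))) \<in> L2"
      and Bu: "B u u \<le> \<kappa> * ip (\<lambda>x. f x (clip k (cube_average (h n) u x))) (\<lambda>x. f x (clip k (cube_average (h n) u x)))" for n u k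
  proof -
    define g where "g x = f x (clip k (cube_average (h n) u x))" for x
    let ?P = "cube_average (h n) u"
    have P: "?P \<in> L2" by (rule average_L2(1)[OF u E(2)])
    have \<epsilon>P: "\<epsilon> *\<^sub>R ?P \<in> L2" by (rule subspace_scale[OF ip.V P])
    have gm: "(\<lambda>x. indicator \<Omega> x *\<^sub>R g x) \<in> borel_measurable lebesgue" using gL unfolding g_def[abs_def] L2_def by blast
    have le: "AE x in lebesgue. x \<in> \<Omega> \<longrightarrow> \<bar>g x\<bar> \<le> \<bar>(\<epsilon> *\<^sub>R ?P) x\<bar> + c"
      using c(2)
    proof eventually_elim
      case (elim x)
      show ?case
      proof
        assume "x \<in> \<Omega>"
        then have "\<bar>g x\<bar> \<le> \<epsilon> * \<bar>clip k (?P x)\<bar> + c" unfolding g_def using elim by blast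
        also have "\<epsilon> * \<bar>clip k (?P x)\<bar> \<le> \<epsilon> * \<bar>?P x\<bar>" using \<epsilon>(1) by (intro mult_left_mono clip_abs(2)[OF k]) simp
        finally show "\<bar>g x\<bar> \<le> \<bar>(\<epsilon> *\<^sub>R ?P) x\<bar> + c" using \<epsilon>(1) by (simp add: abs_mult)
      qed
    qed
    have "ip g g \<le> 2 * ip (\<epsilon> *\<^sub>R ?P) (\<epsilon> *\<^sub>R ?P) + 2 * c\<^sup>2 * vol" by (rule L2_bounded(2)[OF \<epsilon>P gm le])
    also have "ip (\<epsilon> *\<^sub>R ?P) (\<epsilon> *\<^sub>R ?P) = (\<epsilon> * \<epsilon>) * ip ?P ?P"
      unfolding ip.scale[OF P \<epsilon>P] ip.scale_right[OF P P] by (rule mult.assoc[symmetric])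
    also have "ip ?P ?P \<le> 2 * (K + E) * B u u"
      by (rule order_trans[OF average_bound[OF u E(2)]]) (intro mult_right_mono mult_left_mono add_mono E order_refl B.nonneg[OF u], auto)
    finally have "ip g g \<le> 2 * (\<epsilon> * \<epsilon> * (2 * (K + E) * B u u)) + 2 * c\<^sup>2 * vol" using \<epsilon>(1) by simp
    then have "\<kappa> * ip g g \<le> \<kappa> * (2 * (\<epsilon> * \<epsilon> * (2 * (K + E) * B u u)) + 2 * c\<^sup>2 * vol)" using \<kappa> by simp
    moreover have "\<kappa> * (2 * (\<epsilon> * \<epsilon> * (2 * (K + E) * B u u)) + 2 * c\<^sup>2 * vol) = (D / 2) * (\<epsilon> * \<epsilon>) * B u u + 2 * \<kappa> * (c\<^sup>2 * vol)"
      unfolding D_def by (simp add: algebra_simps)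
    moreover have "(D / 2) * (\<epsilon> * \<epsilon>) = 1 / 2" unfolding \<epsilon>(2) using D by simp
    ultimately have "\<kappa> * ip g g \<le> 1 / 2 * B u u + 2 * \<kappa> * (c\<^sup>2 * vol)" by simp
    then show ?thesis using Bu unfolding g_def[abs_def] by linarith
  qed
  then show ?thesis by blast
qed

text \<open>The limit \<open>w\<close> of the approximate solutions is known to lie in
  \<open>L\<^sup>2\<close> only. The solution \<open>v\<close> of the linear problem with
  right-hand side \<open>f x (w x)\<close> lies in the energy space, and by stability it agrees
  with \<open>w\<close> almost everywhere.\<close>

theorem solution_exists: "\<exists>u. solves (\<lambda>x. f x (u x)) u"
proof -
  obtain \<kappa> where wp: "well_posed \<kappa>" using linear_problem unfolding well_posed_def by metis
  define h where "h n = 1 / real (Suc n)" for n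
  have h: "0 < h n" for n by (simp add: h_def)
  have eh: "(\<lambda>n. err (h n)) \<longlonglongrightarrow> 0" unfolding h_def by (rule err(1))
  obtain E where E: "\<And>n. err (h n) \<le> E"
  proof -
    have "Bseq (\<lambda>n. err (h n))" by (rule convergent_imp_Bseq[OF convergentI[OF eh]])
    then obtain E where "\<And>n. norm (err (h n)) \<le> E" unfolding Bseq_def by blast
    then have "err (h n) \<le> E" for n by (metis abs_le_D1 real_norm_def)
    then show ?thesis by (rule that)
  qed
  define g where "g n v y = f y (clip (real n) (cube_average (h n) v y))" for n :: nat and v y
  from a_priori_bound[OF wp E h] obtain T where T: "\<forall>n v k. 0 \<le> k \<longrightarrow> v \<in> X \<longrightarrow> (\<lambda>x. f x (clip k (cube_average (h n) v x))) \<in> L2 \<longrightarrow>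
      B v v \<le> \<kappa> * ip (\<lambda>x. f x (clip k (cube_average (h n) v x))) (\<lambda>x. f x (clip k (cube_average (h n) v x))) \<longrightarrow> B v v \<le> T"
    by (rule exE)
  define approx where "approx n v \<longleftrightarrow> solves (g n v) v \<and> g n v \<in> L2 \<and> B v v \<le> \<kappa> * ip (g n v) (g n v)" for n v
  have "\<exists>v. approx n v" for n
    unfolding approx_def g_def[abs_def] by (rule approximate_solution[OF wp h]) simp
  then obtain u where "\<And>n. approx n (u n)" by metis
  then have u: "solves (g n (u n)) (u n)" "g n (u n) \<in> L2" "B (u n) (u n) \<le> \<kappa> * ip (g n (u n)) (g n (u n))" for n
    by (simp_all only: approx_def)
  have uX: "u n \<in> X" for n using u(1) by (simp add: solves_def)
  have uT: "B (u n) (u n) \<le> T" for n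
    using T[rule_format, of "real n" "u n" n, OF _ uX] u(2,3)[of n] unfolding g_def[abs_def] by simp
  have XL: "v \<in> L2" if "v \<in> X" for v using that X_L2 by blast
  from compact[where x = u, OF uX uT] obtain r where r: "strict_mono (r :: nat \<Rightarrow> nat)"
    and C: "\<forall>e>0. \<exists>M. \<forall>i\<ge>M. \<forall>j\<ge>M. ip (u (r i) - u (r j)) (u (r i) - u (r j)) < e" by (elim exE conjE)
  have C': "\<exists>M. \<forall>i\<ge>M. \<forall>j\<ge>M. ip (u (r i) - u (r j)) (u (r i) - u (r j)) < e" if "0 < e" for e by (rule C[rule_format, OF that])
  define x where "x n = u (r n)" for n
  have xX: "x n \<in> X" for n unfolding x_def by (rule uX)
  obtain w where wm: "w \<in> borel_measurable lebesgue" and xw: "(\<lambda>n. \<integral>\<^sup>+y. ennreal ((norm (x n y - w y))\<^sup>2) \<partial>lebesgue) \<longlonglongrightarrow> 0"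
  proof (rule X_Cauchy_subsequence[where x = x, OF xX])
    show "\<exists>M. \<forall>i\<ge>M. \<forall>j\<ge>M. ip (x i - x j) (x i - x j) < e" if "0 < e" for e
      unfolding x_def by (rule C'[OF that])
  qed (rule that)
  have xwL': "x n - w \<in> L2" if "(\<integral>\<^sup>+y. ennreal ((norm (x n y - w y))\<^sup>2) \<partial>lebesgue) < \<infinity>" for n
  proof -
    have "(\<lambda>y. indicator \<Omega> y *\<^sub>R (x n - w) y) \<in> borel_measurable lebesgue"
      unfolding fun_diff_def by (intro borel_measurable_scaleR borel_measurable_indicator borel_measurable_diff XD(1)[OF xX] wm \<Omega>_lebesgue)
    moreover have "(\<integral>\<^sup>+y. ennreal ((norm (indicator \<Omega> y *\<^sub>R (x n - w) y))\<^sup>2) \<partial>lebesgue) \<le> (\<integral>\<^sup>+y. ennreal ((norm (x n y - w y))\<^sup>2) \<partial>lebesgue)"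
      by (intro nn_integral_mono) (auto simp: indicator_def)
    ultimately show ?thesis unfolding L2_def using that by (auto intro: le_less_trans)
  qed
  have wL: "w \<in> L2"
  proof -
    have "eventually (\<lambda>n. (\<integral>\<^sup>+y. ennreal ((norm (x n y - w y))\<^sup>2) \<partial>lebesgue) < \<infinity>) sequentially" by (rule order_tendstoD(2)[OF xw]) simp
    then obtain n where "(\<integral>\<^sup>+y. ennreal ((norm (x n y - w y))\<^sup>2) \<partial>lebesgue) < \<infinity>" by (auto simp: eventually_sequentially)
    from subspace_diff[OF ip.V XL[OF xX[of n]] xwL'[OF this]] show ?thesis by simp
  qed
  have xwL: "x n - w \<in> L2" for n by (rule subspace_diff[OF ip.V XL[OF xX] wL])
  have xw0: "(\<lambda>n. ip (x n - w) (x n - w)) \<longlonglongrightarrow> 0"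
  proof (rule tendsto_of_ennreal_norm_bound[OF xw])
    fix n
    have "ennreal (norm (ip (x n - w) (x n - w) - 0)) = (\<integral>\<^sup>+y. ennreal ((norm (indicator \<Omega> y *\<^sub>R (x n - w) y))\<^sup>2) \<partial>lebesgue)"
      using ip.nonneg[OF xwL[of n]] unfolding L2_facts(2)[OF xwL, symmetric] by simp
    also have "\<dots> \<le> (\<integral>\<^sup>+y. ennreal ((norm (x n y - w y))\<^sup>2) \<partial>lebesgue)"
      by (intro nn_integral_mono) (auto simp: indicator_def)
    finally show "ennreal (norm (ip (x n - w) (x n - w) - 0)) \<le> (\<integral>\<^sup>+y. ennreal ((norm (x n y - w y))\<^sup>2) \<partial>lebesgue)" .
  qed
  define P where "P n = cube_average (h (r n)) (x n)" for n
  have PL: "P n \<in> L2" and xP: "ip (x n - P n) (x n - P n) \<le> err (h (r n)) * B (x n) (x n)" for n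
    unfolding P_def by (rule average_L2[OF xX h])+
  define D where "D n = P n - w" for n
  have DL: "D n \<in> L2" for n unfolding D_def by (rule subspace_diff[OF ip.V PL wL])
  have D0: "(\<lambda>n. ip (D n) (D n)) \<longlonglongrightarrow> 0"
  proof -
    have "(\<lambda>n. err (h (r n))) \<longlonglongrightarrow> 0" using LIMSEQ_subseq_LIMSEQ[OF eh r] by (simp only: o_def)
    then have "(\<lambda>n. 2 * ip (x n - w) (x n - w) + 2 * (err (h (r n)) * T)) \<longlonglongrightarrow> 2 * 0 + 2 * (0 * T)" by (intro tendsto_intros xw0)
    then have lim: "(\<lambda>n. 2 * ip (x n - w) (x n - w) + 2 * (err (h (r n)) * T)) \<longlonglongrightarrow> 0" by simp
    have "ip (D n) (D n) \<le> 2 * ip (x n - w) (x n - w) + 2 * (err (h (r n)) * T)" for n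
    proof -
      have xPL: "x n - P n \<in> L2" by (rule subspace_diff[OF ip.V XL[OF xX] PL])
      have "D n = (x n - w) - (x n - P n)" unfolding D_def by simp
      then have "ip (D n) (D n) \<le> 2 * ip (x n - w) (x n - w) + 2 * ip (x n - P n) (x n - P n)"
        using ip.sq_diff_le[OF xwL xPL] by (simp only:)
      moreover have "ip (x n - P n) (x n - P n) \<le> err (h (r n)) * T"
        by (rule order_trans[OF xP]) (intro mult_left_mono uT[of "r n", folded x_def] err(2) h)
      ultimately show ?thesis by linarith
    qed
    then show ?thesis by (intro tendsto_sandwich[OF _ _ tendsto_const lim] always_eventually allI ip.nonneg DL)
  qed
  have "(\<lambda>n. ennreal (ip (D n) (D n))) \<longlonglongrightarrow> ennreal 0" by (rule tendsto_ennrealI[OF D0])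
  then have D1: "(\<lambda>n. \<integral>\<^sup>+y. ennreal ((norm (indicator \<Omega> y *\<^sub>R D n y))\<^sup>2) \<partial>lebesgue) \<longlonglongrightarrow> 0"
    unfolding L2_facts(2)[OF DL] by simp
  have Dm: "(\<lambda>y. indicator \<Omega> y *\<^sub>R D n y) \<in> borel_measurable lebesgue" for n using DL unfolding L2_def by blast
  obtain r2 where r2: "strict_mono (r2 :: nat \<Rightarrow> nat)" and DAE: "AE y in lebesgue. (\<lambda>n. indicator \<Omega> y *\<^sub>R D (r2 n) y) \<longlonglongrightarrow> 0"
    by (rule L2_null_AE_subsequence[OF Dm D1])
  have D2: "(\<lambda>n. ip (D (r2 n)) (D (r2 n))) \<longlonglongrightarrow> 0" using LIMSEQ_subseq_LIMSEQ[OF D0 r2] by (simp only: o_def)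
  have xw2: "(\<lambda>n. ip (x (r2 n) - w) (x (r2 n) - w)) \<longlonglongrightarrow> 0" using LIMSEQ_subseq_LIMSEQ[OF xw0 r2] by (simp only: o_def)
  define p where "p n = r (r2 n)" for n
  have p: "filterlim (\<lambda>n. real (p n)) at_top sequentially"
  proof -
    have "strict_mono p" unfolding p_def[abs_def] using strict_mono_o[OF r r2] by (simp only: o_def)
    then show ?thesis by (rule filterlim_compose[OF filterlim_real_sequentially filterlim_subseq])
  qed
  define G where "G n y = f y (clip (real (p n)) (P (r2 n) y))" for n y
  have GL: "G n \<in> L2" and Gs: "solves (G n) (x (r2 n))" for n
    using u(1,2)[of "p n"] unfolding G_def[abs_def] g_def[abs_def] P_def x_def p_def by blast+
  define l where "l y = f y (w y)" for y
  have Gl: "AE y in lebesgue. y \<in> \<Omega> \<longrightarrow> (\<lambda>n. G n y) \<longlonglongrightarrow> l y"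
    using f_continuous DAE
  proof eventually_elim
    case (elim y)
    show ?case
    proof
      assume y: "y \<in> \<Omega>"
      then have "(\<lambda>n. D (r2 n) y) \<longlonglongrightarrow> 0" using elim(2) by simp
      from tendsto_add[OF this tendsto_const[of "w y"]] have "(\<lambda>n. P (r2 n) y) \<longlonglongrightarrow> w y" by (simp add: D_def)
      from clip_exhausts[OF this p] show "(\<lambda>n. G n y) \<longlonglongrightarrow> l y"
        unfolding G_def l_def using elim(1) y by (intro continuous_on_tendsto_compose[of UNIV "f y"]) auto
    qed
  qed
  obtain c where c: "0 \<le> c" "AE x in lebesgue. x \<in> \<Omega> \<longrightarrow> (\<forall>t. \<bar>f x t\<bar> \<le> 1 * \<bar>t\<bar> + c)" using growth[of 1] by auto
  have lm: "(\<lambda>y. indicator \<Omega> y *\<^sub>R l y) \<in> borel_measurable lebesgue"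
  proof (rule borel_measurable_lebesgue_AE)
    have "(\<lambda>y. indicator \<Omega> y *\<^sub>R G n y) \<in> borel_measurable lebesgue" for n using GL unfolding L2_def by blast
    then show "(\<lambda>y. lim (\<lambda>n. indicator \<Omega> y *\<^sub>R G n y)) \<in> borel_measurable lebesgue" by (rule borel_measurable_lim_metric)
    show "AE y in lebesgue. lim (\<lambda>n. indicator \<Omega> y *\<^sub>R G n y) = indicator \<Omega> y *\<^sub>R l y"
      using Gl
    proof eventually_elim
      case (elim y)
      have "(\<lambda>n. indicator \<Omega> y *\<^sub>R G n y) \<longlonglongrightarrow> indicator \<Omega> y *\<^sub>R l y"
        using elim by (cases "y \<in> \<Omega>") auto
      then show ?case by (rule limI)
    qed
  qed
  have lL: "l \<in> L2"
  proof (rule L2_bounded(1)[OF wL lm])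
    show "AE y in lebesgue. y \<in> \<Omega> \<longrightarrow> \<bar>l y\<bar> \<le> \<bar>w y\<bar> + c" using c(2) by eventually_elim (auto simp: l_def)
  qed
  define H where "H y = 2 * \<bar>w y\<bar> + 2 * c" for y
  have HL: "H \<in> L2"
  proof (rule L2_bounded(1)[OF subspace_scale[OF ip.V wL, of 2]])
    show "(\<lambda>y. indicator \<Omega> y *\<^sub>R H y) \<in> borel_measurable lebesgue"
      unfolding H_def by (intro borel_measurable_scaleR borel_measurable_indicator borel_measurable_add borel_measurable_times borel_measurable_const borel_measurable_abs wm \<Omega>_lebesgue)
    show "AE y in lebesgue. y \<in> \<Omega> \<longrightarrow> \<bar>H y\<bar> \<le> \<bar>(2 *\<^sub>R w) y\<bar> + 2 * c" by (rule AE_I2) (use c(1) in \<open>simp add: H_def abs_mult\<close>)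
  qed
  have G0: "(\<lambda>n. ip (G n - l) (G n - l)) \<longlonglongrightarrow> 0"
  proof (rule L2_convergence[OF GL lL DL HL Gl _ D2])
    fix n
    show "AE y in lebesgue. y \<in> \<Omega> \<longrightarrow> \<bar>G n y - l y\<bar> \<le> \<bar>D (r2 n) y\<bar> + \<bar>H y\<bar>"
      using c(2)
    proof eventually_elim
      case (elim y)
      show ?case
      proof
        assume "y \<in> \<Omega>"
        then have "\<bar>G n y\<bar> \<le> 1 * \<bar>clip (real (p n)) (P (r2 n) y)\<bar> + c" "\<bar>l y\<bar> \<le> 1 * \<bar>w y\<bar> + c"
          unfolding G_def l_def using elim by blast+
        moreover have "\<bar>clip (real (p n)) (P (r2 n) y)\<bar> \<le> \<bar>P (r2 n) y\<bar>" by (rule clip_abs(2)) simp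
        moreover have "D (r2 n) y = P (r2 n) y - w y" by (simp add: D_def)
        ultimately show "\<bar>G n y - l y\<bar> \<le> \<bar>D (r2 n) y\<bar> + \<bar>H y\<bar>" unfolding H_def using c(1) by linarith
      qed
    qed
  qed
  obtain v where v: "solves l v" using wp lL unfolding well_posed_def by blast
  have vX: "v \<in> X" using v by (simp add: solves_def)
  have vwL: "v - w \<in> L2" by (rule subspace_diff[OF ip.V XL[OF vX] wL])
  have "ip (v - w) (v - w) \<le> 0"
  proof (rule LIMSEQ_le_const)
    have "(\<lambda>n. 2 * ip (x (r2 n) - w) (x (r2 n) - w) + 2 * (\<kappa> * ip (G n - l) (G n - l))) \<longlonglongrightarrow> 2 * 0 + 2 * (\<kappa> * 0)"
      by (intro tendsto_intros xw2 G0)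
    then show "(\<lambda>n. 2 * ip (x (r2 n) - w) (x (r2 n) - w) + 2 * (\<kappa> * ip (G n - l) (G n - l))) \<longlonglongrightarrow> 0" by simp
    have "ip (v - w) (v - w) \<le> 2 * ip (x (r2 n) - w) (x (r2 n) - w) + 2 * (\<kappa> * ip (G n - l) (G n - l))" for n
    proof -
      have xvL: "x (r2 n) - v \<in> L2" by (rule subspace_diff[OF ip.V XL[OF xX] XL[OF vX]])
      have "v - w = (x (r2 n) - w) - (x (r2 n) - v)" by simp
      then have "ip (v - w) (v - w) \<le> 2 * ip (x (r2 n) - w) (x (r2 n) - w) + 2 * ip (x (r2 n) - v) (x (r2 n) - v)"
        using ip.sq_diff_le[OF xwL xvL] by (simp only:)
      moreover have "ip (x (r2 n) - v) (x (r2 n) - v) \<le> \<kappa> * ip (G n - l) (G n - l)"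
        using wp GL lL Gs v unfolding well_posed_def by blast
      ultimately show ?thesis by linarith
    qed
    then show "\<exists>N. \<forall>n\<ge>N. ip (v - w) (v - w) \<le> 2 * ip (x (r2 n) - w) (x (r2 n) - w) + 2 * (\<kappa> * ip (G n - l) (G n - l))" by blast
  qed
  then have "ennreal (ip (v - w) (v - w)) = 0" by (simp only: ennreal_eq_0_iff)
  then have "(\<integral>\<^sup>+y. ennreal ((norm (indicator \<Omega> y *\<^sub>R (v - w) y))\<^sup>2) \<partial>lebesgue) = 0" unfolding L2_facts(2)[OF vwL] .
  moreover have "(\<lambda>y. ennreal ((norm (indicator \<Omega> y *\<^sub>R (v - w) y))\<^sup>2)) \<in> borel_measurable lebesgue"
  proof -
    have "(\<lambda>y. indicator \<Omega> y *\<^sub>R (v - w) y) \<in> borel_measurable lebesgue" using vwL unfolding L2_def by blast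
    then show ?thesis by measurable
  qed
  ultimately have "AE y in lebesgue. ennreal ((norm (indicator \<Omega> y *\<^sub>R (v - w) y))\<^sup>2) = 0" by (simp only: nn_integral_0_iff_AE)
  then have eq: "AE y in lebesgue. y \<in> \<Omega> \<longrightarrow> l y = f y (v y)"
  proof eventually_elim
    case (elim y)
    show ?case
    proof
      assume "y \<in> \<Omega>"
      then have "v y = w y" using elim by (simp add: ennreal_eq_0_iff)
      then show "l y = f y (v y)" by (simp add: l_def)
    qed
  qed
  have "ip l z = ip (\<lambda>y. f y (v y)) z" if "z \<in> X" for z by (rule L2_cong_AE(2)[OF lL eq XL[OF that]])
  then have "solves (\<lambda>y. f y (v y)) v" using v unfolding solves_def by simp
  then show ?thesis by blast
qed

end

theorem proposition1p3:
  fixes \<Omega> :: "(real ^ 'n) set" and s_sharp lam :: real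
  assumes "CARD('n) \<ge> 2"
    and "open \<Omega>" and "bounded \<Omega>" and "lipschitz_boundary \<Omega>"
    and "0 < s_sharp" and "s_sharp \<le> 1"
  shows "\<exists>\<gamma>0::real. \<gamma>0 > 0 \<and>
    (\<forall>\<gamma> \<in> {0..\<gamma>0}. \<forall>sbar \<in> {0<..s_sharp}. \<forall>\<mu>p \<mu>m :: real measure.
       finite_borel_measure_01 \<mu>p \<longrightarrow> finite_borel_measure_01 \<mu>m \<longrightarrow>
       measure \<mu>p {sbar..1} > 0 \<longrightarrow>
       measure \<mu>m {sbar..1} = 0 \<longrightarrow>
       measure \<mu>m {0..sbar} \<le> \<gamma> * measure \<mu>p {sbar..1} \<longrightarrow>
       measure \<mu>p {s_sharp..1} > 0 \<longrightarrow>
       (\<forall>f :: real ^ 'n \<Rightarrow> real \<Rightarrow> real.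
          caratheodory \<Omega> f \<longrightarrow>
          locally_bounded_nonlinearity \<Omega> f \<longrightarrow>
          sublinear_at_infinity \<Omega> f \<longrightarrow>
          lam \<notin> spectrum_A \<mu>p \<mu>m sbar \<Omega> \<longrightarrow>
          (\<exists>u. weak_solution \<mu>p \<mu>m sbar \<Omega> lam f u)))"
proof -
  obtain C where C: "0 < C" and comparison: "\<forall>s t (u :: real ^ 'n \<Rightarrow> real). 0 \<le> s \<longrightarrow> s \<le> t \<longrightarrow> t \<le> 1 \<longrightarrow>
      u \<in> borel_measurable lebesgue \<longrightarrow> (AE x in lebesgue. x \<notin> \<Omega> \<longrightarrow> u x = 0) \<longrightarrow> seminorm_sq s u \<le> ennreal C * seminorm_sq t u"
    using seminorm_sq_comparison[OF assms(2,3)] by blast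
  show ?thesis
  proof (intro exI[of _ "1 / (2 * C)"] conjI ballI allI impI)
    show "0 < 1 / (2 * C)" using C by simp
    fix \<gamma> sbar :: real and \<mu>p \<mu>m :: "real measure" and f :: "real ^ 'n \<Rightarrow> real \<Rightarrow> real"
    assume \<gamma>: "\<gamma> \<in> {0..1 / (2 * C)}" and sbar: "sbar \<in> {0<..s_sharp}"
      and \<mu>: "finite_borel_measure_01 \<mu>p" "finite_borel_measure_01 \<mu>m" "measure \<mu>m {sbar..1} = 0"
        "measure \<mu>m {0..sbar} \<le> \<gamma> * measure \<mu>p {sbar..1}" "0 < measure \<mu>p {s_sharp..1}"
      and f: "caratheodory \<Omega> f" "locally_bounded_nonlinearity \<Omega> f" "sublinear_at_infinity \<Omega> f"
      and lam: "lam \<notin> spectrum_A \<mu>p \<mu>m sbar \<Omega>"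
    have C\<gamma>: "C * \<gamma> \<le> 1 / 2" using \<gamma> C by (simp add: field_simps)
    interpret sublinear_problem \<Omega> \<mu>p \<mu>m sbar s_sharp C \<gamma> lam f
      by unfold_locales (use assms C comparison sbar \<mu> C\<gamma> lam f in auto)
    obtain u where "solves (\<lambda>x. f x (u x)) u" using solution_exists by blast
    then show "\<exists>u. weak_solution \<mu>p \<mu>m sbar \<Omega> lam f u"
      unfolding weak_solution_def solves_def B_def ip_def by (intro exI[of _ u]) (auto simp: algebra_simps)
  qed
qed

end
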